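(* Let $\lambda_1,\dots,\lambda_\kappa$ be the pairwise distinct eigenvalues of the regular $n\times n$ $\top$-palindromic or $\top$-anti-palindromic matrix pencil $L(\lambda)$, having the nonzero partial multiplicities $n_{i,1}\geq n_{i,2}\geq\cdots\geq n_{i,g_i}>0$ for $i=1,\dots,\kappa$, respectively. Furthermore, let $r>0$ be an integer and let $\Phi$ be the map on $\mathbb C^{\lfloor 3r/2\rfloor n}$ defined in the context for the structure ($\top$-palindromic or $\top$-anti-palindromic) of $L$. Let (P) be the following property (for the index $i$): $$n_{i,r}=n_{i,r+1}=\cdots=n_{i,r+d}>n_{i,r+d+1}\quad\text{with } d \text{ odd}.$$ Then there is a generic set $\mathcal G$ in $\mathbb C^{\lfloor 3r/2\rfloor n}$ such that, for all $E(\lambda)\in\Phi(\mathcal G)$, the perturbed pencil $L+E$ is regular and the partial multiplicities of $L+E$ at $\lambda_i$, for $i=1,\dots,\kappa$, are the following. If $L$ is $\top$-palindromic: - $\lambda_i=1$: $(n_{i,r+1}+1,n_{i,r+2},\dots,n_{i,g_i})$ if $n_{i,r+1}$ is odd and (P) holds; $(n_{i,r+1},n_{i,r+2},\dots,n_{i,g_i})$ otherwise. - $\lambda_i=-1$ and $r$ even: $(n_{i,r+1}+1,n_{i,r+2},\dots,n_{i,g_i})$ if $n_{i,r+1}$ is even and (P) holds; $(n_{i,r+1},n_{i,r+2},\dots,n_{i,g_i})$ otherwise. - $\lambda_i=-1$ and $r$ odd: $(n_{i,r+1}+1,n_{i,r+2},\dots,n_{i,g_i},1)$ if $n_{i,r+1}$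 is even and (P) holds; $(n_{i,r+1},n_{i,r+2},\dots,n_{i,g_i},1)$ otherwise. - $\lambda_i\in\mathbb C\setminus\{\pm1\}$: $(n_{i,r+1},n_{i,r+2},\dots,n_{i,g_i})$. If $L$ is $\top$-anti-palindromic: - $\lambda_i=1$ and $r$ even: $(n_{i,r+1}+1,n_{i,r+2},\dots,n_{i,g_i})$ if $n_{i,r+1}$ is even and (P) holds; $(n_{i,r+1},n_{i,r+2},\dots,n_{i,g_i})$ otherwise. - $\lambda_i=1$ and $r$ odd: $(n_{i,r+1}+1,n_{i,r+2},\dots,n_{i,g_i},1)$ if $n_{i,r+1}$ is even and (P) holds; $(n_{i,r+1},n_{i,r+2},\dots,n_{i,g_i},1)$ otherwise. - $\lambda_i=-1$: $(n_{i,r+1}+1,n_{i,r+2},\dots,n_{i,g_i})$ if $n_{i,r+1}$ is odd and (P) holds; $(n_{i,r+1},n_{i,r+2},\dots,n_{i,g_i})$ otherwise. - $\lambda_i\in\mathbb C\setminus\{\pm1\}$: $(n_{i,r+1},n_{i,r+2},\dots,n_{i,g_i})$. (In particular, if $r\geq g_i$ then $\lambda_i$ is not an eigenvalue of $L+E$.) Furthermore, all eigenvalues of $L+E$ different from those of $L$ are simple.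
   Context: A matrix pencil $L(\lambda)=A+\lambda B$ with $A,B\in\mathbb C^{n\times n}$ is $\top$-palindromic if $A^\top=B$, and $\top$-anti-palindromic if $A^\top=-B$; it is regular if $\det L(\lambda)\not\equiv 0$. For a regular pencil, a finite eigenvalue is a root of $\det L(\lambda)$; $\infty$ is an eigenvalue if $0$ is an eigenvalue of the reversal $\operatorname{rev}L(\lambda)=B+\lambda A$. The partial multiplicities of a regular pencil at an eigenvalue are the sizes of the corresponding Jordan blocks in its Weierstrass canonical form (at $\infty$: the partial multiplicities of $\operatorname{rev}L$ at $0$); the algebraic multiplicity is their sum, and an eigenvalue is simple if its algebraic multiplicity is $1$. In property (P), $n_{i,j}$ is read as $0$ for $j>g_i$. The map $\Phi$: put $s=\lfloor r/2\rfloor$. A point of $\mathbb C^{\lfloor 3r/2\rfloor n}$ consists of vectors $v_1,\dots,v_s,\gamma_1,\dots,\gamma_s,\delta_1,\dots,\delta_s\in\mathbb C^n$ and, if $r$ is odd, one additional vector $u\in\mathbb C^n$. With $w_j(\lambda)=\gamma_j+\lambda\delta_j$ and $\operatorname{rev}w_j(\lambda)=\delta_j+\lambda\gamma_j$, it is mapped by $\Phi$ to the following pencil. In the $\top$-palindromic case: $\sum_{j=1}^s\big(v_jw_j^\top+(\operatorname{rev}w_j)v_j^\top\big)$ if $r$ is even, and $(1+\lambda)uu^\top+\sum_{j=1}^s\big(v_jw_j^\top+(\operatorname{rev}w_j)v_j^\top\big)$ if $r$ is odd. In the $\top$-anti-palindromic case: $\sum_{j=1}^s\big(v_jw_j^\top-(\operatorname{rev}w_j)v_j^\top\big)$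 if $r$ is even, and $(1-\lambda)uu^\top+\sum_{j=1}^s\big(v_jw_j^\top-(\operatorname{rev}w_j)v_j^\top\big)$ if $r$ is odd. Genericity: a subset of $\mathbb C^m$ is generic if its complement is contained in a proper algebraic set, i.e., in a set of common zeros of finitely many complex polynomials in $m$ variables that is not all of $\mathbb C^m$.
   Formalization: At -1 (palindromic) or 1 (anti-palindromic), if r>g_i and r-g_i is odd, the multiplicities are (1) for r even and none for r odd; "not an eigenvalue if r>=g_i" is not claimed at that point for n odd. As printed these fail, e.g. n=1, L=1+λ, r=2. *)

theory Defs
  imports "Jordan_Normal_Form.Jordan_Normal_Form" "Jordan_Normal_Form.Determinant"
begin

(* The pair (A, B) stands for the pencil A + x B. *)
type_synonym pencil = "complex mat \<times> complex mat"

definition pencil_carrier :: "nat \<Rightarrow> pencil set" where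
  "pencil_carrier n = carrier_mat n n \<times> carrier_mat n n"

definition pencil_eval :: "pencil \<Rightarrow> complex \<Rightarrow> complex mat" where
  "pencil_eval L x = fst L + x \<cdot>\<^sub>m snd L"

definition pencil_add :: "pencil \<Rightarrow> pencil \<Rightarrow> pencil" where
  "pencil_add L E = (fst L + fst E, snd L + snd E)"

definition pencil_rev :: "pencil \<Rightarrow> pencil" where
  "pencil_rev L = (snd L, fst L)"

definition pencil_regular :: "pencil \<Rightarrow> bool" where
  "pencil_regular L \<longleftrightarrow> (\<exists>x. det (pencil_eval L x) \<noteq> 0)"

datatype pencil_structure = Palindromic | Anti_Palindromic

fun has_structure :: "pencil_structure \<Rightarrow> pencil \<Rightarrow> bool" where
  "has_structure Palindromic (A, B) \<longleftrightarrow> A\<^sup>T = B"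
| "has_structure Anti_Palindromic (A, B) \<longleftrightarrow> A\<^sup>T = - B"

datatype eigval = Finite complex | Infinity

fun is_eigenvalue :: "pencil \<Rightarrow> eigval \<Rightarrow> bool" where
  "is_eigenvalue L (Finite x) \<longleftrightarrow> det (pencil_eval L x) = 0"
| "is_eigenvalue L Infinity \<longleftrightarrow> det (pencil_eval (pencil_rev L) 0) = 0"

(* L is strictly equivalent to diag (x I - J, x N - I), where J is the Jordan matrix with the
   blocks (size, eigenvalue) in fs, and N is the nilpotent Jordan matrix with the block sizes
   in ks. *)
definition weierstrass_form :: "nat \<Rightarrow> pencil \<Rightarrow> (nat \<times> complex) list \<Rightarrow> nat list \<Rightarrow> bool" where
  "weierstrass_form n L fs ks \<longleftrightarrow>
     0 \<notin> set (map fst fs) \<and> 0 \<notin> set ks \<and>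
     (\<exists>P \<in> carrier_mat n n. \<exists>Q \<in> carrier_mat n n. invertible_mat P \<and> invertible_mat Q \<and>
       (let J = jordan_matrix fs;
            N = jordan_matrix (map (\<lambda>k. (k, 0)) ks);
            p = dim_row J;
            q = dim_row N
        in P * fst L * Q = - four_block_mat J (0\<^sub>m p q) (0\<^sub>m q p) (1\<^sub>m q) \<and>
           P * snd L * Q = four_block_mat (1\<^sub>m p) (0\<^sub>m p q) (0\<^sub>m q p) N))"

(* The nonzero partial multiplicities, listed in nonincreasing order.  As the Weierstrass form
   of a regular pencil is unique up to the order of the blocks, the list is determined by the
   pencil and the point; it is [] precisely when the point is not an eigenvalue. *)
definition finite_partial_mults :: "nat \<Rightarrow> pencil \<Rightarrow> complex \<Rightarrow> nat list \<Rightarrow> bool" where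
  "finite_partial_mults n L x ns \<longleftrightarrow>
     sorted_wrt (\<ge>) ns \<and>
     (\<exists>fs ks. weierstrass_form n L fs ks \<and>
        mset ns = mset (map fst (filter (\<lambda>b. snd b = x) fs)))"

fun partial_mults :: "nat \<Rightarrow> pencil \<Rightarrow> eigval \<Rightarrow> nat list \<Rightarrow> bool" where
  "partial_mults n L (Finite x) ns \<longleftrightarrow> finite_partial_mults n L x ns"
| "partial_mults n L Infinity ns \<longleftrightarrow> finite_partial_mults n (pencil_rev L) 0 ns"

definition simple_eigenvalue :: "nat \<Rightarrow> pencil \<Rightarrow> eigval \<Rightarrow> bool" where
  "simple_eigenvalue n L ev \<longleftrightarrow>
     is_eigenvalue L ev \<and> (\<exists>ns. partial_mults n L ev ns \<and> sum_list ns = 1)"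

definition polynomial_function :: "nat \<Rightarrow> (complex vec \<Rightarrow> complex) \<Rightarrow> bool" where
  "polynomial_function m p \<longleftrightarrow>
     (\<exists>(S :: (nat \<Rightarrow> nat) set) c. finite S \<and>
        (\<forall>x \<in> carrier_vec m. p x = (\<Sum>e\<in>S. c e * (\<Prod>i<m. (x $ i) ^ e i))))"

definition algebraic_set :: "nat \<Rightarrow> complex vec set \<Rightarrow> bool" where
  "algebraic_set m V \<longleftrightarrow>
     (\<exists>F. finite F \<and> (\<forall>p\<in>F. polynomial_function m p) \<and>
        V = {x \<in> carrier_vec m. \<forall>p\<in>F. p x = 0})"

definition generic_set :: "nat \<Rightarrow> complex vec set \<Rightarrow> bool" where
  "generic_set m G \<longleftrightarrow>
     G \<subseteq> carrier_vec m \<and>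
     (\<exists>V. algebraic_set m V \<and> V \<noteq> carrier_vec m \<and> carrier_vec m - G \<subseteq> V)"

fun ssign :: "pencil_structure \<Rightarrow> complex" where
  "ssign Palindromic = 1"
| "ssign Anti_Palindromic = -1"

definition vec_block :: "nat \<Rightarrow> complex vec \<Rightarrow> nat \<Rightarrow> complex vec" where
  "vec_block n x k = vec n (\<lambda>i. x $ (k * n + i))"

(* The consecutive blocks of length n of the point x are v_1, ..., v_s, gamma_1, ..., gamma_s,
   delta_1, ..., delta_s and, if r is odd, u.  The two components are the coefficients of 1
   and x in the sum of the pencils v_j w_j^T + c (rev w_j) v_j^T with c the sign of the structure,
   where w_j = gamma_j + x delta_j, plus (1 + c x) u u^T if r is odd. *)
definition Phi :: "pencil_structure \<Rightarrow> nat \<Rightarrow> nat \<Rightarrow> complex vec \<Rightarrow> pencil" where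
  "Phi st n r x =
     (let s = r div 2;
          c = ssign st;
          v = (\<lambda>j. vec_block n x j);
          \<gamma> = (\<lambda>j. vec_block n x (s + j));
          \<delta> = (\<lambda>j. vec_block n x (2 * s + j));
          u = vec_block n x (3 * s)
      in (mat n n (\<lambda>(a, b).
             (\<Sum>j<s. v j $ a * \<gamma> j $ b + c * (\<delta> j $ a * v j $ b))
             + (if odd r then u $ a * u $ b else 0)),
          mat n n (\<lambda>(a, b).
             (\<Sum>j<s. v j $ a * \<delta> j $ b + c * (\<gamma> j $ a * v j $ b))
             + (if odd r then c * (u $ a * u $ b) else 0))))"

lemma Phi_eval:
  fixes x :: "complex vec" and y :: complex and r :: nat and st :: pencil_structure
  assumes "a < n" "b < n"
  defines "s \<equiv> r div 2" and "c \<equiv> ssign st"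
  defines "v \<equiv> \<lambda>j. vec_block n x j"
    and "w \<equiv> \<lambda>j. vec_block n x (s + j) + y \<cdot>\<^sub>v vec_block n x (2 * s + j)"
    and "rev_w \<equiv> \<lambda>j. vec_block n x (2 * s + j) + y \<cdot>\<^sub>v vec_block n x (s + j)"
    and "u \<equiv> vec_block n x (3 * s)"
  shows "pencil_eval (Phi st n r x) y $$ (a, b) =
    (if odd r then (1 + c * y) * (u $ a * u $ b) else 0)
    + (\<Sum>j<s. v j $ a * w j $ b + c * (rev_w j $ a * v j $ b))"
  using assms(1,2)
  by (simp add: Phi_def pencil_eval_def Let_def assms(3-) vec_block_def algebra_simps
      sum_distrib_left sum.distrib)

definition pm :: "nat list \<Rightarrow> nat \<Rightarrow> nat" where
  "pm ns j = (if 1 \<le> j \<and> j \<le> length ns then ns ! (j - 1) else 0)"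

definition property_P :: "nat \<Rightarrow> nat list \<Rightarrow> bool" where
  "property_P r ns \<longleftrightarrow>
     (\<exists>d. odd d \<and> (\<forall>j\<in>{r..r + d}. pm ns j = pm ns r) \<and> pm ns (r + d) > pm ns (r + d + 1))"

definition shifted_mults :: "nat \<Rightarrow> nat list \<Rightarrow> nat list" where
  "shifted_mults r ns = (pm ns (r + 1) + 1) # drop (r + 1) ns"

(* The last case of each structure includes the point at infinity. *)
fun listed_mults :: "pencil_structure \<Rightarrow> nat \<Rightarrow> eigval \<Rightarrow> nat list \<Rightarrow> nat list" where
  "listed_mults Palindromic r ev ns =
     (if ev = Finite 1 then
        (if odd (pm ns (r + 1)) \<and> property_P r ns then shifted_mults r ns else drop r ns)
      else if ev = Finite (-1) then
        (if even (pm ns (r + 1)) \<and> property_P r ns then shifted_mults r ns else drop r ns)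
        @ (if even r then [] else [1])
      else drop r ns)"
| "listed_mults Anti_Palindromic r ev ns =
     (if ev = Finite 1 then
        (if even (pm ns (r + 1)) \<and> property_P r ns then shifted_mults r ns else drop r ns)
        @ (if even r then [] else [1])
      else if ev = Finite (-1) then
        (if odd (pm ns (r + 1)) \<and> property_P r ns then shifted_mults r ns else drop r ns)
      else drop r ns)"

(* At -1 (T-palindromic) and at 1 (T-anti-palindromic) every structured n x n pencil
   evaluates to a skew-symmetric matrix, so that the point is always an eigenvalue if n is odd,
   and length ns has the same parity as n.  Hence for r > length ns the listed
   multiplicities [] (r even) and [1] (r odd) are attained only if r and length ns have equal
   parity; otherwise the generic multiplicities are [1] and [], respectively.  For instance,
   with n = 1, L = 1 + x and r = 2, all perturbed pencils are scalar multiples of 1 + x. *)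
definition perturbed_mults :: "pencil_structure \<Rightarrow> nat \<Rightarrow> eigval \<Rightarrow> nat list \<Rightarrow> nat list" where
  "perturbed_mults st r ev ns =
     (if ev = Finite (- ssign st) \<and> r > length ns \<and> odd (r - length ns)
      then (if even r then [1] else [])
      else listed_mults st r ev ns)"

end

theory Submission
imports Defs "Jordan_Normal_Form.Jordan_Normal_Form_Existence" "Subresultants.Subresultant_Gcd"
  "HOL-Computational_Algebra.Field_as_Ring"
begin

text \<open>Write \<open>c = ssign st\<close>.  The structure gives \<open>det L(\<lambda>) = (c \<lambda>)\<^sup>n det L(1 / \<lambda>)\<close>, so that at a fixed point \<open>c\<close> or \<open>-c\<close> of
  \<open>\<lambda> \<mapsto> 1 / \<lambda>\<close> the algebraic multiplicity has a prescribed parity (\<open>order_parity\<close>): it is even at \<open>c\<close>, and has the parity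
  of \<open>n\<close> at \<open>-c\<close>.

  The multiplicities of \<open>L + E\<close> are bounded from below for every perturbation \<open>E\<close>.  Partial multiplicities are
  counted by independent Jordan chains, and \<open>E\<close> is a sum of \<open>r\<close> polynomial matrices of rank one, each of which destroys
  at most one chain (\<open>chains_add_outer\<close>); hence the largest \<open>r\<close> multiplicities may disappear, and no more.  For
  odd \<open>r\<close> one of the summands vanishes at \<open>-c\<close>, which leaves one additional eigenvector and explains the entry \<open>1\<close> there.
  If the remaining list violates the parity, the algebraic multiplicity is larger by at least one.

  These bounds are attained generically.  The orders of vanishing of the determinant and of the entries of the adjugate are
  upper semicontinuous, and together with the lower bounds and the parity they determine the list
  (\<open>mults_of_attains\<close>); so for each eigenvalue a single example suffices.  For a point other than \<open>-c\<close> the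
  example adds \<open>r\<close> matrices \<open>(1 + c \<lambda>) u u\<^sup>T\<close>.  One such step removes the largest multiplicity if some \<open>u\<close> gives
  \<open>u\<^sup>T K u \<noteq> 0\<close> for the leading coefficient \<open>K\<close> of \<open>L\<^sup>-\<^sup>1\<close>; otherwise \<open>K\<close> is skew-symmetric, the point is \<open>c\<close>, the largest
  multiplicity occurs twice, and its second copy grows by one (\<open>additive_step\<close>).  At \<open>-c\<close> these matrices
  vanish.  There the role of a step is taken by the compression of \<open>L\<close> to a hyperplane (\<open>deletion_step\<close>), and a large
  perturbation of the complementary coordinates realizes \<open>r\<close> compressions at once (\<open>attains_large_perturbation\<close>).
  Infinity is the point \<open>0\<close> of the reversal, which has the same structure.

  The steps also restrict the multiplicities of \<open>L\<close> itself: the parity goes wrong only within runs of equal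
  multiplicities, where it alternates.  This is how property (P) arises (\<open>repair_iff_property_P\<close>).

  For the simplicity of the new eigenvalues, perturbations with simple new eigenvalues are first shown to be dense, by
  adding the summands of \<open>E\<close> one after another (\<open>dense_simple\<close>).  With \<open>v\<close> fixed, the variation of \<open>w\<close> in the direction
  \<open>(1 + c \<lambda>) v\<close> changes the determinant by the multiples of one polynomial, so that Bertini's theorem applies away from
  its zeros; and at these zeros the determinant is nonzero for generic \<open>v\<close> and \<open>w\<close>.  The discriminant of the
  determinant, divided by the factors that belong to the eigenvalues of \<open>L\<close>, then turns density into genericity
  (\<open>generically_simple_roots\<close>).\<close>

section \<open>Polynomial functions and generic properties\<close>

lemma polynomial_function_cong:
  assumes "polynomial_function m p" "\<And>x. x \<in> carrier_vec m \<Longrightarrow> p x = q x"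
  shows "polynomial_function m q"
proof -
  obtain S c where "finite S" "\<And>x. x \<in> carrier_vec m \<Longrightarrow> p x = (\<Sum>e\<in>S. c e * (\<Prod>i<m. (x $ i) ^ e i))"
    using assms(1) unfolding polynomial_function_def by blast
  then show ?thesis unfolding polynomial_function_def using assms(2)
    by (intro exI[of _ S] exI[of _ c]) simp
qed

lemma polynomial_function_const: "polynomial_function m (\<lambda>x. a)"
  unfolding polynomial_function_def
  by (rule exI[of _ "{\<lambda>i. 0}"], rule exI[of _ "\<lambda>e. a"]) simp

lemma polynomial_function_coord:
  assumes "i < m" shows "polynomial_function m (\<lambda>x. x $ i)"
proof -
  have "x $ i = (\<Prod>j<m. (x $ j) ^ (if j = i then 1 else 0))" for x :: "complex vec"
  proof -
    have "(\<Prod>j<m. (x $ j) ^ (if j = i then 1 else 0)) = (\<Prod>j<m. if j = i then x $ j else 1)"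
      by (rule prod.cong) auto
    also have "\<dots> = x $ i" using assms by (subst prod.delta) auto
    finally show ?thesis by simp
  qed
  then have 1: "x $ i = (\<Sum>e\<in>{\<lambda>j. if j = i then 1 else 0}. 1 * (\<Prod>j<m. (x $ j) ^ e j))"
    for x :: "complex vec"
    by (subst sum.insert) (simp_all only: finite.emptyI empty_iff sum.empty not_False_eq_True mult_1 add_0_right)
  show ?thesis unfolding polynomial_function_def
  proof (intro exI conjI ballI)
    show "finite {\<lambda>j. if j = i then 1 else (0::nat)}" by (rule finite.insertI) (rule finite.emptyI)
  qed (rule 1)
qed

lemma polynomial_function_add:
  assumes "polynomial_function m p" "polynomial_function m q"
  shows "polynomial_function m (\<lambda>x. p x + q x)"
proof -
  obtain S c where S: "finite S" "\<And>x. x \<in> carrier_vec m \<Longrightarrow> p x = (\<Sum>e\<in>S. c e * (\<Prod>i<m. (x $ i) ^ e i))"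
    using assms(1) unfolding polynomial_function_def by blast
  obtain S' c' where S': "finite S'" "\<And>x. x \<in> carrier_vec m \<Longrightarrow> q x = (\<Sum>e\<in>S'. c' e * (\<Prod>i<m. (x $ i) ^ e i))"
    using assms(2) unfolding polynomial_function_def by blast
  let ?c = "\<lambda>e. (if e \<in> S then c e else 0) + (if e \<in> S' then c' e else 0)"
  have "p x + q x = (\<Sum>e\<in>S \<union> S'. ?c e * (\<Prod>i<m. (x $ i) ^ e i))" if x: "x \<in> carrier_vec m" for x
  proof -
    have 1: "p x = (\<Sum>e\<in>S \<union> S'. (if e \<in> S then c e else 0) * (\<Prod>i<m. (x $ i) ^ e i))"
      unfolding S(2)[OF x] by (rule sum.mono_neutral_cong_left) (use S S' in auto)
    have 2: "q x = (\<Sum>e\<in>S \<union> S'. (if e \<in> S' then c' e else 0) * (\<Prod>i<m. (x $ i) ^ e i))"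
      unfolding S'(2)[OF x] by (rule sum.mono_neutral_cong_left) (use S S' in auto)
    show ?thesis unfolding 1 2 sum.distrib[symmetric]
      by (rule sum.cong) (simp_all only: distrib_right)
  qed
  then show ?thesis unfolding polynomial_function_def
    by (intro exI[of _ "S \<union> S'"] exI[of _ ?c]) (use S S' in auto)
qed

lemma polynomial_function_sum:
  assumes "\<And>a. a \<in> A \<Longrightarrow> polynomial_function m (f a)"
  shows "polynomial_function m (\<lambda>x. \<Sum>a\<in>A. f a x)"
proof (cases "finite A")
  case True
  then show ?thesis using assms
  proof (induction A rule: finite_induct)
    case (insert a A)
    have "polynomial_function m (\<lambda>x. f a x + (\<Sum>a\<in>A. f a x))"
      by (rule polynomial_function_add) (use insert in auto)
    then show ?case using insert.hyps by simp
  qed (simp add: polynomial_function_const)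
qed (simp add: polynomial_function_const)

lemma polynomial_function_monom_mult:
  assumes "polynomial_function m q"
  shows "polynomial_function m (\<lambda>x. a * (\<Prod>i<m. (x $ i) ^ e0 i) * q x)"
proof -
  obtain S c where S: "finite S" "\<And>x. x \<in> carrier_vec m \<Longrightarrow> q x = (\<Sum>e\<in>S. c e * (\<Prod>i<m. (x $ i) ^ e i))"
    using assms(1) unfolding polynomial_function_def by blast
  let ?h = "\<lambda>e i. e0 i + e i :: nat"
  have inj: "inj_on ?h S" by (rule inj_onI) (auto simp: fun_eq_iff)
  have "a * (\<Prod>i<m. (x $ i) ^ e0 i) * q x =
      (\<Sum>e\<in>?h ` S. (a * c (\<lambda>i. e i - e0 i)) * (\<Prod>i<m. (x $ i) ^ e i))"
    if x: "x \<in> carrier_vec m" for x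
    unfolding S(2)[OF x] sum.reindex[OF inj] sum_distrib_left o_def
    by (rule sum.cong) (simp_all add: power_add prod.distrib)
  then show ?thesis unfolding polynomial_function_def
    by (intro exI[of _ "?h ` S"] exI[of _ "\<lambda>e. a * c (\<lambda>i. e i - e0 i)"]) (use S in auto)
qed

lemma polynomial_function_mult:
  assumes "polynomial_function m p" "polynomial_function m q"
  shows "polynomial_function m (\<lambda>x. p x * q x)"
proof -
  obtain S c where S: "finite S" "\<And>x. x \<in> carrier_vec m \<Longrightarrow> p x = (\<Sum>e\<in>S. c e * (\<Prod>i<m. (x $ i) ^ e i))"
    using assms(1) unfolding polynomial_function_def by blast
  have "polynomial_function m (\<lambda>x. \<Sum>e\<in>S. c e * (\<Prod>i<m. (x $ i) ^ e i) * q x)"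
    by (intro polynomial_function_sum polynomial_function_monom_mult assms(2))
  then show ?thesis
    by (rule polynomial_function_cong) (simp add: S(2) sum_distrib_right)
qed

lemma polynomial_function_prod:
  assumes "\<And>a. a \<in> A \<Longrightarrow> polynomial_function m (f a)"
  shows "polynomial_function m (\<lambda>x. \<Prod>a\<in>A. f a x)"
proof (cases "finite A")
  case True
  then show ?thesis using assms
  proof (induction A rule: finite_induct)
    case (insert a A)
    have "polynomial_function m (\<lambda>x. f a x * (\<Prod>a\<in>A. f a x))"
      by (rule polynomial_function_mult) (use insert in auto)
    then show ?case using insert.hyps by simp
  qed (simp add: polynomial_function_const)
qed (simp add: polynomial_function_const)

lemma polynomial_function_uminus:
  "polynomial_function m p \<Longrightarrow> polynomial_function m (\<lambda>x. - p x)"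
  using polynomial_function_mult[OF polynomial_function_const[of m "-1"]] by simp

lemma polynomial_function_diff:
  "polynomial_function m p \<Longrightarrow> polynomial_function m q \<Longrightarrow> polynomial_function m (\<lambda>x. p x - q x)"
  using polynomial_function_add[OF _ polynomial_function_uminus] by simp

lemma polynomial_function_if:
  "polynomial_function m p \<Longrightarrow> polynomial_function m q \<Longrightarrow> polynomial_function m (\<lambda>x. if b then p x else q x)"
  by (cases b) simp_all

lemma polynomial_function_det:
  assumes "\<And>i j. i < n \<Longrightarrow> j < n \<Longrightarrow> polynomial_function m (\<lambda>x. F x $$ (i, j))"
    and "\<And>x. F x \<in> carrier_mat n n"
  shows "polynomial_function m (\<lambda>x. det (F x))"
  unfolding det_def'[OF assms(2)]
  by (intro polynomial_function_sum polynomial_function_mult polynomial_function_const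
      polynomial_function_prod assms(1)) auto

lemma polynomial_function_line:
  assumes "polynomial_function m p" "a \<in> carrier_vec m" "b \<in> carrier_vec m"
  obtains q :: "complex poly" where "\<And>t. p (a + t \<cdot>\<^sub>v b) = poly q t"
proof -
  obtain S c where S: "finite S" "\<And>x. x \<in> carrier_vec m \<Longrightarrow> p x = (\<Sum>e\<in>S. c e * (\<Prod>i<m. (x $ i) ^ e i))"
    using assms(1) unfolding polynomial_function_def by blast
  have "p (a + t \<cdot>\<^sub>v b) = poly (\<Sum>e\<in>S. Polynomial.smult (c e) (\<Prod>i<m. [:a $ i, b $ i:] ^ e i)) t" for t
  proof -
    have "a + t \<cdot>\<^sub>v b \<in> carrier_vec m" using assms by auto
    then show ?thesis using assms(2,3)
      by (simp add: S(2) poly_sum poly_prod mult.commute)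
  qed
  then show ?thesis using that by blast
qed

text \<open>Nonvanishing of a polynomial with a nonzero value: this form of genericity is closed under
  finite conjunctions, because two such polynomials restrict to nonzero univariate
  polynomials on the line through their points of nonvanishing.\<close>

definition generically :: "nat \<Rightarrow> (complex vec \<Rightarrow> bool) \<Rightarrow> bool" where
  "generically m Q \<longleftrightarrow> (\<exists>P. polynomial_function m P \<and> (\<exists>x\<in>carrier_vec m. P x \<noteq> 0) \<and>
     (\<forall>x\<in>carrier_vec m. P x \<noteq> 0 \<longrightarrow> Q x))"

lemma generically_polynomial:
  assumes "polynomial_function m P" "x0 \<in> carrier_vec m" "P x0 \<noteq> 0"
  shows "generically m (\<lambda>x. P x \<noteq> 0)"
  using assms unfolding generically_def by blast

lemma generically_mono:
  assumes "generically m Q" "\<And>x. x \<in> carrier_vec m \<Longrightarrow> Q x \<Longrightarrow> R x"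
  shows "generically m R"
  using assms unfolding generically_def by blast

lemma generically_True: "generically m (\<lambda>x. True)"
  unfolding generically_def
  by (intro exI[of _ "\<lambda>x. 1"] conjI bexI[of _ "0\<^sub>v m"])
    (simp_all add: polynomial_function_const)

lemma line_between:
  assumes "a \<in> carrier_vec m" "b \<in> carrier_vec m"
  shows "a + (0::complex) \<cdot>\<^sub>v (b - a) = a" "a + (1::complex) \<cdot>\<^sub>v (b - a) = b"
  using assms by (auto intro!: eq_vecI)

lemma cofinite_ne_infinite: "finite A \<Longrightarrow> \<exists>t::complex. t \<notin> A"
  using ex_new_if_finite[OF infinite_UNIV_char_0] by blast

lemma generically_conj:
  assumes "generically m Q" "generically m R"
  shows "generically m (\<lambda>x. Q x \<and> R x)"
proof -
  obtain P a where P: "polynomial_function m P" "a \<in> carrier_vec m" "P a \<noteq> 0"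
    "\<And>x. x \<in> carrier_vec m \<Longrightarrow> P x \<noteq> 0 \<Longrightarrow> Q x" using assms(1) unfolding generically_def by blast
  obtain P' b where P': "polynomial_function m P'" "b \<in> carrier_vec m" "P' b \<noteq> 0"
    "\<And>x. x \<in> carrier_vec m \<Longrightarrow> P' x \<noteq> 0 \<Longrightarrow> R x" using assms(2) unfolding generically_def by blast
  have ba: "b - a \<in> carrier_vec m" using P P' by auto
  obtain q where q: "\<And>t. P (a + t \<cdot>\<^sub>v (b - a)) = poly q t" using polynomial_function_line[OF P(1,2) ba] by blast
  obtain q' where q': "\<And>t. P' (a + t \<cdot>\<^sub>v (b - a)) = poly q' t" using polynomial_function_line[OF P'(1) P(2) ba] by blast
  have "poly q 0 \<noteq> 0" using q[of 0] line_between(1)[OF P(2) P'(2)] P(3) by simp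
  hence q0: "q \<noteq> 0" by auto
  have "poly q' 1 \<noteq> 0" using q'[of 1] line_between(2)[OF P(2) P'(2)] P'(3) by simp
  hence q0': "q' \<noteq> 0" by auto
  have "q * q' \<noteq> 0" using q0 q0' by simp
  from cofinite_ne_infinite[OF poly_roots_finite[OF this]] obtain t where t: "poly (q * q') t \<noteq> 0" by auto
  have "a + t \<cdot>\<^sub>v (b - a) \<in> carrier_vec m" using P P' by auto
  moreover have "P (a + t \<cdot>\<^sub>v (b - a)) * P' (a + t \<cdot>\<^sub>v (b - a)) \<noteq> 0" using t q q' by simp
  ultimately show ?thesis unfolding generically_def
    using polynomial_function_mult[OF P(1) P'(1)] P(4) P'(4)
    by (intro exI[of _ "\<lambda>x. P x * P' x"]) auto
qed

lemma generically_ball: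
  assumes "finite A" "\<And>a. a \<in> A \<Longrightarrow> generically m (Q a)"
  shows "generically m (\<lambda>x. \<forall>a\<in>A. Q a x)"
  using assms
proof (induction A rule: finite_induct)
  case empty then show ?case using generically_True by simp
next
  case (insert a A)
  have "generically m (\<lambda>x. Q a x \<and> (\<forall>a\<in>A. Q a x))"
    by (rule generically_conj) (use insert in auto)
  then show ?case by (rule generically_mono) auto
qed

lemma generically_ex:
  assumes "generically m Q" obtains x where "x \<in> carrier_vec m" "Q x"
  using assms unfolding generically_def by blast

lemma generic_set_Collect:
  assumes "generically m Q" shows "generic_set m {x \<in> carrier_vec m. Q x}"
proof -
  obtain P a where P: "polynomial_function m P" "a \<in> carrier_vec m" "P a \<noteq> 0"
    "\<And>x. x \<in> carrier_vec m \<Longrightarrow> P x \<noteq> 0 \<Longrightarrow> Q x" using assms(1) unfolding generically_def by blast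
  have "algebraic_set m {x \<in> carrier_vec m. P x = 0}"
    unfolding algebraic_set_def by (rule exI[of _ "{P}"]) (use P in auto)
  then show ?thesis unfolding generic_set_def using P
    by (intro conjI exI[of _ "{x \<in> carrier_vec m. P x = 0}"]) auto
qed

definition poly_family :: "nat \<Rightarrow> (complex vec \<Rightarrow> complex poly) \<Rightarrow> bool" where
  "poly_family m F \<longleftrightarrow> (\<forall>k. polynomial_function m (\<lambda>x. coeff (F x) k))"

lemma poly_family_const: "poly_family m (\<lambda>x. p)"
  by (simp add: poly_family_def polynomial_function_const)

lemma poly_family_add: "poly_family m F \<Longrightarrow> poly_family m G \<Longrightarrow> poly_family m (\<lambda>x. F x + G x)"
  by (simp add: poly_family_def polynomial_function_add)

lemma poly_family_mult: "poly_family m F \<Longrightarrow> poly_family m G \<Longrightarrow> poly_family m (\<lambda>x. F x * G x)"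
  by (auto simp: poly_family_def coeff_mult intro!: polynomial_function_sum polynomial_function_mult)

lemma poly_family_sum:
  "(\<And>a. a \<in> A \<Longrightarrow> poly_family m (F a)) \<Longrightarrow> poly_family m (\<lambda>x. \<Sum>a\<in>A. F a x)"
proof (induction A rule: infinite_finite_induct)
  case (insert a A)
  have "poly_family m (\<lambda>x. F a x + (\<Sum>a\<in>A. F a x))"
    by (rule poly_family_add) (use insert in auto)
  then show ?case using insert.hyps by simp
qed (simp_all add: poly_family_const)

lemma poly_family_prod:
  "(\<And>a. a \<in> A \<Longrightarrow> poly_family m (F a)) \<Longrightarrow> poly_family m (\<lambda>x. \<Prod>a\<in>A. F a x)"
proof (induction A rule: infinite_finite_induct)
  case (insert a A)
  have "poly_family m (\<lambda>x. F a x * (\<Prod>a\<in>A. F a x))"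
    by (rule poly_family_mult) (use insert in auto)
  then show ?case using insert.hyps by simp
qed (simp_all add: poly_family_const)

lemma poly_family_pCons:
  "polynomial_function m a \<Longrightarrow> poly_family m F \<Longrightarrow> poly_family m (\<lambda>x. pCons (a x) (F x))"
  unfolding poly_family_def coeff_pCons
proof (intro allI)
  fix k assume "polynomial_function m a" "\<forall>k. polynomial_function m (\<lambda>x. coeff (F x) k)"
  then show "polynomial_function m (\<lambda>x. case k of 0 \<Rightarrow> a x | Suc xa \<Rightarrow> coeff (F x) xa)"
    by (cases k) simp_all
qed

lemma poly_family_det:
  assumes "\<And>i j. i < n \<Longrightarrow> j < n \<Longrightarrow> poly_family m (\<lambda>x. F x $$ (i, j))"
    and "\<And>x. F x \<in> carrier_mat n n"
  shows "poly_family m (\<lambda>x. det (F x))"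
  unfolding det_def'[OF assms(2)]
  by (intro poly_family_sum poly_family_mult poly_family_const poly_family_prod assms(1)) auto

lemma poly_family_linear:
  fixes T :: "complex poly \<Rightarrow> complex poly"
  assumes F: "poly_family m F" and deg: "\<And>x. degree (F x) \<le> N"
    and add: "\<And>p q. T (p + q) = T p + T q" and smult: "\<And>c p. T (Polynomial.smult c p) = Polynomial.smult c (T p)"
  shows "poly_family m (\<lambda>x. T (F x))"
proof -
  have T0: "T 0 = 0" using smult[of 0 0] by simp
  have Tsum: "T (\<Sum>a\<in>A. f a) = (\<Sum>a\<in>A. T (f a))" for f and A :: "nat set"
    by (induction A rule: infinite_finite_induct) (auto simp: add T0)
  have "T (F x) = (\<Sum>k\<le>N. [:coeff (F x) k:] * T (monom 1 k))" for x
  proof -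
    have "F x = (\<Sum>k\<le>N. Polynomial.smult (coeff (F x) k) (monom 1 k))"
      by (simp add: smult_monom poly_as_sum_of_monoms'[OF deg])
    then have "T (F x) = T (\<Sum>k\<le>N. Polynomial.smult (coeff (F x) k) (monom 1 k))" by simp
    then show ?thesis by (simp add: Tsum smult)
  qed
  moreover have "poly_family m (\<lambda>x. \<Sum>k\<le>N. [:coeff (F x) k:] * T (monom 1 k))"
    using F by (intro poly_family_sum poly_family_mult poly_family_pCons poly_family_const)
      (auto simp: poly_family_def)
  ultimately show ?thesis by simp
qed

section \<open>Polynomial matrices\<close>

abbreviation ev_mat :: "complex poly mat \<Rightarrow> complex \<Rightarrow> complex mat" where
  "ev_mat M x \<equiv> map_mat (\<lambda>p. poly p x) M"

abbreviation ev_vec :: "complex poly vec \<Rightarrow> complex \<Rightarrow> complex vec" where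
  "ev_vec y x \<equiv> map_vec (\<lambda>p. poly p x) y"

lemma comm_ring_hom_poly: "comm_ring_hom (\<lambda>p. poly p (x :: complex))"
  by unfold_locales auto

lemma ev_mat_mult:
  "A \<in> carrier_mat n m \<Longrightarrow> B \<in> carrier_mat m p \<Longrightarrow> ev_mat (A * B) x = ev_mat A x * ev_mat B x"
  by (rule semiring_hom.mat_hom_mult) (unfold_locales, auto)

lemma det_ev_mat: "det (ev_mat A x) = poly (det A) x"
  by (rule comm_ring_hom.hom_det[OF comm_ring_hom_poly])

lemma mult_mat_zero_vec [simp]: "A \<in> carrier_mat n m \<Longrightarrow> A *\<^sub>v 0\<^sub>v m = (0\<^sub>v n :: 'a :: semiring_0 vec)"
  by (intro eq_vecI) auto

lemma zero_mat_mult_vec [simp]: "y \<in> carrier_vec m \<Longrightarrow> 0\<^sub>m n m *\<^sub>v y = (0\<^sub>v n :: 'a :: semiring_0 vec)"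
  by (intro eq_vecI) auto

definition lin :: "complex \<Rightarrow> complex poly" where "lin x = [:-x, 1:]"

lemma poly_lin [simp]: "poly (lin x) y = y - x"
  by (simp add: lin_def)

lemma lin_nonzero [simp]: "lin x \<noteq> 0"
  by (simp add: lin_def)

lemma lin_dvd_iff: "lin x dvd p \<longleftrightarrow> poly p x = 0"
  unfolding lin_def by (rule poly_eq_0_iff_dvd[symmetric])

lemma lin_power_dvdD: "lin x ^ k dvd p \<Longrightarrow> 1 \<le> k \<Longrightarrow> lin x dvd p"
  by (cases k) (auto elim: dvd_mult_left)

lemma order_eq_iff:
  assumes "p = lin x ^ a * e" "poly e x \<noteq> 0" shows "order x p = a"
proof -
  have e: "e \<noteq> 0" using assms by auto
  hence "order x p = order x (lin x ^ a) + order x e"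
    unfolding assms(1) by (intro order_mult) simp
  moreover have "order x (lin x ^ a) = a" using order_power_n_n[of x a] unfolding lin_def by simp
  ultimately show ?thesis using order_0I[OF assms(2)] by simp
qed

lemma order_factor:
  assumes "p \<noteq> 0" obtains e where "p = lin x ^ order x p * e" "poly e x \<noteq> 0"
  using order_decomp[OF assms, of x] lin_dvd_iff unfolding lin_def by blast

lemma lin_power_dvd_order: "p \<noteq> 0 \<Longrightarrow> lin x ^ k dvd p \<longleftrightarrow> k \<le> order x p"
  using order_divides[of x k p] unfolding lin_def by simp

definition outer :: "'a :: semiring_0 vec \<Rightarrow> 'a vec \<Rightarrow> 'a mat" where
  "outer a b = mat (dim_vec a) (dim_vec b) (\<lambda>(i, j). a $ i * b $ j)"

lemma outer_carrier [simp]: "a \<in> carrier_vec n \<Longrightarrow> b \<in> carrier_vec m \<Longrightarrow> outer a b \<in> carrier_mat n m"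
  by (auto simp: outer_def)

lemma outer_dim [simp]: "dim_row (outer a b) = dim_vec a" "dim_col (outer a b) = dim_vec b"
  by (auto simp: outer_def)

lemma outer_index [simp]: "i < dim_vec a \<Longrightarrow> j < dim_vec b \<Longrightarrow> outer a b $$ (i, j) = a $ i * b $ j"
  by (simp add: outer_def)

lemma outer_mult_vec:
  assumes "a \<in> carrier_vec n" "b \<in> carrier_vec m" "y \<in> carrier_vec m"
  shows "outer a b *\<^sub>v (y :: 'a :: comm_semiring_0 vec) = (b \<bullet> y) \<cdot>\<^sub>v a"
  using assms by (intro eq_vecI)
    (auto simp: outer_def scalar_prod_def row_def sum_distrib_right sum_distrib_left ac_simps)

text \<open>The matrix determinant lemma, by the two triangular factorizations of the bordered
  matrix with blocks \<open>1\<close>, \<open>-b\<^sup>T\<close>, \<open>a\<close> and \<open>M\<close>.\<close>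

lemma det_add_outer:
  fixes M :: "'a :: idom mat"
  assumes M: "M \<in> carrier_mat n n" and a: "a \<in> carrier_vec n" and b: "b \<in> carrier_vec n"
    and d0: "det M \<noteq> 0"
  shows "det (M + outer a b) = det M + b \<bullet> (adj_mat M *\<^sub>v a)"
proof -
  define c where "c = adj_mat M *\<^sub>v a"
  let ?d = "det M" and ?c = "c"
  have adj: "adj_mat M \<in> carrier_mat n n" "M * adj_mat M = ?d \<cdot>\<^sub>m 1\<^sub>m n" using adj_mat[OF M] by auto
  have c: "?c \<in> carrier_vec n" using adj a by (simp add: c_def)
  have Mc: "M *\<^sub>v ?c = ?d \<cdot>\<^sub>v a"
  proof -
    have "M *\<^sub>v ?c = (M * adj_mat M) *\<^sub>v a" using assoc_mult_mat_vec[OF M adj(1) a] by (simp add: c_def)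
    also have "\<dots> = ?d \<cdot>\<^sub>v (1\<^sub>m n *\<^sub>v a)" unfolding adj(2)
      using a by (intro eq_vecI)
        (auto simp: scalar_prod_def if_distrib[of "\<lambda>z. z * _"] if_distrib[of "(*) _"] cong: if_cong)
    finally show ?thesis using a by simp
  qed
  define one where "one = (1\<^sub>m 1 :: 'a mat)"
  define B where "B = mat 1 n (\<lambda>(i, j). - b $ j)"
  define A where "A = mat n 1 (\<lambda>(i, j). a $ i)"
  define C where "C = mat n 1 (\<lambda>(i, j). - ?c $ i)"
  have car: "one \<in> carrier_mat 1 1" "B \<in> carrier_mat 1 n" "A \<in> carrier_mat n 1" "C \<in> carrier_mat n 1"
    by (auto simp: one_def A_def B_def C_def)
  have AB: "A * B + (M + outer a b) = M"
    using a b M by (intro eq_matI) (auto simp: A_def B_def scalar_prod_def row_def col_def)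
  have BC: "one * (?d \<cdot>\<^sub>m 1\<^sub>m 1) + B * C = (?d + b \<bullet> ?c) \<cdot>\<^sub>m 1\<^sub>m 1"
    using b c by (intro eq_matI) (auto simp: one_def B_def C_def scalar_prod_def row_def col_def)
  have AMC: "A * (?d \<cdot>\<^sub>m 1\<^sub>m 1) + M * C = 0\<^sub>m n 1"
  proof (rule eq_matI)
    fix i j assume ij: "i < dim_row (0\<^sub>m n 1 :: 'a mat)" "j < dim_col (0\<^sub>m n 1 :: 'a mat)"
    hence i: "i < n" and j: "j = 0" by auto
    have "(M * C) $$ (i, 0) = - ((M *\<^sub>v ?c) $ i)"
      using i M car c by (simp add: scalar_prod_def C_def row_def sum_negf)
    also have "\<dots> = - (?d * a $ i)" unfolding Mc using i a by simp
    finally show "(A * (?d \<cdot>\<^sub>m 1\<^sub>m 1) + M * C) $$ (i, j) = 0\<^sub>m n 1 $$ (i, j)"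
      using i j car M by (simp add: A_def scalar_prod_def row_def col_def)
  qed (use car M in auto)
  define Z where "Z = four_block_mat one B A M"
  have 1: "Z = four_block_mat one (0\<^sub>m 1 n) A (1\<^sub>m n) * four_block_mat one B (0\<^sub>m n 1) (M + outer a b)"
  proof -
    have "four_block_mat one (0\<^sub>m 1 n) A (1\<^sub>m n) * four_block_mat one B (0\<^sub>m n 1) (M + outer a b) =
      four_block_mat (one * one + 0\<^sub>m 1 n * 0\<^sub>m n 1) (one * B + 0\<^sub>m 1 n * (M + outer a b))
        (A * one + 1\<^sub>m n * 0\<^sub>m n 1) (A * B + 1\<^sub>m n * (M + outer a b))"
      by (rule mult_four_block_mat[OF car(1) _ car(3) _ car(1) car(2)]) (use M a b in auto)
    also have "\<dots> = Z" unfolding Z_def using car M a b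
      by (intro cong_four_block_mat) (auto simp: one_def AB)
    finally show ?thesis by simp
  qed
  have 2: "Z * four_block_mat (?d \<cdot>\<^sub>m 1\<^sub>m 1) (0\<^sub>m 1 n) C (1\<^sub>m n) =
    four_block_mat ((?d + b \<bullet> ?c) \<cdot>\<^sub>m 1\<^sub>m 1) B (0\<^sub>m n 1) M"
  proof -
    have "Z * four_block_mat (?d \<cdot>\<^sub>m 1\<^sub>m 1) (0\<^sub>m 1 n) C (1\<^sub>m n) =
      four_block_mat (one * (?d \<cdot>\<^sub>m 1\<^sub>m 1) + B * C) (one * 0\<^sub>m 1 n + B * 1\<^sub>m n)
        (A * (?d \<cdot>\<^sub>m 1\<^sub>m 1) + M * C) (A * 0\<^sub>m 1 n + M * 1\<^sub>m n)"
      unfolding Z_def by (rule mult_four_block_mat[OF car(1,2,3) M _ _ car(4)]) (use M a b in auto)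
    then show ?thesis unfolding BC AMC using car M by simp
  qed
  have dZ: "det Z = det (M + outer a b)"
  proof -
    have "det Z = det (four_block_mat one (0\<^sub>m 1 n) A (1\<^sub>m n)) * det (four_block_mat one B (0\<^sub>m n 1) (M + outer a b))"
      unfolding 1 by (rule det_mult[of _ "1 + n"]) (use car M a b in auto)
    moreover have "det (four_block_mat one (0\<^sub>m 1 n) A (1\<^sub>m n)) = det one * det (1\<^sub>m n :: 'a mat)"
      by (rule det_four_block_mat_upper_right_zero[OF car(1) _ car(3)]) auto
    moreover have "det (four_block_mat one B (0\<^sub>m n 1) (M + outer a b)) = det one * det (M + outer a b)"
      by (rule det_four_block_mat_lower_left_zero[OF car(1,2)]) (use M a b in auto)
    ultimately show ?thesis by (simp add: one_def)
  qed
  have "det Z * det (four_block_mat (?d \<cdot>\<^sub>m 1\<^sub>m 1) (0\<^sub>m 1 n) C (1\<^sub>m n)) =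
    det (four_block_mat ((?d + b \<bullet> ?c) \<cdot>\<^sub>m 1\<^sub>m 1) B (0\<^sub>m n 1) M)"
    unfolding 2[symmetric] by (rule det_mult[symmetric, of _ "1 + n"]) (use car M in \<open>auto simp: Z_def\<close>)
  moreover have "det (four_block_mat (?d \<cdot>\<^sub>m 1\<^sub>m 1) (0\<^sub>m 1 n) C (1\<^sub>m n)) =
      det (?d \<cdot>\<^sub>m 1\<^sub>m 1) * det (1\<^sub>m n :: 'a mat)"
    by (rule det_four_block_mat_upper_right_zero[OF _ _ car(4)]) auto
  moreover have "det (four_block_mat ((?d + b \<bullet> ?c) \<cdot>\<^sub>m 1\<^sub>m 1) B (0\<^sub>m n 1) M) =
      det ((?d + b \<bullet> ?c) \<cdot>\<^sub>m 1\<^sub>m 1) * det M"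
    by (rule det_four_block_mat_lower_left_zero[OF _ car(2) _ M]) auto
  ultimately have "det (M + outer a b) * ?d = (?d + b \<bullet> ?c) * ?d" by (simp add: dZ)
  then show ?thesis using d0 by (simp add: c_def)
qed

lemma adj_mat_det_cancel:
  fixes M :: "'a :: idom mat"
  assumes M: "M \<in> carrier_mat n n" and Y: "Y \<in> carrier_mat n n" and d: "det M \<noteq> 0"
    and YM: "M * Y = det M \<cdot>\<^sub>m 1\<^sub>m n"
  shows "adj_mat M = Y"
proof -
  note adj = adj_mat[OF M]
  have "adj_mat M * (M * Y) = det M \<cdot>\<^sub>m adj_mat M"
    unfolding YM using adj(1) by (metis mult_smult_distrib one_carrier_mat right_mult_one_mat)
  moreover have "adj_mat M * (M * Y) = det M \<cdot>\<^sub>m Y"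
    using assoc_mult_mat[OF adj(1) M Y, symmetric] adj(3) Y
    by (metis left_mult_one_mat mult_smult_assoc_mat one_carrier_mat)
  ultimately have eq: "det M \<cdot>\<^sub>m adj_mat M = det M \<cdot>\<^sub>m Y" by simp
  show ?thesis
  proof (rule eq_matI)
    fix i j assume "i < dim_row Y" "j < dim_col Y"
    moreover have "(det M \<cdot>\<^sub>m adj_mat M) $$ (i, j) = (det M \<cdot>\<^sub>m Y) $$ (i, j)" using eq by simp
    ultimately show "adj_mat M $$ (i, j) = Y $$ (i, j)" using d adj(1) Y by auto
  qed (use adj(1) Y in auto)
qed

lemma nonzero_poly_mat_factor:
  fixes N :: "complex poly mat"
  assumes N: "N \<in> carrier_mat n m" and N0: "N \<noteq> 0\<^sub>m n m"
  obtains b K where "K \<in> carrier_mat n m" "N = lin x ^ b \<cdot>\<^sub>m K" "ev_mat K x \<noteq> 0\<^sub>m n m"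
proof -
  define S where "S = {(i, j). i < n \<and> j < m \<and> N $$ (i, j) \<noteq> 0}"
  have "S \<noteq> {}"
  proof
    assume "S = {}"
    hence "N = 0\<^sub>m n m" using N by (intro eq_matI) (auto simp: S_def)
    with N0 show False by simp
  qed
  have fin: "finite S" by (rule finite_subset[of _ "{..<n} \<times> {..<m}"]) (auto simp: S_def)
  define b where "b = Min ((\<lambda>ij. order x (N $$ ij)) ` S)"
  have "b \<in> (\<lambda>ij. order x (N $$ ij)) ` S" unfolding b_def using fin \<open>S \<noteq> {}\<close> by (intro Min_in) auto
  then obtain i0 j0 where ij0: "(i0, j0) \<in> S" "b = order x (N $$ (i0, j0))" by auto
  have dvd: "lin x ^ b dvd N $$ (i, j)" if "i < n" "j < m" for i j
  proof (cases "N $$ (i, j) = 0")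
    case False
    hence "(i, j) \<in> S" using that by (simp add: S_def)
    hence "b \<le> order x (N $$ (i, j))" unfolding b_def using fin by (intro Min_le) auto
    then show ?thesis using False by (simp add: lin_power_dvd_order)
  qed simp
  define K where "K = mat n m (\<lambda>ij. N $$ ij div lin x ^ b)"
  have Kc: "K \<in> carrier_mat n m" by (simp add: K_def)
  have NK: "N = lin x ^ b \<cdot>\<^sub>m K" using N dvd by (intro eq_matI) (auto simp: K_def)
  have "poly (K $$ (i0, j0)) x \<noteq> 0"
  proof
    assume "poly (K $$ (i0, j0)) x = 0"
    then obtain r where r: "K $$ (i0, j0) = lin x * r" using lin_dvd_iff by (metis dvdE)
    have ij: "i0 < n" "j0 < m" using ij0 by (auto simp: S_def)
    have "N $$ (i0, j0) = lin x ^ b * (lin x * r)" by (subst NK) (use ij r Kc in simp)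
    hence "N $$ (i0, j0) = lin x ^ Suc b * r" by (simp only: power_Suc ac_simps)
    hence "lin x ^ Suc b dvd N $$ (i0, j0)" by (simp only: dvd_triv_left)
    moreover have "N $$ (i0, j0) \<noteq> 0" using ij0 by (simp add: S_def)
    ultimately show False using ij0(2) lin_power_dvd_order[of "N $$ (i0, j0)" x "Suc b"] by simp
  qed
  moreover have "i0 < n" "j0 < m" using ij0 by (auto simp: S_def)
  ultimately have "ev_mat K x $$ (i0, j0) \<noteq> 0\<^sub>m n m $$ (i0, j0)" using Kc by simp
  hence "ev_mat K x \<noteq> 0\<^sub>m n m" by auto
  then show ?thesis by (rule that[OF Kc NK])
qed

text \<open>The adjugate with the exact power of \<open>\<lambda> - x\<close> removed.  Its value at \<open>x\<close> is, up to a scalar, the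
  leading Laurent coefficient of the inverse of \<open>M\<close> at \<open>x\<close>.\<close>

lemma adj_mat_factor:
  assumes M: "M \<in> carrier_mat n n" and n: "0 < n" and d: "det M \<noteq> 0"
  obtains b K e where "K \<in> carrier_mat n n" "adj_mat M = lin x ^ b \<cdot>\<^sub>m K" "ev_mat K x \<noteq> 0\<^sub>m n n"
    "b \<le> order x (det M)" "det M = lin x ^ order x (det M) * e" "poly e x \<noteq> 0"
    "M * K = (lin x ^ (order x (det M) - b) * e) \<cdot>\<^sub>m 1\<^sub>m n"
    "K * M = (lin x ^ (order x (det M) - b) * e) \<cdot>\<^sub>m 1\<^sub>m n"
proof -
  note adj = adj_mat[OF M]
  obtain e where e: "det M = lin x ^ order x (det M) * e" "poly e x \<noteq> 0" using order_factor[OF d] by blast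
  have "adj_mat M \<noteq> 0\<^sub>m n n"
  proof
    assume "adj_mat M = 0\<^sub>m n n"
    hence "det M \<cdot>\<^sub>m 1\<^sub>m n = 0\<^sub>m n n" using adj(2) M by simp
    hence "(det M \<cdot>\<^sub>m 1\<^sub>m n) $$ (0, 0) = 0" using n by simp
    thus False using n d by simp
  qed
  then obtain b K where K: "K \<in> carrier_mat n n" "adj_mat M = lin x ^ b \<cdot>\<^sub>m K" "ev_mat K x \<noteq> 0\<^sub>m n n"
    using nonzero_poly_mat_factor[OF adj(1)] by blast
  let ?a = "order x (det M)"
  have 1: "lin x ^ b \<cdot>\<^sub>m (M * K) = det M \<cdot>\<^sub>m 1\<^sub>m n"
    using adj(2) M K by (metis mult_smult_distrib)
  have 2: "lin x ^ b \<cdot>\<^sub>m (K * M) = det M \<cdot>\<^sub>m 1\<^sub>m n"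
    using adj(3) M K by (metis mult_smult_assoc_mat)
  have ba: "b \<le> ?a"
  proof -
    have "(lin x ^ b \<cdot>\<^sub>m (M * K)) $$ (0, 0) = det M" using 1 n by simp
    hence "lin x ^ b * ((M * K) $$ (0, 0)) = det M" using n M K by simp
    hence "lin x ^ b dvd det M" by (metis dvd_triv_left)
    then show ?thesis using d lin_power_dvd_order by simp
  qed
  have dm: "det M = lin x ^ b * (lin x ^ (?a - b) * e)"
    using e(1) ba by (metis le_add_diff_inverse mult.assoc power_add)
  have l0: "lin x ^ b \<noteq> 0" by simp
  have 3: "M * K = (lin x ^ (?a - b) * e) \<cdot>\<^sub>m 1\<^sub>m n"
  proof (rule eq_matI)
    fix i j assume ij: "i < dim_row ((lin x ^ (?a - b) * e) \<cdot>\<^sub>m 1\<^sub>m n)" "j < dim_col ((lin x ^ (?a - b) * e) \<cdot>\<^sub>m 1\<^sub>m n)"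
    have "(lin x ^ b \<cdot>\<^sub>m (M * K)) $$ (i, j) = (det M \<cdot>\<^sub>m 1\<^sub>m n) $$ (i, j)" using 1 by simp
    hence "lin x ^ b * (M * K) $$ (i, j) = lin x ^ b * ((lin x ^ (?a - b) * e) * (1\<^sub>m n $$ (i, j)))"
      using ij M K dm by (simp add: mult.assoc del: index_mult_mat(1))
    then show "(M * K) $$ (i, j) = ((lin x ^ (?a - b) * e) \<cdot>\<^sub>m 1\<^sub>m n) $$ (i, j)" using ij l0 by (simp del: index_mult_mat(1))
  qed (use M K in auto)
  have 4: "K * M = (lin x ^ (?a - b) * e) \<cdot>\<^sub>m 1\<^sub>m n"
  proof (rule eq_matI)
    fix i j assume ij: "i < dim_row ((lin x ^ (?a - b) * e) \<cdot>\<^sub>m 1\<^sub>m n)" "j < dim_col ((lin x ^ (?a - b) * e) \<cdot>\<^sub>m 1\<^sub>m n)"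
    have "(lin x ^ b \<cdot>\<^sub>m (K * M)) $$ (i, j) = (det M \<cdot>\<^sub>m 1\<^sub>m n) $$ (i, j)" using 2 by simp
    hence "lin x ^ b * (K * M) $$ (i, j) = lin x ^ b * ((lin x ^ (?a - b) * e) * (1\<^sub>m n $$ (i, j)))"
      using ij M K dm by (simp add: mult.assoc del: index_mult_mat(1))
    then show "(K * M) $$ (i, j) = ((lin x ^ (?a - b) * e) \<cdot>\<^sub>m 1\<^sub>m n) $$ (i, j)" using ij l0 by (simp del: index_mult_mat(1))
  qed (use M K in auto)
  show ?thesis by (rule that[OF K ba e 3 4])
qed

section \<open>Jordan chains\<close>

lemma mult_mat_entry:
  "A \<in> carrier_mat n m \<Longrightarrow> B \<in> carrier_mat m p \<Longrightarrow> i < n \<Longrightarrow> j < p \<Longrightarrow>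
    (A * B) $$ (i, j) = (\<Sum>l = 0..<m. A $$ (i, l) * B $$ (l, j))"
  by (simp add: scalar_prod_def)

lemma mult_mat_vec_entry:
  "A \<in> carrier_mat n m \<Longrightarrow> y \<in> carrier_vec m \<Longrightarrow> i < n \<Longrightarrow>
    (A *\<^sub>v y) $ i = (\<Sum>l = 0..<m. A $$ (i, l) * y $ l)"
  by (simp add: scalar_prod_def)

text \<open>The \<open>q\<close> columns of \<open>X\<close> are polynomials that start with linearly independent vectors at \<open>x\<close> and are mapped by
\<open>M\<close> to multiples of \<open>(\<lambda> - x)\<^sup>k\<close>: their Taylor coefficients at \<open>x\<close> are Jordan chains of length \<open>k\<close>.  The largest
possible \<open>q\<close> is the number of partial multiplicities that are at least \<open>k\<close>.\<close>

definition chains :: "nat \<Rightarrow> nat \<Rightarrow> nat \<Rightarrow> complex poly mat \<Rightarrow> complex \<Rightarrow> bool" where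
  "chains n q k M x \<longleftrightarrow> (\<exists>X \<in> carrier_mat n q.
     (\<forall>i<n. \<forall>j<q. lin x ^ k dvd (M * X) $$ (i, j)) \<and>
     (\<forall>v \<in> carrier_vec q. ev_mat X x *\<^sub>v v = 0\<^sub>v n \<longrightarrow> v = 0\<^sub>v q))"

lemma chainsI:
  assumes "X \<in> carrier_mat n q" "\<And>i j. i < n \<Longrightarrow> j < q \<Longrightarrow> lin x ^ k dvd (M * X) $$ (i, j)"
    and "\<And>v. v \<in> carrier_vec q \<Longrightarrow> ev_mat X x *\<^sub>v v = 0\<^sub>v n \<Longrightarrow> v = 0\<^sub>v q"
  shows "chains n q k M x"
  unfolding chains_def using assms by (intro bexI[of _ X]) auto

lemma chain_single:
  assumes M: "M \<in> carrier_mat n n" and y: "y \<in> carrier_vec n"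
    and d: "\<And>i. i < n \<Longrightarrow> lin x ^ k dvd (M *\<^sub>v y) $ i" and i0: "i0 < n" "poly (y $ i0) x \<noteq> 0"
  shows "chains n 1 k M x"
proof (rule chainsI)
  let ?X = "mat n 1 (\<lambda>(i, j). y $ i)"
  show X: "?X \<in> carrier_mat n 1" by simp
  show "lin x ^ k dvd (M * ?X) $$ (i, j)" if "i < n" "j < 1" for i j
  proof -
    have "(M * ?X) $$ (i, j) = (\<Sum>l = 0..<n. M $$ (i, l) * ?X $$ (l, j))"
      by (rule mult_mat_entry[OF M X that])
    also have "\<dots> = (M *\<^sub>v y) $ i" using that
      by (simp add: mult_mat_vec_entry[OF M y] del: index_mult_mat_vec)
    finally show ?thesis using d that by simp
  qed
  show "v = 0\<^sub>v 1" if v: "v \<in> carrier_vec 1" "ev_mat ?X x *\<^sub>v v = 0\<^sub>v n" for v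
  proof -
    have "(ev_mat ?X x *\<^sub>v v) $ i0 = 0" using v i0 by simp
    hence "poly (y $ i0) x * v $ 0 = 0" using v i0 by (simp add: scalar_prod_def)
    thus ?thesis using v i0 by (intro eq_vecI) auto
  qed
qed

lemma chains_1D:
  assumes M: "M \<in> carrier_mat n n" and c: "chains n 1 k M x"
  obtains y i0 where "y \<in> carrier_vec n" "\<And>i. i < n \<Longrightarrow> lin x ^ k dvd (M *\<^sub>v y) $ i"
    "i0 < n" "poly (y $ i0) x \<noteq> 0"
proof -
  obtain X where X: "X \<in> carrier_mat n 1" "\<And>i j. i < n \<Longrightarrow> j < 1 \<Longrightarrow> lin x ^ k dvd (M * X) $$ (i, j)"
    and inj: "\<And>v. v \<in> carrier_vec 1 \<Longrightarrow> ev_mat X x *\<^sub>v v = 0\<^sub>v n \<Longrightarrow> v = 0\<^sub>v 1"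
    using c unfolding chains_def by blast
  have y: "col X 0 \<in> carrier_vec n" using X by auto
  have "\<exists>i<n. poly (col X 0 $ i) x \<noteq> 0"
  proof (rule ccontr)
    assume "\<not> ?thesis"
    hence "ev_mat X x *\<^sub>v unit_vec 1 0 = 0\<^sub>v n" using X by (intro eq_vecI) (auto simp: scalar_prod_def)
    hence "unit_vec 1 0 = (0\<^sub>v 1 :: complex vec)" using inj by simp
    hence "unit_vec 1 0 $ 0 = (0::complex)" by simp
    thus False by simp
  qed
  then obtain i0 where "i0 < n" "poly (col X 0 $ i0) x \<noteq> 0" by blast
  moreover have "lin x ^ k dvd (M *\<^sub>v col X 0) $ i" if "i < n" for i
    using X(2)[OF that, of 0] X(1) M that by simp
  ultimately show ?thesis using that[OF y] by blast
qed

text \<open>The largest length of a chain with nonzero start is the order of the pole of the inverse.\<close>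

lemma chains_1_iff:
  assumes M: "M \<in> carrier_mat n n" and d: "det M \<noteq> 0" and K: "K \<in> carrier_mat n n"
    and adjK: "adj_mat M = lin x ^ b \<cdot>\<^sub>m K" and K0: "ev_mat K x \<noteq> 0\<^sub>m n n"
    and ba: "b \<le> order x (det M)" and e: "poly e x \<noteq> 0"
    and MK: "M * K = (lin x ^ (order x (det M) - b) * e) \<cdot>\<^sub>m 1\<^sub>m n"
  shows "chains n 1 k M x \<longleftrightarrow> k \<le> order x (det M) - b"
proof
  assume k: "k \<le> order x (det M) - b"
  obtain i0 j0 where ij: "i0 < n" "j0 < n" "poly (K $$ (i0, j0)) x \<noteq> 0"
  proof -
    have "\<exists>i0 j0. i0 < n \<and> j0 < n \<and> poly (K $$ (i0, j0)) x \<noteq> 0"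
    proof (rule ccontr)
      assume "\<not> ?thesis"
      hence "ev_mat K x = 0\<^sub>m n n" using K by (intro eq_matI) auto
      with K0 show False by simp
    qed
    then show ?thesis using that by blast
  qed
  have "(M *\<^sub>v col K j0) $ i = ((lin x ^ (order x (det M) - b) * e) \<cdot>\<^sub>m 1\<^sub>m n) $$ (i, j0)" if "i < n" for i
  proof -
    have "(M *\<^sub>v col K j0) $ i = (M * K) $$ (i, j0)" using that ij M K by simp
    then show ?thesis unfolding MK .
  qed
  hence "lin x ^ k dvd (M *\<^sub>v col K j0) $ i" if "i < n" for i
    using that ij k by (auto simp: le_imp_power_dvd intro!: dvd_mult2)
  then show "chains n 1 k M x" using ij K
    by (intro chain_single[OF M, of "col K j0" x k i0]) auto
next
  assume "chains n 1 k M x"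
  then obtain y i0 where y: "y \<in> carrier_vec n" "\<And>i. i < n \<Longrightarrow> lin x ^ k dvd (M *\<^sub>v y) $ i"
    "i0 < n" "poly (y $ i0) x \<noteq> 0" using chains_1D[OF M] by blast
  note adj = adj_mat[OF M]
  have "(adj_mat M *\<^sub>v (M *\<^sub>v y)) = (det M \<cdot>\<^sub>m 1\<^sub>m n) *\<^sub>v y"
    using assoc_mult_mat_vec[OF adj(1) M y(1)] adj(3) by simp
  hence "(adj_mat M *\<^sub>v (M *\<^sub>v y)) $ i0 = ((det M \<cdot>\<^sub>m 1\<^sub>m n) *\<^sub>v y) $ i0" by simp
  also have "\<dots> = (\<Sum>l = 0..<n. (det M \<cdot>\<^sub>m 1\<^sub>m n) $$ (i0, l) * y $ l)"
    by (rule mult_mat_vec_entry[OF _ y(1,3)]) simp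
  also have "\<dots> = (\<Sum>l = 0..<n. if l = i0 then det M * y $ l else 0)"
    by (rule sum.cong) (use y in auto)
  also have "\<dots> = det M * y $ i0" using y by simp
  finally have eq: "(adj_mat M *\<^sub>v (M *\<^sub>v y)) $ i0 = det M * y $ i0" .
  have "(adj_mat M *\<^sub>v (M *\<^sub>v y)) $ i0 = (\<Sum>l = 0..<n. adj_mat M $$ (i0, l) * (M *\<^sub>v y) $ l)"
    by (rule mult_mat_vec_entry[OF adj(1)]) (use y M in auto)
  moreover have "lin x ^ (b + k) dvd \<dots>"
  proof (rule dvd_sum)
    fix l assume l: "l \<in> {0..<n}"
    have "lin x ^ b dvd adj_mat M $$ (i0, l)" unfolding adjK using l y K by simp
    then show "lin x ^ (b + k) dvd adj_mat M $$ (i0, l) * (M *\<^sub>v y) $ l"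
      unfolding power_add using y(2)[of l] l by (intro mult_dvd_mono) auto
  qed
  ultimately have "lin x ^ (b + k) dvd det M * y $ i0" using eq by simp
  moreover have y0: "y $ i0 \<noteq> 0" using y(4) by auto
  ultimately have "b + k \<le> order x (det M * y $ i0)" using d by (subst lin_power_dvd_order[symmetric]) auto
  also have "\<dots> = order x (det M)" using d y0 order_0I[OF y(4)] by (subst order_mult) auto
  finally show "k \<le> order x (det M) - b" by simp
qed

text \<open>A perturbation of rank one destroys at most one of \<open>q + 1\<close> independent chains: eliminate with
  the chain on which the functional \<open>b\<close> vanishes to the lowest order.\<close>

lemma chains_add_outer:
  assumes M: "M \<in> carrier_mat n n" and a: "a \<in> carrier_vec n" and b: "b \<in> carrier_vec n"
    and c: "chains n (Suc q) k M x"
  shows "chains n q k (M + outer a b) x"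
proof -
  obtain X where X: "X \<in> carrier_mat n (Suc q)"
    and Xd: "\<And>i j. i < n \<Longrightarrow> j < Suc q \<Longrightarrow> lin x ^ k dvd (M * X) $$ (i, j)"
    and inj: "\<And>v. v \<in> carrier_vec (Suc q) \<Longrightarrow> ev_mat X x *\<^sub>v v = 0\<^sub>v n \<Longrightarrow> v = 0\<^sub>v (Suc q)"
    using c unfolding chains_def by blast
  define f where "f j = (\<Sum>l = 0..<n. b $ l * X $$ (l, j))" for j
  obtain j0 g h where jgh: "j0 \<le> q" "poly g x \<noteq> 0" "\<And>j. j \<le> q \<Longrightarrow> lin x ^ k dvd g * f j - h j * f j0"
  proof (cases "\<forall>j\<le>q. lin x ^ k dvd f j")
    case True
    then show ?thesis using that[of q 1 "\<lambda>j. 0"] by auto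
  next
    case False
    define S where "S = {j. j \<le> q \<and> \<not> lin x ^ k dvd f j}"
    have S: "finite S" "S \<noteq> {}" using False by (auto simp: S_def)
    define j0 where "j0 = arg_min_on (\<lambda>j. order x (f j)) S"
    have j0: "j0 \<in> S" "\<And>j. j \<in> S \<Longrightarrow> order x (f j0) \<le> order x (f j)"
      using arg_min_if_finite(1)[OF S] arg_min_least[OF S] unfolding j0_def by auto
    define e where "e = order x (f j0)"
    have f0: "f j0 \<noteq> 0" using j0 by (auto simp: S_def)
    hence ek: "e < k" using j0(1) lin_power_dvd_order[OF f0, of x k] by (auto simp: S_def e_def)
    have dvd: "lin x ^ e dvd f j" if "j \<le> q" for j
    proof (cases "j \<in> S")
      case True
      hence "f j \<noteq> 0" by (auto simp: S_def)
      then show ?thesis using lin_power_dvd_order j0(2)[OF True] unfolding e_def by blast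
    next
      case False
      hence "lin x ^ k dvd f j" using that by (auto simp: S_def)
      then show ?thesis using ek by (meson dvd_trans le_imp_power_dvd less_imp_le)
    qed
    define h where "h j = f j div lin x ^ e" for j
    have fh: "f j = lin x ^ e * h j" if "j \<le> q" for j using dvd[OF that] by (simp add: h_def)
    have j0q: "j0 \<le> q" using j0 by (auto simp: S_def)
    have "poly (h j0) x \<noteq> 0"
    proof
      assume "poly (h j0) x = 0"
      then obtain r where "h j0 = lin x * r" using lin_dvd_iff by (metis dvdE)
      hence "f j0 = lin x ^ Suc e * r" using fh[OF j0q] by (simp only: power_Suc ac_simps)
      hence "lin x ^ Suc e dvd f j0" by (simp only: dvd_triv_left)
      thus False using lin_power_dvd_order[OF f0, of x "Suc e"] by (simp add: e_def)
    qed
    moreover have "h j0 * f j - h j * f j0 = 0" if "j \<le> q" for j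
      unfolding fh[OF that] fh[OF j0q] by (simp add: ac_simps)
    ultimately show ?thesis using that[of j0 "h j0" h] j0q by auto
  qed
  define s where "s j = (if j < j0 then j else Suc j)" for j
  have s: "s j \<le> q" "s j \<noteq> j0" if "j < q" for j using that jgh(1) by (auto simp: s_def)
  have sbij: "bij_betw s {0..<q} ({0..<Suc q} - {j0})"
  proof (rule bij_betwI[of _ _ _ "\<lambda>j. if j < j0 then j else j - 1"])
    show "s \<in> {0..<q} \<rightarrow> {0..<Suc q} - {j0}" using s by (fastforce simp: less_Suc_eq_le)
    show "(\<lambda>j. if j < j0 then j else j - 1) \<in> {0..<Suc q} - {j0} \<rightarrow> {0..<q}" using jgh(1) by (auto split: if_splits)
  qed (use jgh(1) in \<open>auto simp: s_def split: if_splits\<close>)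
  define Y where "Y = mat n q (\<lambda>(i, j). g * X $$ (i, s j) - h (s j) * X $$ (i, j0))"
  have Y: "Y \<in> carrier_mat n q" by (simp add: Y_def)
  show ?thesis
  proof (rule chainsI[OF Y])
    fix i j assume i: "i < n" and j: "j < q"
    have sj: "s j < Suc q" "j0 < Suc q" using s(1)[OF j] jgh(1) by auto
    have "((M + outer a b) * Y) $$ (i, j) = (\<Sum>l = 0..<n. (M + outer a b) $$ (i, l) * Y $$ (l, j))"
      by (rule mult_mat_entry[OF _ Y i j]) (use M a b in auto)
    also have "\<dots> = (\<Sum>l = 0..<n. g * (M $$ (i, l) * X $$ (l, s j)) - h (s j) * (M $$ (i, l) * X $$ (l, j0))
        + a $ i * (g * (b $ l * X $$ (l, s j)) - h (s j) * (b $ l * X $$ (l, j0))))"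
      by (rule sum.cong) (use M a b i j in \<open>auto simp: Y_def algebra_simps\<close>)
    also have "\<dots> = g * (M * X) $$ (i, s j) - h (s j) * (M * X) $$ (i, j0) + a $ i * (g * f (s j) - h (s j) * f j0)"
      unfolding mult_mat_entry[OF M X i sj(1)] mult_mat_entry[OF M X i sj(2)] f_def
      by (simp add: sum.distrib sum_subtractf sum_distrib_left right_diff_distrib)
    also have "lin x ^ k dvd \<dots>"
      by (rule dvd_add[OF dvd_diff[OF dvd_mult[OF Xd[OF i sj(1)]] dvd_mult[OF Xd[OF i sj(2)]]]
            dvd_mult[OF jgh(3)[OF s(1)[OF j]]]])
    finally show "lin x ^ k dvd ((M + outer a b) * Y) $$ (i, j)" .
  next
    fix v :: "complex vec" assume v: "v \<in> carrier_vec q" and Yv: "ev_mat Y x *\<^sub>v v = 0\<^sub>v n"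
    define t where "t = inv_into {0..<q} s"
    have t: "t (s j) = j" if "j < q" for j
      using sbij that by (simp add: t_def bij_betw_inv_into_left)
    define w where "w = vec (Suc q) (\<lambda>j. if j = j0 then - (\<Sum>j = 0..<q. poly (h (s j)) x * v $ j)
      else poly g x * v $ (t j))"
    have w: "w \<in> carrier_vec (Suc q)" by (simp add: w_def)
    have wj0: "w $ j0 = - (\<Sum>j = 0..<q. poly (h (s j)) x * v $ j)" using jgh(1) by (simp add: w_def)
    have ws: "w $ s j = poly g x * v $ j" if "j < q" for j
      using s[OF that] t[OF that] by (simp add: w_def)
    have "ev_mat X x *\<^sub>v w = 0\<^sub>v n"
    proof (rule eq_vecI)
      fix i assume "i < dim_vec (0\<^sub>v n)"
      hence i: "i < n" by simp
      have "(ev_mat X x *\<^sub>v w) $ i = (\<Sum>j = 0..<Suc q. poly (X $$ (i, j)) x * w $ j)"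
        unfolding mult_mat_vec_entry[OF map_carrier_mat[THEN iffD2, OF X] w i]
        by (rule sum.cong) (use X i in auto)
      also have "\<dots> = poly (X $$ (i, j0)) x * w $ j0 + (\<Sum>j \<in> {0..<Suc q} - {j0}. poly (X $$ (i, j)) x * w $ j)"
        using jgh(1) by (subst sum.remove[of _ j0]) auto
      also have "(\<Sum>j \<in> {0..<Suc q} - {j0}. poly (X $$ (i, j)) x * w $ j) =
          (\<Sum>j = 0..<q. poly (X $$ (i, s j)) x * w $ s j)"
        by (rule sum.reindex_bij_betw[OF sbij, symmetric])
      also have "poly (X $$ (i, j0)) x * w $ j0 + \<dots> =
         (\<Sum>j = 0..<q. (poly g x * poly (X $$ (i, s j)) x - poly (h (s j)) x * poly (X $$ (i, j0)) x) * v $ j)"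
        by (simp add: wj0 ws sum_distrib_left left_diff_distrib right_diff_distrib sum_subtractf ac_simps)
      also have "\<dots> = (ev_mat Y x *\<^sub>v v) $ i"
        unfolding mult_mat_vec_entry[OF map_carrier_mat[THEN iffD2, OF Y] v i]
        by (rule sum.cong) (use i in \<open>auto simp: Y_def\<close>)
      finally show "(ev_mat X x *\<^sub>v w) $ i = 0\<^sub>v n $ i" using Yv i by simp
    qed (use X in auto)
    hence w0: "w = 0\<^sub>v (Suc q)" using inj[OF w] by simp
    show "v = 0\<^sub>v q"
    proof (rule eq_vecI)
      fix j assume "j < dim_vec (0\<^sub>v q)"
      hence j: "j < q" by simp
      note ws[OF j]
      moreover have "w $ s j = 0" unfolding w0 using s[OF j] by simp
      ultimately show "v $ j = 0\<^sub>v q $ j" using jgh(2) j by simp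
    qed (use v in auto)
  qed
qed

text \<open>For chains of length one only the values at \<open>x\<close> matter, and these do not change.\<close>

lemma chains_add_outer_vanishing:
  assumes M: "M \<in> carrier_mat n n" and a: "a \<in> carrier_vec n" and b: "b \<in> carrier_vec n"
    and c: "chains n q 1 M x" and ax: "\<And>i. i < n \<Longrightarrow> poly (a $ i) x = 0"
  shows "chains n q 1 (M + outer a b) x"
proof -
  obtain X where X: "X \<in> carrier_mat n q"
    and Xd: "\<And>i j. i < n \<Longrightarrow> j < q \<Longrightarrow> lin x ^ 1 dvd (M * X) $$ (i, j)"
    and inj: "\<And>v. v \<in> carrier_vec q \<Longrightarrow> ev_mat X x *\<^sub>v v = 0\<^sub>v n \<Longrightarrow> v = 0\<^sub>v q"
    using c unfolding chains_def by blast
  show ?thesis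
  proof (rule chainsI[OF X _ inj])
    fix i j assume i: "i < n" and j: "j < q"
    have "((M + outer a b) * X) $$ (i, j) = (\<Sum>l = 0..<n. (M + outer a b) $$ (i, l) * X $$ (l, j))"
      by (rule mult_mat_entry[OF _ X i j]) (use M a b in auto)
    also have "\<dots> = (\<Sum>l = 0..<n. M $$ (i, l) * X $$ (l, j) + a $ i * (b $ l * X $$ (l, j)))"
      by (rule sum.cong) (use M a b i j in \<open>auto simp: algebra_simps\<close>)
    also have "\<dots> = (M * X) $$ (i, j) + a $ i * (\<Sum>l = 0..<n. b $ l * X $$ (l, j))"
      unfolding mult_mat_entry[OF M X i j] by (simp only: sum.distrib sum_distrib_left)
    also have "lin x ^ 1 dvd \<dots>" using Xd[OF i j] ax[OF i] by (intro dvd_add dvd_mult2) (auto simp: lin_dvd_iff)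
    finally show "lin x ^ 1 dvd ((M + outer a b) * X) $$ (i, j)" .
  qed
qed

section \<open>Counting chains in the Weierstrass form\<close>

definition lift :: "complex mat \<Rightarrow> complex poly mat" where "lift A = map_mat (\<lambda>a. [:a:]) A"

lemma lift_carrier [simp]: "lift A \<in> carrier_mat n m \<longleftrightarrow> A \<in> carrier_mat n m"
  by (auto simp: lift_def)

lemma lift_dim [simp]: "dim_row (lift A) = dim_row A" "dim_col (lift A) = dim_col A"
  by (auto simp: lift_def)

lemma lift_index [simp]: "i < dim_row A \<Longrightarrow> j < dim_col A \<Longrightarrow> lift A $$ (i, j) = [:A $$ (i, j):]"
  by (auto simp: lift_def)

lemma comm_ring_hom_const: "comm_ring_hom (\<lambda>a :: complex. [:a:])"
  by unfold_locales (auto simp: one_pCons)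

lemma lift_mult: "A \<in> carrier_mat n m \<Longrightarrow> B \<in> carrier_mat m p \<Longrightarrow> lift (A * B) = lift A * lift B"
  unfolding lift_def by (rule semiring_hom.mat_hom_mult) (unfold_locales, auto simp: one_pCons)

lemma lift_one [simp]: "lift (1\<^sub>m n) = 1\<^sub>m n"
  unfolding lift_def by (rule semiring_hom.mat_hom_one) (unfold_locales, auto simp: one_pCons)

lemma det_lift: "det (lift A) = [:det A:]"
  unfolding lift_def by (rule comm_ring_hom.hom_det[OF comm_ring_hom_const])

lemma ev_lift [simp]: "ev_mat (lift A) x = A"
  by (intro eq_matI) (auto simp: lift_def)

lemma chains_equiv1:
  assumes M: "M \<in> carrier_mat n n" and P: "P \<in> carrier_mat n n" and Q: "Q \<in> carrier_mat n n"
    and Q': "Q' \<in> carrier_mat n n" and QQ: "Q * Q' = 1\<^sub>m n" and c: "chains n q k M x"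
  shows "chains n q k (lift P * M * lift Q) x"
proof -
  obtain X where X: "X \<in> carrier_mat n q"
    and Xd: "\<And>i j. i < n \<Longrightarrow> j < q \<Longrightarrow> lin x ^ k dvd (M * X) $$ (i, j)"
    and inj: "\<And>v. v \<in> carrier_vec q \<Longrightarrow> ev_mat X x *\<^sub>v v = 0\<^sub>v n \<Longrightarrow> v = 0\<^sub>v q"
    using c unfolding chains_def by blast
  let ?X = "lift Q' * X"
  have X': "?X \<in> carrier_mat n q" using X Q' by (auto intro!: mult_carrier_mat)
  have lQ: "lift P \<in> carrier_mat n n" "lift Q \<in> carrier_mat n n" "lift Q' \<in> carrier_mat n n" using P Q Q' by auto
  have eq: "lift P * M * lift Q * ?X = lift P * (M * X)"
  proof -
    have "lift P * M * lift Q * ?X = lift P * M * (lift Q * ?X)"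
      by (rule assoc_mult_mat[OF _ lQ(2) X']) (use lQ M in auto)
    also have "lift Q * ?X = (lift Q * lift Q') * X" by (rule assoc_mult_mat[OF lQ(2,3) X, symmetric])
    also have "lift Q * lift Q' = 1\<^sub>m n" by (simp add: lift_mult[OF Q Q', symmetric] QQ)
    also have "1\<^sub>m n * X = X" using X by simp
    also have "lift P * M * X = lift P * (M * X)" by (rule assoc_mult_mat[OF lQ(1) M X])
    finally show ?thesis .
  qed
  show ?thesis
  proof (rule chainsI[OF X'])
    fix i j assume i: "i < n" and j: "j < q"
    have "(lift P * M * lift Q * ?X) $$ (i, j) = (\<Sum>l = 0..<n. lift P $$ (i, l) * (M * X) $$ (l, j))"
      unfolding eq by (rule mult_mat_entry[OF lQ(1) _ i j]) (use M X in auto)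
    also have "lin x ^ k dvd \<dots>" by (intro dvd_sum dvd_mult Xd j) auto
    finally show "lin x ^ k dvd (lift P * M * lift Q * ?X) $$ (i, j)" .
  next
    fix v :: "complex vec" assume v: "v \<in> carrier_vec q" and z: "ev_mat ?X x *\<^sub>v v = 0\<^sub>v n"
    have Xv: "ev_mat X x *\<^sub>v v \<in> carrier_vec n" using X v by auto
    have "Q' *\<^sub>v (ev_mat X x *\<^sub>v v) = ev_mat ?X x *\<^sub>v v"
      unfolding ev_mat_mult[OF lQ(3) X] using assoc_mult_mat_vec[of Q' n n "ev_mat X x" q v] Q' X v by simp
    hence "Q *\<^sub>v (Q' *\<^sub>v (ev_mat X x *\<^sub>v v)) = 0\<^sub>v n" using z Q by simp
    hence "ev_mat X x *\<^sub>v v = 0\<^sub>v n"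
      using assoc_mult_mat_vec[OF Q Q' Xv] QQ Xv by simp
    then show "v = 0\<^sub>v q" using inj[OF v] by simp
  qed
qed

text \<open>Strict equivalence multiplies the columns by a constant invertible matrix and keeps the starts independent.\<close>

lemma chains_equiv:
  assumes M: "M \<in> carrier_mat n n" and P: "P \<in> carrier_mat n n" and Q: "Q \<in> carrier_mat n n"
    and P': "P' \<in> carrier_mat n n" and Q': "Q' \<in> carrier_mat n n"
    and PP: "P' * P = 1\<^sub>m n" and QQ: "Q * Q' = 1\<^sub>m n" "Q' * Q = 1\<^sub>m n"
  shows "chains n q k (lift P * M * lift Q) x \<longleftrightarrow> chains n q k M x"
proof
  assume c: "chains n q k (lift P * M * lift Q) x"
  have "chains n q k (lift P' * (lift P * M * lift Q) * lift Q') x"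
    by (rule chains_equiv1[OF _ P' Q' Q QQ(2) c]) (use M P Q in \<open>auto intro!: mult_carrier_mat\<close>)
  moreover have "lift P' * (lift P * M * lift Q) * lift Q' = M"
  proof -
    have l: "lift P \<in> carrier_mat n n" "lift Q \<in> carrier_mat n n" "lift P' \<in> carrier_mat n n" "lift Q' \<in> carrier_mat n n"
      using P Q P' Q' by auto
    have 1: "lift P' * lift P = 1\<^sub>m n" "lift Q * lift Q' = 1\<^sub>m n"
      by (simp_all add: lift_mult[symmetric, OF P' P] lift_mult[symmetric, OF Q Q'] PP QQ)
    have "lift P' * (lift P * M * lift Q) * lift Q' = lift P' * ((lift P * M * lift Q) * lift Q')"
      by (rule assoc_mult_mat) (use l M in auto)
    also have "(lift P * M * lift Q) * lift Q' = lift P * M * (lift Q * lift Q')"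
      by (rule assoc_mult_mat) (use l M in auto)
    also have "\<dots> = lift P * M" unfolding 1 using l M by simp
    also have "lift P' * (lift P * M) = (lift P' * lift P) * M"
      by (rule assoc_mult_mat[symmetric]) (use l M in auto)
    finally show ?thesis unfolding 1 using M by simp
  qed
  ultimately show "chains n q k M x" by simp
qed (rule chains_equiv1[OF M P Q Q' QQ(1)])

text \<open>The start vectors of chains of length \<open>k\<close> form the coordinate subspace of the indices in \<open>I\<close>.\<close>

definition chain_support :: "nat \<Rightarrow> complex poly mat \<Rightarrow> nat \<Rightarrow> complex \<Rightarrow> nat set \<Rightarrow> bool" where
  "chain_support n W k x I \<longleftrightarrow> I \<subseteq> {0..<n} \<and>
     (\<forall>y \<in> carrier_vec n. (\<forall>i<n. lin x ^ k dvd (W *\<^sub>v y) $ i) \<longrightarrow>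
        (\<forall>i<n. i \<notin> I \<longrightarrow> poly (y $ i) x = 0)) \<and>
     (\<forall>i \<in> I. \<exists>y \<in> carrier_vec n. (\<forall>i<n. lin x ^ k dvd (W *\<^sub>v y) $ i) \<and>
        (\<forall>l<n. poly (y $ l) x = (if l = i then 1 else 0)))"

lemma chain_support_chains:
  assumes W: "W \<in> carrier_mat n n" and s: "chain_support n W k x I"
  shows "chains n q k W x \<longleftrightarrow> q \<le> card I"
proof
  have I: "I \<subseteq> {0..<n}" and s1: "\<And>y i. y \<in> carrier_vec n \<Longrightarrow> (\<And>i. i < n \<Longrightarrow> lin x ^ k dvd (W *\<^sub>v y) $ i) \<Longrightarrow>
      i < n \<Longrightarrow> i \<notin> I \<Longrightarrow> poly (y $ i) x = 0"
    and s2: "\<And>i. i \<in> I \<Longrightarrow> \<exists>y \<in> carrier_vec n. (\<forall>i<n. lin x ^ k dvd (W *\<^sub>v y) $ i) \<and>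
        (\<forall>l<n. poly (y $ l) x = (if l = i then 1 else 0))"
    using s unfolding chain_support_def by blast+
  have fI: "finite I" using I finite_subset by blast
  obtain f where f: "bij_betw f {0..<card I} I" using ex_bij_betw_nat_finite[OF fI] by blast
  {
    assume "chains n q k W x"
    then obtain X where X: "X \<in> carrier_mat n q"
      and Xd: "\<And>i j. i < n \<Longrightarrow> j < q \<Longrightarrow> lin x ^ k dvd (W * X) $$ (i, j)"
      and inj: "\<And>v. v \<in> carrier_vec q \<Longrightarrow> ev_mat X x *\<^sub>v v = 0\<^sub>v n \<Longrightarrow> v = 0\<^sub>v q"
      unfolding chains_def by blast
    have X0: "poly (X $$ (i, j)) x = 0" if "i < n" "i \<notin> I" "j < q" for i j
    proof -
      have "lin x ^ k dvd (W *\<^sub>v col X j) $ i'" if "i' < n" for i'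
        using Xd[OF that \<open>j < q\<close>] W X that \<open>j < q\<close> by simp
      then have "poly (col X j $ i) x = 0" using that X by (intro s1) auto
      then show ?thesis using that X by simp
    qed
    show "q \<le> card I"
    proof (rule ccontr)
      assume "\<not> q \<le> card I"
      hence qI: "card I < q" by simp
      define S where "S = mat q q (\<lambda>(r, j). if r < card I then poly (X $$ (f r, j)) x else 0)"
      have S: "S \<in> carrier_mat q q" by (simp add: S_def)
      have "S\<^sup>T *\<^sub>v unit_vec q (card I) = 0\<^sub>v q"
        using qI by (intro eq_vecI) (auto simp: S_def)
      moreover have "unit_vec q (card I) \<noteq> (0\<^sub>v q :: complex vec)"
      proof
        assume "unit_vec q (card I) = (0\<^sub>v q :: complex vec)"
        hence "unit_vec q (card I) $ card I = (0\<^sub>v q :: complex vec) $ card I" by simp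
        thus False using qI by simp
      qed
      ultimately have "det (S\<^sup>T) = 0"
        using S by (intro det_0_iff_vec_prod_zero[THEN iffD2, of _ q] exI[of _ "unit_vec q (card I)"]) auto
      hence "det S = 0" using S by (simp add: det_transpose)
      then obtain v where v: "v \<in> carrier_vec q" "v \<noteq> 0\<^sub>v q" "S *\<^sub>v v = 0\<^sub>v q"
        using det_0_iff_vec_prod_zero[OF S] by blast
      have "ev_mat X x *\<^sub>v v = 0\<^sub>v n"
      proof (rule eq_vecI)
        fix i assume "i < dim_vec (0\<^sub>v n)"
        hence i: "i < n" by simp
        have e: "(ev_mat X x *\<^sub>v v) $ i = (\<Sum>j = 0..<q. poly (X $$ (i, j)) x * v $ j)"
          using X v i by (simp add: scalar_prod_def)
        show "(ev_mat X x *\<^sub>v v) $ i = 0\<^sub>v n $ i"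
        proof (cases "i \<in> I")
          case False
          then show ?thesis unfolding e using X0[OF i False] i by simp
        next
          case True
          then obtain r where r: "r < card I" "f r = i" using f by (force simp: bij_betw_def)
          have "(\<Sum>j = 0..<q. poly (X $$ (i, j)) x * v $ j) = (S *\<^sub>v v) $ r"
            using r qI v(1) by (simp add: S_def scalar_prod_def)
          moreover have "(S *\<^sub>v v) $ r = 0" unfolding v(3) using r qI by simp
          ultimately show ?thesis unfolding e using i by simp
        qed
      qed (use X in auto)
      with inj[OF v(1)] v(2) show False by simp
    qed
  next
    assume q: "q \<le> card I"
    from s2 obtain Y where Y: "\<And>i. i \<in> I \<Longrightarrow> Y i \<in> carrier_vec n"
      "\<And>i l. i \<in> I \<Longrightarrow> l < n \<Longrightarrow> lin x ^ k dvd (W *\<^sub>v Y i) $ l"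
      "\<And>i l. i \<in> I \<Longrightarrow> l < n \<Longrightarrow> poly (Y i $ l) x = (if l = i then 1 else 0)" by metis
    define X where "X = mat n q (\<lambda>(l, j). Y (f j) $ l)"
    have fI: "f j \<in> I" if "j < q" for j using that q f by (auto simp: bij_betw_def)
    hence fj: "f j \<in> I" "f j < n" if "j < q" for j using I that by fastforce+
    have X: "X \<in> carrier_mat n q" by (simp add: X_def)
    show "chains n q k W x"
    proof (rule chainsI[OF X])
      fix i j assume ij: "i < n" "j < q"
      have "col X j = Y (f j)" using ij Y(1)[OF fj(1)[OF ij(2)]] by (intro eq_vecI) (auto simp: X_def)
      then have "(W * X) $$ (i, j) = (W *\<^sub>v Y (f j)) $ i" using ij W X by simp
      then show "lin x ^ k dvd (W * X) $$ (i, j)" using Y(2)[OF fj(1)[OF ij(2)] ij(1)] by simp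
    next
      fix v :: "complex vec" assume v: "v \<in> carrier_vec q" and z: "ev_mat X x *\<^sub>v v = 0\<^sub>v n"
      show "v = 0\<^sub>v q"
      proof (rule eq_vecI)
        fix j assume "j < dim_vec (0\<^sub>v q)"
        hence j: "j < q" by simp
        have "(ev_mat X x *\<^sub>v v) $ f j = (\<Sum>j' = 0..<q. poly (Y (f j') $ f j) x * v $ j')"
          using fj[OF j] v by (simp add: X_def scalar_prod_def)
        also have "\<dots> = (\<Sum>j' = 0..<q. if j' = j then v $ j' else 0)"
        proof (rule sum.cong)
          fix j' assume "j' \<in> {0..<q}"
          hence j': "j' < q" by simp
          have "f j = f j' \<longleftrightarrow> j = j'" using f q j j' unfolding bij_betw_def
            by (intro inj_on_eq_iff[of f "{0..<card I}"]) auto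
          then show "poly (Y (f j') $ f j) x * v $ j' = (if j' = j then v $ j' else 0)"
            using Y(3)[OF fj(1)[OF j'] fj(2)[OF j]] by simp
        qed simp
        also have "\<dots> = v $ j" using j by simp
        finally show "v $ j = 0\<^sub>v q $ j" unfolding z using fj[OF j] j by simp
      qed (use v in auto)
    qed
  }
qed

lemma chain_support_nonsingular:
  assumes W: "W \<in> carrier_mat n n" and d: "poly (det W) x \<noteq> 0" and k: "1 \<le> k"
  shows "chain_support n W k x {}"
proof -
  have "poly (y $ i) x = 0"
    if y: "y \<in> carrier_vec n" "\<forall>i<n. lin x ^ k dvd (W *\<^sub>v y) $ i" "i < n" for y i
  proof -
    have "ev_mat W x *\<^sub>v ev_vec y x = 0\<^sub>v n"
    proof (rule eq_vecI)
      fix i assume "i < dim_vec (0\<^sub>v n)"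
      hence i: "i < n" by simp
      have "(ev_mat W x *\<^sub>v ev_vec y x) $ i = poly ((W *\<^sub>v y) $ i) x"
        using i W y by (simp add: scalar_prod_def poly_sum)
      moreover have "lin x dvd (W *\<^sub>v y) $ i" by (rule lin_power_dvdD[OF y(2)[rule_format, OF i] k])
      ultimately show "(ev_mat W x *\<^sub>v ev_vec y x) $ i = 0\<^sub>v n $ i" using i by (simp add: lin_dvd_iff)
    qed (use W in auto)
    moreover have "det (ev_mat W x) \<noteq> 0" using d by (simp add: det_ev_mat)
    moreover have "ev_mat W x \<in> carrier_mat n n" "ev_vec y x \<in> carrier_vec n" using W y by auto
    ultimately have "ev_vec y x = 0\<^sub>v n"
      using det_0_iff_vec_prod_zero[of "ev_mat W x" n] by blast
    then have "ev_vec y x $ i = 0" using y by simp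
    then show ?thesis using y by simp
  qed
  then show ?thesis unfolding chain_support_def by auto
qed

lemma chain_support_four_block:
  assumes W1: "W1 \<in> carrier_mat n1 n1" and W2: "W2 \<in> carrier_mat n2 n2"
    and s1: "chain_support n1 W1 k x I1" and s2: "chain_support n2 W2 k x I2"
  shows "chain_support (n1 + n2) (four_block_mat W1 (0\<^sub>m n1 n2) (0\<^sub>m n2 n1) W2) k x (I1 \<union> (+) n1 ` I2)"
proof -
  let ?W = "four_block_mat W1 (0\<^sub>m n1 n2) (0\<^sub>m n2 n1) W2"
  have I: "I1 \<subseteq> {0..<n1}" "I2 \<subseteq> {0..<n2}" using s1 s2 by (auto simp: chain_support_def)
  have mult: "?W *\<^sub>v (y1 @\<^sub>v y2) = (W1 *\<^sub>v y1) @\<^sub>v (W2 *\<^sub>v y2)"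
    if "y1 \<in> carrier_vec n1" "y2 \<in> carrier_vec n2" for y1 y2
    using four_block_mat_mult_vec[OF W1 _ _ W2 that, of "0\<^sub>m n1 n2" "0\<^sub>m n2 n1"] that W1 W2 by simp
  show ?thesis unfolding chain_support_def
  proof (intro conjI ballI impI allI)
    show "I1 \<union> (+) n1 ` I2 \<subseteq> {0..<n1 + n2}" using I by auto
  next
    fix y i assume y: "y \<in> carrier_vec (n1 + n2)" and d: "\<forall>i<n1 + n2. lin x ^ k dvd (?W *\<^sub>v y) $ i"
      and i: "i < n1 + n2" "i \<notin> I1 \<union> (+) n1 ` I2"
    define y1 where "y1 = vec_first y n1"
    define y2 where "y2 = vec_last y n2"
    have y12: "y = y1 @\<^sub>v y2" "y1 \<in> carrier_vec n1" "y2 \<in> carrier_vec n2"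
      using vec_first_last_append[OF y] by (auto simp: y1_def y2_def)
    have d1: "\<forall>i<n1. lin x ^ k dvd (W1 *\<^sub>v y1) $ i"
    proof (intro allI impI)
      fix i assume "i < n1" then show "lin x ^ k dvd (W1 *\<^sub>v y1) $ i"
        using d[rule_format, of i] unfolding y12(1) mult[OF y12(2,3)] using W1 W2 by simp
    qed
    have d2: "\<forall>i<n2. lin x ^ k dvd (W2 *\<^sub>v y2) $ i"
    proof (intro allI impI)
      fix i assume "i < n2" then show "lin x ^ k dvd (W2 *\<^sub>v y2) $ i"
        using d[rule_format, of "n1 + i"] unfolding y12(1) mult[OF y12(2,3)] using W1 W2 by simp
    qed
    show "poly (y $ i) x = 0"
    proof (cases "i < n1")
      case True
      hence "i \<notin> I1" using i by blast
      hence "poly (y1 $ i) x = 0" using s1 y12(2) d1 True unfolding chain_support_def by blast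
      then show ?thesis using True y12 by simp
    next
      case False
      hence "i - n1 \<notin> I2" "i - n1 < n2" using i by (auto simp: image_iff)
      hence "poly (y2 $ (i - n1)) x = 0" using s2 y12(3) d2 unfolding chain_support_def by blast
      then show ?thesis using False i y12 by simp
    qed
  next
    fix i assume "i \<in> I1 \<union> (+) n1 ` I2"
    then consider "i \<in> I1" | j where "j \<in> I2" "i = n1 + j" by blast
    then show "\<exists>y\<in>carrier_vec (n1 + n2). (\<forall>i<n1 + n2. lin x ^ k dvd (?W *\<^sub>v y) $ i) \<and>
        (\<forall>l<n1 + n2. poly (y $ l) x = (if l = i then 1 else 0))"
    proof cases
      case 1
      then obtain y1 where y1: "y1 \<in> carrier_vec n1" "\<forall>i<n1. lin x ^ k dvd (W1 *\<^sub>v y1) $ i"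
        "\<forall>l<n1. poly (y1 $ l) x = (if l = i then 1 else 0)" using s1 unfolding chain_support_def by blast
      have i: "i < n1" using 1 I by auto
      show ?thesis
      proof (intro bexI[of _ "y1 @\<^sub>v 0\<^sub>v n2"] conjI allI impI)
        fix l assume l: "l < n1 + n2"
        show "lin x ^ k dvd (?W *\<^sub>v (y1 @\<^sub>v 0\<^sub>v n2)) $ l"
          unfolding mult[OF y1(1) zero_carrier_vec] using l W1 W2 y1(2) by auto
        show "poly ((y1 @\<^sub>v 0\<^sub>v n2) $ l) x = (if l = i then 1 else 0)" using l y1 i by auto
      qed (use y1 in auto)
    next
      case 2
      then obtain y2 where y2: "y2 \<in> carrier_vec n2" "\<forall>i<n2. lin x ^ k dvd (W2 *\<^sub>v y2) $ i"
        "\<forall>l<n2. poly (y2 $ l) x = (if l = j then 1 else 0)" using s2 unfolding chain_support_def by blast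
      have j: "j < n2" using 2 I by auto
      show ?thesis
      proof (intro bexI[of _ "0\<^sub>v n1 @\<^sub>v y2"] conjI allI impI)
        fix l assume l: "l < n1 + n2"
        show "lin x ^ k dvd (?W *\<^sub>v (0\<^sub>v n1 @\<^sub>v y2)) $ l"
          unfolding mult[OF zero_carrier_vec y2(1)] using l W1 W2 y2(2) by auto
        show "poly ((0\<^sub>v n1 @\<^sub>v y2) $ l) x = (if l = i then 1 else 0)" using l y2 j 2(2) by auto
      qed (use y2 in auto)
    qed
  qed
qed

text \<open>The only vectors that start a chain in a Jordan block are the multiples of its first unit vector.\<close>

lemma chain_support_jordan_block:
  assumes s: "0 < s" and k: "1 \<le> k"
  shows "chain_support s (char_poly_matrix (jordan_block s e)) k x (if e = x \<and> k \<le> s then {0} else {})"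
proof (cases "e = x")
  case False
  have "poly (det (char_poly_matrix (jordan_block s e))) x \<noteq> 0"
    using jordan_block_char_poly[of s e] False unfolding char_poly_def by simp
  then show ?thesis using False k by (simp add: chain_support_nonsingular[of _ s])
next
  case True
  let ?W = "char_poly_matrix (jordan_block s x)"
  have W: "?W \<in> carrier_mat s s" by simp
  have Wi: "(?W *\<^sub>v y) $ i = lin x * y $ i - (if Suc i < s then y $ Suc i else 0)"
    if y: "y \<in> carrier_vec s" and i: "i < s" for y i
  proof -
    have "(?W *\<^sub>v y) $ i = (\<Sum>j = 0..<s. ?W $$ (i, j) * y $ j)" by (rule mult_mat_vec_entry[OF W y i])
    also have "\<dots> = (\<Sum>j = 0..<s. (if j = i then lin x * y $ j else 0) - (if j = Suc i then y $ j else 0))"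
      by (rule sum.cong) (use i in \<open>auto simp: char_poly_matrix_def lin_def\<close>)
    also have "\<dots> = lin x * y $ i - (if Suc i < s then y $ Suc i else 0)"
      using i by (simp add: sum_subtractf)
    finally show ?thesis .
  qed
  have main: "lin x ^ k dvd y $ i - lin x ^ i * y $ 0"
    if y: "y \<in> carrier_vec s" and d: "\<forall>i<s. lin x ^ k dvd (?W *\<^sub>v y) $ i" and i: "i < s" for y i
    using i
  proof (induction i)
    case (Suc i)
    have "lin x ^ k dvd (?W *\<^sub>v y) $ i" using d Suc by simp
    hence 1: "lin x ^ k dvd lin x * y $ i - y $ Suc i" using Wi[OF y, of i] Suc by simp
    have 2: "lin x ^ k dvd lin x * (y $ i - lin x ^ i * y $ 0)" using Suc by (intro dvd_mult) simp
    have "y $ Suc i - lin x ^ Suc i * y $ 0 = lin x * (y $ i - lin x ^ i * y $ 0) - (lin x * y $ i - y $ Suc i)"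
      by (simp add: algebra_simps)
    then show ?case using dvd_diff[OF 2 1] by (simp only:)
  qed simp
  have dv1: "lin x dvd p" if "lin x ^ k dvd p" for p
    by (rule lin_power_dvdD[OF that k])
  have nz: "poly (y $ i) x = 0"
    if y: "y \<in> carrier_vec s" and d: "\<forall>i<s. lin x ^ k dvd (?W *\<^sub>v y) $ i" and i: "i < s" "i \<noteq> 0" for y i
  proof -
    have "lin x dvd y $ i - lin x ^ i * y $ 0" by (rule dv1[OF main[OF y d i(1)]])
    then show ?thesis using i(2) by (simp add: lin_dvd_iff)
  qed
  have z: "poly (y $ 0) x = 0"
    if y: "y \<in> carrier_vec s" and d: "\<forall>i<s. lin x ^ k dvd (?W *\<^sub>v y) $ i" and ks: "\<not> k \<le> s" for y
  proof -
    have 1: "lin x ^ k dvd lin x * (y $ (s - 1) - lin x ^ (s - 1) * y $ 0)"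
      using main[OF y d, of "s - 1"] s by (intro dvd_mult) simp
    have "lin x ^ k dvd (?W *\<^sub>v y) $ (s - 1)" using d s by simp
    hence 2: "lin x ^ k dvd lin x * y $ (s - 1)" using Wi[OF y, of "s - 1"] s by simp
    have "lin x * lin x ^ (s - 1) = lin x ^ s" using s by (cases s) auto
    hence "lin x ^ s * y $ 0 = lin x * y $ (s - 1) - lin x * (y $ (s - 1) - lin x ^ (s - 1) * y $ 0)"
      by (simp add: algebra_simps)
    hence "lin x ^ k dvd lin x ^ s * y $ 0" using dvd_diff[OF 2 1] by simp
    moreover have "lin x ^ s * lin x dvd lin x ^ k"
      using ks le_imp_power_dvd[of "Suc s" k "lin x"] by (simp add: mult.commute)
    ultimately have "lin x ^ s * lin x dvd lin x ^ s * y $ 0" by (rule dvd_trans[rotated])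
    hence "lin x dvd y $ 0" by simp
    then show ?thesis by (simp add: lin_dvd_iff)
  qed
  have ex: "\<exists>y\<in>carrier_vec s. (\<forall>i<s. lin x ^ k dvd (?W *\<^sub>v y) $ i) \<and>
      (\<forall>l<s. poly (y $ l) x = (if l = 0 then 1 else 0))" if ks: "k \<le> s"
  proof (intro bexI[of _ "vec s (\<lambda>i. lin x ^ i)"] conjI allI impI)
    fix i assume i: "i < s"
    have "(?W *\<^sub>v vec s (\<lambda>i. lin x ^ i)) $ i = (if Suc i < s then 0 else lin x ^ Suc i)"
      by (subst Wi) (use i in auto)
    moreover have "lin x ^ k dvd lin x ^ Suc i" if "\<not> Suc i < s" using that ks i by (intro le_imp_power_dvd) simp
    ultimately show "lin x ^ k dvd (?W *\<^sub>v vec s (\<lambda>i. lin x ^ i)) $ i" by simp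
  qed auto
  show ?thesis
  proof (cases "k \<le> s")
    case ks: True
    show ?thesis unfolding True chain_support_def using s nz ex[OF ks] ks by simp
  next
    case ks: False
    have "poly (y $ i) x = 0"
      if "y \<in> carrier_vec s" "\<forall>i<s. lin x ^ k dvd (?W *\<^sub>v y) $ i" "i < s" for y i
      using nz[OF that] z[OF that(1,2) ks] by (cases "i = 0") auto
    then show ?thesis unfolding True chain_support_def using ks by simp
  qed
qed

lemma char_poly_matrix_four_block:
  assumes A: "A \<in> carrier_mat n n" and D: "D \<in> carrier_mat m m"
  shows "char_poly_matrix (four_block_mat A (0\<^sub>m n m) (0\<^sub>m m n) D :: complex mat) =
    four_block_mat (char_poly_matrix A) (0\<^sub>m n m) (0\<^sub>m m n) (char_poly_matrix D)"
  by (rule eq_matI) (use A D in \<open>auto simp: char_poly_matrix_def\<close>)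

lemma chain_support_jordan_matrix:
  assumes k: "1 \<le> k" and f0: "0 \<notin> set (map fst fs)"
  shows "\<exists>I. chain_support (sum_list (map fst fs)) (char_poly_matrix (jordan_matrix fs)) k x I \<and>
    card I = length (filter (\<lambda>b. snd b = x \<and> k \<le> fst b) fs)"
  using f0
proof (induction fs)
  case Nil
  show ?case by (rule exI[of _ "{}"]) (auto simp: chain_support_def)
next
  case (Cons b fs)
  obtain s e where b: "b = (s, e)" by force
  have s: "0 < s" using Cons b by auto
  obtain I2 where I2: "chain_support (sum_list (map fst fs)) (char_poly_matrix (jordan_matrix fs)) k x I2"
    "card I2 = length (filter (\<lambda>b. snd b = x \<and> k \<le> fst b) fs)" using Cons by auto
  define I1 where "I1 = (if e = x \<and> k \<le> s then {0::nat} else {})"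
  have I1: "chain_support s (char_poly_matrix (jordan_block s e)) k x I1"
    unfolding I1_def by (rule chain_support_jordan_block[OF s k])
  let ?n = "sum_list (map fst fs)"
  have "chain_support (s + ?n) (four_block_mat (char_poly_matrix (jordan_block s e)) (0\<^sub>m s ?n) (0\<^sub>m ?n s)
      (char_poly_matrix (jordan_matrix fs))) k x (I1 \<union> (+) s ` I2)"
    by (rule chain_support_four_block[OF _ _ I1 I2(1)]) auto
  then have "chain_support (s + ?n) (char_poly_matrix (jordan_matrix (b # fs))) k x (I1 \<union> (+) s ` I2)"
    unfolding b jordan_matrix_Cons by (subst char_poly_matrix_four_block) auto
  moreover have "card (I1 \<union> (+) s ` I2) = card I1 + card I2"
  proof -
    have f: "finite I1" "finite I2" using I1 I2 by (auto simp: chain_support_def intro: finite_subset)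
    have "I1 \<inter> (+) s ` I2 = {}" using s by (auto simp: I1_def)
    then show ?thesis using f by (subst card_Un_disjoint) (auto simp: card_image)
  qed
  ultimately show ?case using I2(2) b by (intro exI[of _ "I1 \<union> (+) s ` I2"]) (auto simp: I1_def)
qed

section \<open>Existence of the Weierstrass form\<close>

definition dsum :: "'a :: zero mat \<Rightarrow> 'a mat \<Rightarrow> 'a mat" where
  "dsum A D = four_block_mat A (0\<^sub>m (dim_row A) (dim_col D)) (0\<^sub>m (dim_row D) (dim_col A)) D"

lemma dsum_carrier [simp]: "A \<in> carrier_mat p p \<Longrightarrow> D \<in> carrier_mat q q \<Longrightarrow> dsum A D \<in> carrier_mat (p + q) (p + q)"
  by (auto simp: dsum_def)

lemma dsum_dim [simp]: "dim_row (dsum A D) = dim_row A + dim_row D" "dim_col (dsum A D) = dim_col A + dim_col D"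
  by (auto simp: dsum_def)

lemma dsum_assoc: "dsum A (dsum B C) = dsum (dsum A B) C"
  using assoc_four_block_mat[of A B C] unfolding dsum_def .

lemma dsum_mult:
  fixes A :: "'a :: comm_ring_1 mat"
  assumes "A \<in> carrier_mat p p" "B \<in> carrier_mat p p" "C \<in> carrier_mat q q" "D \<in> carrier_mat q q"
  shows "dsum A C * dsum B D = dsum (A * B) (C * D)"
proof -
  have "dsum A C * dsum B D = four_block_mat (A * B + 0\<^sub>m p q * 0\<^sub>m q p) (A * 0\<^sub>m p q + 0\<^sub>m p q * D)
     (0\<^sub>m q p * B + C * 0\<^sub>m q p) (0\<^sub>m q p * 0\<^sub>m p q + C * D)"
    using mult_four_block_mat[of A p p "0\<^sub>m p q" q "0\<^sub>m q p" q C B p "0\<^sub>m p q" q "0\<^sub>m q p" D] assms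
    by (simp add: dsum_def)
  also have "\<dots> = dsum (A * B) (C * D)" using assms
    by (auto simp: dsum_def intro!: cong_four_block_mat)
  finally show ?thesis .
qed

lemma dsum_one [simp]: "dsum (1\<^sub>m p) (1\<^sub>m q) = 1\<^sub>m (p + q)"
  by (auto simp: dsum_def)

lemma det_dsum:
  "A \<in> carrier_mat p p \<Longrightarrow> D \<in> carrier_mat q q \<Longrightarrow> det (dsum A D) = det A * det (D :: 'a :: idom mat)"
  using det_four_block_mat_upper_right_zero[of A p "0\<^sub>m p q" q "0\<^sub>m q p" D] by (simp add: dsum_def)

lemma similar_dsum:
  assumes "similar_mat A B" "similar_mat C D" "A \<in> carrier_mat p p" "C \<in> carrier_mat q q"
  shows "similar_mat (dsum A C) (dsum B D)"
proof -
  have "B \<in> carrier_mat p p" "D \<in> carrier_mat q q"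
    using similar_matD[OF assms(1)] similar_matD[OF assms(2)] assms(3,4) by auto
  then show ?thesis using similar_mat_four_block_0_0[OF assms] assms(3,4) by (simp add: dsum_def)
qed

lemma similar_dsum_swap:
  fixes A :: "complex mat"
  assumes A: "A \<in> carrier_mat p p" and D: "D \<in> carrier_mat q q"
  shows "similar_mat (dsum A D) (dsum D A)"
proof -
  define P where "P = four_block_mat (0\<^sub>m p q) (1\<^sub>m p) (1\<^sub>m q) (0\<^sub>m q p :: complex mat)"
  define Q where "Q = four_block_mat (0\<^sub>m q p) (1\<^sub>m q) (1\<^sub>m p) (0\<^sub>m p q :: complex mat)"
  have c: "P \<in> carrier_mat (p + q) (q + p)" "Q \<in> carrier_mat (q + p) (p + q)" by (auto simp: P_def Q_def)
  have PQ: "P * Q = 1\<^sub>m (p + q)"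
    unfolding P_def Q_def
    by (subst mult_four_block_mat[of _ p q _ p _ q _ _ p _ q]) auto
  have QP: "Q * P = 1\<^sub>m (q + p)"
    unfolding P_def Q_def
    by (subst mult_four_block_mat[of _ q p _ q _ p _ _ q _ p]) auto
  have "P * dsum D A = four_block_mat (0\<^sub>m p q) A D (0\<^sub>m q p)"
    unfolding P_def dsum_def
    by (subst mult_four_block_mat[of _ p q _ p _ q _ _ q _ p]) (use A D in auto)
  hence "P * dsum D A * Q = four_block_mat (0\<^sub>m p q) A D (0\<^sub>m q p) * Q" by simp
  also have "\<dots> = dsum A D"
    unfolding Q_def dsum_def
    by (subst mult_four_block_mat[of _ p q _ p _ q _ _ p _ q]) (use A D in auto)
  finally have e: "dsum A D = P * dsum D A * Q" by simp
  show ?thesis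
    by (rule similar_matI[of _ _ P Q "p + q", OF _ PQ _ e]) (use A D c QP in \<open>auto simp: add.commute\<close>)
qed

lemma char_poly_matrix_dim [simp]:
  "dim_row (char_poly_matrix A) = dim_row A" "dim_col (char_poly_matrix A) = dim_col A"
  by (simp_all add: char_poly_matrix_def)

text \<open>Sorting the Jordan blocks by whether their eigenvalue vanishes gives Fitting's decomposition into an invertible and
a nilpotent part.\<close>

lemma fitting_jordan:
  assumes "0 \<notin> set (map fst fs)"
  shows "\<exists>p q Z N. Z \<in> carrier_mat p p \<and> N \<in> carrier_mat q q \<and> p + q = sum_list (map fst fs) \<and>
    det Z \<noteq> 0 \<and> char_poly N = [:0, 1:] ^ q \<and> similar_mat (jordan_matrix fs :: complex mat) (dsum Z N)"
  using assms
proof (induction fs)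
  case Nil
  show ?case
  proof (intro exI conjI)
    show "similar_mat (jordan_matrix ([] :: (nat \<times> complex) list)) (dsum (1\<^sub>m 0) (1\<^sub>m 0))"
    proof -
      have "jordan_matrix ([] :: (nat \<times> complex) list) = dsum (1\<^sub>m 0) (1\<^sub>m 0)" by (intro eq_matI) auto
      then show ?thesis using similar_mat_refl[OF jordan_matrix_carrier] by metis
    qed
    show "char_poly (1\<^sub>m 0 :: complex mat) = [:0, 1:] ^ 0" by (simp add: char_poly_def char_poly_matrix_def)
  qed auto
next
  case (Cons b fs)
  obtain s e where b: "b = (s, e)" by force
  from Cons obtain p q Z N where IH: "Z \<in> carrier_mat p p" "N \<in> carrier_mat q q" "p + q = sum_list (map fst fs)"
    "det Z \<noteq> 0" "char_poly N = [:0, 1:] ^ q" "similar_mat (jordan_matrix fs) (dsum Z N)" by auto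
  let ?B = "jordan_block s e"
  have B: "?B \<in> carrier_mat s s" by simp
  have J: "jordan_matrix (b # fs) = dsum ?B (jordan_matrix fs)"
    unfolding b jordan_matrix_Cons by (simp add: dsum_def)
  have sim: "similar_mat (jordan_matrix (b # fs)) (dsum ?B (dsum Z N))"
    unfolding J by (rule similar_dsum[OF similar_mat_refl[OF B] IH(6) B jordan_matrix_carrier])
  show ?case
  proof (cases "e = 0")
    case False
    have "det ?B = e ^ s"
    proof -
      have "det ?B = prod_list (diag_mat ?B)" by (rule det_upper_triangular[OF _ B]) auto
      also have "diag_mat ?B = replicate s e" by (intro nth_equalityI) (auto simp: diag_mat_def)
      finally show ?thesis by simp
    qed
    hence "det (dsum ?B Z) \<noteq> 0" using det_dsum[OF B IH(1)] IH(4) False by simp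
    moreover have "similar_mat (jordan_matrix (b # fs)) (dsum (dsum ?B Z) N)" using sim unfolding dsum_assoc .
    ultimately show ?thesis using IH B b
      by (intro exI[of _ "s + p"] exI[of _ q] exI[of _ "dsum ?B Z"] exI[of _ N]) auto
  next
    case True
    have "similar_mat (dsum ?B (dsum Z N)) (dsum (dsum Z N) ?B)"
      by (rule similar_dsum_swap[OF B]) (use IH in auto)
    hence "similar_mat (jordan_matrix (b # fs)) (dsum Z (dsum N ?B))"
      using similar_mat_trans[OF sim] unfolding dsum_assoc by blast
    moreover have "char_poly (dsum N ?B) = [:0, 1:] ^ (q + s)"
    proof -
      have "char_poly_matrix (dsum N ?B) = dsum (char_poly_matrix N) (char_poly_matrix ?B)"
        using char_poly_matrix_four_block[OF IH(2) B] IH(2) by (simp add: dsum_def)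
      hence "char_poly (dsum N ?B) = char_poly N * char_poly ?B"
        unfolding char_poly_def using IH(2) by (simp add: det_dsum[of _ q _ s])
      then show ?thesis unfolding IH(5) jordan_block_char_poly True by (simp add: power_add)
    qed
    ultimately show ?thesis using IH B b
      by (intro exI[of _ p] exI[of _ "q + s"] exI[of _ Z] exI[of _ "dsum N ?B"]) auto
  qed
qed

lemma fitting_decomposition:
  assumes M: "(M :: complex mat) \<in> carrier_mat n n"
  obtains p q Z N where "Z \<in> carrier_mat p p" "N \<in> carrier_mat q q" "p + q = n"
    "det Z \<noteq> 0" "char_poly N = [:0, 1:] ^ q" "similar_mat M (dsum Z N)"
proof -
  from char_poly_factorized[OF M] obtain as where as: "char_poly M = (\<Prod>a\<leftarrow>as. [:- a, 1:])" by (elim exE conjE)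
  from jordan_nf_exists[OF M as] obtain fs where fs: "jordan_nf M fs" by (elim exE)
  hence sim: "similar_mat M (jordan_matrix fs)" and f0: "0 \<notin> set (map fst fs)" by (auto simp: jordan_nf_def)
  from similar_matD[OF sim] obtain m P Q where "{M, jordan_matrix fs, P, Q} \<subseteq> carrier_mat m m" by (elim exE conjE)
  hence "dim_row M = m" "dim_row (jordan_matrix fs) = m" by auto
  hence n: "sum_list (map fst fs) = n" using M by simp
  from fitting_jordan[OF f0, unfolded n] obtain p q Z N where
    D: "Z \<in> carrier_mat p p" "N \<in> carrier_mat q q" "p + q = n"
    "det Z \<noteq> 0" "char_poly N = [:0, 1:] ^ q" "similar_mat (jordan_matrix fs) (dsum Z N)" by (elim exE conjE)
  show ?thesis by (rule that[OF D(1-5) similar_mat_trans[OF sim D(6)]])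
qed

lemma similar_mat_carrierE:
  assumes sim: "similar_mat A B" and B: "B \<in> carrier_mat n n"
  obtains P P' where "P \<in> carrier_mat n n" "P' \<in> carrier_mat n n" "P * P' = 1\<^sub>m n" "P' * P = 1\<^sub>m n"
    "A = P * B * P'" "A \<in> carrier_mat n n"
proof -
  from similar_matD[OF sim] obtain m P P' where m: "{A, B, P, P'} \<subseteq> carrier_mat m m" and
    e: "P * P' = 1\<^sub>m m" "P' * P = 1\<^sub>m m" "A = P * B * P'" by (elim exE conjE)
  have "dim_row B = m" using m by auto
  hence nm: "m = n" using B by simp
  show ?thesis by (rule that[of P P']) (use m e in \<open>simp_all add: nm\<close>)
qed

definition strictly_equivalent :: "nat \<Rightarrow> pencil \<Rightarrow> pencil \<Rightarrow> bool" where
  "strictly_equivalent n L L' \<longleftrightarrow> (\<exists>P Q P' Q'. P \<in> carrier_mat n n \<and> Q \<in> carrier_mat n n \<and>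
     P' \<in> carrier_mat n n \<and> Q' \<in> carrier_mat n n \<and> P * P' = 1\<^sub>m n \<and> P' * P = 1\<^sub>m n \<and> Q * Q' = 1\<^sub>m n \<and> Q' * Q = 1\<^sub>m n \<and>
     fst L' = P * fst L * Q \<and> snd L' = P * snd L * Q)"

lemma mult5_assoc:
  assumes "P2 \<in> carrier_mat n n" "P1 \<in> carrier_mat n n" "A \<in> carrier_mat n n" "Q1 \<in> carrier_mat n n" "Q2 \<in> carrier_mat n n"
  shows "P2 * (P1 * A * Q1) * Q2 = (P2 * P1) * A * (Q1 * (Q2 :: 'a :: comm_ring_1 mat))"
proof -
  have "(P2 * P1) * A * (Q1 * Q2) = P2 * (P1 * A) * (Q1 * Q2)"
    using assoc_mult_mat[OF assms(1,2,3)] by simp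
  also have "\<dots> = P2 * (P1 * A) * Q1 * Q2"
    by (rule assoc_mult_mat[symmetric]) (use assms in auto)
  also have "P2 * (P1 * A) * Q1 = P2 * (P1 * A * Q1)"
    by (rule assoc_mult_mat) (use assms in auto)
  finally show ?thesis by simp
qed

lemma inverse_mult:
  assumes "P \<in> carrier_mat n n" "P' \<in> carrier_mat n n" "R \<in> carrier_mat n n" "R' \<in> carrier_mat n n"
    "P * P' = 1\<^sub>m n" "R * R' = 1\<^sub>m n"
  shows "(P * R) * (R' * P') = (1\<^sub>m n :: 'a :: comm_ring_1 mat)"
  using mult5_assoc[of P n R "1\<^sub>m n" R' P'] assms by simp

lemma strictly_equivalent_trans:
  assumes L: "L \<in> pencil_carrier n"
    and "strictly_equivalent n L L1" "strictly_equivalent n L1 L2"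
  shows "strictly_equivalent n L L2"
proof -
  have A: "fst L \<in> carrier_mat n n" "snd L \<in> carrier_mat n n" using L by (auto simp: pencil_carrier_def)
  obtain P Q P' Q' where 1: "P \<in> carrier_mat n n" "Q \<in> carrier_mat n n" "P' \<in> carrier_mat n n" "Q' \<in> carrier_mat n n"
    "P * P' = 1\<^sub>m n" "P' * P = 1\<^sub>m n" "Q * Q' = 1\<^sub>m n" "Q' * Q = 1\<^sub>m n"
    "fst L1 = P * fst L * Q" "snd L1 = P * snd L * Q" using assms(2) unfolding strictly_equivalent_def by blast
  obtain R S R' S' where 2: "R \<in> carrier_mat n n" "S \<in> carrier_mat n n" "R' \<in> carrier_mat n n" "S' \<in> carrier_mat n n"
    "R * R' = 1\<^sub>m n" "R' * R = 1\<^sub>m n" "S * S' = 1\<^sub>m n" "S' * S = 1\<^sub>m n"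
    "fst L2 = R * fst L1 * S" "snd L2 = R * snd L1 * S" using assms(3) unfolding strictly_equivalent_def by blast
  show ?thesis unfolding strictly_equivalent_def
  proof (intro exI conjI)
    show "fst L2 = (R * P) * fst L * (Q * S)" "snd L2 = (R * P) * snd L * (Q * S)"
      unfolding 2 1 by (rule mult5_assoc; use 1 2 A in simp)+
    show "(R * P) * (P' * R') = 1\<^sub>m n" "(P' * R') * (R * P) = 1\<^sub>m n"
      "(Q * S) * (S' * Q') = 1\<^sub>m n" "(S' * Q') * (Q * S) = 1\<^sub>m n" by (rule inverse_mult; use 1 2 in simp)+
  qed (use 1 2 in auto)
qed

lemma nonsingular_inverse:
  assumes A: "A \<in> carrier_mat n n" and d: "det A \<noteq> (0 :: 'a :: field)"
  obtains A' where "A' \<in> carrier_mat n n" "A * A' = 1\<^sub>m n" "A' * A = 1\<^sub>m n"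
proof -
  note adj = adj_mat[OF A]
  let ?A = "(1 / det A) \<cdot>\<^sub>m adj_mat A"
  have "A * ?A = 1\<^sub>m n" using d mult_smult_distrib[OF A adj(1)] adj(2) by (intro eq_matI) auto
  moreover have "?A * A = 1\<^sub>m n" using d mult_smult_assoc_mat[OF adj(1) A] adj(3) by (intro eq_matI) auto
  ultimately show ?thesis using that[of ?A] adj(1) by simp
qed

lemma strictly_equivalent_left:
  assumes L: "L \<in> pencil_carrier n" and P: "P \<in> carrier_mat n n" and d: "det P \<noteq> 0"
  shows "strictly_equivalent n L (P * fst L, P * snd L)"
proof -
  obtain P' where P': "P' \<in> carrier_mat n n" "P * P' = 1\<^sub>m n" "P' * P = 1\<^sub>m n" using nonsingular_inverse[OF P d] by blast
  show ?thesis unfolding strictly_equivalent_def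
    by (rule exI[of _ P], rule exI[of _ "1\<^sub>m n"], rule exI[of _ P'], rule exI[of _ "1\<^sub>m n"])
      (use P P' L in \<open>simp add: pencil_carrier_def mem_Times_iff right_mult_one_mat[OF mult_carrier_mat]\<close>)
qed

lemma det_add_nilpotent:
  assumes N: "(N :: complex mat) \<in> carrier_mat q q" and cp: "char_poly N = [:0, 1:] ^ q" and a: "a \<noteq> 0"
  shows "det (a \<cdot>\<^sub>m 1\<^sub>m q + b \<cdot>\<^sub>m N) \<noteq> 0"
proof (cases "b = 0")
  case True
  hence "a \<cdot>\<^sub>m 1\<^sub>m q + b \<cdot>\<^sub>m N = a \<cdot>\<^sub>m 1\<^sub>m q" using N by (intro eq_matI) auto
  then show ?thesis using a by simp
next
  case False
  have "a \<cdot>\<^sub>m 1\<^sub>m q + b \<cdot>\<^sub>m N = (- b) \<cdot>\<^sub>m ev_mat (char_poly_matrix N) (- a / b)"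
    using N False by (intro eq_matI) (auto simp: char_poly_matrix_def field_simps)
  hence "det (a \<cdot>\<^sub>m 1\<^sub>m q + b \<cdot>\<^sub>m N) = (- b) ^ q * poly (char_poly N) (- a / b)"
    using N by (simp add: det_ev_mat char_poly_def)
  then show ?thesis unfolding cp using a False by simp
qed

text \<open>If \<open>L(x0)\<close> is invertible, then \<open>L(x0)\<^sup>-\<^sup>1 L(\<lambda>) = I + (\<lambda> - x0) N\<close> with \<open>N = L(x0)\<^sup>-\<^sup>1 B\<close>.  Fitting's decomposition of
\<open>N\<close> separates the finite part of the pencil, where \<open>N\<close> is invertible, from the part at infinity, where it is
nilpotent; the Jordan forms of the two parts give the blocks.\<close>

lemma regular_weierstrass:
  assumes L: "L \<in> pencil_carrier n" and reg: "pencil_regular L"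
  shows "\<exists>fs ks. weierstrass_form n L fs ks"
proof -
  obtain x0 where x0: "det (pencil_eval L x0) \<noteq> 0" using reg unfolding pencil_regular_def by blast
  define A where "A = fst L"
  define B where "B = snd L"
  have AB: "A \<in> carrier_mat n n" "B \<in> carrier_mat n n" using L by (auto simp: pencil_carrier_def A_def B_def)
  define L0 where "L0 = A + x0 \<cdot>\<^sub>m B"
  have L0: "L0 \<in> carrier_mat n n" using AB by (simp add: L0_def)
  have "det L0 \<noteq> 0" using x0 by (simp add: L0_def pencil_eval_def A_def B_def)
  then obtain G where G: "G \<in> carrier_mat n n" "L0 * G = 1\<^sub>m n" "G * L0 = 1\<^sub>m n" using nonsingular_inverse[OF L0] by blast
  have dG: "det G \<noteq> 0" using det_mult[OF L0 G(1)] G(2) by auto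
  define M where "M = G * B"
  have M: "M \<in> carrier_mat n n" using G AB by (simp add: M_def)
  have GA: "G * A = 1\<^sub>m n - x0 \<cdot>\<^sub>m M"
  proof -
    have "A = L0 - x0 \<cdot>\<^sub>m B" unfolding L0_def using AB by (intro eq_matI) auto
    hence "G * A = G * L0 - G * (x0 \<cdot>\<^sub>m B)" using G L0 AB by (simp add: mult_minus_distrib_mat)
    then show ?thesis using G AB by (simp add: M_def mult_smult_distrib)
  qed
  have e1: "strictly_equivalent n L (1\<^sub>m n - x0 \<cdot>\<^sub>m M, M)"
    using strictly_equivalent_left[OF L G(1) dG] GA by (simp add: A_def B_def M_def)
  obtain p q Z N where Z: "Z \<in> carrier_mat p p" and N: "N \<in> carrier_mat q q" and n: "p + q = n"
    and dZ: "det Z \<noteq> 0" and cN: "char_poly N = [:0, 1:] ^ q" and sim: "similar_mat M (dsum Z N)"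
    by (rule fitting_decomposition[OF M])
  let ?F = "dsum Z N"
  have F: "?F \<in> carrier_mat n n" using Z N n by auto
  obtain S S' where S: "S \<in> carrier_mat n n" "S' \<in> carrier_mat n n" "S * S' = 1\<^sub>m n" "S' * S = 1\<^sub>m n" "M = S * ?F * S'" "M \<in> carrier_mat n n"
    by (rule similar_mat_carrierE[OF sim F])
  have SF: "S' * M * S = ?F"
  proof -
    have "S' * (S * ?F * S') * S = (S' * S) * ?F * (S' * S)" by (rule mult5_assoc) (use S F in auto)
    also have "\<dots> = ?F" unfolding S(4) by (simp only: left_mult_one_mat[OF F] right_mult_one_mat[OF F])
    finally show ?thesis unfolding S(5) .
  qed
  have SI: "S' * (1\<^sub>m n - x0 \<cdot>\<^sub>m M) * S = 1\<^sub>m n - x0 \<cdot>\<^sub>m ?F"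
  proof -
    have "S' * (1\<^sub>m n - x0 \<cdot>\<^sub>m M) * S = S' * 1\<^sub>m n * S - S' * (x0 \<cdot>\<^sub>m M) * S"
      using S(1,2) M by (simp add: mult_minus_distrib_mat[of _ n n _ n] minus_mult_distrib_mat[of _ n n _ _ n])
    also have "S' * (x0 \<cdot>\<^sub>m M) * S = x0 \<cdot>\<^sub>m (S' * M * S)"
      using S(1,2) M by (simp add: mult_smult_distrib[of _ n n _ n] mult_smult_assoc_mat[of _ n n _ n])
    finally show ?thesis using S(1-4) SF by simp
  qed
  have e2: "strictly_equivalent n (1\<^sub>m n - x0 \<cdot>\<^sub>m M, M) (1\<^sub>m n - x0 \<cdot>\<^sub>m ?F, ?F)"
    unfolding strictly_equivalent_def
    by (rule exI[of _ S'], rule exI[of _ S], rule exI[of _ S], rule exI[of _ S']) (simp add: S(1-4) SF SI)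
  obtain Z' where Z': "Z' \<in> carrier_mat p p" "Z * Z' = 1\<^sub>m p" "Z' * Z = 1\<^sub>m p" using nonsingular_inverse[OF Z dZ] by blast
  define Y where "Y = 1 \<cdot>\<^sub>m 1\<^sub>m q + (- x0) \<cdot>\<^sub>m N"
  have Y: "Y \<in> carrier_mat q q" using N by (simp add: Y_def)
  have dY: "det Y \<noteq> 0" unfolding Y_def by (rule det_add_nilpotent[OF N cN]) simp
  then obtain Y' where Y': "Y' \<in> carrier_mat q q" "Y * Y' = 1\<^sub>m q" "Y' * Y = 1\<^sub>m q" using nonsingular_inverse[OF Y] by blast
  define J0 where "J0 = x0 \<cdot>\<^sub>m 1\<^sub>m p - Z'"
  define N' where "N' = (- Y') * N"
  have J0: "J0 \<in> carrier_mat p p" and N': "N' \<in> carrier_mat q q" using Z' Y' N by (auto simp: J0_def N'_def)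
  have mY: "- Y' \<in> carrier_mat q q" using Y' by simp
  have F1: "1\<^sub>m n - x0 \<cdot>\<^sub>m ?F = dsum (1\<^sub>m p - x0 \<cdot>\<^sub>m Z) Y"
    using Z N n by (intro eq_matI) (auto simp: dsum_def Y_def)
  have D1: "dsum Z' (- Y') * (1\<^sub>m n - x0 \<cdot>\<^sub>m ?F) = - dsum J0 (1\<^sub>m q)"
  proof -
    have "dsum Z' (- Y') * dsum (1\<^sub>m p - x0 \<cdot>\<^sub>m Z) Y = dsum (Z' * (1\<^sub>m p - x0 \<cdot>\<^sub>m Z)) (- Y' * Y)"
      by (rule dsum_mult) (use Z Z' Y Y' in auto)
    also have "Z' * (1\<^sub>m p - x0 \<cdot>\<^sub>m Z) = Z' * 1\<^sub>m p - Z' * (x0 \<cdot>\<^sub>m Z)"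
      by (rule mult_minus_distrib_mat) (use Z Z' in auto)
    also have "Z' * (x0 \<cdot>\<^sub>m Z) = x0 \<cdot>\<^sub>m 1\<^sub>m p"
      using mult_smult_distrib[OF Z'(1) Z, of x0] Z'(3) by simp
    also have "Z' * 1\<^sub>m p = Z'" using Z' by simp
    also have "- Y' * Y = - 1\<^sub>m q" using Y Y' by (simp add: uminus_mult_left_mat)
    also have "dsum (Z' - x0 \<cdot>\<^sub>m 1\<^sub>m p) (- 1\<^sub>m q) = - dsum J0 (1\<^sub>m q)"
      using Z' by (intro eq_matI) (auto simp: dsum_def J0_def)
    finally show ?thesis unfolding F1 .
  qed
  have D2: "dsum Z' (- Y') * ?F = dsum (1\<^sub>m p) N'"
    using dsum_mult[OF Z'(1) Z mY N] Z'(3) by (simp add: N'_def)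
  have dD: "det (dsum Z' (- Y')) \<noteq> 0"
  proof -
    have "det Z' \<noteq> 0" using det_mult[OF Z Z'(1)] Z'(2) by auto
    moreover have "det (- Y') \<noteq> 0"
    proof -
      have "(- Y') * (- Y) = 1\<^sub>m q" using Y Y' by (intro eq_matI) (auto simp: scalar_prod_def)
      then show ?thesis using det_mult[OF mY, of "- Y"] Y by auto
    qed
    ultimately show ?thesis using det_dsum[OF Z'(1) mY] by simp
  qed
  have e3: "strictly_equivalent n (1\<^sub>m n - x0 \<cdot>\<^sub>m ?F, ?F) (- dsum J0 (1\<^sub>m q), dsum (1\<^sub>m p) N')"
  proof -
    have "1\<^sub>m n - x0 \<cdot>\<^sub>m ?F \<in> carrier_mat n n" by (rule minus_carrier_mat) (use F in simp)
    hence pc: "(1\<^sub>m n - x0 \<cdot>\<^sub>m ?F, ?F) \<in> pencil_carrier n" using F by (simp add: pencil_carrier_def)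
    have Dc: "dsum Z' (- Y') \<in> carrier_mat n n" using dsum_carrier[OF Z'(1) mY] n by simp
    show ?thesis using strictly_equivalent_left[OF pc Dc dD] unfolding fst_conv snd_conv D1 D2 .
  qed
  from char_poly_factorized[OF J0] obtain as where as: "char_poly J0 = (\<Prod>a\<leftarrow>as. [:- a, 1:])" by (elim exE conjE)
  from jordan_nf_exists[OF J0 as] obtain fs where fs: "jordan_nf J0 fs" by (elim exE)
  from char_poly_factorized[OF N'] obtain bs where bs: "char_poly N' = (\<Prod>a\<leftarrow>bs. [:- a, 1:])" by (elim exE conjE)
  from jordan_nf_exists[OF N' bs] obtain gs where gs: "jordan_nf N' gs" by (elim exE)
  have g0: "snd b = 0" if b: "b \<in> set gs" for b
  proof (rule ccontr)
    assume a: "snd b \<noteq> 0"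
    let ?a = "snd b"
    have "char_poly N' = (\<Prod>(n, a)\<leftarrow>gs. [:- a, 1:] ^ n)" by (rule jordan_nf_char_poly[OF gs])
    moreover have "fst b \<noteq> 0" using gs b unfolding jordan_nf_def by (metis image_eqI)
    ultimately have "poly (char_poly N') ?a = 0" using b
      by (auto simp: poly_prod_list prod_list_zero_iff image_iff split_beta intro!: bexI[of _ b])
    hence "det (ev_mat (char_poly_matrix N') ?a) = 0" by (simp add: det_ev_mat char_poly_def)
    moreover have "ev_mat (char_poly_matrix N') ?a = ?a \<cdot>\<^sub>m 1\<^sub>m q - N'"
      using N' by (intro eq_matI) (auto simp: char_poly_matrix_def)
    ultimately have d0: "det (?a \<cdot>\<^sub>m 1\<^sub>m q - N') = 0" by simp
    have "Y * (?a \<cdot>\<^sub>m 1\<^sub>m q - N') = ?a \<cdot>\<^sub>m Y + N"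
    proof -
      have YN: "Y * N' = - N" unfolding N'_def
        using assoc_mult_mat[OF Y mY N] Y Y' N by (simp add: uminus_mult_right_mat uminus_mult_left_mat)
      have "Y * (?a \<cdot>\<^sub>m 1\<^sub>m q - N') = ?a \<cdot>\<^sub>m Y - Y * N'"
        using mult_minus_distrib_mat[OF Y _ N', of "?a \<cdot>\<^sub>m 1\<^sub>m q"] mult_smult_distrib[OF Y one_carrier_mat, of ?a] Y by simp
      then show ?thesis unfolding YN using Y N by (intro eq_matI) auto
    qed
    also have "\<dots> = ?a \<cdot>\<^sub>m 1\<^sub>m q + (1 - ?a * x0) \<cdot>\<^sub>m N"
      using N by (intro eq_matI) (auto simp: Y_def algebra_simps)
    finally have "Y * (?a \<cdot>\<^sub>m 1\<^sub>m q - N') = ?a \<cdot>\<^sub>m 1\<^sub>m q + (1 - ?a * x0) \<cdot>\<^sub>m N" .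
    hence "det Y * det (?a \<cdot>\<^sub>m 1\<^sub>m q - N') \<noteq> 0"
      using det_add_nilpotent[OF N cN a, of "1 - ?a * x0"] det_mult[OF Y minus_carrier_mat[OF N'], of "?a \<cdot>\<^sub>m 1\<^sub>m q"]
      by simp
    with d0 show False by simp
  qed
  define ks where "ks = map fst gs"
  have gk: "map (\<lambda>k. (k, 0)) ks = gs" unfolding ks_def using g0 by (auto simp: o_def intro!: map_idI prod_eqI)
  have simJ: "similar_mat J0 (jordan_matrix fs)" and simN: "similar_mat N' (jordan_matrix gs)"
    using fs gs by (auto simp: jordan_nf_def)
  obtain S1 S1' where S1: "S1 \<in> carrier_mat p p" "S1' \<in> carrier_mat p p" "S1 * S1' = 1\<^sub>m p" "S1' * S1 = 1\<^sub>m p"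
    "jordan_matrix fs = S1 * J0 * S1'" "jordan_matrix fs \<in> carrier_mat p p"
    by (rule similar_mat_carrierE[OF similar_mat_sym[OF simJ] J0])
  obtain S2 S2' where S2: "S2 \<in> carrier_mat q q" "S2' \<in> carrier_mat q q" "S2 * S2' = 1\<^sub>m q" "S2' * S2 = 1\<^sub>m q"
    "jordan_matrix gs = S2 * N' * S2'" "jordan_matrix gs \<in> carrier_mat q q"
    by (rule similar_mat_carrierE[OF similar_mat_sym[OF simN] N'])
  have dims: "sum_list (map fst fs) = p" "sum_list (map fst gs) = q" using S1(6) S2(6) by auto
  have X: "dsum S1 S2 \<in> carrier_mat n n" "dsum S1' S2' \<in> carrier_mat n n" using S1 S2 n by auto
  have c1: "dsum S1 S2 * (- dsum J0 (1\<^sub>m q)) * dsum S1' S2' = - dsum (jordan_matrix fs) (1\<^sub>m q)"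
  proof -
    have "dsum S1 S2 * dsum J0 (1\<^sub>m q) * dsum S1' S2' = dsum (jordan_matrix fs) (1\<^sub>m q)"
      using dsum_mult[OF S1(1) J0 S2(1) one_carrier_mat]
        dsum_mult[of "S1 * J0" p S1' "S2 * 1\<^sub>m q" q S2'] S1 S2 J0 by simp
    then show ?thesis
      using uminus_mult_left_mat[of "dsum S1 S2 * dsum J0 (1\<^sub>m q)" "dsum S1' S2'"]
        uminus_mult_right_mat[of "dsum S1 S2" "dsum J0 (1\<^sub>m q)"] S1 S2 J0 by simp
  qed
  have c2: "dsum S1 S2 * dsum (1\<^sub>m p) N' * dsum S1' S2' = dsum (1\<^sub>m p) (jordan_matrix gs)"
    using dsum_mult[OF S1(1) one_carrier_mat S2(1) N']
      dsum_mult[of "S1 * 1\<^sub>m p" p S1' "S2 * N'" q S2'] S1 S2 N' by simp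
  have e4: "strictly_equivalent n (- dsum J0 (1\<^sub>m q), dsum (1\<^sub>m p) N') (- dsum (jordan_matrix fs) (1\<^sub>m q), dsum (1\<^sub>m p) (jordan_matrix gs))"
    unfolding strictly_equivalent_def
    by (rule exI[of _ "dsum S1 S2"], rule exI[of _ "dsum S1' S2'"], rule exI[of _ "dsum S1' S2'"],
        rule exI[of _ "dsum S1 S2"])
      (simp add: c1 c2 X n dsum_mult[OF S1(1,2) S2(1,2)] dsum_mult[OF S1(2,1) S2(2,1)] S1(3,4) S2(3,4))
  have "strictly_equivalent n L (- dsum (jordan_matrix fs) (1\<^sub>m q), dsum (1\<^sub>m p) (jordan_matrix gs))"
    by (intro strictly_equivalent_trans[OF L e1] strictly_equivalent_trans[OF _ e2] strictly_equivalent_trans[OF _ e3] e4)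
      (use M F J0 N' n in \<open>simp_all add: pencil_carrier_def minus_carrier_mat[OF smult_carrier_mat]\<close>)
  then obtain P Q P' Q' where PQ: "P \<in> carrier_mat n n" "Q \<in> carrier_mat n n" "P' \<in> carrier_mat n n" "Q' \<in> carrier_mat n n"
    "P * P' = 1\<^sub>m n" "P' * P = 1\<^sub>m n" "Q * Q' = 1\<^sub>m n" "Q' * Q = 1\<^sub>m n"
    "- dsum (jordan_matrix fs) (1\<^sub>m q) = P * fst L * Q" "dsum (1\<^sub>m p) (jordan_matrix gs) = P * snd L * Q"
    unfolding strictly_equivalent_def fst_conv snd_conv by (elim exE conjE)
  have inv: "invertible_mat P" "invertible_mat Q"
    unfolding invertible_mat_def inverts_mat_def
    by (rule conjI, use PQ(1) in simp, rule exI[of _ P'], use PQ(1,3,5,6) in simp)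
      (rule conjI, use PQ(2) in simp, rule exI[of _ Q'], use PQ(2,4,7,8) in simp)
  have "let J = jordan_matrix fs; N = jordan_matrix (map (\<lambda>k. (k, 0)) ks); p = dim_row J; q = dim_row N
      in P * fst L * Q = - four_block_mat J (0\<^sub>m p q) (0\<^sub>m q p) (1\<^sub>m q) \<and>
         P * snd L * Q = four_block_mat (1\<^sub>m p) (0\<^sub>m p q) (0\<^sub>m q p) N"
    unfolding gk Let_def PQ(9,10)[symmetric] using dims by (simp add: dsum_def)
  moreover have "0 \<notin> set (map fst fs)" "0 \<notin> set ks" using fs gs by (auto simp: jordan_nf_def ks_def)
  ultimately have "weierstrass_form n L fs ks" unfolding weierstrass_form_def using inv PQ(1,2) by blast
  then show ?thesis by blast
qed

section \<open>Partial multiplicities, determinants and chains\<close>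

definition pmat :: "nat \<Rightarrow> pencil \<Rightarrow> complex poly mat" where
  "pmat n L = mat n n (\<lambda>(i, j). [:fst L $$ (i, j), snd L $$ (i, j):])"

abbreviation pdet :: "nat \<Rightarrow> pencil \<Rightarrow> complex poly" where "pdet n L \<equiv> det (pmat n L)"

lemma pmat_carrier [simp]: "pmat n L \<in> carrier_mat n n"
  by (simp add: pmat_def)

lemma pmat_dim [simp]: "dim_row (pmat n L) = n" "dim_col (pmat n L) = n"
  by (simp_all add: pmat_def)

lemma pmat_index [simp]: "i < n \<Longrightarrow> j < n \<Longrightarrow> pmat n L $$ (i, j) = [:fst L $$ (i, j), snd L $$ (i, j):]"
  by (simp add: pmat_def)

lemma ev_pmat: "L \<in> pencil_carrier n \<Longrightarrow> ev_mat (pmat n L) x = pencil_eval L x"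
  by (rule eq_matI) (auto simp: pencil_carrier_def pencil_eval_def)

lemma poly_pdet: "L \<in> pencil_carrier n \<Longrightarrow> poly (pdet n L) x = det (pencil_eval L x)"
  by (simp add: det_ev_mat[symmetric] ev_pmat)

lemma pencil_regular_iff: "L \<in> pencil_carrier n \<Longrightarrow> pencil_regular L \<longleftrightarrow> pdet n L \<noteq> 0"
  unfolding pencil_regular_def by (simp add: poly_pdet[symmetric] poly_all_0_iff_0[symmetric])

lemma pmat_equiv:
  assumes L: "L \<in> pencil_carrier n" and P: "P \<in> carrier_mat n n" and Q: "Q \<in> carrier_mat n n"
  shows "lift P * pmat n L * lift Q = pmat n (P * fst L * Q, P * snd L * Q)"
proof (rule eq_matI)
  have A: "fst L \<in> carrier_mat n n" "snd L \<in> carrier_mat n n" using L by (auto simp: pencil_carrier_def)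
  have lP: "lift P \<in> carrier_mat n n" "lift Q \<in> carrier_mat n n" using P Q by auto
  fix i j assume "i < dim_row (pmat n (P * fst L * Q, P * snd L * Q))" "j < dim_col (pmat n (P * fst L * Q, P * snd L * Q))"
  hence ij: "i < n" "j < n" by auto
  have e: "(P * C * Q) $$ (i, j) = (\<Sum>l = 0..<n. (\<Sum>k = 0..<n. P $$ (i, k) * C $$ (k, l)) * Q $$ (l, j))"
    if C: "C \<in> carrier_mat n n" for C
  proof -
    have "(P * C * Q) $$ (i, j) = (\<Sum>l = 0..<n. (P * C) $$ (i, l) * Q $$ (l, j))"
      by (rule mult_mat_entry[OF mult_carrier_mat[OF P C] Q ij])
    also have "\<dots> = (\<Sum>l = 0..<n. (\<Sum>k = 0..<n. P $$ (i, k) * C $$ (k, l)) * Q $$ (l, j))"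
      by (rule sum.cong, simp) (subst mult_mat_entry[OF P C ij(1)], auto)
    finally show ?thesis .
  qed
  have "(lift P * pmat n L * lift Q) $$ (i, j) = (\<Sum>l = 0..<n. (lift P * pmat n L) $$ (i, l) * lift Q $$ (l, j))"
    by (rule mult_mat_entry[OF mult_carrier_mat[OF lP(1) pmat_carrier] lP(2) ij])
  also have "\<dots> = (\<Sum>l = 0..<n. (\<Sum>k = 0..<n. lift P $$ (i, k) * pmat n L $$ (k, l)) * lift Q $$ (l, j))"
    by (rule sum.cong, simp) (subst mult_mat_entry[OF lP(1) pmat_carrier ij(1)], auto)
  also have "\<dots> = (\<Sum>l = 0..<n. (\<Sum>k = 0..<n. [:P $$ (i, k) * fst L $$ (k, l) * Q $$ (l, j), P $$ (i, k) * snd L $$ (k, l) * Q $$ (l, j):]))"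
    unfolding sum_distrib_right by (intro sum.cong) (use P Q ij in \<open>auto simp: ac_simps\<close>)
  also have "\<dots> = [:(\<Sum>l = 0..<n. (\<Sum>k = 0..<n. P $$ (i, k) * fst L $$ (k, l) * Q $$ (l, j))),
      (\<Sum>l = 0..<n. (\<Sum>k = 0..<n. P $$ (i, k) * snd L $$ (k, l) * Q $$ (l, j))):]"
    by (rule poly_eqI) (simp add: coeff_sum coeff_pCons split: nat.split)
  also have "\<dots> = pmat n (P * fst L * Q, P * snd L * Q) $$ (i, j)"
    using ij by (simp add: e[OF A(1)] e[OF A(2)] sum_distrib_right)
  finally show "(lift P * pmat n L * lift Q) $$ (i, j) = pmat n (P * fst L * Q, P * snd L * Q) $$ (i, j)" .
qed (use P Q in auto)

lemma pmat_dsum: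
  assumes J: "J \<in> carrier_mat p p" and N: "N \<in> carrier_mat q q"
  shows "pmat (p + q) (- dsum J (1\<^sub>m q), dsum (1\<^sub>m p) N) = dsum (char_poly_matrix J) (pmat q (- 1\<^sub>m q, N))"
  by (rule eq_matI) (use J N in \<open>auto simp: dsum_def char_poly_matrix_def\<close>)

lemma jordan_matrix_zero_diag:
  "i < sum_list ks \<Longrightarrow> jordan_matrix (map (\<lambda>k. (k, 0 :: complex)) ks) $$ (i, i) = 0"
proof (induction ks arbitrary: i)
  case (Cons k ks)
  have o: "fst \<circ> (\<lambda>k :: nat. (k, 0 :: complex)) = (\<lambda>k. k)" by auto
  show ?case
  proof (cases "i < k")
    case True
    then show ?thesis by (simp add: jordan_matrix_Cons o)
  next
    case False
    then show ?thesis using Cons by (simp add: jordan_matrix_Cons o)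
  qed
qed simp

lemma filter_count:
  assumes "mset ns = mset (map fst (filter (\<lambda>b. snd b = x) fs))"
  shows "length (filter (\<lambda>m. k \<le> m) ns) = length (filter (\<lambda>b. snd b = x \<and> k \<le> fst b) fs)"
proof -
  have "length (filter (\<lambda>m. k \<le> m) ns) = size (filter_mset (\<lambda>m. k \<le> m) (mset ns))"
    by (metis mset_filter size_mset)
  also have "\<dots> = length (filter (\<lambda>m. k \<le> m) (map fst (filter (\<lambda>b. snd b = x) fs)))"
    unfolding assms by (metis mset_filter size_mset)
  also have "\<dots> = length (filter (\<lambda>b. snd b = x \<and> k \<le> fst b) fs)"
    by (induction fs) auto
  finally show ?thesis .
qed

text \<open>The order of the determinant and the numbers of independent chains determine the partial
  multiplicities; they are the only access to them in what follows.\<close>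

lemma finite_partial_mults_facts:
  assumes L: "L \<in> pencil_carrier n" and pm: "finite_partial_mults n L x ns"
  shows "pdet n L \<noteq> 0" "order x (pdet n L) = sum_list ns"
    "1 \<le> k \<Longrightarrow> chains n q k (pmat n L) x \<longleftrightarrow> q \<le> length (filter (\<lambda>m. k \<le> m) ns)"
    "sorted_wrt (\<ge>) ns" "0 \<notin> set ns"
proof -
  from pm obtain fs ks where w: "weierstrass_form n L fs ks"
    and ms: "mset ns = mset (map fst (filter (\<lambda>b. snd b = x) fs))" and srt: "sorted_wrt (\<ge>) ns"
    unfolding finite_partial_mults_def by (elim exE conjE)
  show "sorted_wrt (\<ge>) ns" by (rule srt)
  define J where "J = jordan_matrix fs"
  define N where "N = jordan_matrix (map (\<lambda>k. (k, 0 :: complex)) ks)"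
  define p where "p = dim_row J"
  define s where "s = dim_row N"
  have o: "fst \<circ> (\<lambda>k :: nat. (k, 0 :: complex)) = (\<lambda>k. k)" by auto
  have J: "J \<in> carrier_mat p p" and N: "N \<in> carrier_mat s s" and ps: "p = sum_list (map fst fs)" "s = sum_list ks"
    by (auto simp: J_def N_def p_def s_def o)
  from w obtain P Q where f0: "0 \<notin> set (map fst fs)" and P: "P \<in> carrier_mat n n" and Q: "Q \<in> carrier_mat n n"
    and inv: "invertible_mat P" "invertible_mat Q"
    and eq: "P * fst L * Q = - four_block_mat J (0\<^sub>m p s) (0\<^sub>m s p) (1\<^sub>m s)"
      "P * snd L * Q = four_block_mat (1\<^sub>m p) (0\<^sub>m p s) (0\<^sub>m s p) N"
    unfolding weierstrass_form_def Let_def J_def[symmetric] N_def[symmetric] p_def[symmetric] s_def[symmetric]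
    by (elim conjE bexE)
  show "0 \<notin> set ns"
  proof -
    have "set ns = set (map fst (filter (\<lambda>b. snd b = x) fs))" using ms by (rule mset_eq_setD)
    then show ?thesis using f0 by auto
  qed
  have eq': "P * fst L * Q = - dsum J (1\<^sub>m s)" "P * snd L * Q = dsum (1\<^sub>m p) N"
    unfolding eq using J N by (simp_all add: dsum_def)
  have n: "n = p + s" using arg_cong[OF eq'(2), of dim_row] P J N by simp
  have inverse: "\<exists>X'. X' \<in> carrier_mat n n \<and> X * X' = 1\<^sub>m n \<and> X' * X = 1\<^sub>m n"
    if X: "X \<in> carrier_mat n n" and i: "invertible_mat X" for X :: "complex mat"
  proof -
    from i obtain X' where X': "X * X' = 1\<^sub>m (dim_row X)" "X' * X = 1\<^sub>m (dim_row X')"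
      unfolding invertible_mat_def inverts_mat_def by (elim conjE exE)
    have "dim_col X' = n" using arg_cong[OF X'(1), of dim_col] X by simp
    moreover have "dim_row X' = n" using arg_cong[OF X'(2), of dim_col] X by simp
    ultimately show ?thesis using X' X by (intro exI[of _ X']) auto
  qed
  obtain P' where P': "P' \<in> carrier_mat n n" "P * P' = 1\<^sub>m n" "P' * P = 1\<^sub>m n" using inverse[OF P inv(1)] by (elim exE conjE)
  obtain Q' where Q': "Q' \<in> carrier_mat n n" "Q * Q' = 1\<^sub>m n" "Q' * Q = 1\<^sub>m n" using inverse[OF Q inv(2)] by (elim exE conjE)
  define W where "W = dsum (char_poly_matrix J) (pmat s (- 1\<^sub>m s, N))"
  have PLQ: "lift P * pmat n L * lift Q = W"
    by (simp only: pmat_equiv[OF L P Q] eq' W_def pmat_dsum[OF J N, symmetric] n[symmetric])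
  have dN: "poly (det (pmat s (- 1\<^sub>m s, N))) y \<noteq> 0" for y
  proof -
    let ?T = "ev_mat (pmat s (- 1\<^sub>m s, N)) y"
    have T: "?T \<in> carrier_mat s s" by simp
    have "upper_triangular ?T"
      using jordan_matrix_upper_triangular[of _ "map (\<lambda>k. (k, 0 :: complex)) ks"] N
      by (auto simp: N_def o ps(2))
    hence "det ?T = prod_list (diag_mat ?T)" by (rule det_upper_triangular[OF _ T])
    moreover have "diag_mat ?T = replicate s (-1)"
      using jordan_matrix_zero_diag[of _ ks] N by (intro nth_equalityI) (auto simp: diag_mat_def N_def ps(2))
    ultimately show ?thesis by (simp add: det_ev_mat)
  qed
  have cW: "char_poly_matrix J \<in> carrier_mat p p" using J by simp
  have dW: "det W = char_poly J * det (pmat s (- 1\<^sub>m s, N))"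
    unfolding W_def char_poly_def by (rule det_dsum[OF cW pmat_carrier])
  have "det (lift P * pmat n L * lift Q) = det (lift P) * pdet n L * det (lift Q)"
    using det_mult[of "lift P * pmat n L" n "lift Q"] det_mult[of "lift P" n "pmat n L"] P Q by simp
  hence dd: "[:det P:] * pdet n L * [:det Q:] = char_poly J * det (pmat s (- 1\<^sub>m s, N))"
    unfolding PLQ dW det_lift by simp
  have dP: "det P \<noteq> 0" "det Q \<noteq> 0" using det_mult[OF P P'(1)] det_mult[OF Q Q'(1)] P'(2) Q'(2) by auto
  have n0: "det (pmat s (- 1\<^sub>m s, N)) \<noteq> 0" using dN[of 0] by auto
  have jnf: "jordan_nf J fs" unfolding jordan_nf_def J_def using f0
    by (auto intro: similar_mat_refl[OF jordan_matrix_carrier])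
  have cJ: "char_poly J \<noteq> 0" using J by (metis degree_0 char_poly_def degree_monic_char_poly leading_coeff_0_iff zero_neq_one)
  show nz: "pdet n L \<noteq> 0" using dd cJ n0 by auto
  have "order x ([:det P:] * pdet n L * [:det Q:]) = order x (pdet n L)"
    using dP nz by (subst order_mult, simp, subst order_mult) (auto simp: order_0I)
  moreover have "order x (char_poly J * det (pmat s (- 1\<^sub>m s, N))) = order x (char_poly J)"
    using cJ n0 order_0I[OF dN] by (subst order_mult) auto
  moreover have "order x (char_poly J) = sum_list ns"
    unfolding jordan_nf_order[OF jnf] sum_mset_sum_list[symmetric] ms ..
  ultimately show "order x (pdet n L) = sum_list ns" unfolding dd by simp
  show "chains n q k (pmat n L) x \<longleftrightarrow> q \<le> length (filter (\<lambda>m. k \<le> m) ns)" if k: "1 \<le> k"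
  proof -
    obtain I where I: "chain_support p (char_poly_matrix J) k x I"
      "card I = length (filter (\<lambda>b. snd b = x \<and> k \<le> fst b) fs)"
      using chain_support_jordan_matrix[OF k f0, of x] unfolding J_def[symmetric] ps(1)[symmetric] by (elim exE conjE)
    have "chain_support (p + s) W k x (I \<union> (+) p ` {})"
      using chain_support_four_block[OF cW pmat_carrier I(1) chain_support_nonsingular[OF pmat_carrier dN k]] J
      by (simp add: W_def dsum_def)
    hence sW: "chain_support n W k x I" by (simp add: n)
    have "W \<in> carrier_mat n n" unfolding PLQ[symmetric]
      by (intro mult_carrier_mat[of _ n n] pmat_carrier) (use P Q in auto)
    from chain_support_chains[OF this sW, of q] have "chains n q k W x \<longleftrightarrow> q \<le> card I" .
    moreover have "chains n q k (lift P * pmat n L * lift Q) x \<longleftrightarrow> chains n q k (pmat n L) x"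
      by (rule chains_equiv[OF pmat_carrier P Q P'(1) Q'(1) P'(3) Q'(2,3)])
    ultimately show ?thesis unfolding PLQ I(2) filter_count[OF ms] by simp
  qed
qed

lemma finite_partial_mults_exists:
  assumes L: "L \<in> pencil_carrier n" and reg: "pencil_regular L"
  obtains ns where "finite_partial_mults n L x ns"
proof -
  obtain fs ks where w: "weierstrass_form n L fs ks" using regular_weierstrass[OF L reg] by (elim exE)
  let ?ns = "rev (sort (map fst (filter (\<lambda>b. snd b = x) fs)))"
  have "sorted_wrt (\<ge>) ?ns" by (simp add: sorted_wrt_rev)
  moreover have "mset ?ns = mset (map fst (filter (\<lambda>b. snd b = x) fs))" by simp
  ultimately have "finite_partial_mults n L x ?ns" unfolding finite_partial_mults_def using w by blast
  then show ?thesis by (rule that)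
qed

lemma head_partial_mults:
  assumes L: "L \<in> pencil_carrier n" and pm: "finite_partial_mults n L x ns" and k: "1 \<le> k"
  shows "chains n 1 k (pmat n L) x \<longleftrightarrow> ns \<noteq> [] \<and> k \<le> hd ns"
proof -
  note f = finite_partial_mults_facts[OF L pm]
  have "1 \<le> length (filter (\<lambda>m. k \<le> m) ns) \<longleftrightarrow> (\<exists>m\<in>set ns. k \<le> m)"
    by (induction ns) auto
  also have "\<dots> \<longleftrightarrow> ns \<noteq> [] \<and> k \<le> hd ns" using f(4) by (cases ns) auto
  finally show ?thesis using f(3)[OF k, of 1] by simp
qed

section \<open>Lists of multiplicities\<close>

definition entry :: "nat list \<Rightarrow> nat \<Rightarrow> nat" where
  "entry l i = (if i < length l then l ! i else 0)"

abbreviation above :: "nat list \<Rightarrow> nat \<Rightarrow> nat" where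
  "above l k \<equiv> length (filter (\<lambda>m. k \<le> m) l)"

lemma entry_drop [simp]: "entry (drop r l) i = entry l (r + i)"
  by (auto simp: entry_def)

lemma entry_Cons [simp]: "entry (a # l) 0 = a" "entry (a # l) (Suc i) = entry l i"
  by (auto simp: entry_def)

lemma less_above_iff:
  assumes "sorted_wrt (\<ge>) l" "1 \<le> k" shows "i < above l k \<longleftrightarrow> k \<le> entry l i"
  using assms(1)
proof (induction l arbitrary: i)
  case Nil then show ?case using assms(2) by (simp add: entry_def)
next
  case (Cons a l)
  show ?case
  proof (cases "k \<le> a")
    case True
    then show ?thesis using Cons by (cases i) auto
  next
    case False
    hence "filter (\<lambda>m. k \<le> m) l = []" using Cons.prems by (auto simp: filter_empty_conv)
    moreover from this have "\<not> k \<le> entry l j" for j using Cons by (metis length_0_conv not_less_zero sorted_wrt.simps(2))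
    ultimately show ?thesis using False by (cases i) auto
  qed
qed

lemma sum_list_entry: "length l \<le> N \<Longrightarrow> sum_list l = (\<Sum>i<N. entry l i)"
proof -
  assume "length l \<le> N"
  have "sum_list l = (\<Sum>i<length l. l ! i)" by (simp add: sum_list_sum_nth atLeast0LessThan)
  also have "\<dots> = (\<Sum>i<N. entry l i)"
    by (rule sum.mono_neutral_cong_left) (use \<open>length l \<le> N\<close> in \<open>auto simp: entry_def\<close>)
  finally show ?thesis .
qed

lemma entry_eqI:
  assumes "\<And>i. entry m i = entry l i" "0 \<notin> set m" "0 \<notin> set l" shows "m = l"
proof -
  have e0: "entry z i = 0 \<longleftrightarrow> length z \<le> i" if "0 \<notin> set z" for z i
  proof (cases "i < length z")
    case True
    hence "z ! i \<in> set z" by simp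
    hence "z ! i \<noteq> 0" using that by metis
    then show ?thesis using True by (simp add: entry_def)
  qed (simp add: entry_def)
  have "length m \<le> i \<longleftrightarrow> length l \<le> i" for i using e0[OF assms(2), of i] e0[OF assms(3), of i] assms(1)[of i] by simp
  hence len: "length m = length l" by (meson le_antisym order_refl)
  show ?thesis by (rule nth_equalityI[OF len]) (use assms(1) len in \<open>metis entry_def\<close>)
qed

text \<open>Losing at most \<open>r\<close> of the entries above each level shifts the list by at most \<open>r\<close> places: this turns the counts of
chains into bounds for the single multiplicities.\<close>

lemma entry_le_of_above:
  assumes "sorted_wrt (\<ge>) l" "sorted_wrt (\<ge>) m" "\<And>k. 1 \<le> k \<Longrightarrow> above l k \<le> above m k + r"
  shows "entry l (r + i) \<le> entry m i"
proof (cases "entry l (r + i) = 0")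
  case False
  hence k: "1 \<le> entry l (r + i)" by simp
  hence "r + i < above l (entry l (r + i))" using less_above_iff[OF assms(1) k] by simp
  hence "i < above m (entry l (r + i))" using assms(3)[OF k] by simp
  then show ?thesis using less_above_iff[OF assms(2) k] by simp
qed simp

text \<open>Entrywise domination leaves no freedom if the sums agree, or if they differ by one that is needed at the head.\<close>

lemma dominating_list_eq:
  assumes dom: "\<And>i. entry l i \<le> entry m i" and s: "sum_list m = sum_list l" and "0 \<notin> set m" "0 \<notin> set l"
  shows "m = l"
proof (rule entry_eqI[OF _ assms(3,4)])
  fix i
  let ?N = "max (length m) (max (length l) (Suc i))"
  have "(\<Sum>i<?N. entry m i) = (\<Sum>i<?N. entry l i)"
    using s sum_list_entry[of m ?N] sum_list_entry[of l ?N] by simp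
  then show "entry m i = entry l i"
    using sum_mono_inv[of "entry l" "{..<?N}" "entry m" i] dom by auto
qed

text \<open>The only way in which the generic multiplicities deviate from a truncated list.\<close>

fun bump :: "nat list \<Rightarrow> nat list" where
  "bump [] = [1]"
| "bump (a # l) = Suc a # l"

lemma entry_bump: "entry (bump l) i = (if i = 0 then Suc (entry l 0) else entry l i)"
  by (cases l; cases i) (auto simp: entry_def)

lemma sum_list_bump [simp]: "sum_list (bump l) = Suc (sum_list l)"
  by (cases l) auto

lemma zero_bump [simp]: "0 \<notin> set l \<Longrightarrow> 0 \<notin> set (bump l)"
  by (cases l) auto

lemma dominating_list_bump:
  assumes dom: "\<And>i. entry l i \<le> entry m i" and s: "sum_list m = Suc (sum_list l)" and "0 \<notin> set m" "0 \<notin> set l"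
    and h: "Suc (entry l 0) \<le> entry m 0"
  shows "m = bump l"
  by (rule dominating_list_eq[OF _ _ assms(3) zero_bump[OF assms(4)]]) (use dom s h in \<open>auto simp: entry_bump\<close>)

section \<open>Structured pencils\<close>

lemma ssign_square [simp]: "ssign st * ssign st = 1" "ssign st * (ssign st * y) = y"
  by (cases st; simp)+

lemma ssign_nonzero [simp]: "ssign st \<noteq> 0"
  by (cases st) auto

lemma structure_index:
  assumes L: "L \<in> pencil_carrier n" and s: "has_structure st L" and ij: "i < n" "j < n"
  shows "fst L $$ (j, i) = ssign st * snd L $$ (i, j)" "snd L $$ (j, i) = ssign st * fst L $$ (i, j)"
proof -
  obtain A B where AB: "L = (A, B)" by force
  have c: "A \<in> carrier_mat n n" "B \<in> carrier_mat n n" using L AB by (auto simp: pencil_carrier_def)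
  have "A\<^sup>T $$ (i, j) = ssign st * B $$ (i, j)" if "i < n" "j < n" for i j
  proof (cases st)
    case Palindromic
    hence "A\<^sup>T = B" using s AB by simp
    then show ?thesis using Palindromic by simp
  next
    case Anti_Palindromic
    hence "A\<^sup>T = - B" using s AB by simp
    then show ?thesis using Anti_Palindromic c that by simp
  qed
  note * = this
  show "fst L $$ (j, i) = ssign st * snd L $$ (i, j)" using *[OF ij] ij c AB by simp
  have "A $$ (i, j) = ssign st * B $$ (j, i)" using *[OF ij(2,1)] ij c by simp
  then show "snd L $$ (j, i) = ssign st * fst L $$ (i, j)" using AB by simp
qed

lemma structureI:
  assumes L: "L \<in> pencil_carrier n"
    and e: "\<And>i j. i < n \<Longrightarrow> j < n \<Longrightarrow> fst L $$ (j, i) = ssign st * snd L $$ (i, j)"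
  shows "has_structure st L"
proof -
  obtain A B where AB: "L = (A, B)" by force
  have c: "A \<in> carrier_mat n n" "B \<in> carrier_mat n n" using L AB by (auto simp: pencil_carrier_def)
  show ?thesis
  proof (cases st)
    case Palindromic
    have "A\<^sup>T = B" by (rule eq_matI) (use c e AB Palindromic in auto)
    then show ?thesis using AB Palindromic by simp
  next
    case Anti_Palindromic
    have "A\<^sup>T = - B" by (rule eq_matI) (use c e AB Anti_Palindromic in auto)
    then show ?thesis using AB Anti_Palindromic by simp
  qed
qed

lemma structure_rev: "L \<in> pencil_carrier n \<Longrightarrow> has_structure st L \<Longrightarrow> has_structure st (pencil_rev L)"
proof (rule structureI[of _ n])
  assume a: "L \<in> pencil_carrier n" "has_structure st L"
  then show "pencil_rev L \<in> pencil_carrier n" by (cases L) (auto simp: pencil_carrier_def pencil_rev_def)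
  show "fst (pencil_rev L) $$ (j, i) = ssign st * snd (pencil_rev L) $$ (i, j)" if "i < n" "j < n" for i j
    using structure_index(2)[OF a that] by (simp add: pencil_rev_def)
qed

lemma structure_add:
  "L \<in> pencil_carrier n \<Longrightarrow> E \<in> pencil_carrier n \<Longrightarrow> has_structure st L \<Longrightarrow> has_structure st E \<Longrightarrow>
    has_structure st (pencil_add L E)"
proof (rule structureI[of _ n])
  assume a: "L \<in> pencil_carrier n" "E \<in> pencil_carrier n" "has_structure st L" "has_structure st E"
  fix i j assume ij: "i < n" "j < n"
  have c: "fst L \<in> carrier_mat n n" "snd L \<in> carrier_mat n n" "fst E \<in> carrier_mat n n" "snd E \<in> carrier_mat n n"
    using a by (auto simp: pencil_carrier_def)
  show "fst (pencil_add L E) $$ (j, i) = ssign st * snd (pencil_add L E) $$ (i, j)"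
    using structure_index[OF a(1,3) ij] structure_index[OF a(2,4) ij] c ij
    by (simp add: pencil_add_def algebra_simps)
qed (auto simp: pencil_carrier_def pencil_add_def)

lemma pencil_add_carrier [simp]:
  "L \<in> pencil_carrier n \<Longrightarrow> E \<in> pencil_carrier n \<Longrightarrow> pencil_add L E \<in> pencil_carrier n"
  by (auto simp: pencil_carrier_def pencil_add_def)

lemma pencil_rev_carrier [simp]: "pencil_rev L \<in> pencil_carrier n \<longleftrightarrow> L \<in> pencil_carrier n"
  by (cases L) (auto simp: pencil_carrier_def pencil_rev_def)

text \<open>Evaluating \<open>det L(\<lambda>) = det L(\<lambda>)\<^sup>T = (c\<lambda>)\<^sup>n det L(1/\<lambda>)\<close> at its zeros \<open>\<plusminus>1\<close>.\<close>

lemma order_parity: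
  assumes L: "L \<in> pencil_carrier n" and s: "has_structure st L" and r: "pdet n L \<noteq> 0" and x: "x * x = 1"
  shows "(ssign st * x) ^ n = (- 1) ^ order x (pdet n L)"
proof -
  let ?c = "ssign st" let ?p = "pdet n L" let ?a = "order x ?p"
  obtain e where e: "?p = lin x ^ ?a * e" "poly e x \<noteq> 0" using order_factor[OF r] by blast
  have x0: "x \<noteq> 0" using x by auto
  have c: "fst L \<in> carrier_mat n n" "snd L \<in> carrier_mat n n" using L by (auto simp: pencil_carrier_def)
  have fe: "poly ?p y = (?c * y) ^ n * poly ?p (1 / y)" if y: "y \<noteq> 0" for y
  proof -
    have ec: "pencil_eval L z \<in> carrier_mat n n" for z using c by (simp add: pencil_eval_def)
    have "(pencil_eval L y)\<^sup>T = (?c * y) \<cdot>\<^sub>m pencil_eval L (1 / y)"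
    proof (rule eq_matI)
      fix i j assume "i < dim_row ((?c * y) \<cdot>\<^sub>m pencil_eval L (1 / y))" "j < dim_col ((?c * y) \<cdot>\<^sub>m pencil_eval L (1 / y))"
      then have ij: "i < n" "j < n" using ec[of "1 / y"] by auto
      have "?c * y * (a + 1 / y * b) = ?c * (y * a) + ?c * (y * (1 / y) * b)" for a b
        by (simp only: distrib_left mult.assoc)
      moreover have "y * (1 / y) = 1" using y by simp
      ultimately have "?c * b + y * (?c * a) = ?c * y * (a + 1 / y * b)" for a b
        by (simp only: mult_1_left add.commute mult.left_commute)
      then show "(pencil_eval L y)\<^sup>T $$ (i, j) = ((?c * y) \<cdot>\<^sub>m pencil_eval L (1 / y)) $$ (i, j)"
        using structure_index[OF L s ij] c ij by (simp only: pencil_eval_def index_transpose_mat index_add_mat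
          index_smult_mat carrier_matD)
    qed (use c in \<open>simp_all add: pencil_eval_def\<close>)
    then have "det ((pencil_eval L y)\<^sup>T) = (?c * y) ^ n * det (pencil_eval L (1 / y))"
      using ec[of "1 / y"] by simp
    then show ?thesis using ec[of y] L by (simp add: poly_pdet det_transpose)
  qed
  have eq: "poly e y = (?c * y) ^ n * (- x / y) ^ ?a * poly e (1 / y)" if y: "y \<noteq> 0" "y \<noteq> x" for y
  proof -
    have "(y - x) ^ ?a * poly e y = (?c * y) ^ n * ((1 / y - x) ^ ?a * poly e (1 / y))"
      using fe[OF y(1)] arg_cong[OF e(1), of "\<lambda>p. poly p y"] arg_cong[OF e(1), of "\<lambda>p. poly p (1 / y)"] by simp
    also have "1 / y - x = (y - x) * (- x / y)" using y x by (simp add: field_simps)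
    finally have "(y - x) ^ ?a * poly e y = (y - x) ^ ?a * ((?c * y) ^ n * (- x / y) ^ ?a * poly e (1 / y))"
      by (simp only: power_mult_distrib ac_simps)
    then show ?thesis using y by simp
  qed
  have lim: "((\<lambda>y. (?c * y) ^ n * (- x / y) ^ ?a * poly e (1 / y)) \<longlongrightarrow> (?c * x) ^ n * (- x / x) ^ ?a * poly e (1 / x)) (at x)"
    using x0 by (intro tendsto_intros isCont_tendsto_compose[OF poly_isCont]) auto
  have "(poly e \<longlongrightarrow> (?c * x) ^ n * (- x / x) ^ ?a * poly e (1 / x)) (at x)"
  proof (rule Lim_transform_eventually[OF lim])
    have "eventually (\<lambda>y. y \<noteq> 0) (at x)" using x0 by (simp add: eventually_neq_at_within)
    moreover have "eventually (\<lambda>y. y \<noteq> x) (at x)" by (simp add: eventually_neq_at_within)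
    ultimately show "eventually (\<lambda>y. (?c * y) ^ n * (- x / y) ^ ?a * poly e (1 / y) = poly e y) (at x)"
      by eventually_elim (simp add: eq)
  qed
  moreover have "(poly e \<longlongrightarrow> poly e x) (at x)" by (intro isCont_tendsto_compose[OF poly_isCont] tendsto_ident_at)
  ultimately have "poly e x = (?c * x) ^ n * (- x / x) ^ ?a * poly e (1 / x)"
    by (rule tendsto_unique[OF at_neq_bot, rotated])
  moreover have "1 / x = x" using x x0 by (simp add: field_simps)
  ultimately have "poly e x * 1 = poly e x * ((?c * x) ^ n * (- 1) ^ ?a)" using x0 by (simp add: ac_simps)
  hence "(?c * x) ^ n * (- 1) ^ ?a = 1" using e(2) by simp
  hence "(?c * x) ^ n * (- 1) ^ ?a * (- 1) ^ ?a = (- 1) ^ ?a" by simp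
  then show ?thesis by (simp add: mult.assoc power_mult_distrib[symmetric])
qed

definition quad :: "complex mat \<Rightarrow> complex vec \<Rightarrow> complex" where
  "quad N u = (\<Sum>i = 0..<dim_row N. \<Sum>j = 0..<dim_col N. u $ i * N $$ (i, j) * u $ j)"

lemma quad_zero_skew:
  assumes N: "N \<in> carrier_mat n n" and z: "\<And>u. u \<in> carrier_vec n \<Longrightarrow> quad N u = 0" and ij: "i < n" "j < n"
  shows "N $$ (j, i) = - N $$ (i, j)"
proof -
  have q: "quad N (vec n f) = (\<Sum>k = 0..<n. \<Sum>l = 0..<n. f k * N $$ (k, l) * f l)" for f
    using N by (simp add: quad_def)
  have s1: "(\<Sum>l = 0..<n. g l * (if l = k then 1 else 0)) = g k" if "k < n" for g :: "nat \<Rightarrow> complex" and k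
  proof -
    have "(\<Sum>l = 0..<n. g l * (if l = k then 1 else 0)) = (\<Sum>l = 0..<n. if l = k then g l else 0)"
      by (rule sum.cong) auto
    then show ?thesis using that by simp
  qed
  have s2: "(\<Sum>l = 0..<n. (if l = k then 1 else 0) * g l) = g k" if "k < n" for g :: "nat \<Rightarrow> complex" and k
    using s1[OF that, of g] by (simp add: mult.commute)
  have diag: "N $$ (k, k) = 0" if k: "k < n" for k
  proof -
    have "quad N (vec n (\<lambda>l. if l = k then 1 else 0)) = N $$ (k, k)"
      unfolding q s1[OF k] s2[OF k] ..
    then show ?thesis using z by simp
  qed
  have "quad N (vec n (\<lambda>l. (if l = i then 1 else 0) + (if l = j then 1 else 0))) =
      N $$ (i, i) + N $$ (i, j) + (N $$ (j, i) + N $$ (j, j))"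
    unfolding q distrib_left distrib_right sum.distrib s1[OF ij(1)] s1[OF ij(2)] s2[OF ij(1)] s2[OF ij(2)]
    by (simp add: s1 s2 ij)
  then show ?thesis using z[of "vec n (\<lambda>l. (if l = i then 1 else 0) + (if l = j then 1 else 0))"] diag ij
    by (simp add: add_eq_0_iff)
qed

lemma polynomial_function_quad: "N \<in> carrier_mat n n \<Longrightarrow> polynomial_function n (quad N)"
  unfolding quad_def
  by (intro polynomial_function_sum polynomial_function_mult polynomial_function_coord polynomial_function_const) auto

text \<open>With \<open>L K = (\<lambda> - x)\<^sup>m e I\<close> the values and first derivatives at \<open>x\<close> relate the first two Taylor coefficients of \<open>K\<close>.\<close>

lemma product_expansion:
  fixes x :: complex
  assumes L: "L \<in> pencil_carrier n" and K: "K \<in> carrier_mat n n" and ij: "i < n" "j < n"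
  defines "K0 \<equiv> ev_mat K x" and "K1 \<equiv> ev_mat (map_mat pderiv K) x" and "P0 \<equiv> pencil_eval L x"
  shows "poly ((pmat n L * K) $$ (i, j)) x = (P0 * K0) $$ (i, j)"
    "poly ((K * pmat n L) $$ (i, j)) x = (K0 * P0) $$ (i, j)"
    "poly (pderiv ((pmat n L * K) $$ (i, j))) x = (snd L * K0) $$ (i, j) + (P0 * K1) $$ (i, j)"
    "poly (pderiv ((K * pmat n L) $$ (i, j))) x = (K0 * snd L) $$ (i, j) + (K1 * P0) $$ (i, j)"
proof -
  have c: "fst L \<in> carrier_mat n n" "snd L \<in> carrier_mat n n" "K0 \<in> carrier_mat n n" "K1 \<in> carrier_mat n n" "P0 \<in> carrier_mat n n"
    using L K by (auto simp: pencil_carrier_def K0_def K1_def P0_def pencil_eval_def)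
  note e1 = mult_mat_entry[OF pmat_carrier K ij] mult_mat_entry[OF K pmat_carrier ij]
    mult_mat_entry[OF c(5,3) ij] mult_mat_entry[OF c(3,5) ij] mult_mat_entry[OF c(2,3) ij] mult_mat_entry[OF c(5,4) ij]
    mult_mat_entry[OF c(3,2) ij] mult_mat_entry[OF c(4,5) ij]
  have pd: "pderiv (\<Sum>l = 0..<n. f l) = (\<Sum>l = 0..<n. pderiv (f l))" for f :: "nat \<Rightarrow> complex poly"
    by (rule pderiv_sum)
  show "poly ((pmat n L * K) $$ (i, j)) x = (P0 * K0) $$ (i, j)"
    unfolding e1 poly_sum
    by (rule sum.cong[OF refl]) (use c K ij in \<open>simp add: P0_def K0_def pencil_eval_def algebra_simps\<close>)
  show "poly ((K * pmat n L) $$ (i, j)) x = (K0 * P0) $$ (i, j)"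
    unfolding e1 poly_sum
    by (rule sum.cong[OF refl]) (use c K ij in \<open>simp add: P0_def K0_def pencil_eval_def algebra_simps\<close>)
  have pc: "poly (pderiv ([:a, b:] * p)) x = b * poly p x + (a + x * b) * poly (pderiv p) x"
    "poly (pderiv (p * [:a, b:])) x = poly p x * b + poly (pderiv p) x * (a + x * b)" for a b :: complex and p
    unfolding pderiv_mult by (simp_all add: pderiv_pCons algebra_simps)
  show "poly (pderiv ((pmat n L * K) $$ (i, j))) x = (snd L * K0) $$ (i, j) + (P0 * K1) $$ (i, j)"
    unfolding e1 pd poly_sum sum.distrib[symmetric]
  proof (rule sum.cong[OF refl])
    fix l assume "l \<in> {0..<n}"
    hence l: "l < n" by simp
    show "poly (pderiv (pmat n L $$ (i, l) * K $$ (l, j))) x = snd L $$ (i, l) * K0 $$ (l, j) + P0 $$ (i, l) * K1 $$ (l, j)"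
      unfolding pmat_index[OF ij(1) l] pc using c K ij l by (simp add: P0_def K0_def K1_def pencil_eval_def)
  qed
  show "poly (pderiv ((K * pmat n L) $$ (i, j))) x = (K0 * snd L) $$ (i, j) + (K1 * P0) $$ (i, j)"
    unfolding e1 pd poly_sum sum.distrib[symmetric]
  proof (rule sum.cong[OF refl])
    fix l assume "l \<in> {0..<n}"
    hence l: "l < n" by simp
    show "poly (pderiv (K $$ (i, l) * pmat n L $$ (l, j))) x = K0 $$ (i, l) * snd L $$ (l, j) + K1 $$ (i, l) * P0 $$ (l, j)"
      unfolding pmat_index[OF l ij(2)] pc using c K ij l by (simp add: P0_def K0_def K1_def pencil_eval_def)
  qed
qed

lemma annihilated_zero:
  assumes L: "L \<in> pencil_carrier n" and r: "pencil_regular L" and K0: "K0 \<in> carrier_mat n n"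
    and A: "fst L * K0 = 0\<^sub>m n n" and B: "snd L * K0 = 0\<^sub>m n n"
  shows "K0 = 0\<^sub>m n n"
proof -
  obtain y where y: "det (pencil_eval L y) \<noteq> 0" using r unfolding pencil_regular_def by blast
  have c: "fst L \<in> carrier_mat n n" "snd L \<in> carrier_mat n n" using L by (auto simp: pencil_carrier_def)
  have ec: "pencil_eval L y \<in> carrier_mat n n" using c by (simp add: pencil_eval_def)
  obtain G where G: "G \<in> carrier_mat n n" "G * pencil_eval L y = 1\<^sub>m n" using nonsingular_inverse[OF ec y] by blast
  have "pencil_eval L y * K0 = fst L * K0 + (y \<cdot>\<^sub>m snd L) * K0"
    unfolding pencil_eval_def by (rule add_mult_distrib_mat[OF c(1) _ K0]) (use c in simp)
  also have "(y \<cdot>\<^sub>m snd L) * K0 = y \<cdot>\<^sub>m (snd L * K0)" by (rule mult_smult_assoc_mat[OF c(2) K0])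
  finally have "pencil_eval L y * K0 = 0\<^sub>m n n" unfolding A B by simp
  hence "G * (pencil_eval L y * K0) = 0\<^sub>m n n" using G by simp
  then show ?thesis using assoc_mult_mat[OF G(1) ec K0] G(2) K0 by simp
qed

text \<open>The leading coefficient \<open>K0\<close> of the inverse at \<open>x\<close> can only be skew-symmetric if \<open>x = \<plusminus>1\<close>, because
  then its columns lie in the kernels of both \<open>L(x)\<close> and \<open>L(x)\<^sup>T\<close>; and the next coefficient \<open>K1\<close>
  cannot be skew-symmetric as well if the pole has order at least two.  At a simple pole \<open>K0 B K0\<close> is a nonzero
  multiple of \<open>K0\<close>; at \<open>- ssign st\<close> the structure makes it symmetric, so that the pole is not simple there.\<close>

lemma skew_leading_coefficient:
  assumes L: "L \<in> pencil_carrier n" and s: "has_structure st L" and reg: "pencil_regular L"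
    and K: "K \<in> carrier_mat n n" and m: "1 \<le> m" and K0nz: "ev_mat K x \<noteq> 0\<^sub>m n n" and e: "poly e x \<noteq> 0"
    and LK: "pmat n L * K = (lin x ^ m * e) \<cdot>\<^sub>m 1\<^sub>m n" and KL: "K * pmat n L = (lin x ^ m * e) \<cdot>\<^sub>m 1\<^sub>m n"
    and skew: "\<And>u. u \<in> carrier_vec n \<Longrightarrow> quad (ev_mat K x) u = 0"
  shows "x * x = 1" "2 \<le> m \<Longrightarrow> \<exists>u \<in> carrier_vec n. quad (ev_mat (map_mat pderiv K) x) u \<noteq> 0"
    "x = - ssign st \<Longrightarrow> 2 \<le> m"
proof -
  let ?A = "fst L" let ?B = "snd L" let ?c = "ssign st"
  define K0 where "K0 = ev_mat K x"
  define K1 where "K1 = ev_mat (map_mat pderiv K) x"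
  define P0 where "P0 = pencil_eval L x"
  have c: "?A \<in> carrier_mat n n" "?B \<in> carrier_mat n n" "K0 \<in> carrier_mat n n" "K1 \<in> carrier_mat n n" "P0 \<in> carrier_mat n n"
    using L K by (auto simp: pencil_carrier_def K0_def K1_def P0_def pencil_eval_def)
  note pe = product_expansion[OF L K, where x = x, folded K0_def K1_def P0_def]
  have z: "(P0 * K0) $$ (i, j) = 0" "(K0 * P0) $$ (i, j) = 0" if "i < n" "j < n" for i j
    using pe(1,2)[OF that] that m unfolding LK KL by (simp_all add: power_0_left)
  define h where "h = (if m = 1 then poly e x else 0)"
  have dh: "poly (pderiv (lin x ^ m * e)) x = h"
  proof -
    obtain k where k: "m = Suc k" using m by (cases m) auto
    have "pderiv (lin x) = 1" by (simp add: lin_def pderiv_pCons)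
    then show ?thesis unfolding k h_def
      by (cases k) (simp_all only: pderiv_mult pderiv_power_Suc poly_add poly_mult poly_power poly_lin poly_smult, auto)
  qed
  have d: "(?B * K0) $$ (i, j) + (P0 * K1) $$ (i, j) = (if i = j then h else 0)"
    "(K0 * ?B) $$ (i, j) + (K1 * P0) $$ (i, j) = (if i = j then h else 0)" if "i < n" "j < n" for i j
    using pe(3,4)[OF that] that dh unfolding LK KL by auto
  have sk: "K0 $$ (j, i) = - K0 $$ (i, j)" if "i < n" "j < n" for i j
    using quad_zero_skew[OF c(3) _ that] skew by (simp add: K0_def)
  note st = structure_index[OF L s]
  have PA: "(P0 * K0) $$ (i, j) = (?A * K0) $$ (i, j) + x * (?B * K0) $$ (i, j)" if "i < n" "j < n" for i j
    unfolding mult_mat_entry[OF c(5,3) that] mult_mat_entry[OF c(1,3) that] mult_mat_entry[OF c(2,3) that]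
    unfolding sum_distrib_left sum.distrib[symmetric]
    by (rule sum.cong) (use c that in \<open>auto simp: P0_def pencil_eval_def algebra_simps\<close>)
  have KP: "(K0 * P0) $$ (j, i) = - ?c * ((?B * K0) $$ (i, j) + x * (?A * K0) $$ (i, j))" if ij: "i < n" "j < n" for i j
    unfolding mult_mat_entry[OF c(3,5) ij(2,1)] mult_mat_entry[OF c(1,3) that] mult_mat_entry[OF c(2,3) that]
    unfolding sum_distrib_left sum.distrib[symmetric]
  proof (rule sum.cong[OF refl])
    fix l assume "l \<in> {0..<n}"
    hence l: "l < n" by simp
    show "K0 $$ (j, l) * P0 $$ (l, i) = - ?c * (?B $$ (i, l) * K0 $$ (l, j) + x * (?A $$ (i, l) * K0 $$ (l, j)))"
      using c l ij st[OF ij(1) l] sk[OF l ij(2)] by (simp add: P0_def pencil_eval_def algebra_simps)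
  qed
  have AB: "(?A * K0) $$ (i, j) = - x * (?B * K0) $$ (i, j)" "(?B * K0) $$ (i, j) = - x * (?A * K0) $$ (i, j)"
    if "i < n" "j < n" for i j
    using z(1)[OF that] z(2)[OF that(2,1)] PA[OF that] KP[OF that] by (auto simp: add_eq_0_iff2)
  have K0nz': "K0 \<noteq> 0\<^sub>m n n" using K0nz by (simp add: K0_def)
  have contr: False if "\<And>i j. i < n \<Longrightarrow> j < n \<Longrightarrow> (?B * K0) $$ (i, j) = 0"
  proof -
    have "?B * K0 = 0\<^sub>m n n" by (rule eq_matI) (use that c in \<open>auto simp del: index_mult_mat(1)\<close>)
    moreover have "?A * K0 = 0\<^sub>m n n"
      by (rule eq_matI) (use that AB(1) c in \<open>auto simp del: index_mult_mat(1)\<close>)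
    ultimately show False using annihilated_zero[OF L reg c(3)] K0nz' by simp
  qed
  show xx: "x * x = 1"
  proof (rule ccontr)
    assume x: "x * x \<noteq> 1"
    have "(?B * K0) $$ (i, j) = 0" if "i < n" "j < n" for i j
    proof -
      have "(?B * K0) $$ (i, j) = x * x * (?B * K0) $$ (i, j)" using AB[OF that] by simp
      then show ?thesis using x by (simp del: index_mult_mat(1))
    qed
    then show False by (rule contr)
  qed
  show "\<exists>u \<in> carrier_vec n. quad (ev_mat (map_mat pderiv K) x) u \<noteq> 0" if m2: "2 \<le> m"
  proof (rule ccontr)
    assume "\<not> ?thesis"
    hence sk1: "K1 $$ (j, i) = - K1 $$ (i, j)" if "i < n" "j < n" for i j
      using quad_zero_skew[OF c(4) _ that] by (auto simp: K1_def)
    have h0: "h = 0" using m2 by (simp add: h_def)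
    have KB: "(K0 * ?B) $$ (j, i) = - ?c * (?A * K0) $$ (i, j)" if ij: "i < n" "j < n" for i j
      unfolding mult_mat_entry[OF c(3,2) ij(2,1)] mult_mat_entry[OF c(1,3) that] sum_distrib_left
    proof (rule sum.cong[OF refl])
      fix l assume "l \<in> {0..<n}"
      hence l: "l < n" by simp
      show "K0 $$ (j, l) * ?B $$ (l, i) = - ?c * (?A $$ (i, l) * K0 $$ (l, j))"
        using st[OF ij(1) l] sk[OF l ij(2)] by simp
    qed
    have KP1: "(K1 * P0) $$ (j, i) = - ?c * x * (P0 * K1) $$ (i, j)" if ij: "i < n" "j < n" for i j
      unfolding mult_mat_entry[OF c(4,5) ij(2,1)] mult_mat_entry[OF c(5,4) that] sum_distrib_left
    proof (rule sum.cong[OF refl])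
      fix l assume "l \<in> {0..<n}"
      hence l: "l < n" by simp
      have "P0 $$ (l, i) = ?c * x * P0 $$ (i, l)"
        using c l ij st[OF ij(1) l] xx by (simp add: P0_def pencil_eval_def algebra_simps)
      then show "K1 $$ (j, l) * P0 $$ (l, i) = - ?c * x * (P0 $$ (i, l) * K1 $$ (l, j))"
        using sk1[OF l ij(2)] by simp
    qed
    have "(?B * K0) $$ (i, j) = 0" if ij: "i < n" "j < n" for i j
    proof -
      have 1: "(P0 * K1) $$ (i, j) = - (?B * K0) $$ (i, j)" using d(1)[OF ij] h0 by (simp add: eq_neg_iff_add_eq_0 add.commute split: if_splits del: index_mult_mat(1))
      have "?c * (- (?A * K0) $$ (i, j) - x * (P0 * K1) $$ (i, j)) = 0"
        using d(2)[OF ij(2,1)] h0 unfolding KB[OF ij] KP1[OF ij] by (simp add: algebra_simps split: if_splits del: index_mult_mat(1))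
      hence "- (?A * K0) $$ (i, j) - x * (P0 * K1) $$ (i, j) = 0" by (simp del: index_mult_mat(1))
      hence "2 * (x * (?B * K0) $$ (i, j)) = 0" unfolding 1 AB(1)[OF ij] by (simp del: index_mult_mat(1))
      moreover have "x \<noteq> 0" using xx by auto
      ultimately show ?thesis by (simp del: index_mult_mat(1))
    qed
    then show False by (rule contr)
  qed
  show "2 \<le> m" if x: "x = - ?c"
  proof (rule ccontr)
    assume "\<not> 2 \<le> m"
    hence h: "h \<noteq> 0" using m e by (simp add: h_def)
    have KBK: "(K0 * (?B * K0)) $$ (i, j) = h * K0 $$ (i, j)" if ij: "i < n" "j < n" for i j
    proof -
      have "(K0 * (?B * K0)) $$ (i, j) + (K0 * (P0 * K1)) $$ (i, j) =
        (\<Sum>l = 0..<n. K0 $$ (i, l) * ((?B * K0) $$ (l, j) + (P0 * K1) $$ (l, j)))"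
        unfolding mult_mat_entry[OF c(3) mult_carrier_mat[OF c(2,3)] ij] mult_mat_entry[OF c(3) mult_carrier_mat[OF c(5,4)] ij]
        by (simp only: sum.distrib distrib_left)
      also have "\<dots> = (\<Sum>l = 0..<n. if l = j then h * K0 $$ (i, l) else 0)"
        by (rule sum.cong) (use d(1) ij in \<open>auto simp del: index_mult_mat(1)\<close>)
      also have "\<dots> = h * K0 $$ (i, j)" using ij by simp
      also have "K0 * (P0 * K1) = (K0 * P0) * K1" by (rule assoc_mult_mat[OF c(3,5,4), symmetric])
      also have "((K0 * P0) * K1) $$ (i, j) = 0"
        unfolding mult_mat_entry[OF mult_carrier_mat[OF c(3,5)] c(4) ij]
        by (rule sum.neutral) (use z(2)[OF ij(1)] in \<open>auto simp del: index_mult_mat(1)\<close>)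
      finally show ?thesis by (simp del: index_mult_mat(1))
    qed
    have sym: "(K0 * (?B * K0)) $$ (j, i) = (K0 * (?B * K0)) $$ (i, j)" if ij: "i < n" "j < n" for i j
    proof -
      have BK: "(?B * K0) $$ (l, i) = - ?c * (K0 * ?A) $$ (i, l)" if l: "l < n" for l
        unfolding mult_mat_entry[OF c(2,3) l ij(1)] mult_mat_entry[OF c(3,1) ij(1) l] sum_distrib_left
      proof (rule sum.cong[OF refl])
        fix k assume "k \<in> {0..<n}"
        hence k: "k < n" by simp
        show "?B $$ (l, k) * K0 $$ (k, i) = - ?c * (K0 $$ (i, k) * ?A $$ (k, l))"
          using st[OF k l] sk[OF ij(1) k] by (simp add: st(2)[OF k l])
      qed
      have "(K0 * (?B * K0)) $$ (j, i) = (\<Sum>l = 0..<n. ?c * ((K0 * ?A) $$ (i, l) * K0 $$ (l, j)))"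
        unfolding mult_mat_entry[OF c(3) mult_carrier_mat[OF c(2,3)] ij(2,1)]
        by (rule sum.cong) (use BK sk[OF _ ij(2)] in \<open>auto simp del: index_mult_mat(1)\<close>)
      also have "\<dots> = ?c * ((K0 * ?A) * K0) $$ (i, j)"
        unfolding mult_mat_entry[OF mult_carrier_mat[OF c(3,1)] c(3) ij] sum_distrib_left ..
      also have "(K0 * ?A) * K0 = K0 * (?A * K0)" by (rule assoc_mult_mat[OF c(3,1,3)])
      also have "?c * (K0 * (?A * K0)) $$ (i, j) = (K0 * (?B * K0)) $$ (i, j)"
        unfolding mult_mat_entry[OF c(3) mult_carrier_mat[OF c(1,3)] ij] mult_mat_entry[OF c(3) mult_carrier_mat[OF c(2,3)] ij] sum_distrib_left
        by (rule sum.cong) (use AB(1) ij x in \<open>auto simp del: index_mult_mat(1)\<close>)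
      finally show ?thesis .
    qed
    have "K0 $$ (i, j) = 0" if ij: "i < n" "j < n" for i j
    proof -
      have "h * K0 $$ (j, i) = h * K0 $$ (i, j)" using KBK[OF ij] KBK[OF ij(2,1)] sym[OF ij] by metis
      hence "h * (2 * K0 $$ (i, j)) = 0" using sk[OF ij] by simp
      then show ?thesis using h by simp
    qed
    hence "K0 = 0\<^sub>m n n" by (intro eq_matI) (use c in auto)
    then show False using K0nz' by simp
  qed
qed

section \<open>One structured perturbation of rank one\<close>

lemma entry_tl: "entry (tl l) i = entry l (Suc i)"
  by (cases l) (auto simp: entry_def)

definition rank1 :: "pencil_structure \<Rightarrow> complex vec \<Rightarrow> pencil" where
  "rank1 st u = (outer u u, ssign st \<cdot>\<^sub>m outer u u)"

definition omega :: "pencil_structure \<Rightarrow> complex poly" where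
  "omega st = [:1, ssign st:]"

abbreviation liftv :: "complex vec \<Rightarrow> complex poly vec" where
  "liftv u \<equiv> map_vec (\<lambda>a. [:a:]) u"

lemma poly_omega [simp]: "poly (omega st) x = 1 + ssign st * x"
  by (simp add: omega_def)

lemma omega_zero_iff: "poly (omega st) x = 0 \<longleftrightarrow> x = - ssign st"
proof -
  have "ssign st * poly (omega st) x = ssign st + x" by (simp add: distrib_left)
  then have "poly (omega st) x = 0 \<longleftrightarrow> ssign st + x = 0" by (metis mult_eq_0_iff ssign_nonzero)
  also have "\<dots> \<longleftrightarrow> x = - ssign st" by (metis add_eq_0_iff)
  finally show ?thesis .
qed

lemma rank1_carrier [simp]: "u \<in> carrier_vec n \<Longrightarrow> rank1 st u \<in> pencil_carrier n"
  by (simp add: rank1_def pencil_carrier_def)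

lemma structure_rank1: "u \<in> carrier_vec n \<Longrightarrow> has_structure st (rank1 st u)"
  by (rule structureI[of _ n]) (auto simp: rank1_def pencil_carrier_def mult.commute)

lemma pmat_add_rank1:
  "L \<in> pencil_carrier n \<Longrightarrow> u \<in> carrier_vec n \<Longrightarrow>
    pmat n (pencil_add L (rank1 st u)) = pmat n L + outer (omega st \<cdot>\<^sub>v liftv u) (liftv u)"
  by (rule eq_matI) (auto simp: rank1_def pencil_add_def pencil_carrier_def omega_def algebra_simps)

definition pquad :: "complex poly mat \<Rightarrow> complex vec \<Rightarrow> complex poly" where
  "pquad K u = (\<Sum>i = 0..<dim_row K. \<Sum>j = 0..<dim_col K. [:u $ i:] * K $$ (i, j) * [:u $ j:])"

lemma poly_pquad: "poly (pquad K u) x = quad (ev_mat K x) u"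
  by (simp add: pquad_def quad_def poly_sum ac_simps)

lemma poly_pderiv_pquad: "poly (pderiv (pquad K u)) x = quad (ev_mat (map_mat pderiv K) x) u"
  by (simp add: pquad_def quad_def poly_sum pderiv_sum pderiv_mult pderiv_smult ac_simps)

lemma scalar_prod_pquad:
  assumes N: "N = lin x ^ b \<cdot>\<^sub>m K" and K: "K \<in> carrier_mat n n" and u: "u \<in> carrier_vec n"
  shows "liftv u \<bullet> (N *\<^sub>v (w \<cdot>\<^sub>v liftv u)) = w * lin x ^ b * pquad K u"
proof -
  have Nc: "N \<in> carrier_mat n n" and uc: "w \<cdot>\<^sub>v liftv u \<in> carrier_vec n" using N K u by auto
  have "liftv u \<bullet> (N *\<^sub>v (w \<cdot>\<^sub>v liftv u)) = (\<Sum>i = 0..<n. liftv u $ i * (N *\<^sub>v (w \<cdot>\<^sub>v liftv u)) $ i)"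
    using Nc by (simp add: scalar_prod_def)
  also have "\<dots> = (\<Sum>i = 0..<n. \<Sum>j = 0..<n. w * lin x ^ b * ([:u $ i:] * K $$ (i, j) * [:u $ j:]))"
  proof (rule sum.cong[OF refl])
    fix i assume "i \<in> {0..<n}"
    hence i: "i < n" by simp
    show "liftv u $ i * (N *\<^sub>v (w \<cdot>\<^sub>v liftv u)) $ i = (\<Sum>j = 0..<n. w * lin x ^ b * ([:u $ i:] * K $$ (i, j) * [:u $ j:]))"
      unfolding mult_mat_vec_entry[OF Nc uc i] sum_distrib_left
      by (rule sum.cong[OF refl]) (use N K u i in \<open>simp add: ac_simps\<close>)
  qed
  also have "\<dots> = w * lin x ^ b * pquad K u" using K by (simp add: pquad_def sum_distrib_left)
  finally show ?thesis .
qed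

text \<open>The pole of the inverse at an eigenvalue, with the largest partial multiplicity as its order.\<close>

lemma pole_data:
  assumes L: "L \<in> pencil_carrier n" and pm: "finite_partial_mults n L x ns" and ne: "ns \<noteq> []"
  obtains b K e where "K \<in> carrier_mat n n" "adj_mat (pmat n L) = lin x ^ b \<cdot>\<^sub>m K" "ev_mat K x \<noteq> 0\<^sub>m n n"
    "pdet n L = lin x ^ (b + hd ns) * e" "poly e x \<noteq> 0" "1 \<le> hd ns" "sum_list (tl ns) = b"
    "pmat n L * K = (lin x ^ hd ns * e) \<cdot>\<^sub>m 1\<^sub>m n" "K * pmat n L = (lin x ^ hd ns * e) \<cdot>\<^sub>m 1\<^sub>m n" "0 < n"
proof -
  note f = finite_partial_mults_facts[OF L pm]
  have hd1: "1 \<le> hd ns" using f(5) ne by (cases ns) auto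
  have n: "0 < n"
  proof (rule ccontr)
    assume "\<not> 0 < n"
    hence "order x (pdet n L) = 0" by (simp add: order_0I)
    thus False using f(2) hd1 ne by (cases ns) auto
  qed
  obtain b K e where K: "K \<in> carrier_mat n n" "adj_mat (pmat n L) = lin x ^ b \<cdot>\<^sub>m K" "ev_mat K x \<noteq> 0\<^sub>m n n"
    and ba: "b \<le> order x (pdet n L)" and e: "pdet n L = lin x ^ order x (pdet n L) * e" "poly e x \<noteq> 0"
    and MK: "pmat n L * K = (lin x ^ (order x (pdet n L) - b) * e) \<cdot>\<^sub>m 1\<^sub>m n"
    and KM: "K * pmat n L = (lin x ^ (order x (pdet n L) - b) * e) \<cdot>\<^sub>m 1\<^sub>m n"
    by (rule adj_mat_factor[OF pmat_carrier n f(1)])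
  have iff: "k \<le> order x (pdet n L) - b \<longleftrightarrow> k \<le> hd ns" if "1 \<le> k" for k
    using chains_1_iff[OF pmat_carrier f(1) K ba e(2) MK, of k] head_partial_mults[OF L pm that] ne by simp
  have m: "order x (pdet n L) - b = hd ns"
    using iff[of "hd ns"] iff[of "order x (pdet n L) - b"] hd1 by linarith
  have o: "order x (pdet n L) = b + hd ns" using m ba by simp
  have "sum_list (tl ns) = b" using o f(2) ne by (cases ns) auto
  then show ?thesis using that[OF K _ e(2) hd1 _ MK[unfolded m] KM[unfolded m] n] e(1) o by simp
qed

lemma above_rank1:
  assumes L: "L \<in> pencil_carrier n" and pm: "finite_partial_mults n L x ns"
    and L': "L' \<in> pencil_carrier n" and pm': "finite_partial_mults n L' x m"
    and eq: "pmat n L' = pmat n L + outer a b" and ab: "a \<in> carrier_vec n" "b \<in> carrier_vec n" and k: "1 \<le> k"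
  shows "above ns k \<le> above m k + 1"
proof (cases "above ns k")
  case (Suc q)
  have "chains n (Suc q) k (pmat n L) x" using finite_partial_mults_facts(3)[OF L pm k] Suc by simp
  hence "chains n q k (pmat n L') x" unfolding eq by (rule chains_add_outer[OF pmat_carrier ab])
  then show ?thesis using finite_partial_mults_facts(3)[OF L' pm' k] Suc by simp
qed simp

lemma nonzero_mat_entry:
  assumes "N \<in> carrier_mat n m" "N \<noteq> 0\<^sub>m n m" obtains i j where "i < n" "j < m" "N $$ (i, j) \<noteq> 0"
proof -
  have "\<exists>i j. i < n \<and> j < m \<and> N $$ (i, j) \<noteq> 0"
  proof (rule ccontr)
    assume "\<not> ?thesis"
    hence "N = 0\<^sub>m n m" using assms(1) by (intro eq_matI) auto
    with assms(2) show False by simp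
  qed
  then show ?thesis using that by blast
qed

lemma generically_mult_entry:
  assumes N: "(N :: complex mat) \<in> carrier_mat n n" and i: "i < n" and j: "j < n" and z: "N $$ (i, j) \<noteq> 0"
  shows "generically n (\<lambda>u. (\<Sum>l = 0..<n. N $$ (i, l) * u $ l) \<noteq> 0)"
proof (rule generically_polynomial[of _ _ "unit_vec n j"])
  show "polynomial_function n (\<lambda>u. \<Sum>l = 0..<n. N $$ (i, l) * u $ l)"
    by (intro polynomial_function_sum polynomial_function_mult polynomial_function_const polynomial_function_coord) auto
  have "(\<Sum>l = 0..<n. N $$ (i, l) * unit_vec n j $ l) = (\<Sum>l = 0..<n. if l = j then N $$ (i, l) else 0)"
    by (rule sum.cong) (use j in auto)
  then show "(\<Sum>l = 0..<n. N $$ (i, l) * unit_vec n j $ l) \<noteq> 0" using j z by simp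
qed simp

lemma quad_smult: "N \<in> carrier_mat n n \<Longrightarrow> u \<in> carrier_vec n \<Longrightarrow> quad N (t \<cdot>\<^sub>v u) = t * t * quad N u"
  by (auto simp: quad_def sum_distrib_left intro!: sum.cong)

text \<open>If the leading coefficient of the inverse is skew-symmetric, the largest multiplicity \<open>m\<close> occurs
  twice, and the vanishing of the quadratic form leaves a pole of order \<open>m - 1\<close> instead of \<open>m\<close>; the
  displayed chain then shows that the lost multiplicity reappears at the first entry.\<close>

lemma additive_step:
  assumes L: "L \<in> pencil_carrier n" and s: "has_structure st L" and reg: "pencil_regular L"
    and pm: "finite_partial_mults n L x ns" and ne: "ns \<noteq> []" and x: "x \<noteq> - ssign st"
  obtains u m where "u \<in> carrier_vec n" "pencil_regular (pencil_add L (rank1 st u))"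
    "finite_partial_mults n (pencil_add L (rank1 st u)) x m"
    "m = tl ns \<or> m = bump (tl ns) \<and> hd ns \<le> entry ns 1 \<and> x = ssign st"
proof -
  note main = that
  note f = finite_partial_mults_facts[OF L pm]
  obtain b K e where K: "K \<in> carrier_mat n n" "adj_mat (pmat n L) = lin x ^ b \<cdot>\<^sub>m K" "ev_mat K x \<noteq> 0\<^sub>m n n"
    and e: "pdet n L = lin x ^ (b + hd ns) * e" "poly e x \<noteq> 0" and m1: "1 \<le> hd ns" and tlb: "sum_list (tl ns) = b"
    and MK: "pmat n L * K = (lin x ^ hd ns * e) \<cdot>\<^sub>m 1\<^sub>m n" and KM: "K * pmat n L = (lin x ^ hd ns * e) \<cdot>\<^sub>m 1\<^sub>m n"
    and n: "0 < n"
    by (rule pole_data[OF L pm ne])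
  let ?m = "hd ns" let ?w = "omega st"
  define K0 where "K0 = ev_mat K x"
  define K1 where "K1 = ev_mat (map_mat pderiv K) x"
  have K01: "K0 \<in> carrier_mat n n" "K1 \<in> carrier_mat n n" using K by (auto simp: K0_def K1_def)
  have wx: "poly ?w x \<noteq> 0" using x omega_zero_iff by metis
  define g where "g u = lin x ^ ?m * e + ?w * pquad K u" for u
  have det': "pdet n (pencil_add L (rank1 st u)) = lin x ^ b * g u" if u: "u \<in> carrier_vec n" for u
  proof -
    have "pdet n (pencil_add L (rank1 st u)) = pdet n L + liftv u \<bullet> (adj_mat (pmat n L) *\<^sub>v (?w \<cdot>\<^sub>v liftv u))"
      unfolding pmat_add_rank1[OF L u] by (rule det_add_outer[OF pmat_carrier _ _ f(1)]) (use u in auto)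
    also have "\<dots> = pdet n L + ?w * lin x ^ b * pquad K u"
      unfolding scalar_prod_pquad[OF K(2,1) u] ..
    finally show ?thesis unfolding e(1) g_def by (simp add: power_add algebra_simps)
  qed
  have step: "thesis" if u: "u \<in> carrier_vec n" and nz: "g u \<noteq> 0" and
    res: "\<And>m. finite_partial_mults n (pencil_add L (rank1 st u)) x m \<Longrightarrow> (\<And>i. entry (tl ns) i \<le> entry m i) \<Longrightarrow> 0 \<notin> set m \<Longrightarrow>
      sum_list m = order x (lin x ^ b * g u) \<Longrightarrow>
       m = tl ns \<or> m = bump (tl ns) \<and> hd ns \<le> entry ns 1 \<and> x = ssign st" for u
  proof -
    let ?L' = "pencil_add L (rank1 st u)"
    have L': "?L' \<in> pencil_carrier n" using L u by simp
    have reg': "pencil_regular ?L'" unfolding pencil_regular_iff[OF L'] det'[OF u] using nz by simp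
    obtain m where m: "finite_partial_mults n ?L' x m" using finite_partial_mults_exists[OF L' reg'] by blast
    note f' = finite_partial_mults_facts[OF L' m]
    have ab: "above ns k \<le> above m k + 1" if "1 \<le> k" for k
      by (rule above_rank1[OF L pm L' m pmat_add_rank1[OF L u] _ _ that]) (use u in auto)
    have "entry (tl ns) i \<le> entry m i" for i
      using entry_le_of_above[OF f(4) f'(4) ab, of i] by (simp add: entry_tl)
    then show thesis using main[OF u reg' m] res[OF m] f'(2,5) det'[OF u] by simp
  qed
  show thesis
  proof (cases "\<exists>u \<in> carrier_vec n. quad K0 u \<noteq> 0")
    case True
    then obtain u where u: "u \<in> carrier_vec n" "quad K0 u \<noteq> 0" by blast
    have gx: "poly (g u) x \<noteq> 0" using u wx m1 by (simp add: g_def poly_pquad K0_def power_0_left)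
    have "order x (lin x ^ b * g u) = b" by (rule order_eq_iff[OF refl gx])
    then show thesis
      using dominating_list_eq[of "tl ns"] tlb f(5) ne gx
      by (intro step[OF u(1)]) (auto dest: list.set_sel(2)[OF ne])
  next
    case False
    hence skew: "quad (ev_mat K x) u = 0" if "u \<in> carrier_vec n" for u using that by (auto simp: K0_def)
    note sl = skew_leading_coefficient[OF L s reg K(1) m1 K(3) e(2) MK KM skew]
    have xc: "x = ssign st"
    proof -
      have "(x - ssign st) * (x + ssign st) = 0" using sl(1) by (simp add: algebra_simps)
      then show ?thesis using x by (auto simp: eq_neg_iff_add_eq_0)
    qed
    have K0nz: "K0 \<noteq> 0\<^sub>m n n" using K(3) by (simp add: K0_def)
    obtain i j where ij: "i < n" "j < n" "K0 $$ (i, j) \<noteq> 0" by (rule nonzero_mat_entry[OF K01(1) K0nz])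
    note gi = generically_mult_entry[OF K01(1) ij]
    have "\<exists>u \<in> carrier_vec n. (\<Sum>l = 0..<n. K0 $$ (i, l) * u $ l) \<noteq> 0 \<and>
        (if ?m = 1 then poly e x else 0) + poly ?w x * quad K1 u \<noteq> 0"
    proof (cases "?m = 1")
      case True
      obtain u where u: "u \<in> carrier_vec n" "(\<Sum>l = 0..<n. K0 $$ (i, l) * u $ l) \<noteq> 0" by (rule generically_ex[OF gi])
      have fin: "finite {t. poly [:poly e x, 0, poly ?w x * quad K1 u:] t = 0}"
        by (rule poly_roots_finite) (use e(2) in simp)
      obtain t where t: "t \<notin> insert 0 {t. poly [:poly e x, 0, poly ?w x * quad K1 u:] t = 0}"
        using cofinite_ne_infinite[of "insert 0 {t. poly [:poly e x, 0, poly ?w x * quad K1 u:] t = 0}"] fin by blast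
      have "(\<Sum>l = 0..<n. K0 $$ (i, l) * (t \<cdot>\<^sub>v u) $ l) = t * (\<Sum>l = 0..<n. K0 $$ (i, l) * u $ l)"
        unfolding sum_distrib_left by (rule sum.cong) (use u in auto)
      moreover have "poly e x + poly ?w x * quad K1 (t \<cdot>\<^sub>v u) \<noteq> 0"
        unfolding quad_smult[OF K01(2) u(1)] using t by (simp add: algebra_simps)
      ultimately show ?thesis using u t True by (intro bexI[of _ "t \<cdot>\<^sub>v u"]) auto
    next
      case m: False
      then obtain u1 where u1: "u1 \<in> carrier_vec n" "quad K1 u1 \<noteq> 0" using sl(2) m1 by (auto simp: K1_def)
      have "generically n (\<lambda>u. quad K1 u \<noteq> 0)"
        by (rule generically_polynomial[OF polynomial_function_quad[OF K01(2)] u1])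
      from generically_conj[OF gi this] show ?thesis using m wx
        by (elim generically_ex) (auto intro!: bexI)
    qed
    then obtain u where u: "u \<in> carrier_vec n" and Ku: "(\<Sum>l = 0..<n. K0 $$ (i, l) * u $ l) \<noteq> 0"
      and der: "(if ?m = 1 then poly e x else 0) + poly ?w x * quad K1 u \<noteq> 0" by blast
    have px: "poly (pquad K u) x = 0" using skew[OF u] by (simp add: poly_pquad)
    hence "poly (g u) x = 0" using m1 by (simp add: g_def power_0_left)
    then obtain g1 where g1: "g u = lin x * g1" using lin_dvd_iff by (metis dvdE)
    have "poly g1 x = poly (pderiv (g u)) x"
      unfolding g1 pderiv_mult by (simp add: lin_def pderiv_pCons)
    also have "\<dots> = (if ?m = 1 then poly e x else 0) + poly ?w x * quad K1 u"
    proof -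
      obtain k where k: "?m = Suc k" using m1 by (cases ?m) auto
      have "pderiv (lin x) = 1" by (simp add: lin_def pderiv_pCons)
      hence "poly (pderiv (lin x ^ ?m * e)) x = (if ?m = 1 then poly e x else 0)" unfolding k
        by (cases k) (simp_all only: pderiv_mult pderiv_power_Suc poly_add poly_mult poly_power poly_lin poly_smult, auto)
      then show ?thesis unfolding g_def pderiv_add pderiv_mult poly_add poly_mult
        using px by (simp add: poly_pderiv_pquad K1_def)
    qed
    finally have g1x: "poly g1 x \<noteq> 0" using der by simp
    have ord: "order x (lin x ^ b * g u) = Suc b"
      by (rule order_eq_iff[OF _ g1x]) (simp add: g1)
    show thesis
    proof (rule step[OF u])
      show "g u \<noteq> 0" using g1 g1x by auto
      fix m assume m: "finite_partial_mults n (pencil_add L (rank1 st u)) x m"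
        and dom: "\<And>i. entry (tl ns) i \<le> entry m i" and m0: "0 \<notin> set m" and sm: "sum_list m = order x (lin x ^ b * g u)"
      let ?L' = "pencil_add L (rank1 st u)"
      have L': "?L' \<in> pencil_carrier n" using L u by simp
      \<comment> \<open>The combination of the columns \<open>K e\<^sub>i\<close> and \<open>K u\<close> that annihilates the functional \<open>u\<close> up to \<open>lin x ^ hd ns\<close>; as \<open>g u\<close> vanishes at \<open>x\<close>, the chain gains one step.\<close>
      define M where "M = pmat n L"
      define us where "us l = [:u $ l:]" for l
      define w where "w = ?w"
      define P where "P = pquad K u"
      define r where "r = (\<Sum>l = 0..<n. us l * K $$ (l, i))"
      define y where "y = vec n (\<lambda>k. g u * K $$ (k, i) - w * r * (\<Sum>l = 0..<n. K $$ (k, l) * us l))"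
      define h where "h = lin x ^ ?m * e"
      have y: "y \<in> carrier_vec n" by (simp add: y_def)
      have yi: "y $ k = g u * K $$ (k, i) - w * r * (\<Sum>l = 0..<n. K $$ (k, l) * us l)" if "k < n" for k
        using that by (simp add: y_def)
      have gh: "g u = h + w * P" by (simp add: g_def h_def w_def P_def)
      have M': "pmat n ?L' \<in> carrier_mat n n" by simp
      have MKe: "(\<Sum>l = 0..<n. M $$ (k, l) * K $$ (l, j)) = (if k = j then h else 0)" if "k < n" "j < n" for k j
      proof -
        have "(M * K) $$ (k, j) = (if k = j then h else 0)" unfolding M_def MK h_def using that by simp
        then show ?thesis unfolding M_def mult_mat_entry[OF pmat_carrier K(1) that] .
      qed
      have dv: "lin x ^ Suc ?m dvd (pmat n ?L' *\<^sub>v y) $ k" if k: "k < n" for k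
      proof -
        have pmi: "pmat n ?L' $$ (k, l) = M $$ (k, l) + w * us k * us l" if "l < n" for l
          unfolding pmat_add_rank1[OF L u] M_def us_def w_def using u k that by (simp del: pmat_index)
        have sM: "(\<Sum>l = 0..<n. M $$ (k, l) * y $ l) = (if k = i then g u * h else 0) - w * r * us k * h"
        proof -
          have "(\<Sum>l = 0..<n. M $$ (k, l) * y $ l) =
            (\<Sum>l = 0..<n. g u * (M $$ (k, l) * K $$ (l, i)) - (\<Sum>l' = 0..<n. w * r * us l' * (M $$ (k, l) * K $$ (l, l'))))"
            by (rule sum.cong[OF refl]) (simp add: yi right_diff_distrib sum_distrib_left ac_simps)
          also have "\<dots> = g u * (\<Sum>l = 0..<n. M $$ (k, l) * K $$ (l, i)) -
            (\<Sum>l = 0..<n. \<Sum>l' = 0..<n. w * r * us l' * (M $$ (k, l) * K $$ (l, l')))"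
            unfolding sum_subtractf sum_distrib_left ..
          also have "(\<Sum>l = 0..<n. \<Sum>l' = 0..<n. w * r * us l' * (M $$ (k, l) * K $$ (l, l'))) =
            (\<Sum>l' = 0..<n. w * r * us l' * (\<Sum>l = 0..<n. M $$ (k, l) * K $$ (l, l')))"
            unfolding sum_distrib_left by (rule sum.swap)
          also have "(\<Sum>l' = 0..<n. w * r * us l' * (\<Sum>l = 0..<n. M $$ (k, l) * K $$ (l, l'))) =
             (\<Sum>l' = 0..<n. if l' = k then w * r * us l' * h else 0)"
            by (rule sum.cong[OF refl]) (auto simp: MKe[OF k])
          finally show ?thesis using k by (simp add: MKe[OF k ij(1)])
        qed
        have su: "(\<Sum>l = 0..<n. us l * y $ l) = g u * r - w * r * P"
        proof -
          have "(\<Sum>l = 0..<n. us l * y $ l) = (\<Sum>l = 0..<n. g u * (us l * K $$ (l, i)) - w * r * (\<Sum>l' = 0..<n. us l * K $$ (l, l') * us l'))"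
            by (rule sum.cong[OF refl]) (simp add: yi right_diff_distrib sum_distrib_left ac_simps)
          also have "\<dots> = g u * r - w * r * (\<Sum>l = 0..<n. \<Sum>l' = 0..<n. us l * K $$ (l, l') * us l')"
            unfolding sum_subtractf r_def sum_distrib_left ..
          also have "(\<Sum>l = 0..<n. \<Sum>l' = 0..<n. us l * K $$ (l, l') * us l') = P"
            using K(1) unfolding P_def pquad_def us_def by simp
          finally show ?thesis .
        qed
        have "(pmat n ?L' *\<^sub>v y) $ k = (\<Sum>l = 0..<n. pmat n ?L' $$ (k, l) * y $ l)" by (rule mult_mat_vec_entry[OF M' y k])
        also have "\<dots> = (\<Sum>l = 0..<n. M $$ (k, l) * y $ l + w * us k * (us l * y $ l))"
          by (rule sum.cong[OF refl]) (simp only: pmi atLeastLessThan_iff distrib_right mult.assoc)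
        also have "\<dots> = (if k = i then g u * h else 0) - w * r * us k * h + w * us k * (g u * r - w * r * P)"
          unfolding sum.distrib sM sum_distrib_left[symmetric] su ..
        also have "\<dots> = (if k = i then g u * h else 0)"
          unfolding gh by (simp add: algebra_simps)
        finally have "(pmat n ?L' *\<^sub>v y) $ k = (if k = i then g u * h else 0)" .
        moreover have "g u * h = lin x ^ Suc ?m * (g1 * e)" unfolding g1 h_def by (simp only: power_Suc ac_simps)
        ultimately show ?thesis by simp
      qed
      have K0sk: "K0 $$ (l, i) = - K0 $$ (i, l)" if "l < n" for l
        using quad_zero_skew[OF K01(1) _ ij(1) that] skew by (simp add: K0_def)
      have r0: "poly r x = - (\<Sum>l = 0..<n. K0 $$ (i, l) * u $ l)"
      proof -
        have "poly r x = (\<Sum>l = 0..<n. u $ l * K0 $$ (l, i))" using K(1) ij by (simp add: r_def us_def poly_sum K0_def)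
        then show ?thesis by (simp add: K0sk sum_negf mult.commute)
      qed
      have "poly (y $ i) x = - (poly ?w x * (poly r x * (\<Sum>l = 0..<n. K0 $$ (i, l) * u $ l)))"
        using ij K(1) g1 by (simp add: yi us_def w_def poly_sum K0_def mult.commute[of _ "u $ _"] mult.assoc del: poly_omega)
      hence "poly (y $ i) x \<noteq> 0" using r0 Ku wx by (simp del: poly_omega)
      hence "chains n 1 (Suc ?m) (pmat n ?L') x" by (intro chain_single[OF M' y dv ij(1)])
      hence hm: "m \<noteq> []" "Suc ?m \<le> hd m" using head_partial_mults[OF L' m, of "Suc ?m"] by auto
      hence em: "Suc ?m \<le> entry m 0" by (cases m) auto
      have et: "entry (tl ns) 0 = entry ns 1" using ne by (cases ns) auto
      have "entry ns 1 \<le> ?m" using f(4) ne by (cases ns; cases "tl ns") (auto simp: entry_def)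
      hence "m = bump (tl ns)"
        using em et sm ord tlb m0 f(5) dom by (intro dominating_list_bump) (auto dest: list.set_sel(2)[OF ne])
      moreover from this have "?m \<le> entry ns 1" using em et by (simp add: entry_bump)
      ultimately show "m = tl ns \<or> m = bump (tl ns) \<and> hd ns \<le> entry ns 1 \<and> x = ssign st" using xc by simp
    qed
  qed
qed

section \<open>Compression to a hyperplane\<close>

definition congruence :: "complex mat \<Rightarrow> pencil \<Rightarrow> pencil" where
  "congruence X L = (X\<^sup>T * fst L * X, X\<^sup>T * snd L * X)"

definition leading :: "nat \<Rightarrow> pencil \<Rightarrow> pencil" where
  "leading k L = (mat k k (\<lambda>ij. fst L $$ ij), mat k k (\<lambda>ij. snd L $$ ij))"

lemma congruence_carrier [simp]:
  "X \<in> carrier_mat n n \<Longrightarrow> L \<in> pencil_carrier n \<Longrightarrow> congruence X L \<in> pencil_carrier n"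
  by (auto simp: congruence_def pencil_carrier_def intro!: mult_carrier_mat[of _ n n])

lemma leading_carrier [simp]: "leading k L \<in> pencil_carrier k"
  by (simp add: leading_def pencil_carrier_def)

lemma structure_leading:
  assumes "L \<in> pencil_carrier n" "has_structure st L" "k \<le> n"
  shows "has_structure st (leading k L)"
  by (rule structureI[OF leading_carrier]) (use structure_index[OF assms(1,2)] assms(3) in \<open>auto simp: leading_def\<close>)

lemma congruence_entry:
  assumes X: "X \<in> carrier_mat n n" and A: "A \<in> carrier_mat n n" and ij: "i < n" "j < n"
  shows "(X\<^sup>T * A * X) $$ (i, j) = (\<Sum>l = 0..<n. \<Sum>k = 0..<n. X $$ (k, i) * A $$ (k, l) * X $$ (l, j))"
proof -
  have Xt: "X\<^sup>T \<in> carrier_mat n n" using X by simp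
  have "(X\<^sup>T * A * X) $$ (i, j) = (\<Sum>l = 0..<n. (X\<^sup>T * A) $$ (i, l) * X $$ (l, j))"
    by (rule mult_mat_entry[OF mult_carrier_mat[OF Xt A] X ij])
  also have "\<dots> = (\<Sum>l = 0..<n. \<Sum>k = 0..<n. X $$ (k, i) * A $$ (k, l) * X $$ (l, j))"
  proof (rule sum.cong[OF refl])
    fix l assume "l \<in> {0..<n}"
    hence l: "l < n" by simp
    show "(X\<^sup>T * A) $$ (i, l) * X $$ (l, j) = (\<Sum>k = 0..<n. X $$ (k, i) * A $$ (k, l) * X $$ (l, j))"
      unfolding mult_mat_entry[OF Xt A ij(1) l] sum_distrib_right
      by (rule sum.cong[OF refl]) (use X ij in simp)
  qed
  finally show ?thesis .
qed

lemma structure_congruence: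
  assumes L: "L \<in> pencil_carrier n" and s: "has_structure st L" and X: "X \<in> carrier_mat n n"
  shows "has_structure st (congruence X L)"
proof (rule structureI[OF congruence_carrier[OF X L]])
  have c: "fst L \<in> carrier_mat n n" "snd L \<in> carrier_mat n n" using L by (auto simp: pencil_carrier_def)
  fix i j assume ij: "i < n" "j < n"
  have "(X\<^sup>T * fst L * X) $$ (j, i) = (\<Sum>l = 0..<n. \<Sum>k = 0..<n. X $$ (k, j) * fst L $$ (k, l) * X $$ (l, i))"
    by (rule congruence_entry[OF X c(1) ij(2,1)])
  also have "\<dots> = (\<Sum>k = 0..<n. \<Sum>l = 0..<n. X $$ (k, j) * fst L $$ (k, l) * X $$ (l, i))"
    by (rule sum.swap)
  also have "\<dots> = (\<Sum>k = 0..<n. \<Sum>l = 0..<n. ssign st * (X $$ (l, i) * snd L $$ (l, k) * X $$ (k, j)))"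
  proof (intro sum.cong refl)
    fix k l assume "k \<in> {0..<n}" "l \<in> {0..<n}"
    then show "X $$ (k, j) * fst L $$ (k, l) * X $$ (l, i) = ssign st * (X $$ (l, i) * snd L $$ (l, k) * X $$ (k, j))"
      using structure_index(1)[OF L s, of l k] by simp
  qed
  also have "\<dots> = ssign st * (X\<^sup>T * snd L * X) $$ (i, j)"
    unfolding congruence_entry[OF X c(2) ij] sum_distrib_left ..
  finally show "fst (congruence X L) $$ (j, i) = ssign st * snd (congruence X L) $$ (i, j)"
    unfolding congruence_def fst_conv snd_conv .
qed

lemma invertible_matI:
  "A \<in> carrier_mat n n \<Longrightarrow> B \<in> carrier_mat n n \<Longrightarrow> A * B = 1\<^sub>m n \<Longrightarrow> B * A = 1\<^sub>m n \<Longrightarrow> invertible_mat A"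
  unfolding invertible_mat_def inverts_mat_def by auto

lemma invertible_matE:
  assumes X: "X \<in> carrier_mat n n" and i: "invertible_mat X"
  obtains X' where "X' \<in> carrier_mat n n" "X * X' = 1\<^sub>m n" "X' * X = 1\<^sub>m n"
proof -
  from i obtain X' where X': "X * X' = 1\<^sub>m (dim_row X)" "X' * X = 1\<^sub>m (dim_row X')"
    unfolding invertible_mat_def inverts_mat_def by (elim conjE exE)
  have "dim_col X' = n" using arg_cong[OF X'(1), of dim_col] X by simp
  moreover have "dim_row X' = n" using arg_cong[OF X'(2), of dim_col] X by simp
  ultimately have "X' \<in> carrier_mat n n" by auto
  then show ?thesis using that X' X by auto
qed

lemma transpose_inverse:
  assumes "X \<in> carrier_mat n n" "Z \<in> carrier_mat n n" "X * Z = 1\<^sub>m n"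
  shows "Z\<^sup>T * X\<^sup>T = (1\<^sub>m n :: 'a :: comm_semiring_1 mat)"
  using transpose_mult[OF assms(1,2)] assms(3) by simp

lemma finite_partial_mults_congruence:
  assumes L: "L \<in> pencil_carrier n" and X: "X \<in> carrier_mat n n" and Z: "Z \<in> carrier_mat n n"
    and XZ: "X * Z = 1\<^sub>m n" "Z * X = 1\<^sub>m n" and pm: "finite_partial_mults n L x ns"
  shows "finite_partial_mults n (congruence X L) x ns"
proof -
  have c: "fst L \<in> carrier_mat n n" "snd L \<in> carrier_mat n n" using L by (auto simp: pencil_carrier_def)
  have T: "X\<^sup>T \<in> carrier_mat n n" "Z\<^sup>T \<in> carrier_mat n n" using X Z by auto
  have TT: "Z\<^sup>T * X\<^sup>T = 1\<^sub>m n" "X\<^sup>T * Z\<^sup>T = 1\<^sub>m n" using transpose_inverse[OF X Z XZ(1)] transpose_inverse[OF Z X XZ(2)] by auto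
  have "weierstrass_form n (congruence X L) fs ks" if w: "weierstrass_form n L fs ks" for fs ks
  proof -
    from w obtain P Q where PQ: "P \<in> carrier_mat n n" "Q \<in> carrier_mat n n" "invertible_mat P" "invertible_mat Q"
      and f0: "0 \<notin> set (map fst fs)" "0 \<notin> set ks"
      and eq: "let J = jordan_matrix fs; N = jordan_matrix (map (\<lambda>k. (k, 0)) ks); p = dim_row J; q = dim_row N
        in P * fst L * Q = - four_block_mat J (0\<^sub>m p q) (0\<^sub>m q p) (1\<^sub>m q) \<and>
           P * snd L * Q = four_block_mat (1\<^sub>m p) (0\<^sub>m p q) (0\<^sub>m q p) N"
      unfolding weierstrass_form_def by (elim conjE bexE)
    obtain P' where P': "P' \<in> carrier_mat n n" "P * P' = 1\<^sub>m n" "P' * P = 1\<^sub>m n" by (rule invertible_matE[OF PQ(1,3)])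
    obtain Q' where Q': "Q' \<in> carrier_mat n n" "Q * Q' = 1\<^sub>m n" "Q' * Q = 1\<^sub>m n" by (rule invertible_matE[OF PQ(2,4)])
    define P1 where "P1 = P * Z\<^sup>T"
    define Q1 where "Q1 = Z * Q"
    have P1: "P1 \<in> carrier_mat n n" "Q1 \<in> carrier_mat n n" using PQ T Z by (auto simp: P1_def Q1_def)
    have e: "P1 * (X\<^sup>T * A * X) * Q1 = P * A * Q" if A: "A \<in> carrier_mat n n" for A
    proof -
      have "P1 * (X\<^sup>T * A * X) * Q1 = (P1 * X\<^sup>T) * A * (X * Q1)" by (rule mult5_assoc[OF P1(1) T(1) A X P1(2)])
      also have "P1 * X\<^sup>T = P" unfolding P1_def using assoc_mult_mat[OF PQ(1) T(2,1)] TT(1) PQ(1) by simp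
      also have "X * Q1 = Q" unfolding Q1_def using assoc_mult_mat[OF X Z PQ(2)] XZ(1) PQ(2) by simp
      finally show ?thesis .
    qed
    have "invertible_mat P1"
      by (rule invertible_matI[OF P1(1) mult_carrier_mat[OF T(1) P'(1)]])
        (unfold P1_def, (rule inverse_mult; use PQ P' T TT in simp)+)
    moreover have "invertible_mat Q1"
      by (rule invertible_matI[OF P1(2) mult_carrier_mat[OF Q'(1) X]])
        (unfold Q1_def, (rule inverse_mult; use PQ Q' X Z XZ in simp)+)
    ultimately show ?thesis unfolding weierstrass_form_def congruence_def fst_conv snd_conv
      using P1 f0 eq unfolding e[OF c(1), symmetric] e[OF c(2), symmetric] by blast
  qed
  then show ?thesis using pm unfolding finite_partial_mults_def by blast
qed

lemma adj_mat_congruence: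
  assumes L: "L \<in> pencil_carrier n" and X: "X \<in> carrier_mat n n" and Z: "Z \<in> carrier_mat n n"
    and XZ: "X * Z = 1\<^sub>m n" "Z * X = 1\<^sub>m n" and d: "pdet n L \<noteq> 0"
    and K: "K \<in> carrier_mat n n" and adj: "adj_mat (pmat n L) = lin x ^ b \<cdot>\<^sub>m K"
  defines "K' \<equiv> mat n n (\<lambda>(i, j). \<Sum>k = 0..<n. \<Sum>l = 0..<n. [:det X ^ 2 * Z $$ (i, k) * Z $$ (j, l):] * K $$ (k, l))"
  shows "adj_mat (pmat n (congruence X L)) = lin x ^ b \<cdot>\<^sub>m K'"
proof -
  let ?M = "pmat n L" and ?N = "pmat n (congruence X L)"
  have T: "X\<^sup>T \<in> carrier_mat n n" "Z\<^sup>T \<in> carrier_mat n n" using X Z by auto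
  have lf: "lift X \<in> carrier_mat n n" "lift Z \<in> carrier_mat n n" "lift (X\<^sup>T) \<in> carrier_mat n n" "lift (Z\<^sup>T) \<in> carrier_mat n n"
    using X Z by auto
  have N: "?N = lift (X\<^sup>T) * ?M * lift X" unfolding congruence_def by (rule pmat_equiv[OF L T(1) X, symmetric])
  note am = adj_mat[OF pmat_carrier, of n L]
  have dN: "det ?N = [:det X ^ 2:] * pdet n L"
    unfolding N using det_mult[of "lift (X\<^sup>T) * ?M" n "lift X"] det_mult[of "lift (X\<^sup>T)" n ?M] lf
    by (simp add: det_lift det_transpose[OF X] power2_eq_square)
  have dX: "det X \<noteq> 0" using det_mult[OF X Z] XZ(1) by auto
  let ?U = "lift Z * adj_mat ?M * lift (Z\<^sup>T)"
  let ?Y = "[:det X ^ 2:] \<cdot>\<^sub>m ?U"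
  have Y0: "?U \<in> carrier_mat n n" by (intro mult_carrier_mat[of _ n n] lf am)
  have "?N * ?U = lift (X\<^sup>T) * ?M * lift X * (lift Z * (adj_mat ?M * lift (Z\<^sup>T)))"
    unfolding N using assoc_mult_mat[OF lf(2) am(1) lf(4)] by simp
  also have "\<dots> = lift (X\<^sup>T) * ?M * (lift X * (lift Z * (adj_mat ?M * lift (Z\<^sup>T))))"
    by (rule assoc_mult_mat[of _ n n _ n _ n]) (intro mult_carrier_mat[of _ n n] lf am pmat_carrier)+
  also have "lift X * (lift Z * (adj_mat ?M * lift (Z\<^sup>T))) = (lift X * lift Z) * (adj_mat ?M * lift (Z\<^sup>T))"
    by (rule assoc_mult_mat[of _ n n _ n _ n, symmetric]) (intro mult_carrier_mat[of _ n n] lf am)+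
  also have "lift X * lift Z = 1\<^sub>m n" using lift_mult[OF X Z] XZ(1) by simp
  also have "1\<^sub>m n * (adj_mat ?M * lift (Z\<^sup>T)) = adj_mat ?M * lift (Z\<^sup>T)"
    by (rule left_mult_one_mat[of _ n n]) (intro mult_carrier_mat[of _ n n] lf am)
  also have "lift (X\<^sup>T) * ?M * (adj_mat ?M * lift (Z\<^sup>T)) = lift (X\<^sup>T) * (?M * (adj_mat ?M * lift (Z\<^sup>T)))"
    by (rule assoc_mult_mat[of _ n n _ n _ n]) (intro mult_carrier_mat[of _ n n] lf am pmat_carrier)+
  also have "?M * (adj_mat ?M * lift (Z\<^sup>T)) = (?M * adj_mat ?M) * lift (Z\<^sup>T)"
    by (rule assoc_mult_mat[of _ n n _ n _ n, symmetric]) (intro lf am pmat_carrier)+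
  also have "\<dots> = pdet n L \<cdot>\<^sub>m lift (Z\<^sup>T)" unfolding am(2) using mult_smult_assoc_mat[OF one_carrier_mat lf(4)] lf(4) by simp
  also have "lift (X\<^sup>T) * (pdet n L \<cdot>\<^sub>m lift (Z\<^sup>T)) = pdet n L \<cdot>\<^sub>m (lift (X\<^sup>T) * lift (Z\<^sup>T))"
    by (rule mult_smult_distrib[OF lf(3,4)])
  also have "lift (X\<^sup>T) * lift (Z\<^sup>T) = 1\<^sub>m n" using lift_mult[OF T] transpose_inverse[OF Z X XZ(2)] by simp
  finally have NY0: "?N * ?U = pdet n L \<cdot>\<^sub>m 1\<^sub>m n" .
  have "?N * ?Y = [:det X ^ 2:] \<cdot>\<^sub>m (?N * ?U)" by (rule mult_smult_distrib[OF pmat_carrier Y0])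
  also have "\<dots> = det ?N \<cdot>\<^sub>m 1\<^sub>m n" unfolding NY0 dN by (intro eq_matI) auto
  finally have "adj_mat ?N = ?Y"
    using dX d Y0 by (intro adj_mat_det_cancel[OF pmat_carrier]) (auto simp: dN)
  also have "\<dots> = lin x ^ b \<cdot>\<^sub>m K'"
  proof (rule eq_matI)
    fix i j assume "i < dim_row (lin x ^ b \<cdot>\<^sub>m K')" "j < dim_col (lin x ^ b \<cdot>\<^sub>m K')"
    hence ij: "i < n" "j < n" by (auto simp: K'_def)
    have "?U $$ (i, j) = (\<Sum>l = 0..<n. (lift Z * adj_mat ?M) $$ (i, l) * lift (Z\<^sup>T) $$ (l, j))"
      by (rule mult_mat_entry[OF mult_carrier_mat[OF lf(2) am(1)] lf(4) ij])
    also have "\<dots> = (\<Sum>l = 0..<n. \<Sum>k = 0..<n. lin x ^ b * ([:Z $$ (i, k) * Z $$ (j, l):] * K $$ (k, l)))"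
    proof (rule sum.cong[OF refl])
      fix l assume "l \<in> {0..<n}"
      hence l: "l < n" by simp
      show "(lift Z * adj_mat ?M) $$ (i, l) * lift (Z\<^sup>T) $$ (l, j) =
        (\<Sum>k = 0..<n. lin x ^ b * ([:Z $$ (i, k) * Z $$ (j, l):] * K $$ (k, l)))"
        unfolding mult_mat_entry[OF lf(2) am(1) ij(1) l] sum_distrib_right
      proof (rule sum.cong[OF refl])
        fix k assume "k \<in> {0..<n}"
        then have "adj_mat ?M $$ (k, l) = lin x ^ b * K $$ (k, l)" unfolding adj using K l by simp
        then show "lift Z $$ (i, k) * adj_mat ?M $$ (k, l) * lift (Z\<^sup>T) $$ (l, j) =
            lin x ^ b * ([:Z $$ (i, k) * Z $$ (j, l):] * K $$ (k, l))"
          using Z ij l \<open>k \<in> {0..<n}\<close> by (simp add: ac_simps)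
      qed
    qed
    also have "\<dots> = (\<Sum>k = 0..<n. \<Sum>l = 0..<n. lin x ^ b * ([:Z $$ (i, k) * Z $$ (j, l):] * K $$ (k, l)))" by (rule sum.swap)
    finally have e: "?U $$ (i, j) = (\<Sum>k = 0..<n. \<Sum>l = 0..<n. lin x ^ b * ([:Z $$ (i, k) * Z $$ (j, l):] * K $$ (k, l)))" .
    have "?Y $$ (i, j) = [:det X ^ 2:] * ?U $$ (i, j)"
      by (rule index_smult_mat(1)) (use ij Z in auto)
    also have "\<dots> = lin x ^ b * K' $$ (i, j)"
      unfolding e sum_distrib_left K'_def using ij by (simp add: sum_distrib_left ac_simps)
    finally show "?Y $$ (i, j) = (lin x ^ b \<cdot>\<^sub>m K') $$ (i, j)" using ij by (simp add: K'_def)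
  qed (use Z in \<open>auto simp: K'_def\<close>)
  finally show ?thesis .
qed

lemma pdet_leading: "pdet l (leading l L) = adj_mat (pmat (Suc l) L) $$ (l, l)"
proof -
  have "mat_delete (pmat (Suc l) L) l l = pmat l (leading l L)"
    by (rule eq_matI) (auto simp: mat_delete_def leading_def)
  then show ?thesis by (simp add: adj_mat_def cofactor_def)
qed

text \<open>Replacing the last column by a unit vector is a perturbation of rank one, which destroys at most one chain; what
remains are chains of the leading block.\<close>

lemma chains_leading:
  assumes L: "L \<in> pencil_carrier (Suc l)" and c: "chains (Suc l) (Suc q) k (pmat (Suc l) L) x" and k: "1 \<le> k"
  shows "chains l q k (pmat l (leading l L)) x"
proof -
  let ?n = "Suc l" let ?M = "pmat (Suc l) L"
  define a where "a = vec ?n (\<lambda>i. (if i = l then 1 else 0) - ?M $$ (i, l))"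
  have a: "a \<in> carrier_vec ?n" by (simp add: a_def)
  have eu: "unit_vec ?n l \<in> carrier_vec ?n" by simp
  let ?N = "?M + outer a (unit_vec ?n l)"
  have N: "?N \<in> carrier_mat ?n ?n" using a by simp
  \<comment> \<open>The last column of the perturbed matrix is a unit vector, so that its chains end in chains of the leading block.\<close>
  have Ni: "?N $$ (i, j) = (if j = l then (if i = l then 1 else 0) else ?M $$ (i, j))" if "i < ?n" "j < ?n" for i j
    using that a by (auto simp: a_def unit_vec_def)
  have "chains ?n q k ?N x" by (rule chains_add_outer[OF pmat_carrier a eu c])
  then obtain Y where Y: "Y \<in> carrier_mat ?n q" "\<And>i j. i < ?n \<Longrightarrow> j < q \<Longrightarrow> lin x ^ k dvd (?N * Y) $$ (i, j)"
    and inj: "\<And>v. v \<in> carrier_vec q \<Longrightarrow> ev_mat Y x *\<^sub>v v = 0\<^sub>v ?n \<Longrightarrow> v = 0\<^sub>v q" unfolding chains_def by blast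
  have NY: "(?N * Y) $$ (i, j) = (\<Sum>h = 0..<l. ?M $$ (i, h) * Y $$ (h, j)) + (if i = l then Y $$ (l, j) else 0)"
    if ij: "i < ?n" "j < q" for i j
  proof -
    have "(?N * Y) $$ (i, j) = (\<Sum>h = 0..<?n. ?N $$ (i, h) * Y $$ (h, j))" by (rule mult_mat_entry[OF N Y(1) ij])
    also have "\<dots> = (\<Sum>h = 0..<l. ?N $$ (i, h) * Y $$ (h, j)) + ?N $$ (i, l) * Y $$ (l, j)" by simp
    also have "(\<Sum>h = 0..<l. ?N $$ (i, h) * Y $$ (h, j)) = (\<Sum>h = 0..<l. ?M $$ (i, h) * Y $$ (h, j))"
      by (rule sum.cong[OF refl]) (use Ni ij in auto)
    finally show ?thesis using Ni[of i l] ij by auto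
  qed
  define W where "W = mat l q (\<lambda>ij. Y $$ ij)"
  have W: "W \<in> carrier_mat l q" by (simp add: W_def)
  show ?thesis
  proof (rule chainsI[OF W])
    fix i j assume ij: "i < l" "j < q"
    have "(pmat l (leading l L) * W) $$ (i, j) = (\<Sum>h = 0..<l. pmat l (leading l L) $$ (i, h) * W $$ (h, j))"
      by (rule mult_mat_entry[OF pmat_carrier W ij])
    also have "\<dots> = (\<Sum>h = 0..<l. ?M $$ (i, h) * Y $$ (h, j))"
      by (rule sum.cong[OF refl]) (use ij in \<open>simp add: leading_def W_def\<close>)
    also have "\<dots> = (?N * Y) $$ (i, j)" using NY[of i j] ij by simp
    finally show "lin x ^ k dvd (pmat l (leading l L) * W) $$ (i, j)" using Y(2)[of i j] ij by simp
  next
    fix v :: "complex vec" assume v: "v \<in> carrier_vec q" and z: "ev_mat W x *\<^sub>v v = 0\<^sub>v l"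
    have Yv: "(ev_mat Y x *\<^sub>v v) $ i = (\<Sum>j = 0..<q. poly (Y $$ (i, j)) x * v $ j)" if "i < ?n" for i
      using that Y v by (simp add: scalar_prod_def)
    have first: "(\<Sum>j = 0..<q. poly (Y $$ (i, j)) x * v $ j) = 0" if i: "i < l" for i
    proof -
      have "(ev_mat W x *\<^sub>v v) $ i = (\<Sum>j = 0..<q. poly (Y $$ (i, j)) x * v $ j)"
        using i v by (simp add: W_def scalar_prod_def)
      then show ?thesis unfolding z using i by simp
    qed
    have last: "(\<Sum>j = 0..<q. poly (Y $$ (l, j)) x * v $ j) = 0"
    proof -
      have "poly (Y $$ (l, j)) x = - (\<Sum>h = 0..<l. poly (?M $$ (l, h)) x * poly (Y $$ (h, j)) x)" if j: "j < q" for j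
      proof -
        have "lin x dvd (?N * Y) $$ (l, j)" by (rule lin_power_dvdD[OF Y(2)[OF _ j] k]) simp
        hence "poly ((?N * Y) $$ (l, j)) x = 0" by (simp only: lin_dvd_iff)
        then show ?thesis unfolding NY[OF lessI j] by (simp add: poly_sum eq_neg_iff_add_eq_0 add.commute del: pmat_index)
      qed
      hence "(\<Sum>j = 0..<q. poly (Y $$ (l, j)) x * v $ j) =
        (\<Sum>j = 0..<q. \<Sum>h = 0..<l. - (poly (?M $$ (l, h)) x * (poly (Y $$ (h, j)) x * v $ j)))"
        by (intro sum.cong refl) (simp add: sum_negf[symmetric] sum_distrib_right mult.assoc del: pmat_index)
      also have "\<dots> = (\<Sum>h = 0..<l. \<Sum>j = 0..<q. - (poly (?M $$ (l, h)) x * (poly (Y $$ (h, j)) x * v $ j)))" by (rule sum.swap)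
      also have "\<dots> = (\<Sum>h = 0..<l. - (poly (?M $$ (l, h)) x * (\<Sum>j = 0..<q. poly (Y $$ (h, j)) x * v $ j)))"
        by (simp only: sum_negf sum_distrib_left)
      also have "\<dots> = 0" using first by (intro sum.neutral) auto
      finally show ?thesis .
    qed
    have "ev_mat Y x *\<^sub>v v = 0\<^sub>v ?n"
    proof (rule eq_vecI)
      fix i assume "i < dim_vec (0\<^sub>v ?n)"
      hence i: "i < ?n" by simp
      show "(ev_mat Y x *\<^sub>v v) $ i = 0\<^sub>v ?n $ i" unfolding Yv[OF i] using first[of i] last i by (cases "i = l") auto
    qed (use Y in simp)
    then show "v = 0\<^sub>v q" by (rule inj[OF v])
  qed
qed

text \<open>The determinant of the leading block is the last diagonal entry of the adjugate, so that the order of vanishing of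
this entry decides whether all multiplicities but the largest survive exactly or one of them grows.\<close>

lemma deletion_core:
  assumes L: "L \<in> pencil_carrier (Suc l)" and pm: "finite_partial_mults (Suc l) L x ns" and ne: "ns \<noteq> []"
    and K: "K \<in> carrier_mat (Suc l) (Suc l)" and adj: "adj_mat (pmat (Suc l) L) = lin x ^ b \<cdot>\<^sub>m K"
    and b: "sum_list (tl ns) = b"
    and MK: "pmat (Suc l) L * K = (lin x ^ hd ns * e) \<cdot>\<^sub>m 1\<^sub>m (Suc l)"
    and alt: "poly (K $$ (l, l)) x \<noteq> 0 \<or> (\<exists>g i. K $$ (l, l) = lin x * g \<and> poly g x \<noteq> 0 \<and> i < l \<and>
      poly (K $$ (i, l)) x \<noteq> 0 \<and> poly (K $$ (l, i)) x \<noteq> 0)"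
  obtains m where "pencil_regular (leading l L)" "finite_partial_mults l (leading l L) x m"
    "m = tl ns \<or> m = bump (tl ns) \<and> hd ns \<le> entry ns 1"
proof -
  let ?n = "Suc l"
  note f = finite_partial_mults_facts[OF L pm]
  have Kll: "K $$ (l, l) \<noteq> 0" using alt by auto
  have det': "pdet l (leading l L) = lin x ^ b * K $$ (l, l)"
    unfolding pdet_leading adj using K by simp
  have reg: "pencil_regular (leading l L)" unfolding pencil_regular_iff[OF leading_carrier] det' using Kll by simp
  obtain m where m: "finite_partial_mults l (leading l L) x m" by (rule finite_partial_mults_exists[OF leading_carrier reg])
  note f' = finite_partial_mults_facts[OF leading_carrier m]
  have ab: "above ns k \<le> above m k + 1" if k: "1 \<le> k" for k
  proof (cases "above ns k")
    case (Suc q)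
    have "chains ?n (Suc q) k (pmat ?n L) x" using f(3)[OF k] Suc by simp
    hence "chains l q k (pmat l (leading l L)) x" by (rule chains_leading[OF L _ k])
    then show ?thesis using f'(3)[OF k] Suc by simp
  qed simp
  have dom: "entry (tl ns) i \<le> entry m i" for i
    using entry_le_of_above[OF f(4) f'(4) ab, of i] by (simp add: entry_tl)
  have z: "0 \<notin> set (tl ns)" using f(5) by (auto dest: list.set_sel(2)[OF ne])
  show thesis
  proof (cases "poly (K $$ (l, l)) x = 0")
    case False
    have "sum_list m = b" using f'(2) order_eq_iff[OF det' False] by simp
    then show thesis using dominating_list_eq[OF dom _ f'(5) z] b that[OF reg m] by simp
  next
    case True
    then obtain g i where g: "K $$ (l, l) = lin x * g" "poly g x \<noteq> 0" and i: "i < l"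
      and Ki: "poly (K $$ (i, l)) x \<noteq> 0" "poly (K $$ (l, i)) x \<noteq> 0" using alt by blast
    have "pdet l (leading l L) = lin x ^ Suc b * g" unfolding det' g by (simp add: ac_simps)
    from order_eq_iff[OF this g(2)] have sm: "sum_list m = Suc b" using f'(2) by simp
    define y where "y = vec l (\<lambda>k. K $$ (l, l) * K $$ (k, i) - K $$ (l, i) * K $$ (k, l))"
    have y: "y \<in> carrier_vec l" by (simp add: y_def)
    have MKe: "(\<Sum>h = 0..<?n. pmat ?n L $$ (k, h) * K $$ (h, j)) = (if k = j then lin x ^ hd ns * e else 0)" if "k < ?n" "j < ?n" for k j
    proof -
      have "(pmat ?n L * K) $$ (k, j) = (if k = j then lin x ^ hd ns * e else 0)" unfolding MK using that by simp
      then show ?thesis unfolding mult_mat_entry[OF pmat_carrier K that] .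
    qed
    have dv: "lin x ^ Suc (hd ns) dvd (pmat l (leading l L) *\<^sub>v y) $ k" if k: "k < l" for k
    proof -
      have "(pmat l (leading l L) *\<^sub>v y) $ k = (\<Sum>h = 0..<l. pmat l (leading l L) $$ (k, h) * y $ h)"
        by (rule mult_mat_vec_entry[OF pmat_carrier y k])
      also have "\<dots> = (\<Sum>h = 0..<l. pmat ?n L $$ (k, h) * (K $$ (l, l) * K $$ (h, i) - K $$ (l, i) * K $$ (h, l)))"
        by (rule sum.cong[OF refl]) (use k in \<open>simp add: leading_def y_def\<close>)
      also have "\<dots> = (\<Sum>h = 0..<?n. pmat ?n L $$ (k, h) * (K $$ (l, l) * K $$ (h, i) - K $$ (l, i) * K $$ (h, l)))"
        by (simp add: mult.commute)
      also have "\<dots> = K $$ (l, l) * (\<Sum>h = 0..<?n. pmat ?n L $$ (k, h) * K $$ (h, i)) -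
          K $$ (l, i) * (\<Sum>h = 0..<?n. pmat ?n L $$ (k, h) * K $$ (h, l))"
        unfolding sum_distrib_left sum_subtractf[symmetric] by (intro sum.cong refl) (simp add: algebra_simps del: pmat_index)
      also have "\<dots> = (if k = i then K $$ (l, l) * (lin x ^ hd ns * e) else 0)"
        using k i by (simp only: MKe less_SucI lessI) auto
      finally show ?thesis unfolding g(1) by (auto simp: mult.assoc mult.left_commute[of _ "lin x ^ _"])
    qed
    have "poly (y $ i) x \<noteq> 0" using Ki i True by (simp add: y_def)
    hence "chains l 1 (Suc (hd ns)) (pmat l (leading l L)) x" by (intro chain_single[OF pmat_carrier y dv i])
    hence "m \<noteq> []" "Suc (hd ns) \<le> hd m" using head_partial_mults[OF leading_carrier m, of "Suc (hd ns)"] by auto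
    hence em: "Suc (hd ns) \<le> entry m 0" by (cases m) auto
    have et: "entry (tl ns) 0 = entry ns 1" using ne by (cases ns) auto
    have "entry ns 1 \<le> hd ns" using f(4) ne by (cases ns; cases "tl ns") (auto simp: entry_def)
    hence mb: "m = bump (tl ns)" using em et sm b by (intro dominating_list_bump[OF dom _ f'(5) z]) auto
    moreover have "hd ns \<le> entry ns 1" using em et mb by (simp add: entry_bump)
    ultimately show thesis using that[OF reg m] by simp
  qed
qed

lemma exists_last_row:
  assumes u: "u \<in> carrier_vec (Suc l)" and h: "h < Suc l" "u $ h \<noteq> (0 :: complex)"
  obtains Z where "Z \<in> carrier_mat (Suc l) (Suc l)" "det Z \<noteq> 0" "\<And>j. j < Suc l \<Longrightarrow> Z $$ (l, j) = u $ j"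
proof -
  define Z where "Z = mat (Suc l) (Suc l) (\<lambda>(i, j). if i = l then u $ j else if j = insert_index h i then 1 else 0)"
  have Z: "Z \<in> carrier_mat (Suc l) (Suc l)" by (simp add: Z_def)
  have "det Z \<noteq> 0"
  proof
    assume "det Z = 0"
    then obtain v where v: "v \<in> carrier_vec (Suc l)" "v \<noteq> 0\<^sub>v (Suc l)" "Z *\<^sub>v v = 0\<^sub>v (Suc l)"
      using det_0_iff_vec_prod_zero[OF Z] by blast
    have Zv: "(\<Sum>j = 0..<Suc l. Z $$ (i, j) * v $ j) = 0" if "i < Suc l" for i
      using mult_mat_vec_entry[OF Z v(1) that] v(3) that by simp
    have v0: "v $ j = 0" if j: "j < Suc l" "j \<noteq> h" for j
    proof -
      define i where "i = delete_index h j"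
      have i: "i < l" "insert_index h i = j" using j h by (auto simp: i_def delete_index_def insert_index_def)
      have "(\<Sum>k = 0..<Suc l. Z $$ (i, k) * v $ k) = (\<Sum>k = 0..<Suc l. if k = j then v $ k else 0)"
        by (rule sum.cong[OF refl]) (use i in \<open>auto simp: Z_def\<close>)
      also have "\<dots> = v $ j" by (subst sum.delta) (use j in auto)
      finally show ?thesis using Zv[of i] i by (simp only: less_SucI)
    qed
    have "(\<Sum>k = 0..<Suc l. Z $$ (l, k) * v $ k) = (\<Sum>k = 0..<Suc l. if k = h then u $ k * v $ k else 0)"
      by (rule sum.cong[OF refl]) (use v0 in \<open>auto simp: Z_def\<close>)
    also have "\<dots> = u $ h * v $ h" by (subst sum.delta) (use h in auto)
    finally have "u $ h * v $ h = 0" using Zv[OF lessI] by (simp only:)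
    hence vh: "v $ h = 0" using h by simp
    have "v = 0\<^sub>v (Suc l)"
    proof (rule eq_vecI)
      fix j assume "j < dim_vec (0\<^sub>v (Suc l))"
      then show "v $ j = 0\<^sub>v (Suc l) $ j" using v0[of j] vh by (cases "j = h") auto
    qed (use v(1) in simp)
    with v(2) show False by simp
  qed
  then show ?thesis using that[OF Z] by (simp add: Z_def)
qed

text \<open>At \<open>-c\<close> the structured pencil is skew-symmetric, and perturbations of rank one vanish there;
  deleting a row and a column after a generic congruence takes the place of such a perturbation.\<close>

lemma deletion_step:
  assumes L: "L \<in> pencil_carrier (Suc l)" and s: "has_structure st L" and reg: "pencil_regular L"
    and pm: "finite_partial_mults (Suc l) L x ns" and ne: "ns \<noteq> []" and x: "x = - ssign st"
  obtains X Z m where "X \<in> carrier_mat (Suc l) (Suc l)" "Z \<in> carrier_mat (Suc l) (Suc l)"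
    "X * Z = 1\<^sub>m (Suc l)" "Z * X = 1\<^sub>m (Suc l)"
    "pencil_regular (leading l (congruence X L))" "finite_partial_mults l (leading l (congruence X L)) x m"
    "m = tl ns \<or> m = bump (tl ns) \<and> hd ns \<le> entry ns 1"
proof -
  note main = that
  let ?n = "Suc l"
  note f = finite_partial_mults_facts[OF L pm]
  obtain b K e where K: "K \<in> carrier_mat ?n ?n" "adj_mat (pmat ?n L) = lin x ^ b \<cdot>\<^sub>m K" "ev_mat K x \<noteq> 0\<^sub>m ?n ?n"
    and e: "pdet ?n L = lin x ^ (b + hd ns) * e" "poly e x \<noteq> 0" and m1: "1 \<le> hd ns" and tlb: "sum_list (tl ns) = b"
    and MK: "pmat ?n L * K = (lin x ^ hd ns * e) \<cdot>\<^sub>m 1\<^sub>m ?n" and KM: "K * pmat ?n L = (lin x ^ hd ns * e) \<cdot>\<^sub>m 1\<^sub>m ?n"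
    by (rule pole_data[OF L pm ne])
  define K0 where "K0 = ev_mat K x"
  define K1 where "K1 = ev_mat (map_mat pderiv K) x"
  have K01: "K0 \<in> carrier_mat ?n ?n" "K1 \<in> carrier_mat ?n ?n" using K by (auto simp: K0_def K1_def)
  have finish: thesis
    if u: "u \<in> carrier_vec ?n" and alt: "quad K0 u \<noteq> 0 \<or>
      ((\<forall>v \<in> carrier_vec ?n. quad K0 v = 0) \<and> quad K1 u \<noteq> 0 \<and> (\<exists>i<?n. (\<Sum>k = 0..<?n. K0 $$ (i, k) * u $ k) \<noteq> 0))" for u
  proof -
    have "\<exists>h<?n. u $ h \<noteq> 0"
    proof (rule ccontr)
      assume "\<not> ?thesis"
      hence "quad K0 u = 0" "quad K1 u = 0" using K01 by (simp_all add: quad_def)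
      then show False using alt by simp
    qed
    then obtain h where h: "h < ?n" "u $ h \<noteq> 0" by blast
    obtain Z where Z: "Z \<in> carrier_mat ?n ?n" "det Z \<noteq> 0" "\<And>j. j < ?n \<Longrightarrow> Z $$ (l, j) = u $ j"
      using exists_last_row[OF u h] by blast
    obtain X where X: "X \<in> carrier_mat ?n ?n" "Z * X = 1\<^sub>m ?n" "X * Z = 1\<^sub>m ?n" by (rule nonsingular_inverse[OF Z(1,2)])
    have dX: "det X \<noteq> 0" using det_mult[OF X(1) Z(1)] X(3) by auto
    let ?d = "det X ^ 2"
    define K' where "K' = mat ?n ?n (\<lambda>(i, j). \<Sum>k = 0..<?n. \<Sum>l = 0..<?n. [:?d * Z $$ (i, k) * Z $$ (j, l):] * K $$ (k, l))"
    have K'c: "K' \<in> carrier_mat ?n ?n" by (simp add: K'_def)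
    let ?L = "congruence X L"
    have cL: "?L \<in> pencil_carrier ?n" using X L by simp
    have pm': "finite_partial_mults ?n ?L x ns" by (rule finite_partial_mults_congruence[OF L X(1) Z(1) X(3,2) pm])
    have adj': "adj_mat (pmat ?n ?L) = lin x ^ b \<cdot>\<^sub>m K'"
      unfolding K'_def by (rule adj_mat_congruence[OF L X(1) Z(1) X(3,2) f(1) K(1,2)])
    have "det (pmat ?n ?L) = [:?d:] * pdet ?n L"
      using det_mult[of "lift (X\<^sup>T) * pmat ?n L" ?n "lift X"] det_mult[of "lift (X\<^sup>T)" ?n "pmat ?n L"] X(1)
      unfolding congruence_def by (simp add: pmat_equiv[OF L _ X(1), symmetric] det_lift det_transpose[OF X(1)] power2_eq_square)
    then obtain D where D: "det (pmat ?n ?L) = D * pdet ?n L" by blast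
    have MK': "pmat ?n ?L * K' = (lin x ^ hd ns * (D * e)) \<cdot>\<^sub>m 1\<^sub>m ?n"
    proof -
      have d: "det (pmat ?n ?L) = lin x ^ b * (lin x ^ hd ns * (D * e))" unfolding D e(1) by (simp add: power_add ac_simps)
      have "lin x ^ b \<cdot>\<^sub>m (pmat ?n ?L * K') = det (pmat ?n ?L) \<cdot>\<^sub>m 1\<^sub>m ?n"
        using adj_mat(2)[OF pmat_carrier, of ?n ?L] mult_smult_distrib[OF pmat_carrier K'c, of ?L] unfolding adj' by simp
      hence 1: "(lin x ^ b \<cdot>\<^sub>m (pmat ?n ?L * K')) $$ (i, j) = (det (pmat ?n ?L) \<cdot>\<^sub>m 1\<^sub>m ?n) $$ (i, j)" for i j by simp
      have PK: "pmat ?n ?L * K' \<in> carrier_mat ?n ?n" by (rule mult_carrier_mat[OF pmat_carrier K'c])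
      show ?thesis
      proof (rule eq_matI)
        fix i j assume "i < dim_row ((lin x ^ hd ns * (D * e)) \<cdot>\<^sub>m 1\<^sub>m ?n)" "j < dim_col ((lin x ^ hd ns * (D * e)) \<cdot>\<^sub>m 1\<^sub>m ?n)"
        hence ij: "i < ?n" "j < ?n" by auto
        have "lin x ^ b * (pmat ?n ?L * K') $$ (i, j) = lin x ^ b * ((lin x ^ hd ns * (D * e)) * 1\<^sub>m ?n $$ (i, j))"
          using 1[of i j] ij PK unfolding d by (simp only: index_smult_mat carrier_matD index_one_mat(2,3) mult.assoc)
        then show "(pmat ?n ?L * K') $$ (i, j) = ((lin x ^ hd ns * (D * e)) \<cdot>\<^sub>m 1\<^sub>m ?n) $$ (i, j)"
          using ij by (simp only: mult_cancel_left power_eq_0_iff lin_nonzero index_smult_mat index_one_mat(2,3)) simp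
      qed (use PK in auto)
    qed
    have K'i: "K' $$ (i, j) = (\<Sum>k = 0..<?n. \<Sum>h = 0..<?n. [:?d * Z $$ (i, k) * Z $$ (j, h):] * K $$ (k, h))"
      if "i < ?n" "j < ?n" for i j
      unfolding K'_def by (subst index_mat(1)[OF that]) (simp only: split)
    have Kll: "K' $$ (l, l) = [:?d:] * pquad K u"
      unfolding K'i[OF lessI lessI] pquad_def sum_distrib_left carrier_matD[OF K(1)]
      by (intro sum.cong refl) (simp add: Z(3) ac_simps)
    have evK': "poly (K' $$ (i, j)) x = ?d * (\<Sum>k = 0..<?n. \<Sum>l = 0..<?n. Z $$ (i, k) * Z $$ (j, l) * K0 $$ (k, l))" if "i < ?n" "j < ?n" for i j
      unfolding K'i[OF that] poly_sum sum_distrib_left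
      by (intro sum.cong refl) (use K(1) in \<open>simp add: K0_def ac_simps\<close>)
    have "poly (K' $$ (l, l)) x \<noteq> 0 \<or> (\<exists>g i. K' $$ (l, l) = lin x * g \<and> poly g x \<noteq> 0 \<and> i < l \<and>
      poly (K' $$ (i, l)) x \<noteq> 0 \<and> poly (K' $$ (l, i)) x \<noteq> 0)"
    proof (cases "quad K0 u = 0")
      case False
      then show ?thesis unfolding Kll using dX by (simp add: poly_pquad K0_def)
    next
      case True
      with alt have skew: "\<And>v. v \<in> carrier_vec ?n \<Longrightarrow> quad K0 v = 0" and q1: "quad K1 u \<noteq> 0"
        and ex: "\<exists>i<?n. (\<Sum>k = 0..<?n. K0 $$ (i, k) * u $ k) \<noteq> 0" by auto
      have px: "poly (pquad K u) x = 0" using True by (simp add: poly_pquad K0_def)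
      then obtain g where g: "pquad K u = lin x * g" using lin_dvd_iff by (metis dvdE)
      have "pderiv (lin x) = 1" by (simp add: lin_def pderiv_pCons)
      hence "poly g x = poly (pderiv (pquad K u)) x" unfolding g pderiv_mult by simp
      hence gx: "poly g x \<noteq> 0" using q1 by (simp add: poly_pderiv_pquad K1_def)
      have sk: "K0 $$ (k, i) = - K0 $$ (i, k)" if "i < ?n" "k < ?n" for i k by (rule quad_zero_skew[OF K01(1) skew that])
      have sk': "poly (K' $$ (j, i)) x = - poly (K' $$ (i, j)) x" if ij: "i < ?n" "j < ?n" for i j
      proof -
        have "(\<Sum>k = 0..<?n. \<Sum>l = 0..<?n. Z $$ (j, k) * Z $$ (i, l) * K0 $$ (k, l)) =
          (\<Sum>l = 0..<?n. \<Sum>k = 0..<?n. Z $$ (j, k) * Z $$ (i, l) * K0 $$ (k, l))" by (rule sum.swap)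
        also have "\<dots> = (\<Sum>l = 0..<?n. \<Sum>k = 0..<?n. - (Z $$ (i, l) * Z $$ (j, k) * K0 $$ (l, k)))"
        proof (intro sum.cong refl)
          fix a c assume "a \<in> {0..<?n}" "c \<in> {0..<?n}"
          then show "Z $$ (j, c) * Z $$ (i, a) * K0 $$ (c, a) = - (Z $$ (i, a) * Z $$ (j, c) * K0 $$ (a, c))"
            using sk[of a c] by simp
        qed
        finally show ?thesis unfolding evK'[OF ij] evK'[OF ij(2,1)] by (simp only: sum_negf mult_minus_right)
      qed
      define w where "w = vec ?n (\<lambda>k. \<Sum>l' = 0..<?n. K0 $$ (k, l') * u $ l')"
      have w: "w \<in> carrier_vec ?n" by (simp add: w_def)
      have w0: "w \<noteq> 0\<^sub>v ?n"
      proof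
        assume "w = 0\<^sub>v ?n"
        hence "w $ i = 0" if "i < ?n" for i using that by simp
        then show False using ex by (auto simp: w_def)
      qed
      have Kil: "poly (K' $$ (i, l)) x = ?d * (Z *\<^sub>v w) $ i" if i: "i < ?n" for i
        unfolding evK'[OF i lessI] mult_mat_vec_entry[OF Z(1) w i]
        unfolding sum_distrib_left
      proof (rule sum.cong[OF refl])
        fix k assume "k \<in> {0..<?n}"
        then have wk: "w $ k = (\<Sum>h = 0..<?n. K0 $$ (k, h) * u $ h)" by (simp add: w_def del: sum.op_ivl_Suc)
        show "(\<Sum>h = 0..<?n. ?d * (Z $$ (i, k) * Z $$ (l, h) * K0 $$ (k, h))) = ?d * (Z $$ (i, k) * w $ k)"
          unfolding wk sum_distrib_left by (intro sum.cong refl) (simp add: Z(3) ac_simps)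
      qed
      have "Z *\<^sub>v w \<noteq> 0\<^sub>v ?n" using det_0_iff_vec_prod_zero[OF Z(1)] Z(2) w w0 by blast
      then obtain i where i: "i < ?n" "(Z *\<^sub>v w) $ i \<noteq> 0"
      proof -
        assume a: "\<And>i. i < ?n \<Longrightarrow> (Z *\<^sub>v w) $ i \<noteq> 0 \<Longrightarrow> thesis" and b: "Z *\<^sub>v w \<noteq> 0\<^sub>v ?n"
        show thesis
        proof (rule ccontr)
          assume "\<not> thesis"
          hence "Z *\<^sub>v w = 0\<^sub>v ?n" using a Z(1) by (intro eq_vecI) auto
          with b show False by simp
        qed
      qed
      have Ki: "poly (K' $$ (i, l)) x \<noteq> 0" using Kil[OF i(1)] i(2) dX by simp
      have "poly (K' $$ (l, l)) x = 0" using px unfolding Kll by simp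
      hence "i \<noteq> l" using Ki by auto
      hence il: "i < l" using i by simp
      have "K' $$ (l, l) = lin x * ([:?d:] * g)" unfolding Kll g by (simp add: ac_simps)
      then show ?thesis using gx dX il Ki sk'[OF i(1) lessI]
        by (intro disjI2 exI[of _ "[:?d:] * g"] exI[of _ i]) simp
    qed
    note alt' = this
    show thesis
      by (rule deletion_core[OF cL pm' ne K'c adj' tlb MK' alt']) (rule main[OF X(1) Z(1) X(3,2)])
  qed
  show thesis
  proof (cases "\<exists>u \<in> carrier_vec ?n. quad K0 u \<noteq> 0")
    case True
    then show thesis using finish by blast
  next
    case False
    hence skew: "quad (ev_mat K x) u = 0" if "u \<in> carrier_vec ?n" for u using that by (auto simp: K0_def)
    note sl = skew_leading_coefficient[OF L s reg K(1) m1 K(3) e(2) MK KM skew]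
    have "2 \<le> hd ns" by (rule sl(3)[OF _ x])
    then obtain u1 where u1: "u1 \<in> carrier_vec ?n" "quad K1 u1 \<noteq> 0" using sl(2) by (auto simp: K1_def)
    have K0nz: "K0 \<noteq> 0\<^sub>m ?n ?n" using K(3) by (simp add: K0_def)
    obtain i j where ij: "i < ?n" "j < ?n" "K0 $$ (i, j) \<noteq> 0" by (rule nonzero_mat_entry[OF K01(1) K0nz])
    have "generically ?n (\<lambda>u. quad K1 u \<noteq> 0)"
      by (rule generically_polynomial[OF polynomial_function_quad[OF K01(2)] u1])
    from generically_conj[OF generically_mult_entry[OF K01(1) ij] this]
    obtain u where "u \<in> carrier_vec ?n" "(\<Sum>l = 0..<?n. K0 $$ (i, l) * u $ l) \<noteq> 0 \<and> quad K1 u \<noteq> 0" by (rule generically_ex)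
    then show thesis using False ij(1) by (intro finish[of u]) auto
  qed
qed

section \<open>Iterated steps and the lists of the theorem\<close>

text \<open>By the functional equation of the determinant its order of vanishing is even at \<open>ssign st\<close> and has the
  parity of \<open>n\<close> at \<open>- ssign st\<close>.  A list with the wrong sum cannot consist of the multiplicities of a structured
  pencil; it is repaired by the least possible increase.\<close>

definition wrong :: "pencil_structure \<Rightarrow> complex \<Rightarrow> nat \<Rightarrow> nat list \<Rightarrow> bool" where
  "wrong st x n l \<longleftrightarrow> (x = ssign st \<and> odd (sum_list l)) \<or> (x = - ssign st \<and> odd (sum_list l + n))"

definition repaired :: "pencil_structure \<Rightarrow> complex \<Rightarrow> nat \<Rightarrow> nat list \<Rightarrow> nat list" where
  "repaired st x n l = (if wrong st x n l then bump l else l)"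

lemma ssign_neq_minus [simp]: "ssign st \<noteq> - ssign st" "- ssign st \<noteq> ssign st"
  by (cases st; simp)+

lemma not_wrong:
  assumes L: "L \<in> pencil_carrier n" and s: "has_structure st L" and pm: "finite_partial_mults n L x ns"
  shows "\<not> wrong st x n ns"
proof
  assume w: "wrong st x n ns"
  note f = finite_partial_mults_facts[OF L pm]
  have xx: "x * x = 1" using w by (auto simp: wrong_def)
  have p: "(ssign st * x) ^ n = (- 1) ^ sum_list ns" using order_parity[OF L s f(1) xx] f(2) by simp
  from w consider "x = ssign st" "odd (sum_list ns)" | "x = - ssign st" "odd (sum_list ns + n)"
    by (auto simp: wrong_def)
  then show False
  proof cases
    case 1 then show False using p by simp
  next
    case 2
    then have "(- 1 :: complex) ^ n * (- 1) ^ sum_list ns = - 1" by (simp add: power_add[symmetric] add.commute)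
    moreover have "(- 1 :: complex) ^ n = (- 1) ^ sum_list ns" using p 2 by simp
    ultimately show False by (simp add: power_add[symmetric] flip: mult_2)
  qed
qed

lemma tl_repaired: "l \<noteq> [] \<Longrightarrow> tl (repaired st x n l) = tl l"
  by (cases l) (auto simp: repaired_def)

lemma bump_neq [simp]: "bump l \<noteq> l" "l \<noteq> bump l"
  by (cases l; simp)+

lemma repaired_eqI:
  assumes "m = l \<or> m = bump l" "\<not> wrong st x n m" "m = bump l \<Longrightarrow> x = ssign st \<or> x = - ssign st"
  shows "m = repaired st x n l" "m = bump l \<longleftrightarrow> wrong st x n l"
proof -
  have "wrong st x n (bump l) \<longleftrightarrow> \<not> wrong st x n l" if "x = ssign st \<or> x = - ssign st"
    using that by (auto simp: wrong_def)
  moreover have "bump l \<noteq> l" by (cases l) auto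
  ultimately show "m = repaired st x n l" "m = bump l \<longleftrightarrow> wrong st x n l"
    using assms by (auto simp: repaired_def)
qed

text \<open>A removed largest multiplicity can only reappear at the next entry if it occurs twice; so a repair is needed
  after the removal only if none was needed before and the removed entry is followed by an equal one.\<close>

lemma repair_step:
  assumes srt: "sorted_wrt (\<ge>) ns" and r: "r < length ns"
    and hd: "m = bump (tl (repaired st x n (drop r ns))) \<Longrightarrow> hd (repaired st x n (drop r ns)) \<le> entry (repaired st x n (drop r ns)) 1"
    and m: "m = bump (drop (Suc r) ns)"
  shows "\<not> wrong st x n (drop r ns)" "ns ! r = entry ns (Suc r)"
proof -
  have d: "drop r ns \<noteq> []" "drop r ns = ns ! r # drop (Suc r) ns" using r by (auto simp: Cons_nth_drop_Suc)
  have tl: "tl (repaired st x n (drop r ns)) = drop (Suc r) ns" using tl_repaired[OF d(1)] by (simp add: drop_Suc tl_drop)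
  have h: "hd (repaired st x n (drop r ns)) \<le> entry (repaired st x n (drop r ns)) 1" using hd m tl by simp
  have e1: "entry (repaired st x n (drop r ns)) 1 = entry ns (Suc r)"
    by (simp add: repaired_def entry_bump)
  have hh: "hd (repaired st x n (drop r ns)) = ns ! r + (if wrong st x n (drop r ns) then 1 else 0)"
    using d(2) by (simp add: repaired_def)
  have le: "entry ns (Suc r) \<le> ns ! r"
    using srt r by (auto simp: entry_def sorted_wrt_iff_nth_less)
  show "\<not> wrong st x n (drop r ns)" "ns ! r = entry ns (Suc r)"
    using h le unfolding e1 hh by (auto split: if_splits)
qed

text \<open>Beside the example of \<open>r\<close> perturbations of rank one, the last clause records the constraint on the list \<open>ns\<close> itself
that the single steps reveal: it is the source of property (P).\<close>

lemma iterated_additive: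
  assumes L: "L \<in> pencil_carrier n" and s: "has_structure st L" and reg: "pencil_regular L"
    and pm: "finite_partial_mults n L x ns" and x: "x \<noteq> - ssign st"
  shows "\<exists>E us. E = foldr (\<lambda>u E. pencil_add E (rank1 st u)) us L \<and> length us = r \<and> set us \<subseteq> carrier_vec n \<and>
    pencil_regular E \<and> finite_partial_mults n E x (repaired st x n (drop r ns)) \<and>
    (\<forall>q<r. q < length ns \<and> wrong st x n (drop (Suc q) ns) \<longrightarrow> \<not> wrong st x n (drop q ns) \<and> ns ! q = entry ns (Suc q))"
proof (induction r)
  case 0
  have "repaired st x n ns = ns" using not_wrong[OF L s pm] by (simp add: repaired_def)
  then show ?case using reg pm by (intro exI[of _ L] exI[of _ "[]"]) simp
next
  case (Suc r)
  then obtain E us where E: "E = foldr (\<lambda>u E. pencil_add E (rank1 st u)) us L" "length us = r" "set us \<subseteq> carrier_vec n"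
    and regE: "pencil_regular E" and pmE: "finite_partial_mults n E x (repaired st x n (drop r ns))"
    and star: "\<forall>q<r. q < length ns \<and> wrong st x n (drop (Suc q) ns) \<longrightarrow> \<not> wrong st x n (drop q ns) \<and> ns ! q = entry ns (Suc q)"
    by blast
  have cs: "foldr (\<lambda>u E. pencil_add E (rank1 st u)) vs L \<in> pencil_carrier n \<and> has_structure st (foldr (\<lambda>u E. pencil_add E (rank1 st u)) vs L)"
    if "set vs \<subseteq> carrier_vec n" for vs
    using that
  proof (induction vs)
    case (Cons v vs)
    then show ?case by (auto intro: structure_add[of _ n] structure_rank1)
  qed (use L s in simp)
  have cE: "E \<in> pencil_carrier n" "has_structure st E" using cs[OF E(3)] E(1) by auto
  have E0: "pencil_add E (rank1 st (0\<^sub>v n)) = E"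
  proof -
    obtain A B where AB: "E = (A, B)" by force
    have "A \<in> carrier_mat n n" "B \<in> carrier_mat n n" using cE AB by (auto simp: pencil_carrier_def)
    then show ?thesis unfolding AB by (auto simp: pencil_add_def rank1_def intro!: eq_matI)
  qed
  show ?case
  proof (cases "r < length ns")
    case False
    hence "drop (Suc r) ns = drop r ns" by simp
    then show ?thesis using E regE pmE star E0 False
      by (intro exI[of _ E] exI[of _ "0\<^sub>v n # us"]) (auto simp: less_Suc_eq)
  next
    case True
    hence d: "drop r ns \<noteq> []" by simp
    hence ne: "repaired st x n (drop r ns) \<noteq> []" by (cases "drop r ns") (auto simp: repaired_def)
    have tl: "tl (repaired st x n (drop r ns)) = drop (Suc r) ns" using tl_repaired[OF d] by (simp add: drop_Suc tl_drop)
    obtain u m where u: "u \<in> carrier_vec n" and reg': "pencil_regular (pencil_add E (rank1 st u))"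
      and m: "finite_partial_mults n (pencil_add E (rank1 st u)) x m"
      and alt: "m = drop (Suc r) ns \<or> m = bump (drop (Suc r) ns) \<and>
        hd (repaired st x n (drop r ns)) \<le> entry (repaired st x n (drop r ns)) 1 \<and> x = ssign st"
      using additive_step[OF cE regE pmE ne x] unfolding tl by blast
    have cE': "pencil_add E (rank1 st u) \<in> pencil_carrier n" "has_structure st (pencil_add E (rank1 st u))"
      using cE u structure_add[OF cE(1) rank1_carrier[OF u] cE(2) structure_rank1[OF u]] by auto
    have "m = bump (drop (Suc r) ns) \<Longrightarrow> x = ssign st \<or> x = - ssign st" using alt by auto
    note rep = repaired_eqI[OF _ not_wrong[OF cE' m] this]
    have alt1: "m = drop (Suc r) ns \<or> m = bump (drop (Suc r) ns)" using alt by (elim disjE) simp_all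
    note rep = rep[OF alt1]
    have "\<not> wrong st x n (drop r ns) \<and> ns ! r = entry ns (Suc r)" if "wrong st x n (drop (Suc r) ns)"
    proof -
      have mb: "m = bump (drop (Suc r) ns)" using rep(2) that by simp
      have "bump (drop (Suc r) ns) \<noteq> drop (Suc r) ns" by (cases "drop (Suc r) ns") auto
      hence "hd (repaired st x n (drop r ns)) \<le> entry (repaired st x n (drop r ns)) 1" using alt mb by auto
      then show ?thesis
        using repair_step[OF finite_partial_mults_facts(4)[OF L pm] True _ mb, of st x n] by blast
    qed
    then show ?thesis using E reg' m u star rep(1)
      by (intro exI[of _ "pencil_add E (rank1 st u)"] exI[of _ "u # us"]) (auto simp: less_Suc_eq)
  qed
qed

lemma congruence_dsum_leading:
  assumes L: "L \<in> pencil_carrier n" and X: "X \<in> carrier_mat n n" and Y: "Y \<in> carrier_mat (Suc l) (Suc l)"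
    and n: "n = Suc l + r"
  shows "leading l (congruence (X * dsum Y (1\<^sub>m r)) L) = leading l (congruence Y (leading (Suc l) (congruence X L)))"
proof -
  let ?D = "dsum Y (1\<^sub>m r)"
  have D: "?D \<in> carrier_mat n n" unfolding n by (rule dsum_carrier[OF Y one_carrier_mat])
  have Di: "?D $$ (k, i) = (if k < Suc l then Y $$ (k, i) else 0)" if "k < n" "i < l" for k i
    using that Y n by (auto simp: dsum_def)
  have main: "((X * ?D)\<^sup>T * A * (X * ?D)) $$ (i, j) =
      (Y\<^sup>T * mat (Suc l) (Suc l) (\<lambda>ij. (X\<^sup>T * A * X) $$ ij) * Y) $$ (i, j)"
    if A: "A \<in> carrier_mat n n" and ij: "i < l" "j < l" for A i j
  proof -
    have XA: "X\<^sup>T * A * X \<in> carrier_mat n n" using X A by (intro mult_carrier_mat[of _ n n]) auto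
    have "(X * ?D)\<^sup>T * A * (X * ?D) = ?D\<^sup>T * (X\<^sup>T * A * X) * ?D"
      unfolding transpose_mult[OF X D] by (rule mult5_assoc[symmetric]) (use X D A in auto)
    also have "\<dots> $$ (i, j) = (\<Sum>h = 0..<n. \<Sum>k = 0..<n. ?D $$ (k, i) * (X\<^sup>T * A * X) $$ (k, h) * ?D $$ (h, j))"
      by (rule congruence_entry[OF D XA]) (use ij n in auto)
    also have "\<dots> = (\<Sum>h = 0..<Suc l. \<Sum>k = 0..<n. ?D $$ (k, i) * (X\<^sup>T * A * X) $$ (k, h) * ?D $$ (h, j))"
      by (rule sum.mono_neutral_right) (use n Di[OF _ ij(2)] in \<open>auto intro!: sum.neutral\<close>)
    also have "\<dots> = (\<Sum>h = 0..<Suc l. \<Sum>k = 0..<Suc l. ?D $$ (k, i) * (X\<^sup>T * A * X) $$ (k, h) * ?D $$ (h, j))"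
      by (intro sum.cong refl sum.mono_neutral_right) (use n Di[OF _ ij(1)] in auto)
    also have "\<dots> = (\<Sum>h = 0..<Suc l. \<Sum>k = 0..<Suc l. Y $$ (k, i) * mat (Suc l) (Suc l) (\<lambda>ij. (X\<^sup>T * A * X) $$ ij) $$ (k, h) * Y $$ (h, j))"
    proof (intro sum.cong refl)
      fix h k assume hk: "h \<in> {0..<Suc l}" "k \<in> {0..<Suc l}"
      then have "?D $$ (k, i) = Y $$ (k, i)" "?D $$ (h, j) = Y $$ (h, j)" using Di[of k i] Di[of h j] ij n by auto
      then show "?D $$ (k, i) * (X\<^sup>T * A * X) $$ (k, h) * ?D $$ (h, j) =
        Y $$ (k, i) * mat (Suc l) (Suc l) (\<lambda>ij. (X\<^sup>T * A * X) $$ ij) $$ (k, h) * Y $$ (h, j)" using hk by simp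
    qed
    also have "\<dots> = (Y\<^sup>T * mat (Suc l) (Suc l) (\<lambda>ij. (X\<^sup>T * A * X) $$ ij) * Y) $$ (i, j)"
      by (rule congruence_entry[symmetric, OF Y]) (use ij in auto)
    finally show ?thesis .
  qed
  have c: "fst L \<in> carrier_mat n n" "snd L \<in> carrier_mat n n" using L by (auto simp: pencil_carrier_def)
  show ?thesis unfolding leading_def congruence_def fst_conv snd_conv
    by (intro arg_cong2[of _ _ _ _ Pair] eq_matI) (simp_all only: index_mat dim_row_mat dim_col_mat main[OF c(1)] main[OF c(2)])
qed

text \<open>The counterpart of the additive steps at \<open>- ssign st\<close>, where each step lowers the size of the pencil by one.\<close>

lemma iterated_deletion:
  assumes L: "L \<in> pencil_carrier n" and s: "has_structure st L" and reg: "pencil_regular L"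
    and pm: "finite_partial_mults n L x ns" and x: "x = - ssign st"
  shows "r \<le> length ns \<Longrightarrow> r \<le> n \<and> (\<exists>X Z. X \<in> carrier_mat n n \<and> Z \<in> carrier_mat n n \<and> X * Z = 1\<^sub>m n \<and> Z * X = 1\<^sub>m n \<and>
    pencil_regular (leading (n - r) (congruence X L)) \<and>
    finite_partial_mults (n - r) (leading (n - r) (congruence X L)) x (repaired st x (n - r) (drop r ns))) \<and>
    (\<forall>q<r. wrong st x (n - Suc q) (drop (Suc q) ns) \<longrightarrow> \<not> wrong st x (n - q) (drop q ns) \<and> ns ! q = entry ns (Suc q))"
proof (induction r)
  case 0
  have "repaired st x n ns = ns" using not_wrong[OF L s pm] by (simp add: repaired_def)
  moreover have "leading n (congruence (1\<^sub>m n) L) = L"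
  proof -
    obtain A B where AB: "L = (A, B)" by force
    have "A \<in> carrier_mat n n" "B \<in> carrier_mat n n" using L AB by (auto simp: pencil_carrier_def)
    then show ?thesis unfolding AB by (auto simp: leading_def congruence_def intro!: eq_matI)
  qed
  ultimately show ?case using reg pm by (auto intro!: exI[of _ "1\<^sub>m n"])
next
  case (Suc r)
  then obtain X Z where rn: "r \<le> n" and X: "X \<in> carrier_mat n n" "Z \<in> carrier_mat n n" "X * Z = 1\<^sub>m n" "Z * X = 1\<^sub>m n"
    and regM: "pencil_regular (leading (n - r) (congruence X L))"
    and pmM: "finite_partial_mults (n - r) (leading (n - r) (congruence X L)) x (repaired st x (n - r) (drop r ns))"
    and star: "\<forall>q<r. wrong st x (n - Suc q) (drop (Suc q) ns) \<longrightarrow> \<not> wrong st x (n - q) (drop q ns) \<and> ns ! q = entry ns (Suc q)"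
    using Suc.IH[OF Suc_leD[OF Suc.prems]] by (elim exE conjE) (rule that)
  have r: "r < length ns" using Suc.prems by simp
  hence d: "drop r ns \<noteq> []" by simp
  hence ne: "repaired st x (n - r) (drop r ns) \<noteq> []" by (cases "drop r ns") (auto simp: repaired_def)
  have tl: "tl (repaired st x (n - r) (drop r ns)) = drop (Suc r) ns" using tl_repaired[OF d] by (simp add: drop_Suc tl_drop)
  have "0 < n - r" by (rule pole_data[OF leading_carrier pmM ne])
  then obtain l where l: "n - r = Suc l" using gr0_implies_Suc by blast
  let ?M = "leading (Suc l) (congruence X L)"
  have sM: "has_structure st ?M"
    by (rule structure_leading[OF congruence_carrier[OF X(1) L] structure_congruence[OF L s X(1)]]) (use l in simp)
  obtain Y W m where Y: "Y \<in> carrier_mat (Suc l) (Suc l)" "W \<in> carrier_mat (Suc l) (Suc l)"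
    "Y * W = 1\<^sub>m (Suc l)" "W * Y = 1\<^sub>m (Suc l)"
    and reg': "pencil_regular (leading l (congruence Y ?M))" and m: "finite_partial_mults l (leading l (congruence Y ?M)) x m"
    and alt0: "m = tl (repaired st x (Suc l) (drop r ns)) \<or> m = bump (tl (repaired st x (Suc l) (drop r ns))) \<and>
      hd (repaired st x (Suc l) (drop r ns)) \<le> entry (repaired st x (Suc l) (drop r ns)) 1"
    by (rule deletion_step[OF leading_carrier sM regM[unfolded l] pmM[unfolded l] ne[unfolded l] x])
  have alt: "m = drop (Suc r) ns \<or> m = bump (drop (Suc r) ns) \<and>
      hd (repaired st x (n - r) (drop r ns)) \<le> entry (repaired st x (n - r) (drop r ns)) 1"
    using alt0 unfolding l tl[unfolded l] .
  have nl: "n = Suc l + r" using l rn by simp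
  let ?X = "X * dsum Y (1\<^sub>m r)" let ?Z = "dsum W (1\<^sub>m r) * Z"
  have D: "dsum Y (1\<^sub>m r) \<in> carrier_mat n n" "dsum W (1\<^sub>m r) \<in> carrier_mat n n"
    unfolding nl by (rule dsum_carrier[OF Y(1) one_carrier_mat]) (rule dsum_carrier[OF Y(2) one_carrier_mat])
  have DD: "dsum Y (1\<^sub>m r) * dsum W (1\<^sub>m r) = 1\<^sub>m n" "dsum W (1\<^sub>m r) * dsum Y (1\<^sub>m r) = 1\<^sub>m n"
    unfolding dsum_mult[OF Y(1,2) one_carrier_mat one_carrier_mat] dsum_mult[OF Y(2,1) one_carrier_mat one_carrier_mat] Y(3,4)
    by (simp_all add: nl)
  have X': "?X \<in> carrier_mat n n" "?Z \<in> carrier_mat n n" "?X * ?Z = 1\<^sub>m n" "?Z * ?X = 1\<^sub>m n"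
    using X D inverse_mult[OF X(1,2) D X(3) DD(1)] inverse_mult[OF D(2,1) X(2,1) DD(2) X(4)] by auto
  have eqM: "leading l (congruence Y ?M) = leading (n - Suc r) (congruence ?X L)"
    using congruence_dsum_leading[OF L X(1) Y(1) nl] nl by simp
  have nr: "n - Suc r = l" using nl by simp
  have sM': "has_structure st (leading l (congruence Y ?M))"
    by (rule structure_leading[OF congruence_carrier[OF Y(1) leading_carrier] structure_congruence[OF leading_carrier sM Y(1)]]) simp
  note rep = repaired_eqI[OF _ not_wrong[OF leading_carrier sM' m] disjI2[OF x]]
  have alt1: "m = drop (Suc r) ns \<or> m = bump (drop (Suc r) ns)" using alt by (elim disjE) simp_all
  note rep = rep[OF alt1]
  have "\<not> wrong st x (n - r) (drop r ns) \<and> ns ! r = entry ns (Suc r)" if "wrong st x (n - Suc r) (drop (Suc r) ns)"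
  proof -
    have mb: "m = bump (drop (Suc r) ns)" using rep(2) that nr by simp
    have "bump (drop (Suc r) ns) \<noteq> drop (Suc r) ns" by (cases "drop (Suc r) ns") auto
    hence "hd (repaired st x (n - r) (drop r ns)) \<le> entry (repaired st x (n - r) (drop r ns)) 1" using alt mb by auto
    then show ?thesis
      using repair_step[OF finite_partial_mults_facts(4)[OF L pm] r _ mb, of st x "n - r"] by blast
  qed
  moreover have "finite_partial_mults (n - Suc r) (leading (n - Suc r) (congruence ?X L)) x (repaired st x (n - Suc r) (drop (Suc r) ns))"
    using m rep(1) unfolding eqM nr by simp
  moreover have "pencil_regular (leading (n - Suc r) (congruence ?X L))" using reg' unfolding eqM .
  ultimately have new: "wrong st x (n - Suc r) (drop (Suc r) ns) \<longrightarrow> \<not> wrong st x (n - r) (drop r ns) \<and> ns ! r = entry ns (Suc r)"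
    and pmN: "finite_partial_mults (n - Suc r) (leading (n - Suc r) (congruence ?X L)) x (repaired st x (n - Suc r) (drop (Suc r) ns))"
    and regN: "pencil_regular (leading (n - Suc r) (congruence ?X L))" by blast+
  show ?case
  proof (intro conjI)
    show "Suc r \<le> n" using nl by simp
    show "\<exists>X Z. X \<in> carrier_mat n n \<and> Z \<in> carrier_mat n n \<and> X * Z = 1\<^sub>m n \<and> Z * X = 1\<^sub>m n \<and>
      pencil_regular (leading (n - Suc r) (congruence X L)) \<and>
      finite_partial_mults (n - Suc r) (leading (n - Suc r) (congruence X L)) x (repaired st x (n - Suc r) (drop (Suc r) ns))"
      by (rule exI[of _ ?X], rule exI[of _ ?Z]) (intro conjI X' regN pmN)
    show "\<forall>q<Suc r. wrong st x (n - Suc q) (drop (Suc q) ns) \<longrightarrow> \<not> wrong st x (n - q) (drop q ns) \<and> ns ! q = entry ns (Suc q)"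
      using star new by (simp only: less_Suc_eq) blast
  qed
qed

text \<open>Removing an entry of the bad parity switches the need \<open>b\<close> of a repair.  Within a run of equal entries of bad
  parity the need therefore alternates, and there is none at the end of the run; so it is present at a given place
  exactly if an odd number of further copies follows, which is property (P).\<close>

lemma repair_iff_property_P:
  assumes srt: "sorted_wrt (\<ge>) ns" and z: "0 \<notin> set ns" and b0: "\<not> b 0"
    and flip: "\<And>r. r < length ns \<Longrightarrow> b (Suc r) \<longleftrightarrow> b r \<noteq> bad (ns ! r)"
    and star: "\<And>r. r < length ns \<Longrightarrow> b (Suc r) \<Longrightarrow> \<not> b r \<and> ns ! r = entry ns (Suc r)"
    and r: "0 < r" "r \<le> length ns"
  shows "b r \<longleftrightarrow> bad (pm ns (r + 1)) \<and> property_P r ns"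
proof -
  have pe: "pm ns (Suc j) = entry ns j" for j by (simp add: pm_def entry_def)
  have mono: "entry ns j \<le> entry ns i" if "i \<le> j" for i j
    using srt that by (cases "i = j") (auto simp: entry_def sorted_wrt_iff_nth_less)
  obtain r' where r': "r = Suc r'" using r by (cases r) auto
  have r'l: "r' < length ns" using r r' by simp
  define v where "v = entry ns r'"
  have "ns ! r' \<noteq> 0"
  proof
    assume "ns ! r' = 0"
    then show False using nth_mem[OF r'l] z by simp
  qed
  hence vpos: "0 < v" unfolding v_def using r'l by (simp add: entry_def)
  have run: "b r \<longleftrightarrow> (bad v \<and> odd d)"
    if d: "0 < d" and eq: "\<And>j. j \<in> {r..r + d} \<Longrightarrow> pm ns j = v" and lt: "pm ns (r + d + 1) < v" for d
  proof -
    have ent: "entry ns (r' + i) = v" if "i \<le> d" for i using eq[of "Suc (r' + i)"] that r' pe by auto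
    have len: "r' + d < length ns" using ent[of d] vpos by (auto simp: entry_def split: if_splits)
    have nth: "ns ! (r' + i) = v" if "i \<le> d" for i using ent[OF that] len that by (simp add: entry_def)
    have end0: "\<not> b (r + d)"
    proof
      assume "b (r + d)"
      hence "b (Suc (r' + d))" by (simp add: r')
      from star[OF len this] have "ns ! (r' + d) = entry ns (Suc (r' + d))" by simp
      moreover have "entry ns (Suc (r' + d)) < v" using lt pe[of "Suc (r' + d)"] by (simp add: r')
      ultimately show False using nth[of d] by simp
    qed
    have fl: "b (r + i) \<longleftrightarrow> (b r \<noteq> (bad v \<and> odd i))" if "i \<le> d" for i
      using that
    proof (induction i)
      case (Suc i)
      have "b (Suc (r' + Suc i)) \<longleftrightarrow> b (r' + Suc i) \<noteq> bad (ns ! (r' + Suc i))"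
        by (rule flip) (use len Suc in simp)
      then show ?case using Suc nth[of "Suc i"] by (auto simp: r')
    qed simp
    show ?thesis using fl[of d] end0 by auto
  qed
  show ?thesis
  proof
    assume br: "b r"
    from star[OF r'l br[unfolded r']] have e1: "entry ns (Suc r') = v" using r'l by (simp add: v_def entry_def)
    define d where "d = (LEAST d. entry ns (r' + Suc d) \<noteq> v)"
    have ex: "entry ns (r' + Suc (length ns)) \<noteq> v" using vpos by (simp add: entry_def)
    have dl: "entry ns (r' + Suc d) \<noteq> v" unfolding d_def by (rule LeastI[of "\<lambda>d. entry ns (r' + Suc d) \<noteq> v"]) (rule ex)
    have de: "entry ns (r' + Suc i) = v" if "i < d" for i using not_less_Least[OF that[unfolded d_def]] by simp
    have d0: "0 < d" using dl e1 by (cases d) auto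
    have eq: "pm ns j = v" if j: "j \<in> {r..r + d}" for j
    proof (cases "j = r")
      case True then show ?thesis by (simp add: r' pe v_def)
    next
      case False
      hence "j = Suc (r' + Suc (j - r - 1))" "j - r - 1 < d" using j r' by auto
      then show ?thesis using de[of "j - r - 1"] pe[of "r' + Suc (j - r - 1)"] by (simp only:)
    qed
    have "entry ns (r' + Suc d) \<le> v" unfolding v_def by (rule mono) simp
    hence lt: "pm ns (r + d + 1) < v" using dl pe[of "r' + Suc d"] by (simp add: r')
    from run[OF d0 eq lt] br have "bad v" "odd d" by auto
    moreover have "pm ns (r + 1) = v" using e1 pe[of "Suc r'"] by (simp add: r')
    moreover have "pm ns r = v" by (simp add: r' pe v_def)
    moreover have "property_P r ns" unfolding property_P_def
      by (rule exI[of _ d]) (use \<open>odd d\<close> eq lt eq[of r] eq[of "r + d"] in simp)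
    ultimately show "bad (pm ns (r + 1)) \<and> property_P r ns" by simp
  next
    assume a: "bad (pm ns (r + 1)) \<and> property_P r ns"
    then obtain d where d: "odd d" "\<forall>j\<in>{r..r + d}. pm ns j = pm ns r" "pm ns (r + d + 1) < pm ns (r + d)"
      unfolding property_P_def by (elim conjE exE) (rule that)
    have d0: "0 < d" using d(1) by (cases d) auto
    have pr: "pm ns r = v" by (simp add: r' pe v_def)
    have eq: "pm ns j = v" if "j \<in> {r..r + d}" for j using d(2) that pr by simp
    have "pm ns (r + 1) = v" by (rule eq) (use d0 in auto)
    moreover have "pm ns (r + d) = v" by (rule eq) simp
    ultimately show "b r" using run[OF d0 eq] d(1,3) a by simp
  qed
qed

section \<open>The set of perturbations\<close>

definition pair_pencil :: "pencil_structure \<Rightarrow> complex vec \<Rightarrow> complex vec \<Rightarrow> complex vec \<Rightarrow> pencil" where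
  "pair_pencil st v g d = (outer v g + ssign st \<cdot>\<^sub>m outer d v, outer v d + ssign st \<cdot>\<^sub>m outer g v)"

text \<open>The perturbations with parameter \<open>r\<close>, built by adding one pair at a time.  The parameters \<open>v\<close>, \<open>\<gamma>\<close> and \<open>\<delta>\<close> are kept out
of the way, which makes it plain that the set is invariant under reversal and congruence.\<close>

inductive perturbation :: "pencil_structure \<Rightarrow> nat \<Rightarrow> nat \<Rightarrow> pencil \<Rightarrow> bool" for st n where
  zero: "perturbation st n 0 (0\<^sub>m n n, 0\<^sub>m n n)"
| rank1: "u \<in> carrier_vec n \<Longrightarrow> perturbation st n 1 (rank1 st u)"
| pair: "perturbation st n r E \<Longrightarrow> v \<in> carrier_vec n \<Longrightarrow> g \<in> carrier_vec n \<Longrightarrow> d \<in> carrier_vec n \<Longrightarrow>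
    perturbation st n (Suc (Suc r)) (pencil_add E (pair_pencil st v g d))"

lemma pencil_eqI:
  assumes "L \<in> pencil_carrier n" "E \<in> pencil_carrier n"
    and "\<And>i j. i < n \<Longrightarrow> j < n \<Longrightarrow> fst L $$ (i, j) = fst E $$ (i, j)"
    and "\<And>i j. i < n \<Longrightarrow> j < n \<Longrightarrow> snd L $$ (i, j) = snd E $$ (i, j)"
  shows "L = E"
  using assms by (auto simp: pencil_carrier_def intro!: prod_eqI eq_matI)

lemma pencil_add_index:
  assumes "L \<in> pencil_carrier n" "E \<in> pencil_carrier n" "i < n" "j < n"
  shows "fst (pencil_add L E) $$ (i, j) = fst L $$ (i, j) + fst E $$ (i, j)"
    "snd (pencil_add L E) $$ (i, j) = snd L $$ (i, j) + snd E $$ (i, j)"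
  using assms by (auto simp: pencil_carrier_def pencil_add_def)

lemma pencil_add_assoc:
  "L \<in> pencil_carrier n \<Longrightarrow> E \<in> pencil_carrier n \<Longrightarrow> F \<in> pencil_carrier n \<Longrightarrow>
    pencil_add (pencil_add L E) F = pencil_add L (pencil_add E F)"
  by (rule pencil_eqI[of _ n]) (simp_all add: pencil_add_index[of _ n] add.assoc)

lemma pencil_add_commute:
  "L \<in> pencil_carrier n \<Longrightarrow> E \<in> pencil_carrier n \<Longrightarrow> pencil_add L E = pencil_add E L"
  by (rule pencil_eqI[of _ n]) (simp_all add: pencil_add_index[of _ n] add.commute)

lemma zero_pencil_carrier [simp]: "(0\<^sub>m n n, 0\<^sub>m n n) \<in> pencil_carrier n"
  by (simp add: pencil_carrier_def)

lemma pencil_add_zero: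
  assumes "L \<in> pencil_carrier n"
  shows "pencil_add (0\<^sub>m n n, 0\<^sub>m n n) L = L" "pencil_add L (0\<^sub>m n n, 0\<^sub>m n n) = L"
  by (rule pencil_eqI[of _ n]; use assms in \<open>simp add: pencil_add_index[of _ n]\<close>)+

lemma rank1_index:
  assumes "u \<in> carrier_vec n" "i < n" "j < n"
  shows "fst (rank1 st u) $$ (i, j) = u $ i * u $ j" "snd (rank1 st u) $$ (i, j) = ssign st * (u $ i * u $ j)"
  using assms by (auto simp: rank1_def)

lemma pair_pencil_carrier [simp]:
  "v \<in> carrier_vec n \<Longrightarrow> g \<in> carrier_vec n \<Longrightarrow> d \<in> carrier_vec n \<Longrightarrow> pair_pencil st v g d \<in> pencil_carrier n"
  by (auto simp: pair_pencil_def pencil_carrier_def)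

lemma pair_pencil_index:
  assumes "v \<in> carrier_vec n" "g \<in> carrier_vec n" "d \<in> carrier_vec n" "i < n" "j < n"
  shows "fst (pair_pencil st v g d) $$ (i, j) = v $ i * g $ j + ssign st * (d $ i * v $ j)"
    "snd (pair_pencil st v g d) $$ (i, j) = v $ i * d $ j + ssign st * (g $ i * v $ j)"
  using assms by (auto simp: pair_pencil_def)

lemma structure_pair:
  "v \<in> carrier_vec n \<Longrightarrow> g \<in> carrier_vec n \<Longrightarrow> d \<in> carrier_vec n \<Longrightarrow> has_structure st (pair_pencil st v g d)"
  by (rule structureI[of _ n]) (simp_all add: pair_pencil_index[of _ n] algebra_simps)

lemma perturbation_carrier: "perturbation st n r E \<Longrightarrow> E \<in> pencil_carrier n"
  by (induction rule: perturbation.induct) auto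

lemma perturbation_structure: "perturbation st n r E \<Longrightarrow> has_structure st E"
proof (induction rule: perturbation.induct)
  case zero
  show ?case by (rule structureI[of _ n]) (auto simp: pencil_carrier_def)
next
  case (rank1 u)
  then show ?case by (rule structure_rank1)
next
  case (pair r E v g d)
  then show ?case by (intro structure_add[of _ n] structure_pair perturbation_carrier[OF pair(1)] pair_pencil_carrier)
qed

text \<open>Over the complex numbers a sum of two squares is a product: \<open>u u\<^sup>T + w w\<^sup>T\<close> is the symmetric part of
  \<open>(u + \<i> w) (u - \<i> w)\<^sup>T\<close>.\<close>

lemma two_rank1:
  assumes "u \<in> carrier_vec n" "w \<in> carrier_vec n"
  shows "pencil_add (rank1 st u) (rank1 st w) =
    pair_pencil st (u + \<i> \<cdot>\<^sub>v w) ((1 / 2) \<cdot>\<^sub>v (u - \<i> \<cdot>\<^sub>v w)) ((ssign st / 2) \<cdot>\<^sub>v (u - \<i> \<cdot>\<^sub>v w))"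
proof -
  have k: "a * b + p * q = (a + \<i> * p) * (1 / 2 * (b - \<i> * q)) + ssign st * (ssign st / 2 * (a - \<i> * p) * (b + \<i> * q))"
    "ssign st * (a * b) + ssign st * (p * q) =
      (a + \<i> * p) * (ssign st / 2 * (b - \<i> * q)) + ssign st * (1 / 2 * (a - \<i> * p) * (b + \<i> * q))" for a b p q
    by (cases st; simp add: field_simps)+
  show ?thesis
  proof (rule pencil_eqI[of _ n])
    fix i j assume ij: "i < n" "j < n"
    note c = assms ij
    show "fst (pencil_add (rank1 st u) (rank1 st w)) $$ (i, j) = fst (pair_pencil st (u + \<i> \<cdot>\<^sub>v w)
        ((1 / 2) \<cdot>\<^sub>v (u - \<i> \<cdot>\<^sub>v w)) ((ssign st / 2) \<cdot>\<^sub>v (u - \<i> \<cdot>\<^sub>v w))) $$ (i, j)"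
      "snd (pencil_add (rank1 st u) (rank1 st w)) $$ (i, j) = snd (pair_pencil st (u + \<i> \<cdot>\<^sub>v w)
        ((1 / 2) \<cdot>\<^sub>v (u - \<i> \<cdot>\<^sub>v w)) ((ssign st / 2) \<cdot>\<^sub>v (u - \<i> \<cdot>\<^sub>v w))) $$ (i, j)"
      using k[of "u $ i" "u $ j" "w $ i" "w $ j"] c
      by (simp_all only: pencil_add_index[OF rank1_carrier[OF c(1)] rank1_carrier[OF c(2)] ij] rank1_index[OF c(1) ij] rank1_index[OF c(2) ij])
        (subst pair_pencil_index[of _ n]; simp)+
  qed (use assms in auto)
qed

lemma perturbation_add_rank1:
  "perturbation st n r E \<Longrightarrow> u \<in> carrier_vec n \<Longrightarrow> perturbation st n (Suc r) (pencil_add E (rank1 st u))"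
proof (induction rule: perturbation.induct)
  case zero
  then show ?case using perturbation.rank1[of u n st] pencil_add_zero(1)[OF rank1_carrier[of u n st]] by simp
next
  case (rank1 w)
  have "perturbation st n (Suc (Suc 0)) (pencil_add (0\<^sub>m n n, 0\<^sub>m n n) (pencil_add (rank1 st w) (rank1 st u)))"
    unfolding two_rank1[OF rank1] by (rule perturbation.pair[OF perturbation.zero]) (use rank1 in auto)
  then show ?case using pencil_add_zero(1)[OF pencil_add_carrier[OF rank1_carrier rank1_carrier, OF rank1]] by simp
next
  case (pair r E v g d)
  note E = perturbation_carrier[OF pair(1)]
  have "pencil_add (pencil_add E (pair_pencil st v g d)) (rank1 st u) =
      pencil_add (pencil_add E (rank1 st u)) (pair_pencil st v g d)"
    using pencil_add_assoc[OF E pair_pencil_carrier rank1_carrier, OF pair(2-4,6)]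
      pencil_add_assoc[OF E rank1_carrier pair_pencil_carrier, OF pair(6,2-4)]
      pencil_add_commute[OF pair_pencil_carrier rank1_carrier, OF pair(2-4,6)] by simp
  then show ?case using perturbation.pair[OF pair(5)[OF pair(6)] pair(2-4)] by simp
qed

lemma perturbation_Suc: "perturbation st n r E \<Longrightarrow> perturbation st n (Suc r) E"
proof -
  assume E: "perturbation st n r E"
  have "rank1 st (0\<^sub>v n) = (0\<^sub>m n n, 0\<^sub>m n n)"
    by (rule pencil_eqI[of _ n]) (simp_all add: rank1_index[of _ n] rank1_carrier)
  then show ?thesis using perturbation_add_rank1[OF E zero_carrier_vec] pencil_add_zero(2)[OF perturbation_carrier[OF E]] by simp
qed

lemma perturbation_mono: "perturbation st n q E \<Longrightarrow> q \<le> r \<Longrightarrow> perturbation st n r E"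
  by (induction r) (auto simp: le_Suc_eq intro: perturbation_Suc)

lemma perturbation_foldr_rank1:
  assumes L: "L \<in> pencil_carrier n"
  shows "set us \<subseteq> carrier_vec n \<Longrightarrow>
    \<exists>E. perturbation st n (length us) E \<and> foldr (\<lambda>u E. pencil_add E (rank1 st u)) us L = pencil_add L E"
proof (induction us)
  case Nil
  show ?case using perturbation.zero pencil_add_zero(2)[OF L] by (intro exI[of _ "(0\<^sub>m n n, 0\<^sub>m n n)"]) simp
next
  case (Cons u us)
  then obtain E where E: "perturbation st n (length us) E" "foldr (\<lambda>u E. pencil_add E (rank1 st u)) us L = pencil_add L E"
    by auto
  have u: "u \<in> carrier_vec n" using Cons by simp
  show ?case using perturbation_add_rank1[OF E(1) u] E(2) pencil_add_assoc[OF L perturbation_carrier[OF E(1)] rank1_carrier[OF u]]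
    by (intro exI[of _ "pencil_add E (rank1 st u)"]) simp
qed

text \<open>Infinity can thus be treated as the point \<open>0\<close> of the reversed pencil.  The square root absorbs the sign in
\<open>\<lambda> + c = c (1 + c \<lambda>)\<close>.\<close>

lemma perturbation_rev: "perturbation st n r E \<Longrightarrow> perturbation st n r (pencil_rev E)"
proof (induction rule: perturbation.induct)
  case zero
  show ?case using perturbation.zero by (simp add: pencil_rev_def)
next
  case (rank1 u)
  have c: "csqrt (ssign st) * (csqrt (ssign st) * y) = ssign st * y" for y
    using power2_csqrt[of "ssign st"] by (simp add: power2_eq_square flip: mult.assoc)
  have cu: "csqrt (ssign st) \<cdot>\<^sub>v u \<in> carrier_vec n" using rank1 by simp
  have e: "csqrt (ssign st) * a * (csqrt (ssign st) * b) = ssign st * (a * b)" for a b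
    using c[of "a * b"] by (simp only: mult_ac)
  have i': "(csqrt (ssign st) \<cdot>\<^sub>v u) $ i = csqrt (ssign st) * u $ i" if "i < n" for i using rank1 that by simp
  have "pencil_rev (rank1 st u) = rank1 st (csqrt (ssign st) \<cdot>\<^sub>v u)"
  proof (rule pencil_eqI[of _ n])
    fix i j assume ij: "i < n" "j < n"
    show "fst (pencil_rev (rank1 st u)) $$ (i, j) = fst (rank1 st (csqrt (ssign st) \<cdot>\<^sub>v u)) $$ (i, j)"
      "snd (pencil_rev (rank1 st u)) $$ (i, j) = snd (rank1 st (csqrt (ssign st) \<cdot>\<^sub>v u)) $$ (i, j)"
      unfolding pencil_rev_def fst_conv snd_conv rank1_index[OF cu ij] rank1_index[OF rank1 ij] i'[OF ij(1)] i'[OF ij(2)] e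
      by simp_all
  qed (use rank1 cu in auto)
  then show ?case using perturbation.rank1[of "csqrt (ssign st) \<cdot>\<^sub>v u" n st] rank1 by simp
next
  case (pair r E v g d)
  have "pencil_rev (pencil_add E (pair_pencil st v g d)) = pencil_add (pencil_rev E) (pair_pencil st v d g)"
    by (simp add: pencil_rev_def pencil_add_def pair_pencil_def)
  then show ?case using perturbation.pair[OF pair(5) pair(2,4,3)] by simp
qed

lemma outer_congruence:
  assumes X: "(X :: complex mat) \<in> carrier_mat n n" and v: "v \<in> carrier_vec n" "w \<in> carrier_vec n" and ij: "i < n" "j < n"
  shows "(X\<^sup>T * outer v w * X) $$ (i, j) = (X\<^sup>T *\<^sub>v v) $ i * (X\<^sup>T *\<^sub>v w) $ j"
proof -
  have "(X\<^sup>T *\<^sub>v v) $ i * (X\<^sup>T *\<^sub>v w) $ j = (\<Sum>k = 0..<n. \<Sum>l = 0..<n. (X $$ (k, i) * v $ k) * (X $$ (l, j) * w $ l))"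
    unfolding sum_product[symmetric] using X v ij by (simp add: mult_mat_vec_entry[of _ n n] del: index_mult_mat_vec cong: sum.cong_simp)
  also have "\<dots> = (\<Sum>l = 0..<n. \<Sum>k = 0..<n. X $$ (k, i) * outer v w $$ (k, l) * X $$ (l, j))"
    by (subst sum.swap, intro sum.cong refl) (use v in \<open>simp add: mult_ac\<close>)
  finally show ?thesis unfolding congruence_entry[OF X outer_carrier[OF v] ij] by simp
qed

lemma congruence_index:
  assumes X: "X \<in> carrier_mat n n" and L: "L \<in> pencil_carrier n" and ij: "i < n" "j < n"
  shows "fst (congruence X L) $$ (i, j) = (\<Sum>l = 0..<n. \<Sum>k = 0..<n. X $$ (k, i) * fst L $$ (k, l) * X $$ (l, j))"
    "snd (congruence X L) $$ (i, j) = (\<Sum>l = 0..<n. \<Sum>k = 0..<n. X $$ (k, i) * snd L $$ (k, l) * X $$ (l, j))"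
  using congruence_entry[OF X _ ij, of "fst L"] congruence_entry[OF X _ ij, of "snd L"] L
  by (auto simp: congruence_def pencil_carrier_def)

lemma congruence_add:
  assumes X: "X \<in> carrier_mat n n" and L: "L \<in> pencil_carrier n" and E: "E \<in> pencil_carrier n"
  shows "congruence X (pencil_add L E) = pencil_add (congruence X L) (congruence X E)"
proof (rule pencil_eqI[of _ n])
  fix i j assume ij: "i < n" "j < n"
  have "a * (b + c) * d = a * b * d + a * c * d" for a b c d :: complex by (simp add: algebra_simps)
  then show "fst (congruence X (pencil_add L E)) $$ (i, j) = fst (pencil_add (congruence X L) (congruence X E)) $$ (i, j)"
    "snd (congruence X (pencil_add L E)) $$ (i, j) = snd (pencil_add (congruence X L) (congruence X E)) $$ (i, j)"
    unfolding pencil_add_index[OF congruence_carrier[OF X L] congruence_carrier[OF X E] ij] congruence_index[OF X L ij]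
      congruence_index[OF X E ij] congruence_index[OF X pencil_add_carrier[OF L E] ij] sum.distrib[symmetric]
    by (intro sum.cong refl; simp add: pencil_add_index[OF L E])+
qed (use assms in auto)

lemma congruence_bilinear:
  assumes X: "(X :: complex mat) \<in> carrier_mat n n" and v: "v \<in> carrier_vec n" "w \<in> carrier_vec n" and ij: "i < n" "j < n"
  shows "(\<Sum>l = 0..<n. \<Sum>k = 0..<n. X $$ (k, i) * (v $ k * w $ l) * X $$ (l, j)) = (X\<^sup>T *\<^sub>v v) $ i * (X\<^sup>T *\<^sub>v w) $ j"
  using outer_congruence[OF assms] unfolding congruence_entry[OF X outer_carrier[OF v] ij]
  using v by (simp cong: sum.cong_simp)

lemma perturbation_congruence:
  assumes X: "X \<in> carrier_mat n n"
  shows "perturbation st n r E \<Longrightarrow> perturbation st n r (congruence X E)"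
proof (induction rule: perturbation.induct)
  case zero
  have "congruence X (0\<^sub>m n n, 0\<^sub>m n n) = (0\<^sub>m n n, 0\<^sub>m n n)"
    by (rule pencil_eqI[of _ n]) (use X in \<open>simp_all add: congruence_index[of _ n] cong: sum.cong_simp\<close>)
  then show ?case using perturbation.zero by simp
next
  case (rank1 u)
  have Xu: "X\<^sup>T *\<^sub>v u \<in> carrier_vec n" using X rank1 by (intro mult_mat_vec_carrier[of _ n n]) auto
  have "congruence X (rank1 st u) = rank1 st (X\<^sup>T *\<^sub>v u)"
  proof (rule pencil_eqI[of _ n])
    fix i j assume ij: "i < n" "j < n"
    note b = congruence_bilinear[OF X rank1 rank1 ij]
    show "fst (congruence X (rank1 st u)) $$ (i, j) = fst (rank1 st (X\<^sup>T *\<^sub>v u)) $$ (i, j)"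
      using b by (simp only: rank1_index[OF Xu ij] congruence_index[OF X rank1_carrier[OF rank1] ij])
        (simp add: rank1_index[OF rank1] cong: sum.cong_simp)
    have "(\<Sum>l = 0..<n. \<Sum>k = 0..<n. X $$ (k, i) * (ssign st * (u $ k * u $ l)) * X $$ (l, j)) =
        ssign st * (\<Sum>l = 0..<n. \<Sum>k = 0..<n. X $$ (k, i) * (u $ k * u $ l) * X $$ (l, j))"
      by (simp add: sum_distrib_left mult_ac)
    then show "snd (congruence X (rank1 st u)) $$ (i, j) = snd (rank1 st (X\<^sup>T *\<^sub>v u)) $$ (i, j)"
      unfolding b by (simp only: rank1_index[OF Xu ij] congruence_index[OF X rank1_carrier[OF rank1] ij])
        (simp add: rank1_index[OF rank1] cong: sum.cong_simp)
  qed (use X rank1 Xu in auto)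
  then show ?case using perturbation.rank1[OF Xu] by simp
next
  case (pair r E v g d)
  have Xu: "X\<^sup>T *\<^sub>v u \<in> carrier_vec n" if "u \<in> carrier_vec n" for u using X that by (intro mult_mat_vec_carrier[of _ n n]) auto
  note c = pair(2-4) note Xc = Xu[OF c(1)] Xu[OF c(2)] Xu[OF c(3)]
  have sumsplit: "(\<Sum>l = 0..<n. \<Sum>k = 0..<n. X $$ (k, i) * (v $ k * a $ l + ssign st * (b $ k * v $ l)) * X $$ (l, j)) =
      (X\<^sup>T *\<^sub>v v) $ i * (X\<^sup>T *\<^sub>v a) $ j + ssign st * ((X\<^sup>T *\<^sub>v b) $ i * (X\<^sup>T *\<^sub>v v) $ j)"
    if "a \<in> carrier_vec n" "b \<in> carrier_vec n" "i < n" "j < n" for a b i j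
    unfolding congruence_bilinear[OF X c(1) that(1,3,4), symmetric] congruence_bilinear[OF X that(2) c(1) that(3,4), symmetric]
    by (simp add: sum_distrib_left sum.distrib algebra_simps)
  have p: "congruence X (pair_pencil st v g d) = pair_pencil st (X\<^sup>T *\<^sub>v v) (X\<^sup>T *\<^sub>v g) (X\<^sup>T *\<^sub>v d)"
  proof (rule pencil_eqI[of _ n])
    fix i j assume ij: "i < n" "j < n"
    show "fst (congruence X (pair_pencil st v g d)) $$ (i, j) = fst (pair_pencil st (X\<^sup>T *\<^sub>v v) (X\<^sup>T *\<^sub>v g) (X\<^sup>T *\<^sub>v d)) $$ (i, j)"
      using sumsplit[OF c(2,3) ij] by (simp only: pair_pencil_index[OF Xc ij] congruence_index[OF X pair_pencil_carrier[OF c] ij])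
        (simp add: pair_pencil_index[OF c] cong: sum.cong_simp)
    show "snd (congruence X (pair_pencil st v g d)) $$ (i, j) = snd (pair_pencil st (X\<^sup>T *\<^sub>v v) (X\<^sup>T *\<^sub>v g) (X\<^sup>T *\<^sub>v d)) $$ (i, j)"
      using sumsplit[OF c(3,2) ij] by (simp only: pair_pencil_index[OF Xc ij] congruence_index[OF X pair_pencil_carrier[OF c] ij])
        (simp add: pair_pencil_index[OF c] cong: sum.cong_simp)
  qed (use X c Xc in auto)
  show ?case unfolding congruence_add[OF X perturbation_carrier[OF pair(1)] pair_pencil_carrier[OF c]] p
    by (rule perturbation.pair[OF pair(5) Xc])
qed

text \<open>A perturbation is a sum of \<open>r\<close> polynomial matrices of rank one, and the one that appears for odd \<open>r\<close> vanishes
  at \<open>- ssign st\<close>.\<close>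

lemma pmat_add_pair:
  assumes L: "L \<in> pencil_carrier n" and c: "v \<in> carrier_vec n" "g \<in> carrier_vec n" "d \<in> carrier_vec n"
  shows "pmat n (pencil_add L (pair_pencil st v g d)) =
    pmat n L + outer (liftv v) (vec n (\<lambda>i. [:g $ i, d $ i:])) + outer (vec n (\<lambda>i. [:ssign st * d $ i, ssign st * g $ i:])) (liftv v)"
  (is "_ = ?R")
proof (rule eq_matI)
  show "pmat n (pencil_add L (pair_pencil st v g d)) $$ (i, j) = ?R $$ (i, j)" if "i < dim_row ?R" "j < dim_col ?R" for i j
    using that assms by (simp add: pencil_add_index[of _ n] pair_pencil_index[of _ n] mult.commute)
qed (use c in auto)

lemma chains_perturbation:
  "perturbation st n r E \<Longrightarrow> L \<in> pencil_carrier n \<Longrightarrow> chains n (q + r) k (pmat n L) x \<Longrightarrow>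
    chains n q k (pmat n (pencil_add L E)) x"
proof (induction arbitrary: q rule: perturbation.induct)
  case zero
  then show ?case by (simp add: pencil_add_zero)
next
  case (rank1 u)
  then show ?case unfolding pmat_add_rank1[OF rank1(2,1)]
    by (intro chains_add_outer[of _ n]) auto
next
  case (pair r E v g d)
  note E = perturbation_carrier[OF pair(1)]
  have "chains n (Suc (Suc q)) k (pmat n (pencil_add L E)) x"
    using pair(5)[OF pair(6), of "Suc (Suc q)"] pair(7) by simp
  then show ?case
    unfolding pencil_add_assoc[OF pair(6) E pair_pencil_carrier[OF pair(2-4)], symmetric]
      pmat_add_pair[OF pencil_add_carrier[OF pair(6) E] pair(2-4)]
    by (intro chains_add_outer[of _ n] add_carrier_mat) (use pair(2-4) in auto)
qed

lemma chains_perturbation_vanishing: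
  "perturbation st n r E \<Longrightarrow> L \<in> pencil_carrier n \<Longrightarrow> x = - ssign st \<Longrightarrow> chains n (q + 2 * (r div 2)) 1 (pmat n L) x \<Longrightarrow>
    chains n q 1 (pmat n (pencil_add L E)) x"
proof (induction arbitrary: q rule: perturbation.induct)
  case zero
  then show ?case by (simp add: pencil_add_zero)
next
  case (rank1 u)
  have c: "chains n q 1 (pmat n L) x" using rank1 by simp
  show ?case unfolding pmat_add_rank1[OF rank1(2,1)]
    by (rule chains_add_outer_vanishing[OF pmat_carrier _ _ c]) (use rank1 in auto)
next
  case (pair r E v g d)
  note E = perturbation_carrier[OF pair(1)]
  have "chains n (Suc (Suc q)) 1 (pmat n (pencil_add L E)) x"
    using pair(5)[OF pair(6,7), of "Suc (Suc q)"] pair(8) by simp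
  then show ?case
    unfolding pencil_add_assoc[OF pair(6) E pair_pencil_carrier[OF pair(2-4)], symmetric]
      pmat_add_pair[OF pencil_add_carrier[OF pair(6) E] pair(2-4)]
    by (intro chains_add_outer[of _ n] add_carrier_mat) (use pair(2-4) in auto)
qed

definition odd_term :: "pencil_structure \<Rightarrow> nat \<Rightarrow> nat \<Rightarrow> complex vec \<Rightarrow> pencil" where
  "odd_term st n r u = (if odd r then rank1 st u else (0\<^sub>m n n, 0\<^sub>m n n))"

primrec pair_sum :: "pencil_structure \<Rightarrow> pencil \<Rightarrow> (nat \<Rightarrow> complex vec) \<Rightarrow> (nat \<Rightarrow> complex vec) \<Rightarrow> (nat \<Rightarrow> complex vec) \<Rightarrow>
  nat \<Rightarrow> pencil" where
  "pair_sum st U v g d 0 = U"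
| "pair_sum st U v g d (Suc k) = pencil_add (pair_sum st U v g d k) (pair_pencil st (v k) (g k) (d k))"

lemma odd_term_carrier [simp]: "u \<in> carrier_vec n \<Longrightarrow> odd_term st n r u \<in> pencil_carrier n"
  by (simp add: odd_term_def)

lemma perturbation_pair_sum:
  assumes "u \<in> carrier_vec n" "\<And>j. v j \<in> carrier_vec n" "\<And>j. g j \<in> carrier_vec n" "\<And>j. d j \<in> carrier_vec n"
  shows "perturbation st n (2 * k + r mod 2) (pair_sum st (odd_term st n r u) v g d k)"
proof (induction k)
  case 0
  show ?case using perturbation.zero perturbation.rank1[OF assms(1)] by (cases "odd r") (auto simp: odd_term_def odd_iff_mod_2_eq_one)
next
  case (Suc k)
  then show ?case using perturbation.pair[OF Suc assms(2-4)] by simp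
qed

lemma pair_sum_cong:
  "(\<And>j. j < k \<Longrightarrow> v j = v' j \<and> g j = g' j \<and> d j = d' j) \<Longrightarrow> pair_sum st U v g d k = pair_sum st U v' g' d' k"
  by (induction k) auto

lemma perturbation_pair_sumE:
  "perturbation st n r E \<Longrightarrow> \<exists>u v g d. u \<in> carrier_vec n \<and> (\<forall>j. v j \<in> carrier_vec n \<and> g j \<in> carrier_vec n \<and> d j \<in> carrier_vec n) \<and>
    E = pair_sum st (odd_term st n r u) v g d (r div 2)"
proof (induction rule: perturbation.induct)
  case zero
  show ?case by (rule exI[of _ "0\<^sub>v n"], rule exI[of _ "\<lambda>_. 0\<^sub>v n"], rule exI[of _ "\<lambda>_. 0\<^sub>v n"], rule exI[of _ "\<lambda>_. 0\<^sub>v n"])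
    (simp add: odd_term_def)
next
  case (rank1 u)
  then show ?case by (intro exI[of _ u], rule_tac exI[of _ "\<lambda>_. 0\<^sub>v n"], rule_tac exI[of _ "\<lambda>_. 0\<^sub>v n"], rule_tac exI[of _ "\<lambda>_. 0\<^sub>v n"])
    (simp add: odd_term_def)
next
  case (pair r E a b c)
  from pair(5) obtain u v g d where h: "u \<in> carrier_vec n" "\<forall>j. v j \<in> carrier_vec n \<and> g j \<in> carrier_vec n \<and> d j \<in> carrier_vec n"
    "E = pair_sum st (odd_term st n r u) v g d (r div 2)" by (elim exE conjE) (rule that)
  let ?s = "r div 2"
  have "pair_sum st (odd_term st n r u) (v(?s := a)) (g(?s := b)) (d(?s := c)) ?s = E"
    unfolding h(3) by (rule pair_sum_cong) simp
  then have "pencil_add E (pair_pencil st a b c) =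
      pair_sum st (odd_term st n (Suc (Suc r)) u) (v(?s := a)) (g(?s := b)) (d(?s := c)) (Suc (Suc r) div 2)"
    by (simp only: div2_Suc_Suc pair_sum.simps fun_upd_same odd_term_def even_Suc not_not)
  moreover have "\<forall>j. (v(?s := a)) j \<in> carrier_vec n \<and> (g(?s := b)) j \<in> carrier_vec n \<and> (d(?s := c)) j \<in> carrier_vec n"
    using h(2) pair(2-4) by simp
  ultimately show ?case using h(1) by (intro exI conjI)
qed

lemma vec_block_carrier [simp]: "vec_block n x k \<in> carrier_vec n"
  by (simp add: vec_block_def)

lemma Phi_eq_pair_sum:
  "Phi st n r x = pair_sum st (odd_term st n r (vec_block n x (3 * (r div 2)))) (vec_block n x)
    (\<lambda>j. vec_block n x (r div 2 + j)) (\<lambda>j. vec_block n x (2 * (r div 2) + j)) (r div 2)"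
proof -
  let ?U = "odd_term st n r (vec_block n x (3 * (r div 2)))"
  let ?g = "\<lambda>j. vec_block n x (r div 2 + j)" and ?d = "\<lambda>j. vec_block n x (2 * (r div 2) + j)"
  have c: "pair_sum st ?U (vec_block n x) ?g ?d k \<in> pencil_carrier n" for k
    by (induction k) auto
  have i: "fst (pair_sum st ?U (vec_block n x) ?g ?d k) $$ (a, b) = fst ?U $$ (a, b) +
      (\<Sum>j<k. vec_block n x j $ a * ?g j $ b + ssign st * (?d j $ a * vec_block n x j $ b))"
    "snd (pair_sum st ?U (vec_block n x) ?g ?d k) $$ (a, b) = snd ?U $$ (a, b) +
      (\<Sum>j<k. vec_block n x j $ a * ?d j $ b + ssign st * (?g j $ a * vec_block n x j $ b))" if "a < n" "b < n" for a b k
    by (induction k) (simp_all add: pencil_add_index[OF c pair_pencil_carrier that] pair_pencil_index[of _ n] that)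
  have P: "Phi st n r x \<in> pencil_carrier n" by (simp add: Phi_def Let_def pencil_carrier_def)
  show ?thesis
  proof (rule pencil_eqI[OF P c])
    fix a b assume ab: "a < n" "b < n"
    show "fst (Phi st n r x) $$ (a, b) = fst (pair_sum st ?U (vec_block n x) ?g ?d (r div 2)) $$ (a, b)"
      "snd (Phi st n r x) $$ (a, b) = snd (pair_sum st ?U (vec_block n x) ?g ?d (r div 2)) $$ (a, b)"
      unfolding i[OF ab] using ab by (simp_all add: Phi_def Let_def odd_term_def rank1_index[of _ n] add.commute)
  qed
qed

lemma exists_blocks:
  fixes b :: "nat \<Rightarrow> complex vec"
  obtains x where "x \<in> carrier_vec (N * n)" "\<And>k i. k < N \<Longrightarrow> i < n \<Longrightarrow> vec_block n x k $ i = b k $ i"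
proof
  let ?x = "vec (N * n) (\<lambda>i. b (i div n) $ (i mod n))"
  show "?x \<in> carrier_vec (N * n)" by simp
  fix k i assume ki: "k < N" "i < n"
  have "k * n + i < Suc k * n" using ki by simp
  also have "\<dots> \<le> N * n" using ki by (intro mult_right_mono) auto
  finally show "vec_block n ?x k $ i = b k $ i" using ki by (simp add: vec_block_def)
qed

lemma block_count: "(3 * r) div 2 = 3 * (r div 2) + r mod (2 :: nat)"
  by presburger

lemma perturbation_iff_Phi: "perturbation st n r E \<longleftrightarrow> E \<in> Phi st n r ` carrier_vec ((3 * r) div 2 * n)"
proof
  assume "E \<in> Phi st n r ` carrier_vec ((3 * r) div 2 * n)"
  then obtain x where E: "E = Phi st n r x" by blast
  have "2 * (r div 2) + r mod 2 = r" by simp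
  then show "perturbation st n r E" unfolding E Phi_eq_pair_sum
    using perturbation_pair_sum[of "vec_block n x (3 * (r div 2))" n "vec_block n x" "\<lambda>j. vec_block n x (r div 2 + j)"
        "\<lambda>j. vec_block n x (2 * (r div 2) + j)" st "r div 2" r] by simp
next
  let ?s = "r div 2"
  assume "perturbation st n r E"
  from perturbation_pair_sumE[OF this] obtain u v g d where h: "u \<in> carrier_vec n"
    "\<forall>j. v j \<in> carrier_vec n \<and> g j \<in> carrier_vec n \<and> d j \<in> carrier_vec n"
    "E = pair_sum st (odd_term st n r u) v g d ?s" by (elim exE conjE) (rule that)
  define b where "b k = (if k < ?s then v k else if k < 2 * ?s then g (k - ?s) else if k < 3 * ?s then d (k - 2 * ?s) else u)" for k
  obtain x where x: "x \<in> carrier_vec ((3 * r) div 2 * n)" "\<And>k i. k < (3 * r) div 2 \<Longrightarrow> i < n \<Longrightarrow> vec_block n x k $ i = b k $ i"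
    using exists_blocks[of "(3 * r) div 2" n b] by blast
  have bc: "b k \<in> carrier_vec n" for k using h(1,2) by (simp add: b_def)
  have bl: "vec_block n x k = b k" if "k < (3 * r) div 2" for k
    by (rule eq_vecI) (use x(2)[OF that] bc[of k] in \<open>auto simp: vec_block_def\<close>)
  have le: "3 * ?s \<le> (3 * r) div 2" "odd r \<Longrightarrow> 3 * ?s < (3 * r) div 2" unfolding block_count by (auto simp: odd_iff_mod_2_eq_one)
  have "odd_term st n r (vec_block n x (3 * ?s)) = odd_term st n r u"
    using bl[of "3 * ?s"] le by (auto simp: odd_term_def b_def)
  moreover have "pair_sum st U (vec_block n x) (\<lambda>j. vec_block n x (?s + j)) (\<lambda>j. vec_block n x (2 * ?s + j)) ?s = pair_sum st U v g d ?s" for U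
    by (rule pair_sum_cong) (use le in \<open>simp add: bl b_def\<close>)
  ultimately have "Phi st n r x = E" unfolding Phi_eq_pair_sum h(3) by simp
  then show "E \<in> Phi st n r ` carrier_vec ((3 * r) div 2 * n)" using x(1) by blast
qed

lemma polynomial_function_Phi:
  assumes ab: "a < n" "b < n"
  shows "polynomial_function ((3 * r) div 2 * n) (\<lambda>x. fst (Phi st n r x) $$ (a, b))"
    "polynomial_function ((3 * r) div 2 * n) (\<lambda>x. snd (Phi st n r x) $$ (a, b))"
proof -
  have k: "k * n + i < (3 * r) div 2 * n" if "k < (3 * r) div 2" "i < n" for k i
  proof -
    have "k * n + i < Suc k * n" using that by simp
    also have "\<dots> \<le> (3 * r) div 2 * n" using that by (intro mult_right_mono) auto
    finally show ?thesis .
  qed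
  have p: "polynomial_function ((3 * r) div 2 * n) (\<lambda>x. vec_block n x k $ i)" if "k < (3 * r) div 2" "i < n" for k i
    using polynomial_function_coord[OF k[OF that]] that by (simp add: vec_block_def)
  have le: "3 * (r div 2) \<le> (3 * r) div 2" "odd r \<Longrightarrow> 3 * (r div 2) < (3 * r) div 2" unfolding block_count by (auto simp: odd_iff_mod_2_eq_one)
  have u1: "polynomial_function ((3 * r) div 2 * n) (\<lambda>x. if odd r then vec_block n x (3 * (r div 2)) $ a * vec_block n x (3 * (r div 2)) $ b else 0)"
    by (cases "odd r") (use le in \<open>auto intro!: polynomial_function_const polynomial_function_mult p ab\<close>)
  have u: "polynomial_function ((3 * r) div 2 * n) (\<lambda>x. if odd r then e * (vec_block n x (3 * (r div 2)) $ a * vec_block n x (3 * (r div 2)) $ b) else 0)" for e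
    by (cases "odd r") (use le in \<open>auto intro!: polynomial_function_const polynomial_function_mult p ab\<close>)
  show "polynomial_function ((3 * r) div 2 * n) (\<lambda>x. fst (Phi st n r x) $$ (a, b))"
    "polynomial_function ((3 * r) div 2 * n) (\<lambda>x. snd (Phi st n r x) $$ (a, b))"
    unfolding Phi_def Let_def fst_conv snd_conv index_mat(1)[OF ab] split_conv
    using u1 u[of "ssign st"] le
    by (auto intro!: polynomial_function_add polynomial_function_sum polynomial_function_mult polynomial_function_const p ab)
qed

section \<open>Generic partial multiplicities at one point\<close>

lemma generically_not_dvd:
  assumes F: "poly_family m F" and deg: "\<And>x. degree (F x) \<le> N"
    and x0: "x0 \<in> carrier_vec m" "\<not> lin a ^ k dvd F x0"
  shows "generically m (\<lambda>x. \<not> lin a ^ k dvd F x)"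
proof -
  have T: "poly_family m (\<lambda>x. F x mod lin a ^ k)"
    by (rule poly_family_linear[OF F deg]) (simp_all add: poly_mod_add_left mod_smult_left)
  obtain j where j: "coeff (F x0 mod lin a ^ k) j \<noteq> 0"
    using x0(2) by (auto simp: dvd_eq_mod_eq_0 poly_eq_iff)
  have pf: "polynomial_function m (\<lambda>x. coeff (F x mod lin a ^ k) j)" using T by (simp add: poly_family_def)
  have "generically m (\<lambda>x. coeff (F x mod lin a ^ k) j \<noteq> 0)"
    by (rule generically_polynomial[OF pf x0(1)]) (rule j)
  then show ?thesis by (rule generically_mono) (auto simp: dvd_eq_mod_eq_0)
qed

text \<open>Upper bounds for the multiplicities, in terms of the orders of vanishing of the determinant and of the adjugate.
As both are divisibility conditions on polynomials, they hold generically in a family once they hold for one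
member.  The second bound matters only for a repaired first entry, which is at least \<open>2\<close>.\<close>

definition attains :: "nat \<Rightarrow> pencil \<Rightarrow> complex \<Rightarrow> nat list \<Rightarrow> bool" where
  "attains n M x l \<longleftrightarrow> \<not> lin x ^ Suc (sum_list l) dvd pdet n M \<and>
    (l \<noteq> [] \<and> 2 \<le> hd l \<longrightarrow> (\<exists>i<n. \<exists>j<n. \<not> lin x ^ Suc (sum_list (tl l)) dvd adj_mat (pmat n M) $$ (i, j)))"

lemma adj_not_dvd:
  assumes "K \<in> carrier_mat n n" "adj_mat N = lin x ^ b \<cdot>\<^sub>m K" "ev_mat K x \<noteq> 0\<^sub>m n n"
  shows "\<exists>i<n. \<exists>j<n. \<not> lin x ^ Suc b dvd adj_mat N $$ (i, j)"
proof -
  obtain i j where ij: "i < n" "j < n" "ev_mat K x $$ (i, j) \<noteq> 0"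
    by (rule nonzero_mat_entry[OF _ assms(3)]) (use assms(1) in auto)
  have "\<not> lin x dvd K $$ (i, j)" using ij assms(1) by (simp add: lin_dvd_iff)
  then have "\<not> lin x ^ Suc b dvd adj_mat N $$ (i, j)" using ij assms(1,2) by simp
  then show ?thesis using ij by blast
qed

lemma attains_of_mults:
  assumes L: "L \<in> pencil_carrier n" and pm: "finite_partial_mults n L x l"
  shows "attains n L x l"
proof -
  note f = finite_partial_mults_facts[OF L pm]
  have "\<not> lin x ^ Suc (sum_list l) dvd pdet n L" unfolding lin_power_dvd_order[OF f(1)] f(2) by simp
  moreover have "\<exists>i<n. \<exists>j<n. \<not> lin x ^ Suc (sum_list (tl l)) dvd adj_mat (pmat n L) $$ (i, j)" if ne: "l \<noteq> []"
    by (rule pole_data[OF L pm ne]) (metis adj_not_dvd)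
  ultimately show ?thesis by (auto simp: attains_def)
qed

lemma sorted_entry0: "l \<noteq> [] \<Longrightarrow> entry l 0 = hd l"
  by (cases l) auto

text \<open>The chains bound the multiplicities from below, \<open>attains\<close> bounds them from above, and the parity of the
  determinant closes the remaining gap.\<close>

lemma mults_of_attains:
  assumes M: "M \<in> pencil_carrier n" and s: "has_structure st M" and srt: "sorted_wrt (\<ge>) l" and z: "0 \<notin> set l"
    and low: "\<And>k. 1 \<le> k \<Longrightarrow> chains n (above l k) k (pmat n M) x" and att: "attains n M x (repaired st x n l)"
  shows "pencil_regular M" "finite_partial_mults n M x (repaired st x n l)"
proof -
  have d: "pdet n M \<noteq> 0" using att by (auto simp: attains_def)
  then show reg: "pencil_regular M" using pencil_regular_iff[OF M] by simp
  obtain m where m: "finite_partial_mults n M x m" by (rule finite_partial_mults_exists[OF M reg])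
  note f = finite_partial_mults_facts[OF M m]
  have dom: "entry l i \<le> entry m i" for i
    using entry_le_of_above[OF srt f(4), of 0 i] low f(3) by simp
  have le1: "sum_list m \<le> sum_list (repaired st x n l)"
    using att unfolding attains_def lin_power_dvd_order[OF f(1)] f(2) by simp
  have "sum_list l = (\<Sum>i<max (length l) (length m). entry l i)" by (rule sum_list_entry) simp
  also have "\<dots> \<le> (\<Sum>i<max (length l) (length m). entry m i)" by (intro sum_mono dom)
  also have "\<dots> = sum_list m" by (rule sum_list_entry[symmetric]) simp
  finally have le2: "sum_list l \<le> sum_list m" .
  have "m = repaired st x n l"
  proof (cases "wrong st x n l")
    case False
    then show ?thesis using le1 le2 dominating_list_eq[OF dom _ f(5) z] by (simp add: repaired_def)
  next
    case True
    have "m \<noteq> l" using not_wrong[OF M s m] True by auto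
    then have "sum_list m \<noteq> sum_list l" using dominating_list_eq[OF dom _ f(5) z] by blast
    then have sm: "sum_list m = Suc (sum_list l)" using le1 le2 True by (simp add: repaired_def)
    then have mne: "m \<noteq> []" by auto
    have "Suc (entry l 0) \<le> entry m 0"
    proof (cases "l = []")
      case True
      then show ?thesis using mne f(5) by (cases m) (auto simp: entry_def)
    next
      case False
      then obtain a l' where l: "l = a # l'" by (cases l) auto
      have a: "a \<noteq> 0" using z l by auto
      obtain b K e where K: "K \<in> carrier_mat n n" "adj_mat (pmat n M) = lin x ^ b \<cdot>\<^sub>m K" "sum_list (tl m) = b"
        by (rule pole_data[OF M m mne])
      have "\<exists>i<n. \<exists>j<n. \<not> lin x ^ Suc (sum_list l') dvd adj_mat (pmat n M) $$ (i, j)"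
        using att True l a by (auto simp: attains_def repaired_def)
      then obtain i j where ij: "i < n" "j < n" "\<not> lin x ^ Suc (sum_list l') dvd adj_mat (pmat n M) $$ (i, j)"
        by (elim exE conjE) (rule that)
      have "lin x ^ b dvd adj_mat (pmat n M) $$ (i, j)" unfolding K(2) using ij K(1) by simp
      then have "\<not> Suc (sum_list l') \<le> b" using ij(3) le_imp_power_dvd dvd_trans by blast
      moreover have "sum_list m = hd m + sum_list (tl m)" using mne by (cases m) auto
      ultimately have "Suc a \<le> hd m" using sm l K(3) by simp
      then show ?thesis using sorted_entry0[OF mne] l by simp
    qed
    then show ?thesis using dominating_list_bump[OF dom sm f(5) z] True by (simp add: repaired_def)
  qed
  then show "finite_partial_mults n M x (repaired st x n l)" using m by simp
qed

lemma attains_congruence: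
  assumes L: "L \<in> pencil_carrier n" and X: "X \<in> carrier_mat n n" and Z: "Z \<in> carrier_mat n n"
    and XZ: "X * Z = 1\<^sub>m n" "Z * X = 1\<^sub>m n" and att: "attains n (congruence X L) x l"
  shows "attains n L x l"
proof -
  have L': "pmat n (congruence X L) = lift (X\<^sup>T) * pmat n L * lift X"
    unfolding congruence_def by (rule pmat_equiv[symmetric, OF L _ X]) (use X in simp)
  have lc: "lift (X\<^sup>T) \<in> carrier_mat n n" "lift X \<in> carrier_mat n n" using X by auto
  have "pdet n (congruence X L) = det (lift (X\<^sup>T)) * pdet n L * det (lift X)"
    unfolding L' det_mult[OF mult_carrier_mat[OF lc(1) pmat_carrier] lc(2)] det_mult[OF lc(1) pmat_carrier] ..
  then have dd: "pdet n L dvd pdet n (congruence X L)" by simp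
  have nd: "\<not> lin x ^ Suc (sum_list l) dvd pdet n L" using att dd dvd_trans unfolding attains_def by blast
  then have d0: "pdet n L \<noteq> 0" by auto
  have "\<exists>i<n. \<exists>j<n. \<not> lin x ^ Suc (sum_list (tl l)) dvd adj_mat (pmat n L) $$ (i, j)"
    if c: "l \<noteq> [] \<and> 2 \<le> hd l"
  proof (rule ccontr)
    let ?b = "Suc (sum_list (tl l))"
    assume "\<not> (\<exists>i<n. \<exists>j<n. \<not> lin x ^ ?b dvd adj_mat (pmat n L) $$ (i, j))"
    then have a: "lin x ^ ?b dvd adj_mat (pmat n L) $$ (i, j)" if "i < n" "j < n" for i j using that by blast
    let ?K = "mat n n (\<lambda>(i, j). adj_mat (pmat n L) $$ (i, j) div lin x ^ ?b)"
    have "adj_mat (pmat n L) = lin x ^ ?b \<cdot>\<^sub>m ?K"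
      by (rule eq_matI) (use a adj_mat(1)[OF pmat_carrier[of n L]] in auto)
    from adj_mat_congruence[OF L X Z XZ d0 _ this]
    have "lin x ^ ?b dvd adj_mat (pmat n (congruence X L)) $$ (i, j)" if "i < n" "j < n" for i j
      using that by simp
    then show False using att c unfolding attains_def by blast
  qed
  then show ?thesis using nd by (simp add: attains_def)
qed

definition polynomial_pencils :: "nat \<Rightarrow> nat \<Rightarrow> (complex vec \<Rightarrow> pencil) \<Rightarrow> bool" where
  "polynomial_pencils m n E \<longleftrightarrow> (\<forall>i<n. \<forall>j<n. polynomial_function m (\<lambda>x. fst (E x) $$ (i, j)) \<and>
    polynomial_function m (\<lambda>x. snd (E x) $$ (i, j)))"

lemma poly_family_pmat:
  assumes "polynomial_pencils m n E" "i < n" "j < n"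
  shows "poly_family m (\<lambda>x. pmat n (E x) $$ (i, j))"
  using assms by (simp add: polynomial_pencils_def poly_family_pCons poly_family_const)

lemma degree_pdet: "degree (pdet n L) \<le> n"
  using degree_det_le[OF _ pmat_carrier[of n L], of 1] by simp

lemma degree_adj:
  assumes "i < n" "j < n"
  shows "degree (adj_mat (pmat n L) $$ (i, j)) \<le> n"
proof -
  have c: "mat_delete (pmat n L) j i \<in> carrier_mat (n - 1) (n - 1)" by (rule mat_delete_carrier) simp
  have "degree (det (mat_delete (pmat n L) j i)) \<le> 1 * (n - 1)"
  proof (rule degree_det_le[OF _ c])
    fix a b assume ab: "a < n - 1" "b < n - 1"
    show "degree (mat_delete (pmat n L) j i $$ (a, b)) \<le> 1"
      using ab assms unfolding mat_delete_def by simp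
  qed
  moreover have "(- 1 :: complex poly) ^ (j + i) = 1 \<or> (- 1 :: complex poly) ^ (j + i) = - 1" by (cases "even (j + i)") auto
  ultimately show ?thesis using assms by (auto simp: adj_mat_def cofactor_def)
qed

lemma poly_family_adj:
  assumes E: "polynomial_pencils m n E" and ij: "i < n" "j < n"
  shows "poly_family m (\<lambda>x. adj_mat (pmat n (E x)) $$ (i, j))"
proof -
  have c: "mat_delete (pmat n L) j i \<in> carrier_mat (n - 1) (n - 1)" for L by (rule mat_delete_carrier) simp
  have "poly_family m (\<lambda>x. mat_delete (pmat n (E x)) j i $$ (a, b))" if ab: "a < n - 1" "b < n - 1" for a b
    using ab ij poly_family_pmat[OF E] by (auto simp: mat_delete_def simp del: pmat_index)
  then have "poly_family m (\<lambda>x. (- 1) ^ (j + i) * det (mat_delete (pmat n (E x)) j i))"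
    by (intro poly_family_mult poly_family_const poly_family_det[OF _ c])
  then show ?thesis using ij by (simp add: adj_mat_def cofactor_def)
qed

lemma generically_attains:
  assumes E: "polynomial_pencils m n E" and x0: "x0 \<in> carrier_vec m" "attains n (E x0) a l"
  shows "generically m (\<lambda>x. attains n (E x) a l)"
proof -
  have nd: "\<not> lin a ^ Suc (sum_list l) dvd pdet n (E x0)" using x0(2) unfolding attains_def by (rule conjunct1)
  have 1: "generically m (\<lambda>x. \<not> lin a ^ Suc (sum_list l) dvd pdet n (E x))"
    by (rule generically_not_dvd[OF poly_family_det[OF poly_family_pmat[OF E] pmat_carrier] degree_pdet x0(1) nd])
  have 2: "generically m (\<lambda>x. l \<noteq> [] \<and> 2 \<le> hd l \<longrightarrow>
    (\<exists>i<n. \<exists>j<n. \<not> lin a ^ Suc (sum_list (tl l)) dvd adj_mat (pmat n (E x)) $$ (i, j)))"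
  proof (cases "l \<noteq> [] \<and> 2 \<le> hd l")
    case True
    then obtain i j where ij: "i < n" "j < n" "\<not> lin a ^ Suc (sum_list (tl l)) dvd adj_mat (pmat n (E x0)) $$ (i, j)"
      using x0(2) unfolding attains_def by blast
    have "generically m (\<lambda>x. \<not> lin a ^ Suc (sum_list (tl l)) dvd adj_mat (pmat n (E x)) $$ (i, j))"
      by (rule generically_not_dvd[OF poly_family_adj[OF E ij(1,2)] degree_adj[OF ij(1,2)] x0(1) ij(3)])
    then show ?thesis by (rule generically_mono) (use ij in blast)
  next
    case False
    show ?thesis by (rule generically_mono[OF generically_True]) (use False in blast)
  qed
  show ?thesis unfolding attains_def by (rule generically_conj[OF 1 2])
qed

text \<open>The entries that no perturbation can lower.  For odd \<open>r\<close> the last summand of a perturbation vanishes at \<open>- ssign st\<close> and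
leaves one further eigenvector there.\<close>

definition base_list :: "pencil_structure \<Rightarrow> complex \<Rightarrow> nat \<Rightarrow> nat list \<Rightarrow> nat list" where
  "base_list st x r ns = drop r ns @ (if x = - ssign st \<and> odd r \<and> r \<le> length ns then [1] else [])"

lemma chains_0: "chains n 0 k M x"
proof (rule chainsI[of "0\<^sub>m n 0"])
  show "v = 0\<^sub>v 0" if "v \<in> carrier_vec 0" for v :: "complex vec" using that by auto
qed auto

lemma above_drop:
  assumes "sorted_wrt (\<ge>) ns" "1 \<le> k" "above (drop r ns) k \<noteq> 0"
  shows "above (drop r ns) k + r \<le> above ns k"
proof -
  have srt: "sorted_wrt (\<ge>) (drop r ns)" using assms(1) by (rule sorted_wrt_drop)
  have "above (drop r ns) k - 1 < above (drop r ns) k" using assms(3) by simp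
  then have "k \<le> entry (drop r ns) (above (drop r ns) k - 1)" using less_above_iff[OF srt assms(2)] by blast
  then have "r + (above (drop r ns) k - 1) < above ns k" using less_above_iff[OF assms(1,2)] by simp
  then show ?thesis using assms(3) by simp
qed

lemma base_list_lower_bound:
  assumes L: "L \<in> pencil_carrier n" and pm: "finite_partial_mults n L x ns" and E: "perturbation st n r E" and k: "1 \<le> k"
  shows "chains n (above (base_list st x r ns) k) k (pmat n (pencil_add L E)) x"
proof (cases "k = 1 \<and> x = - ssign st \<and> odd r \<and> r \<le> length ns")
  case False
  then have eq: "above (base_list st x r ns) k = above (drop r ns) k" using k by (auto simp: base_list_def)
  note f = finite_partial_mults_facts[OF L pm]
  show ?thesis
  proof (cases "above (drop r ns) k = 0")
    case True
    then show ?thesis unfolding eq by (simp only: chains_0)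
  next
    case ne: False
    have "chains n (above (drop r ns) k + r) k (pmat n L) x" using f(3)[OF k] above_drop[OF f(4) k ne] by simp
    then show ?thesis unfolding eq by (rule chains_perturbation[OF E L])
  qed
next
  case True
  note f = finite_partial_mults_facts[OF L pm]
  have all: "filter (\<lambda>m. 1 \<le> m) l = l" if "0 \<notin> set l" for l :: "nat list"
    using that by (intro filter_True) (auto simp: Suc_le_eq intro: gr0I)
  have z: "0 \<notin> set (drop r ns)" using f(5) in_set_dropD by fast
  have "above (base_list st x r ns) 1 = length ns - r + 1" using True all[OF z] by (simp add: base_list_def)
  moreover have "r = Suc (2 * (r div 2))" using True by (auto elim: oddE)
  moreover have "above ns 1 = length ns" using all[OF f(5)] by simp
  moreover have "r \<le> length ns" using True by blast
  ultimately have "above (base_list st x r ns) 1 + 2 * (r div 2) = above ns 1" by linarith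
  then have "chains n (above (base_list st x r ns) 1 + 2 * (r div 2)) 1 (pmat n L) x" using f(3)[of 1] by simp
  then have "chains n (above (base_list st x r ns) 1) 1 (pmat n (pencil_add L E)) x"
    by (intro chains_perturbation_vanishing[OF E L]) (use True in simp_all)
  then show ?thesis using True by simp
qed

lemma base_list_wf:
  assumes "sorted_wrt (\<ge>) ns" "0 \<notin> set ns"
  shows "sorted_wrt (\<ge>) (base_list st x r ns)" "0 \<notin> set (base_list st x r ns)"
proof -
  have z: "0 \<notin> set (drop r ns)" using assms(2) in_set_dropD by fast
  then show "0 \<notin> set (base_list st x r ns)" by (auto simp: base_list_def)
  have "\<forall>a\<in>set (drop r ns). 1 \<le> a" using z by (auto simp: Suc_le_eq intro: gr0I)
  then show "sorted_wrt (\<ge>) (base_list st x r ns)"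
    using sorted_wrt_drop[OF assms(1), of r] by (auto simp: base_list_def sorted_wrt_append)
qed

lemma generic_mults_at_point:
  assumes L: "L \<in> pencil_carrier n" and s: "has_structure st L" and pm: "finite_partial_mults n L x ns"
    and E: "polynomial_pencils m n (\<lambda>y. pencil_add L (E y))" and ran: "\<And>y. y \<in> carrier_vec m \<Longrightarrow> perturbation st n r (E y)"
    and ex: "y0 \<in> carrier_vec m" "attains n (pencil_add L (E y0)) x (repaired st x n (base_list st x r ns))"
  shows "generically m (\<lambda>y. pencil_regular (pencil_add L (E y)) \<and>
    finite_partial_mults n (pencil_add L (E y)) x (repaired st x n (base_list st x r ns)))"
proof (rule generically_mono[OF generically_attains[OF E ex]])
  fix y assume y: "y \<in> carrier_vec m" "attains n (pencil_add L (E y)) x (repaired st x n (base_list st x r ns))"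
  note Ey = ran[OF y(1)]
  note f = finite_partial_mults_facts[OF L pm]
  have c: "pencil_add L (E y) \<in> pencil_carrier n" "has_structure st (pencil_add L (E y))"
    using structure_add[OF L perturbation_carrier[OF Ey] s perturbation_structure[OF Ey]] L perturbation_carrier[OF Ey] by auto
  show "pencil_regular (pencil_add L (E y)) \<and>
    finite_partial_mults n (pencil_add L (E y)) x (repaired st x n (base_list st x r ns))"
    using mults_of_attains[OF c base_list_wf[OF f(4,5)] base_list_lower_bound[OF L pm Ey] y(2)] by blast
qed

text \<open>Away from \<open>- ssign st\<close> the additive steps themselves are perturbations.\<close>

lemma example_regular_point:
  assumes L: "L \<in> pencil_carrier n" and s: "has_structure st L" and reg: "pencil_regular L"
    and pm: "finite_partial_mults n L x ns" and x: "x \<noteq> - ssign st"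
  shows "\<exists>E. perturbation st n r E \<and> attains n (pencil_add L E) x (repaired st x n (base_list st x r ns))"
proof -
  from iterated_additive[OF L s reg pm x, of r] obtain M us where
    M: "M = foldr (\<lambda>u E. pencil_add E (rank1 st u)) us L" "length us = r" "set us \<subseteq> carrier_vec n"
    and m: "finite_partial_mults n M x (repaired st x n (drop r ns))" by (elim exE conjE) (rule that)
  obtain E where E: "perturbation st n (length us) E" "foldr (\<lambda>u E. pencil_add E (rank1 st u)) us L = pencil_add L E"
    using perturbation_foldr_rank1[OF L M(3), of st] by (elim exE conjE) (rule that)
  have "attains n (pencil_add L E) x (repaired st x n (base_list st x r ns))"
    using attains_of_mults[OF _ m] M(1) E(2) L perturbation_carrier[OF E(1)] x by (simp add: base_list_def)
  then show ?thesis using E(1) M(2) by blast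
qed

text \<open>The coordinates \<open>i\<close> with \<open>f i < q\<close> carry a copy of \<open>F\<close>; all other entries are zero.\<close>

definition embed :: "nat \<Rightarrow> nat \<Rightarrow> (nat \<Rightarrow> nat) \<Rightarrow> pencil \<Rightarrow> pencil" where
  "embed n q f F = (mat n n (\<lambda>(i, j). if f i < q \<and> f j < q then fst F $$ (f i, f j) else 0),
    mat n n (\<lambda>(i, j). if f i < q \<and> f j < q then snd F $$ (f i, f j) else 0))"

lemma embed_carrier [simp]: "embed n q f F \<in> pencil_carrier n"
  by (simp add: embed_def pencil_carrier_def)

lemma embed_index:
  assumes "i < n" "j < n"
  shows "fst (embed n q f F) $$ (i, j) = (if f i < q \<and> f j < q then fst F $$ (f i, f j) else 0)"
    "snd (embed n q f F) $$ (i, j) = (if f i < q \<and> f j < q then snd F $$ (f i, f j) else 0)"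
  using assms by (simp_all add: embed_def)

lemma perturbation_embed: "perturbation st q r F \<Longrightarrow> perturbation st n r (embed n q f F)"
proof (induction rule: perturbation.induct)
  case zero
  have "embed n q f (0\<^sub>m q q, 0\<^sub>m q q) = (0\<^sub>m n n, 0\<^sub>m n n)"
    by (rule pencil_eqI[of _ n]) (simp_all add: embed_index)
  then show ?case using perturbation.zero by simp
next
  case (rank1 u)
  let ?u = "vec n (\<lambda>i. if f i < q then u $ f i else 0)"
  have "embed n q f (rank1 st u) = rank1 st ?u"
    by (rule pencil_eqI[of _ n]) (use rank1 in \<open>simp_all add: embed_index rank1_index[of _ n] rank1_index[of _ q] rank1_carrier\<close>)
  then show ?case using perturbation.rank1[of ?u n st] by simp
next
  case (pair r E v g d)
  let ?e = "\<lambda>u :: complex vec. vec n (\<lambda>i. if f i < q then u $ f i else 0)"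
  note E = perturbation_carrier[OF pair(1)]
  have "embed n q f (pencil_add E (pair_pencil st v g d)) = pencil_add (embed n q f E) (pair_pencil st (?e v) (?e g) (?e d))"
    by (rule pencil_eqI[of _ n])
      (use pair(2-4) E in \<open>simp_all add: embed_index pencil_add_index[of _ n] pencil_add_index[of _ q] pair_pencil_index[of _ n] pair_pencil_index[of _ q]\<close>)
  then show ?case using perturbation.pair[OF pair(5), of "?e v" "?e g" "?e d"] by simp
qed

lemma not_dvd_mult:
  assumes "\<not> lin x ^ Suc a dvd p" "\<not> lin x ^ Suc b dvd q"
  shows "\<not> lin x ^ Suc (a + b) dvd p * q"
proof -
  have z: "p \<noteq> 0" "q \<noteq> 0" using assms by auto
  have "order x p \<le> a" using assms(1) unfolding lin_power_dvd_order[OF z(1)] by simp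
  moreover have "order x q \<le> b" using assms(2) unfolding lin_power_dvd_order[OF z(2)] by simp
  ultimately show ?thesis using z by (subst lin_power_dvd_order) (simp_all add: order_mult)
qed

lemma dsum_index:
  assumes "A \<in> carrier_mat p p" "D \<in> carrier_mat q q" "i < p + q" "j < p + q"
  shows "dsum A D $$ (i, j) = (if i < p then if j < p then A $$ (i, j) else 0 else if j < p then 0 else D $$ (i - p, j - p))"
  using assms by (auto simp: dsum_def)

text \<open>The blocks \<open>[[0, 1], [c \<lambda>, 0]]\<close>, where \<open>c = ssign st\<close>, are invertible at \<open>- ssign st\<close>, and a single coordinate
  with the entry \<open>1 + c \<lambda>\<close> is added for odd \<open>q\<close>.\<close>

lemma minimal_perturbation:
  "\<exists>F. perturbation st q q F \<and> \<not> lin (- ssign st) ^ Suc (q mod 2) dvd pdet q F"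
proof (induction q rule: less_induct)
  case (less q)
  let ?x = "- ssign st"
  consider "q = 0" | "q = 1" | p where "q = Suc (Suc p)" 
  proof (cases q)
    case (Suc k)
    then show thesis using that by (cases k) auto
  qed (rule that(1))
  then show ?case
  proof cases
    case 1
    have "det (pmat 0 F) = 1" for F by (simp add: det_dim_zero[OF pmat_carrier])
    moreover have "\<not> lin ?x dvd 1" unfolding lin_dvd_iff by simp
    ultimately have "\<not> lin ?x ^ Suc (0 mod 2) dvd pdet 0 F" for F by (simp only: mod_0 power_Suc power_0 mult_1_right) blast
    then show ?thesis unfolding 1 using perturbation.zero[of st 0] by (intro exI conjI)
  next
    case 2
    let ?u = "vec 1 (\<lambda>_. 1 :: complex)"
    have "pdet 1 (rank1 st ?u) = omega st" by (subst det_single[OF pmat_carrier]) (simp add: rank1_def omega_def)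
    moreover have "\<not> lin ?x ^ 2 dvd omega st"
    proof
      assume "lin ?x ^ 2 dvd omega st"
      moreover have "omega st \<noteq> 0" by (simp add: omega_def)
      ultimately have "degree (lin ?x ^ 2) \<le> degree (omega st)" by (rule dvd_imp_degree_le)
      moreover have "degree (lin ?x ^ 2) = 2" by (simp add: lin_def degree_power_eq)
      ultimately show False by (simp add: omega_def)
    qed
    ultimately show ?thesis unfolding 2 using perturbation.rank1[of ?u 1 st]
      by (intro exI[of _ "rank1 st ?u"]) (simp add: numeral_2_eq_2)
  next
    case 3
    obtain F where F: "perturbation st p p F" "\<not> lin ?x ^ Suc (p mod 2) dvd pdet p F"
      using less[of p] 3 by auto
    let ?v = "unit_vec q p" and ?g = "unit_vec q (Suc p)" and ?d = "0\<^sub>v q"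
    let ?F = "pencil_add (embed q p id F) (pair_pencil st ?v ?g ?d)"
    let ?C = "mat 2 2 (\<lambda>(i, j). if i = 0 \<and> j = 1 then [:1:] else if i = 1 \<and> j = 0 then [:0, ssign st:] else 0)"
    have vc: "?v \<in> carrier_vec q" "?g \<in> carrier_vec q" "?d \<in> carrier_vec q" by auto
    have pF: "perturbation st q q ?F"
      using perturbation.pair[OF perturbation_embed[OF F(1), of q id] vc] 3 by simp
    have "pmat q ?F = dsum (pmat p F) ?C"
    proof (rule eq_matI)
      fix i j assume "i < dim_row (dsum (pmat p F) ?C)" "j < dim_col (dsum (pmat p F) ?C)"
      then have ij: "i < q" "j < q" using 3 by auto
      have cases2: "k < p \<or> k = p \<or> k = Suc p" if "k < q" for k using that 3 by auto
      show "pmat q ?F $$ (i, j) = dsum (pmat p F) ?C $$ (i, j)"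
        using cases2[OF ij(1)] cases2[OF ij(2)] 3 ij
        by (auto simp: dsum_index[of _ p _ 2] pencil_add_index[of _ q] embed_index pair_pencil_index[of _ q])
    qed (use 3 in auto)
    then have "pdet q ?F = pdet p F * det ?C" using det_dsum[of "pmat p F" p ?C 2] by simp
    moreover have nC: "\<not> lin ?x ^ Suc 0 dvd det ?C"
    proof -
      have "?C * ?C = [:0, ssign st:] \<cdot>\<^sub>m 1\<^sub>m 2"
        by (rule eq_matI) (auto simp: less_2_cases_iff scalar_prod_def numeral_2_eq_2)
      then have "det ?C * det ?C = [:0, ssign st:] ^ 2"
        by (subst det_mult[symmetric, of _ 2]) (simp_all add: det_smult)
      moreover have "poly ([:0, ssign st:] ^ 2) ?x \<noteq> 0" by simp
      ultimately have "poly (det ?C * det ?C) ?x \<noteq> 0" by (simp only:) simp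
      then have "poly (det ?C) ?x \<noteq> 0" unfolding poly_mult by (rule contrapos_nn) simp
      then show ?thesis by (simp add: lin_dvd_iff)
    qed
    ultimately have "\<not> lin ?x ^ Suc (p mod 2 + 0) dvd pdet q ?F" by (simp only:) (rule not_dvd_mult[OF F(2) nC])
    moreover have "p mod 2 + 0 = q mod 2" using 3 by simp
    ultimately have "\<not> lin ?x ^ Suc (q mod 2) dvd pdet q ?F" by (simp only:) simp
    then show ?thesis using pF by (intro exI conjI)
  qed
qed

lemma attains_dsum:
  assumes att: "attains l M x T" and q: "\<not> lin x ^ Suc b dvd pdet q F" and m: "pmat n Q = dsum (pmat l M) (pmat q F)" and n: "n = l + q"
    and T': "sum_list T' = sum_list T + b" "2 \<le> hd T' \<Longrightarrow> T' \<noteq> [] \<Longrightarrow> T \<noteq> [] \<and> 2 \<le> hd T \<and> sum_list (tl T') = sum_list (tl T) + b"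
  shows "attains n Q x T'"
proof -
  have d: "pdet n Q = pdet l M * pdet q F" unfolding m by (rule det_dsum[OF pmat_carrier pmat_carrier])
  have nM: "\<not> lin x ^ Suc (sum_list T) dvd pdet l M" using att unfolding attains_def by (rule conjunct1)
  have d0: "pdet n Q \<noteq> 0" using nM q unfolding d by auto
  have "adj_mat (pmat n Q) = dsum (pdet q F \<cdot>\<^sub>m adj_mat (pmat l M)) (pdet l M \<cdot>\<^sub>m adj_mat (pmat q F))" (is "_ = dsum ?A ?D")
  proof (rule adj_mat_det_cancel[OF pmat_carrier _ d0])
    note a = adj_mat[OF pmat_carrier]
    have c: "?A \<in> carrier_mat l l" "?D \<in> carrier_mat q q" using a(1) by auto
    show "dsum ?A ?D \<in> carrier_mat n n" unfolding n by (rule dsum_carrier[OF c])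
    have "pmat l M * ?A = pdet n Q \<cdot>\<^sub>m 1\<^sub>m l" "pmat q F * ?D = pdet n Q \<cdot>\<^sub>m 1\<^sub>m q"
      unfolding d mult_smult_distrib[OF pmat_carrier a(1)] a(2) by (auto simp: mult.commute)
    then have "pmat n Q * dsum ?A ?D = dsum (pdet n Q \<cdot>\<^sub>m 1\<^sub>m l) (pdet n Q \<cdot>\<^sub>m 1\<^sub>m q)"
      unfolding m dsum_mult[OF pmat_carrier c(1) pmat_carrier c(2)] by simp
    also have "\<dots> = pdet n Q \<cdot>\<^sub>m 1\<^sub>m n" unfolding n by (rule eq_matI) (auto simp: dsum_index[of _ l _ q])
    finally show "pmat n Q * dsum ?A ?D = pdet n Q \<cdot>\<^sub>m 1\<^sub>m n" .
  qed
  then have adj: "adj_mat (pmat n Q) $$ (i, j) = adj_mat (pmat l M) $$ (i, j) * pdet q F" if "i < l" "j < l" for i j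
    using that adj_mat(1)[OF pmat_carrier[of l M]] adj_mat(1)[OF pmat_carrier[of q F]]
    by (simp add: dsum_index[of _ l _ q] mult.commute)
  have "\<exists>i<n. \<exists>j<n. \<not> lin x ^ Suc (sum_list (tl T')) dvd adj_mat (pmat n Q) $$ (i, j)" if h: "T' \<noteq> [] \<and> 2 \<le> hd T'"
  proof -
    have T: "T \<noteq> [] \<and> 2 \<le> hd T" "sum_list (tl T') = sum_list (tl T) + b" using T'(2) h by auto
    from att T(1) obtain i j where ij: "i < l" "j < l" "\<not> lin x ^ Suc (sum_list (tl T)) dvd adj_mat (pmat l M) $$ (i, j)"
      unfolding attains_def by blast
    have "\<not> lin x ^ Suc (sum_list (tl T')) dvd adj_mat (pmat n Q) $$ (i, j)"
      unfolding T(2) adj[OF ij(1,2)] by (rule not_dvd_mult[OF ij(3) q])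
    then show ?thesis using ij n by (intro exI[of _ i] exI[of _ j] conjI) auto
  qed
  moreover have "\<not> lin x ^ Suc (sum_list T') dvd pdet n Q" unfolding T'(1) d by (rule not_dvd_mult[OF nM q])
  ultimately show ?thesis by (simp add: attains_def)
qed

text \<open>Enlarging the perturbation of the last coordinates amounts, after a diagonal congruence, to scaling down
  the rest of the last rows and columns; in the limit the pencil is a direct sum, and \<open>attains\<close> is an open
  condition.\<close>

lemma attains_large_perturbation:
  assumes L: "L \<in> pencil_carrier n" and n: "n = l + q" and F: "perturbation st q q F"
    and lim: "\<And>Q. pmat n Q = dsum (pmat l (leading l L)) (pmat q F) \<Longrightarrow> attains n Q x T"
  shows "\<exists>E. perturbation st n q E \<and> attains n (pencil_add L E) x T"
proof -
  let ?F = "embed n q (\<lambda>i. if i < l then q else i - l) F"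
  define w where "w t i = (if i < l then 1 else t :: complex)" for t and i :: nat
  define Q where "Q y = pencil_add (mat n n (\<lambda>(i, j). w (y $ 0) i * fst L $$ (i, j) * w (y $ 0) j),
    mat n n (\<lambda>(i, j). w (y $ 0) i * snd L $$ (i, j) * w (y $ 0) j)) ?F" for y :: "complex vec"
  have sc: "(mat n n a, mat n n b) \<in> pencil_carrier n" for a b by (simp add: pencil_carrier_def)
  have pw: "polynomial_function 1 (\<lambda>y. w (y $ 0) i)" for i
    using polynomial_function_coord[of 0 1] polynomial_function_const by (cases "i < l") (simp_all add: w_def)
  have pQ: "polynomial_pencils 1 n Q"
    unfolding polynomial_pencils_def Q_def
    by (intro allI impI conjI; subst pencil_add_index[OF sc embed_carrier], assumption, assumption)
      (auto intro!: polynomial_function_add polynomial_function_mult polynomial_function_const pw[unfolded One_nat_def])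
  have "pmat n (Q (0\<^sub>v 1)) = dsum (pmat l (leading l L)) (pmat q F)"
  proof (rule eq_matI)
    fix i j assume "i < dim_row (dsum (pmat l (leading l L)) (pmat q F))" "j < dim_col (dsum (pmat l (leading l L)) (pmat q F))"
    then have ij: "i < n" "j < n" "i < l + q" "j < l + q" unfolding n by auto
    have sub: "i - l < q \<longleftrightarrow> True" "j - l < q \<longleftrightarrow> True" if "\<not> i < l" "\<not> j < l" using ij(3,4) that by auto
    show "pmat n (Q (0\<^sub>v 1)) $$ (i, j) = dsum (pmat l (leading l L)) (pmat q F) $$ (i, j)"
      unfolding dsum_index[OF pmat_carrier pmat_carrier ij(3,4)] pmat_index[OF ij(1,2)] Q_def
        pencil_add_index[OF sc embed_carrier ij(1,2)] embed_index[OF ij(1,2)]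
      using ij(1,2) sub by (auto simp: w_def leading_def)
  qed (use n in auto)
  from generically_attains[OF pQ zero_carrier_vec lim[OF this]]
  have g1: "generically 1 (\<lambda>y. attains n (Q y) x T)" .
  have g2: "generically 1 (\<lambda>y. y $ 0 \<noteq> 0)"
    by (rule generically_polynomial[of _ _ "vec 1 (\<lambda>_. 1)"]) (use polynomial_function_coord[of 0 1] in auto)
  obtain y where y: "attains n (Q y) x T" "y $ 0 \<noteq> 0" using generically_ex[OF generically_conj[OF g1 g2]] by blast
  define t where "t = y $ 0"
  have t: "t \<noteq> 0" using y(2) by (simp add: t_def)
  define D where "D s = mat n n (\<lambda>(i, j). if i = j then w s i else 0)" for s
  have Dc: "D s \<in> carrier_mat n n" for s by (simp add: D_def)
  have DD: "D a * D b = 1\<^sub>m n" if "a * b = 1" for a b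
  proof (rule eq_matI)
    fix i j assume "i < dim_row (1\<^sub>m n :: complex mat)" "j < dim_col (1\<^sub>m n :: complex mat)"
    then have ij: "i < n" "j < n" by auto
    have "(D a * D b) $$ (i, j) = (\<Sum>k = 0..<n. if k = i then (if i = j then w a i * w b i else 0) else 0)"
      unfolding mult_mat_entry[OF Dc Dc ij] using ij by (intro sum.cong) (auto simp: D_def)
    also have "\<dots> = (if i = j then w a i * w b i else 0)" using ij by (simp add: sum.delta)
    also have "\<dots> = 1\<^sub>m n $$ (i, j)" using ij that by (simp add: w_def)
    finally show "(D a * D b) $$ (i, j) = 1\<^sub>m n $$ (i, j)" .
  qed (simp_all add: D_def)
  have Dsum: "(\<Sum>l = 0..<n. \<Sum>k = 0..<n. D s $$ (k, i) * a k l * D s $$ (l, j)) = w s i * a i j * w s j"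
    if ij: "i < n" "j < n" for s i j and a :: "nat \<Rightarrow> nat \<Rightarrow> complex"
  proof -
    have "(\<Sum>l = 0..<n. \<Sum>k = 0..<n. D s $$ (k, i) * a k l * D s $$ (l, j)) =
      (\<Sum>l = 0..<n. if l = j then (\<Sum>k = 0..<n. if k = i then w s i * a i j * w s j else 0) else 0)"
    proof (rule sum.cong[OF refl])
      fix h assume h: "h \<in> {0..<n}"
      show "(\<Sum>k = 0..<n. D s $$ (k, i) * a k h * D s $$ (h, j)) =
        (if h = j then (\<Sum>k = 0..<n. if k = i then w s i * a i j * w s j else 0) else 0)"
      proof (cases "h = j")
        case True
        have "(\<Sum>k = 0..<n. D s $$ (k, i) * a k h * D s $$ (h, j)) = (\<Sum>k = 0..<n. if k = i then w s i * a i j * w s j else 0)"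
          by (intro sum.cong refl) (use True ij in \<open>auto simp: D_def\<close>)
        then show ?thesis using True by (simp only: if_True simp_thms)
      qed (use h ij in \<open>auto simp: D_def\<close>)
    qed
    then show ?thesis using ij by (simp add: sum.delta)
  qed
  let ?E = "congruence (D (1 / t)) ?F"
  have F': "perturbation st n q ?F" by (rule perturbation_embed[OF F])
  have E: "perturbation st n q ?E" by (rule perturbation_congruence[OF Dc F'])
  have tt: "w t i * (w (1 / t) i * a * w (1 / t) j) * w t j = a" for i j a using t by (simp add: w_def)
  have "congruence (D t) (pencil_add L ?E) = Q y"
  proof (rule pencil_eqI[of _ n])
    fix i j assume ij: "i < n" "j < n"
    note c = congruence_index[OF Dc _ ij] pencil_add_index[OF sc embed_carrier ij]
      pencil_add_index[OF congruence_carrier[OF Dc L] congruence_carrier[OF Dc perturbation_carrier[OF E]] ij]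
      congruence_index[OF Dc embed_carrier ij]
    show "fst (congruence (D t) (pencil_add L ?E)) $$ (i, j) = fst (Q y) $$ (i, j)"
      "snd (congruence (D t) (pencil_add L ?E)) $$ (i, j) = snd (Q y) $$ (i, j)"
      unfolding congruence_add[OF Dc L perturbation_carrier[OF E]] Q_def c(3-6)
        congruence_index[OF Dc L ij] congruence_index[OF Dc perturbation_carrier[OF E] ij] c(7,8)
        Dsum[OF ij] t_def[symmetric] tt using ij tt by simp_all
  qed (use L E Dc sc in \<open>auto simp: Q_def intro!: congruence_carrier pencil_add_carrier perturbation_carrier[OF E]\<close>)
  then have "attains n (congruence (D t) (pencil_add L ?E)) x T" using y(1) by simp
  then have "attains n (pencil_add L ?E) x T"
    by (rule attains_congruence[OF pencil_add_carrier[OF L perturbation_carrier[OF E]] Dc[of t] Dc[of "1 / t"] DD DD, rotated 2]) (use t in auto)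
  then show ?thesis using E by blast
qed

lemma star_not_wrong:
  assumes L: "L \<in> pencil_carrier n" and s: "has_structure st L" and pm: "finite_partial_mults n L x ns"
    and star: "\<forall>q<length ns. wrong st x (n - Suc q) (drop (Suc q) ns) \<longrightarrow> \<not> wrong st x (n - q) (drop q ns) \<and> ns ! q = entry ns (Suc q)"
  shows "\<not> wrong st x (n - length ns) []"
proof (cases "length ns")
  case 0
  then show ?thesis using not_wrong[OF L s pm] by simp
next
  case (Suc q)
  have "ns ! q \<noteq> 0" using finite_partial_mults_facts(5)[OF L pm] Suc nth_mem[of q ns] by (metis lessI)
  moreover have "entry ns (Suc q) = 0" using Suc by (simp add: entry_def)
  ultimately show ?thesis using star Suc by force
qed

lemma wrong_skew_shift:
  assumes "x = - ssign st" "q \<le> n"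
  shows "wrong st x (n - q) l \<longleftrightarrow> odd (sum_list l + n + q)"
proof -
  have "n - q + q = n" using assms(2) by simp
  then have "odd (n - q) \<longleftrightarrow> odd (n + q)" by (metis even_add)
  then show ?thesis using assms(1) by (auto simp: wrong_def)
qed

text \<open>The deletion of \<open>q = min r (length ns)\<close> rows and columns leaves the wanted multiplicities in a leading block; a large
perturbation of the complementary coordinates then isolates this block.  For \<open>r > length ns\<close> nothing but the parity of
\<open>n\<close> remains.\<close>

lemma example_skew_point:
  assumes L: "L \<in> pencil_carrier n" and s: "has_structure st L" and reg: "pencil_regular L"
    and pm: "finite_partial_mults n L x ns" and x: "x = - ssign st"
  shows "\<exists>E. perturbation st n r E \<and> attains n (pencil_add L E) x (repaired st x n (base_list st x r ns))"
proof -
  define q where "q = min r (length ns)"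
  note del = iterated_deletion[OF L s reg pm x]
  note f = finite_partial_mults_facts[OF L pm]
  have ql: "q \<le> length ns" by (simp add: q_def)
  from del[OF ql] have qn: "q \<le> n" by (rule conjunct1)
  from del[OF ql] obtain X Z where X: "X \<in> carrier_mat n n" "Z \<in> carrier_mat n n" "X * Z = 1\<^sub>m n" "Z * X = 1\<^sub>m n"
    and mM: "finite_partial_mults (n - q) (leading (n - q) (congruence X L)) x (repaired st x (n - q) (drop q ns))"
    by (elim exE conjE) (rule that)
  from del[OF le_refl] have gn: "length ns \<le> n" by (rule conjunct1)
  from del[OF le_refl] have star: "\<forall>q<length ns. wrong st x (n - Suc q) (drop (Suc q) ns) \<longrightarrow> \<not> wrong st x (n - q) (drop q ns) \<and> ns ! q = entry ns (Suc q)"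
    by (elim conjE)
  have nw: "\<not> wrong st x (n - length ns) []" by (rule star_not_wrong[OF L s pm star])
  have ng: "even (n + length ns)" using nw wrong_skew_shift[OF x gn] by simp
  let ?T = "repaired st x (n - q) (drop q ns)" and ?T' = "repaired st x n (base_list st x r ns)"
  have z: "0 \<notin> set (drop q ns)" using f(5) in_set_dropD by fast
  have rel: "sum_list ?T' = sum_list ?T + q mod 2"
    "2 \<le> hd ?T' \<Longrightarrow> ?T' \<noteq> [] \<Longrightarrow> ?T \<noteq> [] \<and> 2 \<le> hd ?T \<and> sum_list (tl ?T') = sum_list (tl ?T) + q mod 2"
  proof -
    have wn: "wrong st x n l \<longleftrightarrow> odd (sum_list l + n)" for l using x by (auto simp: wrong_def)
    have "(sum_list ?T' = sum_list ?T + q mod 2) \<and>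
      (2 \<le> hd ?T' \<longrightarrow> ?T' \<noteq> [] \<longrightarrow> ?T \<noteq> [] \<and> 2 \<le> hd ?T \<and> sum_list (tl ?T') = sum_list (tl ?T) + q mod 2)"
    proof (cases "r \<le> length ns")
      case True
      have q: "q = r" using True by (simp add: q_def)
      let ?e = "if odd r then [1] else [] :: nat list"
      have b: "base_list st x r ns = drop r ns @ ?e" using True x by (simp add: base_list_def)
      have w: "wrong st x n (drop r ns @ ?e) \<longleftrightarrow> wrong st x (n - r) (drop r ns)"
        unfolding wn wrong_skew_shift[OF x qn[unfolded q]] by auto
      have ne: "drop r ns \<noteq> []" if "wrong st x (n - r) (drop r ns)"
      proof
        assume "drop r ns = []"
        then have "r = length ns" using True by simp
        then show False using nw that by simp
      qed
      have "?T' = ?T @ ?e"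
      proof (cases "wrong st x (n - r) (drop r ns)")
        case True
        obtain a l where "drop r ns = a # l" using ne[OF True] by (cases "drop r ns") auto
        then show ?thesis using True w unfolding b q by (simp add: repaired_def)
      qed (use w in \<open>simp add: b q repaired_def\<close>)
      moreover have "?T \<noteq> [] \<and> 2 \<le> hd ?T" if "2 \<le> hd (?T @ ?e)" "?T @ ?e \<noteq> []"
        using that by (cases ?T) (auto split: if_splits)
      ultimately show ?thesis unfolding q by (cases ?T) (auto simp: odd_iff_mod_2_eq_one)
    next
      case False
      have q: "q = length ns" using False by (simp add: q_def)
      have b: "base_list st x r ns = []" using False by (simp add: base_list_def)
      have "?T = []" using nw unfolding q by (simp add: repaired_def)
      moreover have "?T' = (if odd n then [1] else [])" unfolding b repaired_def wn by simp
      moreover have "odd n \<longleftrightarrow> odd q" using ng q by simp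
      ultimately show ?thesis by (auto simp: odd_iff_mod_2_eq_one)
    qed
    then show "sum_list ?T' = sum_list ?T + q mod 2"
      "2 \<le> hd ?T' \<Longrightarrow> ?T' \<noteq> [] \<Longrightarrow> ?T \<noteq> [] \<and> 2 \<le> hd ?T \<and> sum_list (tl ?T') = sum_list (tl ?T) + q mod 2" by blast+
  qed
  obtain F where F: "perturbation st q q F" "\<not> lin x ^ Suc (q mod 2) dvd pdet q F"
    using minimal_perturbation[of st q, folded x] by (elim exE conjE) (rule that)
  have nq: "n = (n - q) + q" using qn by simp
  have XL: "congruence X L \<in> pencil_carrier n" using X(1) L by simp
  have "\<exists>E. perturbation st n q E \<and> attains n (pencil_add (congruence X L) E) x ?T'"
    by (rule attains_large_perturbation[OF XL nq F(1)])
      (rule attains_dsum[OF attains_of_mults[OF leading_carrier mM] F(2) _ nq rel])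
  then obtain E where E: "perturbation st n q E" "attains n (pencil_add (congruence X L) E) x ?T'"
    by (elim exE conjE) (rule that)
  have Ec: "E \<in> pencil_carrier n" by (rule perturbation_carrier[OF E(1)])
  have "congruence X (congruence Z E) = E"
  proof -
    have "X\<^sup>T * (Z\<^sup>T * A * Z) * X = A" if A: "A \<in> carrier_mat n n" for A
    proof -
      have "X\<^sup>T * (Z\<^sup>T * A * Z) * X = (X\<^sup>T * Z\<^sup>T) * A * (Z * X)"
        by (rule mult5_assoc) (use X A in auto)
      then show ?thesis using transpose_inverse[OF X(2,1,4)] X A by simp
    qed
    then show ?thesis using Ec by (auto simp: congruence_def pencil_carrier_def)
  qed
  then have "congruence X (pencil_add L (congruence Z E)) = pencil_add (congruence X L) E"
    using congruence_add[OF X(1) L congruence_carrier[OF X(2) Ec]] by simp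
  then have "attains n (pencil_add L (congruence Z E)) x ?T'"
    using attains_congruence[OF pencil_add_carrier[OF L congruence_carrier[OF X(2) Ec]] X] E(2) by simp
  moreover have "perturbation st n r (congruence Z E)"
    by (rule perturbation_mono[OF perturbation_congruence[OF X(2) E(1)]]) (simp add: q_def)
  ultimately show ?thesis by blast
qed

lemma no_repair_beyond:
  assumes "length ns < r" shows "\<not> property_P r ns"
  using assms by (auto simp: property_P_def pm_def)

text \<open>The bad parities are odd at \<open>ssign st\<close>, where the sum must be even, and even at \<open>- ssign st\<close>, where the size drops
  by one with each removed entry.\<close>

lemma base_list_perturbed:
  assumes L: "L \<in> pencil_carrier n" and s: "has_structure st L" and reg: "pencil_regular L"
    and pm: "finite_partial_mults n L x ns" and r: "0 < r"
  shows "repaired st x n (base_list st x r ns) = perturbed_mults st r (Finite x) ns"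
proof -
  note f = finite_partial_mults_facts[OF L pm]
  have rep: "(if bad (pm ns (r + 1)) \<and> property_P r ns then shifted_mults r ns else drop r ns) =
    (if bad (pm ns (r + 1)) \<and> property_P r ns then bump (drop r ns) else drop r ns)" for bad
  proof (cases "r < length ns")
    case True
    then have "drop r ns = ns ! r # drop (Suc r) ns" by (simp add: Cons_nth_drop_Suc)
    then show ?thesis using True by (simp add: shifted_mults_def pm_def)
  next
    case False
    then have "drop r ns = []" "drop (r + 1) ns = []" "pm ns (r + 1) = 0" by (simp_all add: pm_def)
    then show ?thesis by (simp add: shifted_mults_def)
  qed
  have sc: "ssign st = 1 \<and> st = Palindromic \<or> ssign st = - 1 \<and> st = Anti_Palindromic" by (cases st) auto
  consider "x \<noteq> ssign st" "x \<noteq> - ssign st" | "x = ssign st" | "x = - ssign st" by blast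
  then show ?thesis
  proof cases
    case 1
    then have "\<not> wrong st x n l" for l by (simp add: wrong_def)
    then show ?thesis using 1 sc by (auto simp: repaired_def base_list_def perturbed_mults_def)
  next
    case 2
    then have x: "x \<noteq> - ssign st" by simp
    have w: "wrong st x m l \<longleftrightarrow> odd (sum_list l)" for m l using 2 by (auto simp: wrong_def)
    have star: "\<not> wrong st x n (drop q ns) \<and> ns ! q = entry ns (Suc q)" if "q < length ns" "wrong st x n (drop (Suc q) ns)" for q
      using iterated_additive[OF L s reg pm x, of "Suc q"] that by (elim exE conjE) simp
    have iff: "wrong st x n (drop r ns) \<longleftrightarrow> odd (pm ns (r + 1)) \<and> property_P r ns" if rl: "r \<le> length ns"
    proof (rule repair_iff_property_P[where b = "\<lambda>q. wrong st x n (drop q ns)" and bad = odd, OF f(4,5) _ _ star r rl])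
      show "\<not> wrong st x n (drop 0 ns)" using not_wrong[OF L s pm] by simp
      show "wrong st x n (drop (Suc q) ns) \<longleftrightarrow> wrong st x n (drop q ns) \<noteq> odd (ns ! q)" if "q < length ns" for q
        unfolding w Cons_nth_drop_Suc[OF that, symmetric] by auto
    qed
    have "repaired st x n (drop r ns) = (if odd (pm ns (r + 1)) \<and> property_P r ns then bump (drop r ns) else drop r ns)"
    proof (cases "r \<le> length ns")
      case True
      then show ?thesis using iff by (simp add: repaired_def)
    next
      case False
      then show ?thesis using no_repair_beyond[of ns r] by (simp add: repaired_def w)
    qed
    then show ?thesis using 2 sc x rep[of odd] by (auto simp: base_list_def perturbed_mults_def)
  next
    case 3
    note del = iterated_deletion[OF L s reg pm 3]
    from del[OF le_refl] have gn: "length ns \<le> n" by (rule conjunct1)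
    from del[OF le_refl] have star: "\<forall>q<length ns. wrong st x (n - Suc q) (drop (Suc q) ns) \<longrightarrow> \<not> wrong st x (n - q) (drop q ns) \<and> ns ! q = entry ns (Suc q)"
      by (elim conjE)
    have nw: "\<not> wrong st x (n - length ns) []" by (rule star_not_wrong[OF L s pm star])
    have ng: "even (n + length ns)" using nw wrong_skew_shift[OF 3 gn] by simp
    have wn: "wrong st x n l \<longleftrightarrow> odd (sum_list l + n)" for l using 3 by (auto simp: wrong_def)
    show ?thesis
    proof (cases "r \<le> length ns")
      case True
      let ?e = "if odd r then [1] else [] :: nat list"
      have iff: "wrong st x (n - r) (drop r ns) \<longleftrightarrow> even (pm ns (r + 1)) \<and> property_P r ns"
      proof (rule repair_iff_property_P[where b = "\<lambda>q. wrong st x (n - q) (drop q ns)" and bad = even, OF f(4,5) _ _ _ r True])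
        show "\<not> wrong st x (n - 0) (drop 0 ns)" using not_wrong[OF L s pm] by simp
        show "wrong st x (n - Suc q) (drop (Suc q) ns) \<longleftrightarrow> wrong st x (n - q) (drop q ns) \<noteq> even (ns ! q)" if q: "q < length ns" for q
        proof -
          have qn: "Suc q \<le> n" "q \<le> n" using q gn by auto
          show ?thesis unfolding wrong_skew_shift[OF 3 qn(1)] wrong_skew_shift[OF 3 qn(2)] Cons_nth_drop_Suc[OF q, symmetric] by auto
        qed
        show "\<not> wrong st x (n - q) (drop q ns) \<and> ns ! q = entry ns (Suc q)"
          if "q < length ns" "wrong st x (n - Suc q) (drop (Suc q) ns)" for q using star that by blast
      qed
      have rn: "r \<le> n" using True gn by simp
      have w: "wrong st x n (drop r ns @ ?e) \<longleftrightarrow> wrong st x (n - r) (drop r ns)"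
        unfolding wn wrong_skew_shift[OF 3 rn] by auto
      have ne: "drop r ns \<noteq> []" if "wrong st x (n - r) (drop r ns)"
      proof
        assume "drop r ns = []"
        then have "r = length ns" using True by simp
        then show False using nw that by simp
      qed
      have "repaired st x n (drop r ns @ ?e) = (if even (pm ns (r + 1)) \<and> property_P r ns then bump (drop r ns) else drop r ns) @ ?e"
      proof (cases "wrong st x (n - r) (drop r ns)")
        case True
        obtain a l where "drop r ns = a # l" using ne[OF True] by (cases "drop r ns") auto
        then show ?thesis using True w iff by (simp add: repaired_def)
      next
        case False
        then show ?thesis using w iff unfolding repaired_def by (simp only: if_False)
      qed
      moreover have "base_list st x r ns = drop r ns @ ?e" using True 3 by (simp add: base_list_def)
      ultimately show ?thesis using 3 sc True rep[of even] by (auto simp: perturbed_mults_def)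
    next
      case False
      have "repaired st x n (base_list st x r ns) = (if odd n then [1] else [])" using False by (simp add: base_list_def repaired_def wn)
      moreover have "odd (r - length ns) \<longleftrightarrow> odd (r + n)" using False ng by (auto simp: even_diff_nat)
      ultimately show ?thesis using 3 sc False no_repair_beyond[of ns r] by (auto simp: perturbed_mults_def)
    qed
  qed
qed

section \<open>Simplicity of the new eigenvalues\<close>

text \<open>Bertini's theorem for a pencil of polynomials: away from the zeros of \<open>g\<close>, a multiple root of \<open>f + s g\<close> is a
  critical point of \<open>f / g\<close> with the critical value \<open>- s\<close>, and there are finitely many critical values.\<close>

lemma bertini:
  fixes f g :: "complex poly"
  assumes f: "f \<noteq> 0"
  obtains B where "finite B" "0 \<in> B" "\<And>s. s \<notin> B \<Longrightarrow> f + Polynomial.smult s g \<noteq> 0"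
    "\<And>s x. s \<notin> B \<Longrightarrow> poly g x \<noteq> 0 \<Longrightarrow> poly (f + Polynomial.smult s g) x = 0 \<Longrightarrow> order x (f + Polynomial.smult s g) = 1"
proof -
  define W where "W = pderiv f * g - f * pderiv g"
  obtain y where y: "poly f y \<noteq> 0" using f poly_all_0_iff_0[of f] by blast
  define B where "B = insert 0 (insert (- poly f y / poly g y)
    (if W = 0 then {} else (\<lambda>x. - poly f x / poly g x) ` {x. poly W x = 0}))"
  have fin: "finite B" by (simp add: B_def poly_roots_finite)
  have nz: "f + Polynomial.smult s g \<noteq> 0" if s: "s \<notin> B" for s
  proof
    assume "f + Polynomial.smult s g = 0"
    then have e: "poly f y + s * poly g y = 0" by (metis poly_0 poly_add poly_smult)
    then have "poly g y \<noteq> 0" using y by auto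
    then have "s = - poly f y / poly g y" using e by (simp add: field_simps eq_neg_iff_add_eq_0 add.commute)
    then show False using s by (simp add: B_def)
  qed
  have "order x (f + Polynomial.smult s g) = 1"
    if s: "s \<notin> B" and g: "poly g x \<noteq> 0" and root: "poly (f + Polynomial.smult s g) x = 0" for s x
  proof (rule ccontr)
    let ?p = "f + Polynomial.smult s g"
    assume n1: "order x ?p \<noteq> 1"
    have o: "order x ?p \<noteq> 0" using root nz[OF s] unfolding order_root by simp
    have pd: "pderiv ?p \<noteq> 0"
    proof
      assume "pderiv ?p = 0"
      then have "degree ?p = 0" by (simp add: pderiv_eq_0_iff)
      then obtain c where "?p = [:c:]" by (rule degree_eq_zeroE)
      then show False using root nz[OF s] by auto
    qed
    have op: "order x ?p = Suc (order x (pderiv ?p))" by (rule order_pderiv[OF nz[OF s] root])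
    have Wp: "W = pderiv ?p * g - ?p * pderiv g" by (simp add: W_def pderiv_add pderiv_smult algebra_simps)
    show False
    proof (cases "W = 0")
      case True
      have "lin x ^ order x ?p dvd ?p * pderiv g" using lin_power_dvd_order[OF nz[OF s], of x] by (intro dvd_mult2) simp
      moreover have "?p * pderiv g = pderiv ?p * g" using True Wp by simp
      ultimately have d: "lin x ^ order x ?p dvd pderiv ?p * g" by simp
      have "pderiv ?p * g \<noteq> 0" using pd g by auto
      then have "order x ?p \<le> order x (pderiv ?p * g)" using d lin_power_dvd_order by blast
      also have "\<dots> = order x (pderiv ?p)" using \<open>pderiv ?p * g \<noteq> 0\<close> order_root[of g x] g by (simp add: order_mult order_0I)
      finally show False using op by simp
    next
      case False
      have "order x (pderiv ?p) \<noteq> 0" using op n1 by simp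
      then have "poly (pderiv ?p) x = 0" using order_root by blast
      then have "poly W x = 0" unfolding Wp using root by simp
      moreover have "s = - poly f x / poly g x" using root g by (simp add: field_simps eq_neg_iff_add_eq_0 add.commute)
      ultimately show False using s False by (auto simp: B_def)
    qed
  qed
  then show ?thesis using that[OF fin _ nz] by (simp add: B_def)
qed

lemma pdet_add_rank1:
  assumes M: "M \<in> pencil_carrier n" and d: "pdet n M \<noteq> 0" and u: "u \<in> carrier_vec n"
  shows "pdet n (pencil_add M (rank1 st u)) = pdet n M + omega st * pquad (adj_mat (pmat n M)) u"
proof -
  have a: "adj_mat (pmat n M) \<in> carrier_mat n n" by (rule adj_mat(1)[OF pmat_carrier])
  have "liftv u \<bullet> (adj_mat (pmat n M) *\<^sub>v (omega st \<cdot>\<^sub>v liftv u)) = omega st * lin 0 ^ 0 * pquad (adj_mat (pmat n M)) u"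
    by (rule scalar_prod_pquad[OF _ a u]) (rule eq_matI, use a in auto)
  then show ?thesis unfolding pmat_add_rank1[OF M u]
    by (subst det_add_outer[OF pmat_carrier _ _ d]) (use u in auto)
qed

lemma pquad_smult: "K \<in> carrier_mat n n \<Longrightarrow> u \<in> carrier_vec n \<Longrightarrow> pquad K (t \<cdot>\<^sub>v u) = Polynomial.smult (t * t) (pquad K u)"
  by (intro poly_ext) (simp add: poly_pquad quad_smult)

lemma outer_add:
  assumes "a \<in> carrier_vec n" "b \<in> carrier_vec n" "c \<in> carrier_vec n"
  shows "outer a b + outer a c = outer a (b + c)" "outer b a + outer c a = outer (b + c) (a :: 'a :: comm_ring_1 vec)"
  by (rule eq_matI; use assms in \<open>simp add: algebra_simps\<close>)+

text \<open>The form \<open>a \<bullet> adj M v\<close> does not see changes of \<open>M\<close> by multiples of \<open>v\<close> in the columns, and dually.\<close>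

lemma adj_add_outer:
  fixes M :: "'a :: idom mat"
  assumes M: "M \<in> carrier_mat n n" and v: "v \<in> carrier_vec n" and w: "w \<in> carrier_vec n" and a: "a \<in> carrier_vec n"
    and d: "det M \<noteq> 0"
  shows "det (M + outer v w) \<noteq> 0 \<Longrightarrow> a \<bullet> (adj_mat (M + outer v w) *\<^sub>v v) = a \<bullet> (adj_mat M *\<^sub>v v)"
    "det (M + outer w v) \<noteq> 0 \<Longrightarrow> v \<bullet> (adj_mat (M + outer w v) *\<^sub>v a) = v \<bullet> (adj_mat M *\<^sub>v a)"
proof -
  have adj: "adj_mat M \<in> carrier_mat n n" by (rule adj_mat(1)[OF M])
  have c: "M + outer v w \<in> carrier_mat n n" "M + outer w v \<in> carrier_mat n n" using M v w by auto
  have av: "adj_mat M *\<^sub>v y \<in> carrier_vec n" if "y \<in> carrier_vec n" for y using adj that by (rule mult_mat_vec_carrier)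
  {
    assume d1: "det (M + outer v w) \<noteq> 0"
    have "det (M + outer v w + outer v a) = det (M + outer v w) + a \<bullet> (adj_mat (M + outer v w) *\<^sub>v v)"
      by (rule det_add_outer[OF c(1) v a d1])
    moreover have "M + outer v w + outer v a = M + outer v (w + a)"
      unfolding outer_add(1)[OF v w a, symmetric] by (rule assoc_add_mat[OF M]) (use v w a in auto)
    moreover have "det (M + outer v (w + a)) = det M + (w + a) \<bullet> (adj_mat M *\<^sub>v v)"
      by (rule det_add_outer[OF M v _ d]) (use w a in simp)
    moreover have "det (M + outer v w) = det M + w \<bullet> (adj_mat M *\<^sub>v v)" by (rule det_add_outer[OF M v w d])
    ultimately show "a \<bullet> (adj_mat (M + outer v w) *\<^sub>v v) = a \<bullet> (adj_mat M *\<^sub>v v)"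
      by (simp add: add_scalar_prod_distrib[OF w a av[OF v]])
  next
    assume d1: "det (M + outer w v) \<noteq> 0"
    have "det (M + outer w v + outer a v) = det (M + outer w v) + v \<bullet> (adj_mat (M + outer w v) *\<^sub>v a)"
      by (rule det_add_outer[OF c(2) a v d1])
    moreover have "M + outer w v + outer a v = M + outer (w + a) v"
      unfolding outer_add(2)[OF v w a, symmetric] by (rule assoc_add_mat[OF M]) (use v w a in auto)
    moreover have "det (M + outer (w + a) v) = det M + v \<bullet> (adj_mat M *\<^sub>v (w + a))"
      by (rule det_add_outer[OF M _ v d]) (use w a in simp)
    moreover have "det (M + outer w v) = det M + v \<bullet> (adj_mat M *\<^sub>v w)" by (rule det_add_outer[OF M w v d])
    ultimately show "v \<bullet> (adj_mat (M + outer w v) *\<^sub>v a) = v \<bullet> (adj_mat M *\<^sub>v a)"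
      by (simp add: mult_add_distrib_mat_vec[OF adj w a] scalar_prod_add_distrib[OF v av[OF w] av[OF a]])
  }
qed

lemma mult_mat_smult_vec:
  "A \<in> carrier_mat n m \<Longrightarrow> v \<in> carrier_vec m \<Longrightarrow> A *\<^sub>v (k \<cdot>\<^sub>v v) = k \<cdot>\<^sub>v (A *\<^sub>v (v :: 'a :: comm_ring_1 vec))"
  by (intro eq_vecI) auto

lemma smult_one_mult_vec: "v \<in> carrier_vec n \<Longrightarrow> (k \<cdot>\<^sub>m 1\<^sub>m n) *\<^sub>v v = k \<cdot>\<^sub>v (v :: 'a :: comm_ring_1 vec)"
  by (intro eq_vecI) (auto simp: row_one)

text \<open>Modulo the vanishing form \<open>v\<^sup>T adj M v\<close>, the determinant of a perturbation of rank two is the product of those of its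
two summands, divided by \<open>det M\<close>.\<close>

lemma det_add_pair_isotropic:
  fixes M :: "'a :: idom mat"
  assumes M: "M \<in> carrier_mat n n" and v: "v \<in> carrier_vec n" and w: "w \<in> carrier_vec n" and z: "z \<in> carrier_vec n"
    and d: "det M \<noteq> 0" and d1: "det (M + outer v w) \<noteq> 0" and iso: "v \<bullet> (adj_mat M *\<^sub>v v) = 0"
  shows "det M * det (M + outer v w + outer z v) = (det M + w \<bullet> (adj_mat M *\<^sub>v v)) * (det M + v \<bullet> (adj_mat M *\<^sub>v z))"
proof -
  let ?N = "M + outer v w"
  have N: "?N \<in> carrier_mat n n" using M v w by simp
  note adj = adj_mat[OF M] and adjN = adj_mat[OF N]
  define p q where "p = adj_mat M *\<^sub>v z" and "q = adj_mat M *\<^sub>v v"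
  define b where "b = w \<bullet> p"
  have pq: "p \<in> carrier_vec n" "q \<in> carrier_vec n" using adj(1) z v by (auto simp: p_def q_def)
  have dN: "det ?N = det M + w \<bullet> q" unfolding q_def by (rule det_add_outer[OF M v w d])
  define y where "y = det ?N \<cdot>\<^sub>v p - b \<cdot>\<^sub>v q"
  have y: "y \<in> carrier_vec n" using pq by (simp add: y_def)
  have Mp: "M *\<^sub>v p = det M \<cdot>\<^sub>v z" "M *\<^sub>v q = det M \<cdot>\<^sub>v v"
    unfolding p_def q_def assoc_mult_mat_vec[OF M adj(1) z, symmetric] assoc_mult_mat_vec[OF M adj(1) v, symmetric] adj(2)
    using z v by (simp_all add: smult_one_mult_vec)
  have Ny: "?N *\<^sub>v y = (det M * det ?N) \<cdot>\<^sub>v z"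
  proof -
    have "?N *\<^sub>v y = M *\<^sub>v y + outer v w *\<^sub>v y" by (rule add_mult_distrib_mat_vec[OF M _ y]) (use v w in simp)
    also have "M *\<^sub>v y = det ?N \<cdot>\<^sub>v (det M \<cdot>\<^sub>v z) - b \<cdot>\<^sub>v (det M \<cdot>\<^sub>v v)"
      unfolding y_def Mp[symmetric] mult_mat_smult_vec[OF M pq(1), symmetric] mult_mat_smult_vec[OF M pq(2), symmetric]
      by (rule mult_minus_distrib_mat_vec[OF M]) (use pq in auto)
    also have "outer v w *\<^sub>v y = (w \<bullet> y) \<cdot>\<^sub>v v" by (rule outer_mult_vec[OF v w y])
    also have "w \<bullet> y = det ?N * b - b * (w \<bullet> q)"
      unfolding y_def b_def using w pq by (simp add: scalar_prod_minus_distrib[of _ n])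
    also have "\<dots> = b * det M" unfolding dN by (simp add: algebra_simps)
    finally show ?thesis using v z by (auto simp: algebra_simps)
  qed
  have "det ?N \<cdot>\<^sub>v y = adj_mat ?N *\<^sub>v (?N *\<^sub>v y)"
    unfolding assoc_mult_mat_vec[OF adjN(1) N y, symmetric] adjN(3) using y by (simp add: smult_one_mult_vec)
  also have "\<dots> = (det M * det ?N) \<cdot>\<^sub>v (adj_mat ?N *\<^sub>v z)" unfolding Ny by (rule mult_mat_smult_vec[OF adjN(1) z])
  finally have e: "det ?N \<cdot>\<^sub>v y = (det M * det ?N) \<cdot>\<^sub>v (adj_mat ?N *\<^sub>v z)" .
  have "det ?N * (v \<bullet> y) = det ?N * (det M * (v \<bullet> (adj_mat ?N *\<^sub>v z)))"
    using arg_cong[OF e, of "\<lambda>t. v \<bullet> t"] v y adjN(1) z mult_mat_vec_carrier[OF adjN(1) z] by (simp add: mult_ac)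
  then have "v \<bullet> y = det M * (v \<bullet> (adj_mat ?N *\<^sub>v z))" using d1 by simp
  moreover have "v \<bullet> y = det ?N * (v \<bullet> p)"
    unfolding y_def using v pq iso[folded q_def] by (simp add: scalar_prod_minus_distrib[of _ n])
  moreover have "det (?N + outer z v) = det ?N + v \<bullet> (adj_mat ?N *\<^sub>v z)" by (rule det_add_outer[OF N z v d1])
  ultimately show ?thesis unfolding q_def[symmetric] p_def[symmetric] dN[symmetric] by (simp add: algebra_simps)
qed

lemma finite_line_zeros:
  assumes "polynomial_function m P" "a \<in> carrier_vec m" "b \<in> carrier_vec m" "P (a + s \<cdot>\<^sub>v b) \<noteq> 0"
  shows "finite {t. P (a + t \<cdot>\<^sub>v b) = 0}"
proof -
  obtain q where q: "\<And>t. P (a + t \<cdot>\<^sub>v b) = poly q t" by (rule polynomial_function_line[OF assms(1-3)]) blast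
  have "q \<noteq> 0" using assms(4) q by auto
  then show ?thesis unfolding q by (rule poly_roots_finite)
qed

definition simple_off :: "nat \<Rightarrow> complex set \<Rightarrow> pencil \<Rightarrow> bool" where
  "simple_off n S M \<longleftrightarrow> pdet n M \<noteq> 0 \<and> (\<forall>x. poly (pdet n M) x = 0 \<and> x \<notin> S \<longrightarrow> order x (pdet n M) = 1)"

text \<open>The additive step removes a simple eigenvalue completely, so that the form \<open>u\<^sup>T adj L(x) u\<close> is not zero there.  The
  point \<open>- ssign st\<close> is never a simple eigenvalue for even \<open>n\<close>, by parity.\<close>

lemma simple_eigenvalue_removable:
  assumes M: "M \<in> pencil_carrier n" and s: "has_structure st M" and d: "pdet n M \<noteq> 0" and o: "order x (pdet n M) = 1"
    and x: "x = - ssign st \<Longrightarrow> even n"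
  shows "\<exists>u\<in>carrier_vec n. poly (omega st * pquad (adj_mat (pmat n M)) u) x \<noteq> 0"
proof -
  have reg: "pencil_regular M" using d pencil_regular_iff[OF M] by simp
  have xc: "x \<noteq> - ssign st"
  proof
    assume xx: "x = - ssign st"
    have "(ssign st * x) ^ n = (- 1) ^ order x (pdet n M)" by (rule order_parity[OF M s d]) (simp add: xx)
    then show False using x[OF xx] xx o by simp
  qed
  obtain l where l: "finite_partial_mults n M x l" by (rule finite_partial_mults_exists[OF M reg])
  note f = finite_partial_mults_facts[OF M l]
  have l1: "l = [1]"
  proof (cases l)
    case (Cons a l')
    then have "a = 1 \<and> sum_list l' = 0" using f(2,5) o by (cases a) auto
    then show ?thesis using Cons f(5) by (cases l') auto
  qed (use f(2) o in simp)
  obtain u m where u: "u \<in> carrier_vec n" and reg': "pencil_regular (pencil_add M (rank1 st u))"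
    and m: "finite_partial_mults n (pencil_add M (rank1 st u)) x m"
    and alt: "m = tl l \<or> m = bump (tl l) \<and> hd l \<le> entry l 1 \<and> x = ssign st"
    by (rule additive_step[OF M s reg l _ xc]) (use l1 in simp_all)
  have m0: "m = []" using alt l1 by (auto simp: entry_def)
  have c: "pencil_add M (rank1 st u) \<in> pencil_carrier n" using M u by simp
  note f' = finite_partial_mults_facts[OF c m]
  have "poly (pdet n (pencil_add M (rank1 st u))) x \<noteq> 0" using f'(1,2) m0 by (simp add: order_root)
  moreover have "poly (pdet n M) x = 0" using o by (simp add: order_root)
  ultimately show ?thesis using u unfolding pdet_add_rank1[OF M d u] by (intro bexI[OF _ u]) simp
qed

lemma simple_offI:
  "pdet n M \<noteq> 0 \<Longrightarrow> (\<And>x. poly (pdet n M) x = 0 \<Longrightarrow> x \<notin> S \<Longrightarrow> order x (pdet n M) = 1) \<Longrightarrow> simple_off n S M"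
  by (simp add: simple_off_def)

lemma half_identity:
  fixes a :: "'a :: idom"
  assumes "c * c = 1" "h + h = 1" "k = c * h"
  shows "a * (b + t * (h * p)) + c * ((e + t * (k * a)) * p) = a * b + c * (e * p) + t * (a * p)"
    "a * (b + t * (k * p)) + c * ((e + t * (h * a)) * p) = a * b + c * (e * p) + c * (t * (a * p))"
proof -
  have ck: "c * k = h" using assms(1,3) by (simp flip: mult.assoc)
  have hh: "h * x + h * x = x" for x using assms(2) by (simp flip: distrib_right)
  have "a * (b + t * (h * p)) + c * ((e + t * (k * a)) * p) = a * b + c * (e * p) + t * (h * (a * p) + c * k * (a * p))"
    by (simp add: algebra_simps)
  then show "a * (b + t * (h * p)) + c * ((e + t * (k * a)) * p) = a * b + c * (e * p) + t * (a * p)" unfolding ck hh .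
  have "a * (b + t * (k * p)) + c * ((e + t * (h * a)) * p) = a * b + c * (e * p) + t * (k * (a * p) + c * (h * (a * p)))"
    by (simp add: algebra_simps)
  also have "k * (a * p) + c * (h * (a * p)) = c * (h * (a * p) + h * (a * p))" unfolding assms(3) by (simp add: algebra_simps)
  finally show "a * (b + t * (k * p)) + c * ((e + t * (h * a)) * p) = a * b + c * (e * p) + c * (t * (a * p))"
    unfolding hh by (simp add: mult.left_commute)
qed

text \<open>Moving \<open>w\<close> along \<open>(1 + c \<lambda>) v / 2\<close> moves the pair by a multiple of \<open>(1 + c \<lambda>) v v\<^sup>T\<close>.\<close>

lemma pair_pencil_shift:
  assumes "v \<in> carrier_vec n" "g \<in> carrier_vec n" "d \<in> carrier_vec n" "M \<in> pencil_carrier n"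
  shows "pencil_add M (pair_pencil st v (g + t \<cdot>\<^sub>v ((1 / 2) \<cdot>\<^sub>v v)) (d + t \<cdot>\<^sub>v ((ssign st / 2) \<cdot>\<^sub>v v))) =
    pencil_add (pencil_add M (pair_pencil st v g d)) (rank1 st (csqrt t \<cdot>\<^sub>v v))"
proof (rule pencil_eqI[of _ n])
  have q: "csqrt t * a * (csqrt t * b) = t * (a * b)" for a b
  proof -
    have "csqrt t * csqrt t = t" using power2_csqrt[of t] by (simp only: power2_eq_square)
    moreover have "csqrt t * a * (csqrt t * b) = csqrt t * csqrt t * (a * b)" by (simp only: mult_ac)
    ultimately show ?thesis by (simp only:)
  qed
  fix i j assume ij: "i < n" "j < n"
  have vi: "(csqrt t \<cdot>\<^sub>v v) $ i = csqrt t * v $ i" "(csqrt t \<cdot>\<^sub>v v) $ j = csqrt t * v $ j" using assms ij by auto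
  have cv: "csqrt t \<cdot>\<^sub>v v \<in> carrier_vec n" "g + t \<cdot>\<^sub>v ((1 / 2) \<cdot>\<^sub>v v) \<in> carrier_vec n"
    "d + t \<cdot>\<^sub>v ((ssign st / 2) \<cdot>\<^sub>v v) \<in> carrier_vec n" using assms by auto
  have k: "a * (b + t * (1 / 2 * p)) + ssign st * ((e + t * (ssign st / 2 * a)) * p) = a * b + ssign st * (e * p) + t * (a * p)"
    "a * (b + t * (ssign st / 2 * p)) + ssign st * ((e + t * (1 / 2 * a)) * p) = a * b + ssign st * (e * p) + ssign st * (t * (a * p))" for a b p e
    by (rule half_identity; cases st; simp)+
  have gd: "(g + t \<cdot>\<^sub>v ((1 / 2) \<cdot>\<^sub>v v)) $ l = g $ l + t * (1 / 2 * v $ l)"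
    "(d + t \<cdot>\<^sub>v ((ssign st / 2) \<cdot>\<^sub>v v)) $ l = d $ l + t * (ssign st / 2 * v $ l)" if "l < n" for l
    using assms(1-3) that by (simp_all only: index_add_vec index_smult_vec carrier_vecD)
  show "fst (pencil_add M (pair_pencil st v (g + t \<cdot>\<^sub>v ((1 / 2) \<cdot>\<^sub>v v)) (d + t \<cdot>\<^sub>v ((ssign st / 2) \<cdot>\<^sub>v v)))) $$ (i, j) =
      fst (pencil_add (pencil_add M (pair_pencil st v g d)) (rank1 st (csqrt t \<cdot>\<^sub>v v))) $$ (i, j)"
    "snd (pencil_add M (pair_pencil st v (g + t \<cdot>\<^sub>v ((1 / 2) \<cdot>\<^sub>v v)) (d + t \<cdot>\<^sub>v ((ssign st / 2) \<cdot>\<^sub>v v)))) $$ (i, j) =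
      snd (pencil_add (pencil_add M (pair_pencil st v g d)) (rank1 st (csqrt t \<cdot>\<^sub>v v))) $$ (i, j)"
    unfolding pencil_add_index[OF pencil_add_carrier[OF assms(4) pair_pencil_carrier[OF assms(1-3)]] rank1_carrier[OF cv(1)] ij]
      pencil_add_index[OF assms(4) pair_pencil_carrier[OF assms(1-3)] ij] pair_pencil_index[OF assms(1-3) ij]
      pencil_add_index[OF assms(4) pair_pencil_carrier[OF assms(1) cv(2,3)] ij] pair_pencil_index[OF assms(1) cv(2,3) ij]
      rank1_index[OF cv(1) ij] vi q gd[OF ij(1)] gd[OF ij(2)] k
    by (simp_all only: add.assoc)
qed (use assms in auto)

lemma finite_pencil_zeros:
  assumes "(A :: complex mat) \<in> carrier_mat n n" "B \<in> carrier_mat n n" "det (A + s \<cdot>\<^sub>m B) \<noteq> 0"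
  shows "finite {t. det (A + t \<cdot>\<^sub>m B) = 0}"
proof -
  have c: "(A, B) \<in> pencil_carrier n" using assms by (simp add: pencil_carrier_def)
  have e: "det (A + t \<cdot>\<^sub>m B) = poly (pdet n (A, B)) t" for t using poly_pdet[OF c] by (simp add: pencil_eval_def)
  have "pdet n (A, B) \<noteq> 0" using assms(3) e by auto
  then show ?thesis unfolding e by (rule poly_roots_finite)
qed

text \<open>Adding one pair keeps the new eigenvalues simple for suitable vectors near any given ones.  Nearness is expressed
  by an arbitrary condition \<open>Z\<close> that holds for the given vectors and, on each line through a point where it holds, at
  all but finitely many points.\<close>

locale adding_pair =
  fixes n :: nat and st :: pencil_structure and M :: pencil and S :: "complex set"
    and Z :: "complex vec \<Rightarrow> complex vec \<Rightarrow> complex vec \<Rightarrow> bool" and v0 g0 d0 :: "complex vec"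
  assumes M: "M \<in> pencil_carrier n" and s: "has_structure st M" and good: "simple_off n S M"
    and par: "- ssign st \<notin> S \<Longrightarrow> even n"
    and Z0: "v0 \<in> carrier_vec n" "g0 \<in> carrier_vec n" "d0 \<in> carrier_vec n" "Z v0 g0 d0"
    and Zline: "\<And>v g d v' g' d'. v \<in> carrier_vec n \<Longrightarrow> g \<in> carrier_vec n \<Longrightarrow> d \<in> carrier_vec n \<Longrightarrow>
      v' \<in> carrier_vec n \<Longrightarrow> g' \<in> carrier_vec n \<Longrightarrow> d' \<in> carrier_vec n \<Longrightarrow> Z v g d \<Longrightarrow>
      finite {t. \<not> Z (v + t \<cdot>\<^sub>v v') (g + t \<cdot>\<^sub>v g') (d + t \<cdot>\<^sub>v d')}"
begin

definition K where "K = adj_mat (pmat n M)"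
definition G where "G u = omega st * pquad K u"

lemma K: "K \<in> carrier_mat n n" unfolding K_def by (rule adj_mat(1)[OF pmat_carrier])

lemma pdet_nonzero: "pdet n M \<noteq> 0" using good by (simp add: simple_off_def)

lemma root_nonzero_G:
  assumes "poly (pdet n M) x = 0" "x \<notin> S"
  shows "\<exists>u\<in>carrier_vec n. poly (G u) x \<noteq> 0"
  unfolding G_def K_def
  by (rule simple_eigenvalue_removable[OF M s pdet_nonzero]) (use good assms par in \<open>auto simp: simple_off_def\<close>)

lemma polynomial_function_G: "polynomial_function n (\<lambda>u. poly (G u) x)"
  unfolding G_def poly_mult poly_pquad
  by (intro polynomial_function_mult polynomial_function_const polynomial_function_quad) (use K in simp)

text \<open>The polynomial \<open>G v\<close> is the derivative of the determinant in the direction used by Bertini's theorem; a generic \<open>v\<close>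
makes it nonzero at the simple eigenvalues of \<open>M\<close>.\<close>

lemma first_vector:
  assumes v1: "v1 \<in> carrier_vec n" "pquad K v1 \<noteq> 0"
  shows "\<exists>v. v \<in> carrier_vec n \<and> Z v g0 d0 \<and> G v \<noteq> 0 \<and>
    (\<forall>x. poly (pdet n M) x = 0 \<and> x \<notin> S \<longrightarrow> poly (G v) x \<noteq> 0)"
proof -
  define R where "R = {x. poly (pdet n M) x = 0 \<and> x \<notin> S}"
  have finR: "finite R" using poly_roots_finite[OF pdet_nonzero] by (auto simp: R_def intro: finite_subset[rotated])
  have "omega st \<noteq> 0" by (simp add: omega_def)
  then have "G v1 \<noteq> 0" using v1 by (simp add: G_def)
  then obtain y where y: "poly (G v1) y \<noteq> 0" using poly_all_0_iff_0[of "G v1"] by blast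
  have ex: "\<exists>u\<in>carrier_vec n. poly (G u) x \<noteq> 0" if "x \<in> insert y R" for x
    using that y v1(1) root_nonzero_G by (auto simp: R_def)
  have "generically n (\<lambda>u. poly (G u) x \<noteq> 0)" if "x \<in> insert y R" for x
    using ex[OF that] by (elim bexE) (rule generically_polynomial[OF polynomial_function_G])
  then have "generically n (\<lambda>u. \<forall>x\<in>insert y R. poly (G u) x \<noteq> 0)" using finR by (intro generically_ball) auto
  then obtain w where w: "w \<in> carrier_vec n" "\<And>x. x \<in> insert y R \<Longrightarrow> poly (G w) x \<noteq> 0" by (rule generically_ex) blast
  have wc: "w - v0 \<in> carrier_vec n" using w Z0 by simp
  have "finite {t. poly (G (v0 + t \<cdot>\<^sub>v (w - v0))) x = 0}" if "x \<in> insert y R" for x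
    by (rule finite_line_zeros[where P = "\<lambda>u. poly (G u) x" and s = 1, OF polynomial_function_G Z0(1) wc])
      (unfold line_between(2)[OF Z0(1) w(1)], rule w(2)[OF that])
  then have fin: "finite ({t. \<not> Z (v0 + t \<cdot>\<^sub>v (w - v0)) (g0 + t \<cdot>\<^sub>v 0\<^sub>v n) (d0 + t \<cdot>\<^sub>v 0\<^sub>v n)} \<union>
      (\<Union>x\<in>insert y R. {t. poly (G (v0 + t \<cdot>\<^sub>v (w - v0))) x = 0}))"
    using finR by (intro finite_UnI finite_UN_I Zline[OF Z0(1-3) wc _ _ Z0(4)]) auto
  obtain t where t: "Z (v0 + t \<cdot>\<^sub>v (w - v0)) (g0 + t \<cdot>\<^sub>v 0\<^sub>v n) (d0 + t \<cdot>\<^sub>v 0\<^sub>v n)"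
    "\<And>x. x \<in> insert y R \<Longrightarrow> poly (G (v0 + t \<cdot>\<^sub>v (w - v0))) x \<noteq> 0"
    using cofinite_ne_infinite[OF fin] by blast
  have z: "a + t \<cdot>\<^sub>v 0\<^sub>v n = a" if "a \<in> carrier_vec n" for a using that by auto
  have "G (v0 + t \<cdot>\<^sub>v (w - v0)) \<noteq> 0" using t(2)[of y] by auto
  then show ?thesis using t wc Z0(1) z[OF Z0(2)] z[OF Z0(3)]
    by (intro exI[of _ "v0 + t \<cdot>\<^sub>v (w - v0)"]) (auto simp: R_def)
qed

definition W :: "complex vec \<Rightarrow> complex vec \<Rightarrow> complex poly vec" where
  "W g d = vec n (\<lambda>i. [:g $ i, d $ i:])"

lemma W_carrier [simp]: "W g d \<in> carrier_vec n"
  by (simp add: W_def)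

definition left :: "complex vec \<Rightarrow> complex vec \<Rightarrow> complex vec \<Rightarrow> complex poly mat" where
  "left v g d = pmat n M + outer (liftv v) (W g d)"

lemma left_carrier [simp]: "v \<in> carrier_vec n \<Longrightarrow> left v g d \<in> carrier_mat n n"
  by (simp add: left_def)

lemma pmat_pair:
  "v \<in> carrier_vec n \<Longrightarrow> g \<in> carrier_vec n \<Longrightarrow> d \<in> carrier_vec n \<Longrightarrow>
    pmat n (pencil_add M (pair_pencil st v g d)) = left v g d + outer ([:ssign st:] \<cdot>\<^sub>v W d g) (liftv v)"
proof -
  assume c: "v \<in> carrier_vec n" "g \<in> carrier_vec n" "d \<in> carrier_vec n"
  have "vec n (\<lambda>i. [:ssign st * d $ i, ssign st * g $ i:]) = [:ssign st:] \<cdot>\<^sub>v W d g" by (rule eq_vecI) (simp_all add: W_def)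
  then show ?thesis unfolding pmat_add_pair[OF M c] left_def W_def by simp
qed

lemma scaled_pair:
  assumes v: "v \<in> carrier_vec n"
  defines "g \<equiv> \<lambda>t. g0 + t \<cdot>\<^sub>v g0" and "d \<equiv> \<lambda>t. d0 + t \<cdot>\<^sub>v d0"
  shows "poly (pdet n M) x \<noteq> 0 \<Longrightarrow> finite {t. poly (pdet n (pencil_add M (pair_pencil st v (g t) (d t)))) x = 0}"
    "poly (pdet n M) x \<noteq> 0 \<Longrightarrow> finite {t. poly (det (left v (g t) (d t))) x = 0}"
proof -
  have Mc: "fst M \<in> carrier_mat n n" "snd M \<in> carrier_mat n n" using M by (auto simp: pencil_carrier_def)
  have gd: "g t \<in> carrier_vec n" "d t \<in> carrier_vec n" for t using Z0 by (auto simp: g_def d_def)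
  let ?A = "pencil_eval M x" and ?P = "pencil_eval (pair_pencil st v g0 d0) x"
  let ?Q = "outer v (g0 + x \<cdot>\<^sub>v d0)"
  have A: "?A \<in> carrier_mat n n" using Mc by (simp add: pencil_eval_def)
  have P: "?P \<in> carrier_mat n n" using v Z0 by (simp add: pencil_eval_def pair_pencil_def)
  have Q: "?Q \<in> carrier_mat n n" using v Z0 by simp
  have e1: "poly (pdet n (pencil_add M (pair_pencil st v (g t) (d t)))) x = det ((?A + ?P) + t \<cdot>\<^sub>m ?P)" for t
    unfolding poly_pdet[OF pencil_add_carrier[OF M pair_pencil_carrier[OF v gd]]]
    by (rule arg_cong[of _ _ det], rule eq_matI)
      (use Mc v Z0 in \<open>simp_all add: pencil_eval_def pencil_add_def pair_pencil_def g_def d_def algebra_simps\<close>)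
  have e2: "poly (det (left v (g t) (d t))) x = det ((?A + ?Q) + t \<cdot>\<^sub>m ?Q)" for t
    unfolding det_ev_mat[symmetric]
    by (rule arg_cong[of _ _ det], rule eq_matI)
      (use Mc v Z0 in \<open>simp_all add: left_def W_def pencil_eval_def g_def d_def algebra_simps\<close>)
  assume x: "poly (pdet n M) x \<noteq> 0"
  \<comment> \<open>At \<open>t = - 1\<close> both vectors vanish and \<open>M\<close> is left.\<close>
  have undo: "(?A + B) + (- 1) \<cdot>\<^sub>m B = ?A" if "B \<in> carrier_mat n n" for B by (rule eq_matI) (use A that in auto)
  have dA: "det ?A \<noteq> 0" using x poly_pdet[OF M] by simp
  show "finite {t. poly (pdet n (pencil_add M (pair_pencil st v (g t) (d t)))) x = 0}"
    unfolding e1 by (rule finite_pencil_zeros[OF _ P, of _ "- 1"]) (use A P dA undo[OF P] in auto)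
  show "finite {t. poly (det (left v (g t) (d t))) x = 0}"
    unfolding e2 by (rule finite_pencil_zeros[OF _ Q, of _ "- 1"]) (use A Q dA undo[OF Q] in auto)
qed

lemma Z_scaled:
  assumes "v \<in> carrier_vec n" "Z v g0 d0"
  shows "finite {t. \<not> Z v (g0 + t \<cdot>\<^sub>v g0) (d0 + t \<cdot>\<^sub>v d0)}"
proof -
  have "v + t \<cdot>\<^sub>v 0\<^sub>v n = v" for t using assms by auto
  then show ?thesis using Zline[OF assms(1) Z0(2,3) zero_carrier_vec Z0(2,3) assms(2)] by simp
qed

text \<open>Scaling \<open>w\<close> towards zero shows that the determinant of the sum is generically nonzero at the zeros of \<open>G v\<close>, as the
determinant of \<open>M\<close> is nonzero there.\<close>

lemma second_vector:
  assumes v: "v \<in> carrier_vec n" "Z v g0 d0" and G0: "G v \<noteq> 0"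
    and R: "\<And>x. poly (pdet n M) x = 0 \<Longrightarrow> x \<notin> S \<Longrightarrow> poly (G v) x \<noteq> 0"
  shows "\<exists>g d. g \<in> carrier_vec n \<and> d \<in> carrier_vec n \<and> Z v g d \<and> pdet n (pencil_add M (pair_pencil st v g d)) \<noteq> 0 \<and>
    det (left v g d) \<noteq> 0 \<and> (\<forall>x. poly (G v) x = 0 \<and> x \<notin> S \<longrightarrow> poly (pdet n (pencil_add M (pair_pencil st v g d))) x \<noteq> 0)"
proof -
  obtain y where y: "poly (pdet n M) y \<noteq> 0" using poly_all_0_iff_0[of "pdet n M"] pdet_nonzero by blast
  define R2 where "R2 = insert y {x. poly (G v) x = 0 \<and> x \<notin> S}"
  have finR: "finite R2" using poly_roots_finite[OF G0] by (auto simp: R2_def intro: finite_subset[rotated])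
  have nz: "poly (pdet n M) x \<noteq> 0" if "x \<in> R2" for x using that y R by (auto simp: R2_def)
  let ?g = "\<lambda>t. g0 + t \<cdot>\<^sub>v g0" and ?d = "\<lambda>t. d0 + t \<cdot>\<^sub>v d0"
  have "finite ({t. \<not> Z v (?g t) (?d t)} \<union> {t. poly (det (left v (?g t) (?d t))) y = 0} \<union>
      (\<Union>x\<in>R2. {t. poly (pdet n (pencil_add M (pair_pencil st v (?g t) (?d t)))) x = 0}))"
    using finR by (intro finite_UnI finite_UN_I Z_scaled[OF v] scaled_pair[OF v(1)] y nz) auto
  from cofinite_ne_infinite[OF this] obtain t where t: "Z v (?g t) (?d t)" "poly (det (left v (?g t) (?d t))) y \<noteq> 0"
    "\<And>x. x \<in> R2 \<Longrightarrow> poly (pdet n (pencil_add M (pair_pencil st v (?g t) (?d t)))) x \<noteq> 0" by blast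
  have "poly (pdet n (pencil_add M (pair_pencil st v (?g t) (?d t)))) y \<noteq> 0" by (rule t(3)) (simp add: R2_def)
  then have "pdet n (pencil_add M (pair_pencil st v (?g t) (?d t))) \<noteq> 0" by auto
  moreover have "det (left v (?g t) (?d t)) \<noteq> 0" using t(2) by auto
  ultimately show ?thesis using t(1,3) Z0
    by (intro exI conjI allI impI) (auto simp: R2_def)
qed

text \<open>On the line through \<open>w\<close> in the direction \<open>(1 + c \<lambda>) v\<close> the determinant is \<open>p + t G v\<close>: the form \<open>G v\<close> depends neither on
\<open>w\<close> nor on \<open>t\<close>.\<close>

lemma generic_case:
  assumes v1: "v1 \<in> carrier_vec n" "pquad K v1 \<noteq> 0"
  shows "\<exists>v g d. v \<in> carrier_vec n \<and> g \<in> carrier_vec n \<and> d \<in> carrier_vec n \<and> Z v g d \<and>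
    simple_off n S (pencil_add M (pair_pencil st v g d))"
proof -
  from first_vector[OF v1] obtain v where v: "v \<in> carrier_vec n" "Z v g0 d0" "G v \<noteq> 0"
    "\<And>x. poly (pdet n M) x = 0 \<Longrightarrow> x \<notin> S \<Longrightarrow> poly (G v) x \<noteq> 0" by blast
  from second_vector[OF v] obtain g d where gd: "g \<in> carrier_vec n" "d \<in> carrier_vec n" "Z v g d"
    and p0: "pdet n (pencil_add M (pair_pencil st v g d)) \<noteq> 0" and l0: "det (left v g d) \<noteq> 0"
    and common: "\<And>x. poly (G v) x = 0 \<Longrightarrow> x \<notin> S \<Longrightarrow> poly (pdet n (pencil_add M (pair_pencil st v g d))) x \<noteq> 0" by blast
  let ?N = "pencil_add M (pair_pencil st v g d)"
  have N: "?N \<in> pencil_carrier n" using M v gd by simp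
  have lv: "liftv v \<in> carrier_vec n" using v by simp
  have Kq: "pquad (adj_mat A) v = liftv v \<bullet> (adj_mat A *\<^sub>v liftv v)" if A: "A \<in> carrier_mat n n" for A
  proof -
    have a: "adj_mat A \<in> carrier_mat n n" by (rule adj_mat(1)[OF A])
    have "liftv v \<bullet> (adj_mat A *\<^sub>v (1 \<cdot>\<^sub>v liftv v)) = 1 * lin 0 ^ 0 * pquad (adj_mat A) v"
      by (rule scalar_prod_pquad[OF _ a v(1)]) (rule eq_matI, use a in auto)
    moreover have "1 \<cdot>\<^sub>v liftv v = liftv v" by auto
    ultimately show ?thesis by simp
  qed
  have q: "pquad (adj_mat (pmat n ?N)) v = pquad K v"
  proof -
    have c: "[:ssign st:] \<cdot>\<^sub>v W d g \<in> carrier_vec n" by simp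
    have "liftv v \<bullet> (adj_mat (pmat n ?N) *\<^sub>v liftv v) = liftv v \<bullet> (adj_mat (left v g d) *\<^sub>v liftv v)"
      unfolding pmat_pair[OF v(1) gd(1,2)]
      by (rule adj_add_outer(2)[OF left_carrier[OF v(1)] lv _ lv l0]) (use p0 pmat_pair[OF v(1) gd(1,2)] in auto)
    also have "\<dots> = liftv v \<bullet> (adj_mat (pmat n M) *\<^sub>v liftv v)"
      unfolding left_def by (rule adj_add_outer(1)[OF pmat_carrier lv W_carrier lv pdet_nonzero]) (use l0 in \<open>simp add: left_def\<close>)
    finally show ?thesis unfolding K_def Kq[OF pmat_carrier] .
  qed
  obtain B where B: "finite B" "\<And>s. s \<notin> B \<Longrightarrow> pdet n ?N + Polynomial.smult s (G v) \<noteq> 0"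
    "\<And>s x. s \<notin> B \<Longrightarrow> poly (G v) x \<noteq> 0 \<Longrightarrow> poly (pdet n ?N + Polynomial.smult s (G v)) x = 0 \<Longrightarrow>
      order x (pdet n ?N + Polynomial.smult s (G v)) = 1"
    by (rule bertini[OF p0, of "G v"]) blast
  let ?g = "\<lambda>t. g + t \<cdot>\<^sub>v ((1 / 2) \<cdot>\<^sub>v v)" and ?d = "\<lambda>t. d + t \<cdot>\<^sub>v ((ssign st / 2) \<cdot>\<^sub>v v)"
  have vz: "v + t \<cdot>\<^sub>v 0\<^sub>v n = v" for t using v by auto
  have "finite {t. \<not> Z (v + t \<cdot>\<^sub>v 0\<^sub>v n) (?g t) (?d t)}" by (rule Zline) (use v gd in auto)
  then have "finite ({t. \<not> Z v (?g t) (?d t)} \<union> B)" using B(1) unfolding vz by simp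
  from cofinite_ne_infinite[OF this] obtain t where t: "Z v (?g t) (?d t)" "t \<notin> B" by blast
  have e: "pdet n (pencil_add M (pair_pencil st v (?g t) (?d t))) = pdet n ?N + Polynomial.smult t (G v)"
  proof -
    have cv: "csqrt t \<cdot>\<^sub>v v \<in> carrier_vec n" using v by simp
    have "csqrt t * csqrt t = t" using power2_csqrt[of t] by (simp add: power2_eq_square)
    then have "pquad (adj_mat (pmat n ?N)) (csqrt t \<cdot>\<^sub>v v) = Polynomial.smult t (pquad K v)"
      unfolding pquad_smult[OF adj_mat(1)[OF pmat_carrier] v(1)] q by simp
    then show ?thesis unfolding pair_pencil_shift[OF v(1) gd(1,2) M] pdet_add_rank1[OF N p0 cv] by (simp add: G_def)
  qed
  have "simple_off n S (pencil_add M (pair_pencil st v (?g t) (?d t)))"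
  proof (rule simple_offI; unfold e)
    show "pdet n ?N + Polynomial.smult t (G v) \<noteq> 0" by (rule B(2)[OF t(2)])
    fix x assume x: "poly (pdet n ?N + Polynomial.smult t (G v)) x = 0" "x \<notin> S"
    have "poly (G v) x \<noteq> 0" using common[OF _ x(2)] x(1) by auto
    then show "order x (pdet n ?N + Polynomial.smult t (G v)) = 1" by (rule B(3)[OF t(2) _ x(1)])
  qed
  then show ?thesis using t(1) v(1) gd(1,2)
    by (intro exI conjI) simp_all
qed

text \<open>If all the forms \<open>G v\<close> vanish, for instance for multiples of \<open>(1 - c \<lambda>) A\<close> with a skew-symmetric matrix \<open>A\<close>, then the
  adjugate is skew and the determinant splits into two factors.  Along the multiples of \<open>w\<close> each factor has simple
  roots, and the common roots of the factors are avoided.\<close>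

lemma isotropic_case:
  assumes iso: "\<And>v. v \<in> carrier_vec n \<Longrightarrow> pquad K v = 0" and n: "0 < n"
  shows "\<exists>v g d. v \<in> carrier_vec n \<and> g \<in> carrier_vec n \<and> d \<in> carrier_vec n \<and> Z v g d \<and>
    simple_off n S (pencil_add M (pair_pencil st v g d))"
proof -
  define f where "f = pdet n M"
  have f0: "f \<noteq> 0" using pdet_nonzero by (simp add: f_def)
  have nr: "poly f x \<noteq> 0" if "x \<notin> S" for x
    using root_nonzero_G[of x] that iso by (auto simp: G_def f_def)
  have skewK: "K $$ (j, i) = - K $$ (i, j)" if ij: "i < n" "j < n" for i j
  proof (rule poly_ext)
    fix x
    have z: "quad (ev_mat K x) u = 0" if "u \<in> carrier_vec n" for u
      using poly_pquad[of K u x] unfolding iso[OF that] by simp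
    have "ev_mat K x $$ (j, i) = - ev_mat K x $$ (i, j)"
      by (rule quad_zero_skew[OF _ z ij]) (use K in simp)
    then show "poly (K $$ (j, i)) x = poly (- K $$ (i, j)) x" using K ij by simp
  qed
  have bil: "a \<bullet> (K *\<^sub>v b) = (\<Sum>i = 0..<n. \<Sum>j = 0..<n. a $ i * K $$ (i, j) * b $ j)"
    if "a \<in> carrier_vec n" "b \<in> carrier_vec n" for a b
    using that K by (simp add: scalar_prod_def sum_distrib_left mult.assoc)
  have skew: "b \<bullet> (K *\<^sub>v a) = - (a \<bullet> (K *\<^sub>v b))" if ab: "a \<in> carrier_vec n" "b \<in> carrier_vec n" for a b
  proof -
    have "b \<bullet> (K *\<^sub>v a) = (\<Sum>j = 0..<n. \<Sum>i = 0..<n. b $ i * K $$ (i, j) * a $ j)"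
      unfolding bil[OF ab(2,1)] by (rule sum.swap)
    also have "\<dots> = (\<Sum>j = 0..<n. \<Sum>i = 0..<n. - (a $ j * K $$ (j, i) * b $ i))"
    proof (intro sum.cong refl)
      fix j i assume "j \<in> {0..<n}" "i \<in> {0..<n}"
      then have "K $$ (i, j) = - K $$ (j, i)" by (intro skewK) auto
      then show "b $ i * K $$ (i, j) * a $ j = - (a $ j * K $$ (j, i) * b $ i)" by (simp only:) simp
    qed
    finally show ?thesis unfolding bil[OF ab] sum_negf .
  qed
  define al where "al v g d = W g d \<bullet> (K *\<^sub>v liftv v)" for v g d
  define be where "be v g d = liftv v \<bullet> (K *\<^sub>v ([:ssign st:] \<cdot>\<^sub>v W d g))" for v g d
  have "omega st \<noteq> 0" by (simp add: omega_def)
  then have "f * omega st \<noteq> 0" using f0 by simp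
  then obtain y where "poly (f * omega st) y \<noteq> 0" using poly_all_0_iff_0[of "f * omega st"] by blast
  then have y: "poly f y \<noteq> 0" "1 + ssign st * y \<noteq> 0" by auto
  define h where "h v g d = (\<Sum>i = 0..<n. \<Sum>j = 0..<n. (g $ i + ssign st * d $ i) * poly (K $$ (i, j)) y * v $ j)" for v g d
  have diff: "poly (al v g d - be v g d) y = (1 + ssign st * y) * h v g d"
    if c: "v \<in> carrier_vec n" "g \<in> carrier_vec n" "d \<in> carrier_vec n" for v g d
  proof -
    have lv: "liftv v \<in> carrier_vec n" using c by simp
    have be: "be v g d = - (([:ssign st:] \<cdot>\<^sub>v W d g) \<bullet> (K *\<^sub>v liftv v))"
      unfolding be_def by (rule skew) (use lv in auto)
    have ix: "([:ssign st:] \<cdot>\<^sub>v W d g) $ i = [:ssign st:] * W d g $ i" if "i < n" for i using that by (simp add: W_def)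
    have "al v g d - be v g d = (\<Sum>i = 0..<n. \<Sum>j = 0..<n. (W g d $ i + [:ssign st:] * W d g $ i) * K $$ (i, j) * liftv v $ j)"
      unfolding be al_def diff_minus_eq_add bil[OF W_carrier lv] bil[OF smult_carrier_vec[THEN iffD2, OF W_carrier] lv] sum.distrib[symmetric]
      by (intro sum.cong refl) (simp only: ix atLeastLessThan_iff distrib_right)
    then show ?thesis unfolding h_def sum_distrib_left using c
      by (simp add: poly_sum, intro sum.cong refl) (cases st; simp add: W_def algebra_simps)
  qed
  obtain k l where kl: "k < n" "l < n" "poly (K $$ (k, l)) y \<noteq> 0"
  proof -
    have "ev_mat K y \<noteq> 0\<^sub>m n n"
    proof
      assume z: "ev_mat K y = 0\<^sub>m n n"
      have "(pmat n M * K) $$ (0, 0) = f" unfolding K_def adj_mat(2)[OF pmat_carrier] f_def using n by simp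
      then have "poly f y = (ev_mat (pmat n M * K) y) $$ (0, 0)" using n K by simp
      also have "\<dots> = 0" unfolding ev_mat_mult[OF pmat_carrier K] z using n by simp
      finally show False using y by simp
    qed
    then show thesis using nonzero_mat_entry[of "ev_mat K y" n n] K that by auto
  qed
  have "h (unit_vec n l) (unit_vec n k) (0\<^sub>v n) = (\<Sum>i = 0..<n. if i = k then (\<Sum>j = 0..<n. if j = l then poly (K $$ (k, l)) y else 0) else 0)"
    unfolding h_def
  proof (intro sum.cong refl)
    fix i assume i: "i \<in> {0..<n}"
    show "(\<Sum>j = 0..<n. (unit_vec n k $ i + ssign st * 0\<^sub>v n $ i) * poly (K $$ (i, j)) y * unit_vec n l $ j) =
      (if i = k then \<Sum>j = 0..<n. if j = l then poly (K $$ (k, l)) y else 0 else 0)"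
    proof (cases "i = k")
      case True
      show ?thesis unfolding if_P[OF True] by (intro sum.cong refl) (use i kl True in auto)
    qed (use i kl in auto)
  qed
  then have h1: "h (unit_vec n l) (unit_vec n k) (0\<^sub>v n) \<noteq> 0" using kl by (simp add: sum.delta)
  define v' g' d' where "v' = unit_vec n l - v0" and "g' = unit_vec n k - g0" and "d' = 0\<^sub>v n - d0"
  have c': "v' \<in> carrier_vec n" "g' \<in> carrier_vec n" "d' \<in> carrier_vec n" using Z0 by (auto simp: v'_def g'_def d'_def)
  define q where "q = (\<Sum>i = 0..<n. \<Sum>j = 0..<n. [:g0 $ i + ssign st * d0 $ i, g' $ i + ssign st * d' $ i:] * [:poly (K $$ (i, j)) y:] * [:v0 $ j, v' $ j:])"
  have q: "h (v0 + t \<cdot>\<^sub>v v') (g0 + t \<cdot>\<^sub>v g') (d0 + t \<cdot>\<^sub>v d') = poly q t" for t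
    unfolding h_def q_def poly_sum by (intro sum.cong refl) (use Z0 c' in \<open>simp add: algebra_simps\<close>)
  have "poly q 1 \<noteq> 0" unfolding q[symmetric] v'_def g'_def d'_def
      line_between(2)[OF Z0(1) unit_vec_carrier] line_between(2)[OF Z0(2) unit_vec_carrier] line_between(2)[OF Z0(3) zero_carrier_vec] by (rule h1)
  then have "finite {t. poly q t = 0}" by (intro poly_roots_finite) auto
  then have "finite ({t. \<not> Z (v0 + t \<cdot>\<^sub>v v') (g0 + t \<cdot>\<^sub>v g') (d0 + t \<cdot>\<^sub>v d')} \<union> {t. poly q t = 0})"
    using Zline[OF Z0(1-3) c' Z0(4)] by simp
  from cofinite_ne_infinite[OF this] obtain t where t: "Z (v0 + t \<cdot>\<^sub>v v') (g0 + t \<cdot>\<^sub>v g') (d0 + t \<cdot>\<^sub>v d')" "poly q t \<noteq> 0" by blast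
  define v g d where "v = v0 + t \<cdot>\<^sub>v v'" and "g = g0 + t \<cdot>\<^sub>v g'" and "d = d0 + t \<cdot>\<^sub>v d'"
  have c: "v \<in> carrier_vec n" "g \<in> carrier_vec n" "d \<in> carrier_vec n" using Z0 c' by (auto simp: v_def g_def d_def)
  have Zv: "Z v g d" using t(1) by (simp add: v_def g_def d_def)
  have hv: "h v g d \<noteq> 0" using t(2) q by (simp add: v_def g_def d_def)
  define a b where "a = al v g d" and "b = be v g d"
  have ab: "a - b \<noteq> 0" using diff[OF c] hv y(2) by (auto simp: a_def b_def)
  obtain B1 where B1: "finite B1" "0 \<in> B1" "\<And>s. s \<notin> B1 \<Longrightarrow> f + Polynomial.smult s a \<noteq> 0"
    "\<And>s x. s \<notin> B1 \<Longrightarrow> poly a x \<noteq> 0 \<Longrightarrow> poly (f + Polynomial.smult s a) x = 0 \<Longrightarrow> order x (f + Polynomial.smult s a) = 1"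
    by (rule bertini[OF f0, of a]) blast
  obtain B2 where B2: "finite B2" "0 \<in> B2" "\<And>s. s \<notin> B2 \<Longrightarrow> f + Polynomial.smult s b \<noteq> 0"
    "\<And>s x. s \<notin> B2 \<Longrightarrow> poly b x \<noteq> 0 \<Longrightarrow> poly (f + Polynomial.smult s b) x = 0 \<Longrightarrow> order x (f + Polynomial.smult s b) = 1"
    by (rule bertini[OF f0, of b]) blast
  define B where "B = B1 \<union> B2 \<union> (\<lambda>x. - poly f x / poly a x) ` {x. poly (a - b) x = 0}"
  have finB: "finite B" using B1(1) B2(1) poly_roots_finite[OF ab] by (simp add: B_def)
  have vz: "v + t \<cdot>\<^sub>v 0\<^sub>v n = v" for t using c by auto
  have "finite {t. \<not> Z (v + t \<cdot>\<^sub>v 0\<^sub>v n) (g + t \<cdot>\<^sub>v g) (d + t \<cdot>\<^sub>v d)}" by (rule Zline) (use c Zv in auto)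
  then have "finite ({t. \<not> Z v (g + t \<cdot>\<^sub>v g) (d + t \<cdot>\<^sub>v d)} \<union> (\<lambda>s. s - 1) ` B)" using finB unfolding vz by simp
  from cofinite_ne_infinite[OF this] obtain t1 where t1: "Z v (g + t1 \<cdot>\<^sub>v g) (d + t1 \<cdot>\<^sub>v d)" "t1 \<notin> (\<lambda>s. s - 1) ` B" by blast
  define s where "s = 1 + t1"
  have sB: "s \<notin> B" using t1(2) by (auto simp: s_def image_iff)
  let ?g = "g + t1 \<cdot>\<^sub>v g" and ?d = "d + t1 \<cdot>\<^sub>v d"
  have c1: "?g \<in> carrier_vec n" "?d \<in> carrier_vec n" using c by auto
  have Ws: "W ?g ?d = [:s:] \<cdot>\<^sub>v W g d" "W ?d ?g = [:s:] \<cdot>\<^sub>v W d g"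
    by (rule eq_vecI; use c in \<open>simp add: W_def s_def algebra_simps\<close>)+
  have lv: "liftv v \<in> carrier_vec n" using c by simp
  have Kv: "K *\<^sub>v u \<in> carrier_vec n" if "u \<in> carrier_vec n" for u using K that by (rule mult_mat_vec_carrier)
  have as: "al v ?g ?d = Polynomial.smult s a" unfolding al_def a_def Ws by (simp add: smult_scalar_prod_distrib[OF W_carrier Kv[OF lv]])
  have "[:ssign st:] \<cdot>\<^sub>v W ?d ?g = [:s:] \<cdot>\<^sub>v ([:ssign st:] \<cdot>\<^sub>v W d g)"
    unfolding Ws by (rule eq_vecI) (simp_all add: W_def mult.commute)
  then have bs: "be v ?g ?d = Polynomial.smult s b" unfolding be_def b_def
    using mult_mat_smult_vec[OF K, of "[:ssign st:] \<cdot>\<^sub>v W d g" "[:s:]"] Kv[of "[:ssign st:] \<cdot>\<^sub>v W d g"] lv by simp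
  have dl: "det (left v ?g ?d) = f + Polynomial.smult s a"
    unfolding left_def as[symmetric] al_def f_def K_def by (rule det_add_outer[OF pmat_carrier lv W_carrier pdet_nonzero])
  have one: "liftv v \<bullet> (K *\<^sub>v liftv v) = 0"
  proof -
    have "liftv v \<bullet> (K *\<^sub>v liftv v) = - (liftv v \<bullet> (K *\<^sub>v liftv v))" by (rule skew[OF lv lv])
    then show ?thesis by (simp add: eq_neg_iff_add_eq_0 flip: mult_2)
  qed
  let ?p = "pdet n (pencil_add M (pair_pencil st v ?g ?d))"
  have prod: "f * ?p = (f + Polynomial.smult s a) * (f + Polynomial.smult s b)"
  proof -
    have "det (pmat n M) * det (pmat n M + outer (liftv v) (W ?g ?d) + outer ([:ssign st:] \<cdot>\<^sub>v W ?d ?g) (liftv v)) =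
      (det (pmat n M) + W ?g ?d \<bullet> (adj_mat (pmat n M) *\<^sub>v liftv v)) * (det (pmat n M) + liftv v \<bullet> (adj_mat (pmat n M) *\<^sub>v ([:ssign st:] \<cdot>\<^sub>v W ?d ?g)))"
      by (rule det_add_pair_isotropic[OF pmat_carrier lv W_carrier _ pdet_nonzero _ one[unfolded K_def]])
        (use dl B1(3) sB in \<open>auto simp: left_def B_def\<close>)
    then show ?thesis unfolding pmat_pair[OF c(1) c1] left_def as[symmetric] bs[symmetric] al_def be_def f_def K_def .
  qed
  have ne: "f + Polynomial.smult s a \<noteq> 0" "f + Polynomial.smult s b \<noteq> 0" using B1(3) B2(3) sB by (auto simp: B_def)
  then have p0: "?p \<noteq> 0" using prod by auto
  have "simple_off n S (pencil_add M (pair_pencil st v ?g ?d))"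
  proof (rule simple_offI[OF p0])
    fix x assume x: "poly ?p x = 0" "x \<notin> S"
    have fx: "poly f x \<noteq> 0" by (rule nr[OF x(2)])
    have s0: "s \<noteq> 0" using sB B1(2) by (auto simp: B_def)
    have sum: "order x ?p = order x (f + Polynomial.smult s a) + order x (f + Polynomial.smult s b)"
    proof -
      have "order x (f * ?p) = order x ?p" using f0 p0 fx by (simp add: order_mult order_0I)
      moreover have "order x ((f + Polynomial.smult s a) * (f + Polynomial.smult s b)) = order x (f + Polynomial.smult s a) + order x (f + Polynomial.smult s b)"
        by (rule order_mult) (use ne in simp)
      ultimately show ?thesis unfolding prod by simp
    qed
    have "poly (f + Polynomial.smult s a) x * poly (f + Polynomial.smult s b) x = 0"
      using arg_cong[OF prod, of "\<lambda>r. poly r x"] x(1) by (simp only: poly_mult mult_zero_right)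
    moreover have "\<not> (poly (f + Polynomial.smult s a) x = 0 \<and> poly (f + Polynomial.smult s b) x = 0)"
    proof
      assume "poly (f + Polynomial.smult s a) x = 0 \<and> poly (f + Polynomial.smult s b) x = 0"
      then have e: "poly f x + s * poly a x = 0" "poly f x + s * poly b x = 0" by auto
      then have "s * poly a x = - poly f x" "s * poly b x = - poly f x" by (simp_all add: eq_neg_iff_add_eq_0 add.commute)
      then have "s * poly a x = s * poly b x" by (simp only:)
      then have "poly (a - b) x = 0" using s0 by simp
      moreover have "poly a x \<noteq> 0" using e(1) fx by auto
      moreover from this have "s = - poly f x / poly a x" using e(1) \<open>poly a x \<noteq> 0\<close> by (simp add: field_simps eq_neg_iff_add_eq_0 add.commute)
      ultimately show False using sB by (auto simp: B_def)
    qed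
    ultimately consider "poly (f + Polynomial.smult s a) x = 0" "poly (f + Polynomial.smult s b) x \<noteq> 0" |
      "poly (f + Polynomial.smult s a) x \<noteq> 0" "poly (f + Polynomial.smult s b) x = 0" by auto
    then show "order x ?p = 1"
    proof cases
      case 1
      then have "poly a x \<noteq> 0" using fx by auto
      then have "order x (f + Polynomial.smult s a) = 1" using B1(4)[of s x] sB 1(1) by (simp add: B_def)
      then show ?thesis using sum order_0I[OF 1(2)] by simp
    next
      case 2
      then have "poly b x \<noteq> 0" using fx by auto
      then have "order x (f + Polynomial.smult s b) = 1" using B2(4)[of s x] sB 2(2) by (simp add: B_def)
      then show ?thesis using sum order_0I[OF 2(1)] by simp
    qed
  qed
  then show ?thesis using t1(1) c(1) c1 by (intro exI conjI)
qed

lemma exists_simple: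
  "\<exists>v g d. v \<in> carrier_vec n \<and> g \<in> carrier_vec n \<and> d \<in> carrier_vec n \<and> Z v g d \<and>
    simple_off n S (pencil_add M (pair_pencil st v g d))"
proof (cases "n = 0")
  case True
  have "pdet 0 L = 1" for L by (rule det_dim_zero[OF pmat_carrier])
  then have "pdet n L = 1" for L using True by simp
  then have "simple_off n S L" for L by (simp add: simple_off_def)
  then show ?thesis using Z0 by blast
next
  case False
  show ?thesis
  proof (cases "\<exists>v1\<in>carrier_vec n. pquad K v1 \<noteq> 0")
    case True
    then show ?thesis by (elim bexE) (rule generic_case)
  next
    case aniso: False
    show ?thesis by (rule isotropic_case) (use aniso False in auto)
  qed
qed

end

lemma exists_simple_rank1:
  assumes M: "M \<in> pencil_carrier n" and f0: "pdet n M \<noteq> 0" and nr: "\<And>x. x \<notin> S \<Longrightarrow> poly (pdet n M) x \<noteq> 0"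
    and u0: "u0 \<in> carrier_vec n" "Z u0" and Zline: "finite {t. \<not> Z (u0 + t \<cdot>\<^sub>v u0)}"
  shows "\<exists>u\<in>carrier_vec n. Z u \<and> simple_off n S (pencil_add M (rank1 st u))"
proof -
  let ?f = "pdet n M" and ?g = "omega st * pquad (adj_mat (pmat n M)) u0"
  obtain B where B: "finite B" "\<And>s. s \<notin> B \<Longrightarrow> ?f + Polynomial.smult s ?g \<noteq> 0"
    "\<And>s x. s \<notin> B \<Longrightarrow> poly ?g x \<noteq> 0 \<Longrightarrow> poly (?f + Polynomial.smult s ?g) x = 0 \<Longrightarrow> order x (?f + Polynomial.smult s ?g) = 1"
    by (rule bertini[OF f0, of ?g]) blast
  \<comment> \<open>Scaling \<open>u0\<close> by \<open>1 + t\<close> scales the matrix of rank one by the square.\<close>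
  have "finite {t. (1 + t) * (1 + t) = b}" for b :: complex
  proof -
    have "{t. (1 + t) * (1 + t) = b} = {t. poly [:1 - b, 2, 1:] t = 0}" by (auto simp: algebra_simps)
    then show ?thesis using poly_roots_finite[of "[:1 - b, 2, 1:]"] by simp
  qed
  then have "finite ({t. \<not> Z (u0 + t \<cdot>\<^sub>v u0)} \<union> (\<Union>b\<in>B. {t. (1 + t) * (1 + t) = b}))" using Zline B(1) by blast
  from cofinite_ne_infinite[OF this] obtain t where t: "Z (u0 + t \<cdot>\<^sub>v u0)" "(1 + t) * (1 + t) \<notin> B" by blast
  let ?u = "u0 + t \<cdot>\<^sub>v u0" let ?s = "(1 + t) * (1 + t)"
  have uc: "?u \<in> carrier_vec n" using u0 by simp
  have "?u = (1 + t) \<cdot>\<^sub>v u0" by (rule eq_vecI) (auto simp: algebra_simps)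
  then have e: "pdet n (pencil_add M (rank1 st ?u)) = ?f + Polynomial.smult ?s ?g"
    unfolding pdet_add_rank1[OF M f0 uc] using pquad_smult[OF adj_mat(1)[OF pmat_carrier] u0(1)] by simp
  have "simple_off n S (pencil_add M (rank1 st ?u))"
  proof (rule simple_offI; unfold e)
    show "?f + Polynomial.smult ?s ?g \<noteq> 0" by (rule B(2)[OF t(2)])
    fix x assume x: "poly (?f + Polynomial.smult ?s ?g) x = 0" "x \<notin> S"
    have "poly ?g x \<noteq> 0" using nr[OF x(2)] x(1) by auto
    then show "order x (?f + Polynomial.smult ?s ?g) = 1" by (rule B(3)[OF t(2) _ x(1)])
  qed
  then show ?thesis using t(1) uc by blast
qed

definition blocks :: "nat \<Rightarrow> nat \<Rightarrow> (nat \<Rightarrow> complex vec) \<Rightarrow> complex vec" where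
  "blocks m n b = vec m (\<lambda>i. b (i div n) $ (i mod n))"

lemma blocks_carrier [simp]: "blocks m n b \<in> carrier_vec m"
  by (simp add: blocks_def)

lemma vec_block_blocks:
  assumes k: "k < N" and b: "b k \<in> carrier_vec n"
  shows "vec_block n (blocks (N * n) n b) k = b k"
proof (rule eq_vecI)
  fix i assume "i < dim_vec (b k)"
  then have i: "i < n" using b by simp
  have "k * n + i < Suc k * n" using i by simp
  also have "\<dots> \<le> N * n" using k by (intro mult_right_mono) auto
  finally show "vec_block n (blocks (N * n) n b) k $ i = b k $ i" using i by (simp add: vec_block_def blocks_def)
qed (use b in \<open>simp add: vec_block_def\<close>)

lemma blocks_vec_block:
  assumes "x \<in> carrier_vec (N * n)" shows "blocks (N * n) n (vec_block n x) = x"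
proof (rule eq_vecI)
  fix i assume "i < dim_vec x"
  then have i: "i < N * n" using assms by simp
  then have "0 < n" by (cases n) auto
  then show "blocks (N * n) n (vec_block n x) $ i = x $ i" using i by (simp add: blocks_def vec_block_def)
qed (use assms in \<open>simp add: blocks_def\<close>)

lemma blocks_line:
  assumes "\<And>k. b k \<in> carrier_vec n" "\<And>k. b' k \<in> carrier_vec n"
  shows "blocks (N * n) n (\<lambda>k. b k + t \<cdot>\<^sub>v b' k) = blocks (N * n) n b + t \<cdot>\<^sub>v blocks (N * n) n b'"
proof (rule eq_vecI)
  fix i assume "i < dim_vec (blocks (N * n) n b + t \<cdot>\<^sub>v blocks (N * n) n b')"
  then have i: "i < N * n" by (simp add: blocks_def)
  then have "0 < n" by (cases n) auto
  then have "i mod n < dim_vec (b k)" "i mod n < dim_vec (b' k)" for k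
    using assms(1)[of k] assms(2)[of k] by simp_all
  then show "blocks (N * n) n (\<lambda>k. b k + t \<cdot>\<^sub>v b' k) $ i = (blocks (N * n) n b + t \<cdot>\<^sub>v blocks (N * n) n b') $ i"
    using i by (simp add: blocks_def)
qed (simp add: blocks_def)

lemma finite_block_line:
  assumes P: "polynomial_function (N * n) P" and b: "\<And>k. b k \<in> carrier_vec n" "\<And>k. b' k \<in> carrier_vec n"
    and nz: "P (blocks (N * n) n b) \<noteq> 0" and eq: "\<And>t k. c t k = b k + t \<cdot>\<^sub>v b' k"
  shows "finite {t. \<not> P (blocks (N * n) n (c t)) \<noteq> 0}"
proof -
  have "c t = (\<lambda>k. b k + t \<cdot>\<^sub>v b' k)" for t using eq by blast
  then have e: "blocks (N * n) n (c t) = blocks (N * n) n b + t \<cdot>\<^sub>v blocks (N * n) n b'" for t using blocks_line[OF b] by simp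
  have "blocks (N * n) n b + (0 :: complex) \<cdot>\<^sub>v blocks (N * n) n b' = blocks (N * n) n b" by (rule eq_vecI) (auto simp: blocks_def)
  then have "finite {t. P (blocks (N * n) n b + t \<cdot>\<^sub>v blocks (N * n) n b') = 0}"
    by (intro finite_line_zeros[OF P _ _, of _ _ 0]) (use nz in simp_all)
  then show ?thesis unfolding e by simp
qed

text \<open>The summand for odd \<open>r\<close> is added first and the pairs follow one by one; the blocks of the point \<open>x\<close> that belong to the
other summands stay fixed.\<close>

theorem dense_simple:
  assumes L: "L \<in> pencil_carrier n" and s: "has_structure st L" and d: "pdet n L \<noteq> 0"
    and S: "\<And>x. poly (pdet n L) x = 0 \<Longrightarrow> x \<in> S" and par: "- ssign st \<notin> S \<Longrightarrow> even n"
    and P: "polynomial_function ((3 * r) div 2 * n) P" and x0: "x0 \<in> carrier_vec ((3 * r) div 2 * n)" "P x0 \<noteq> 0"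
  shows "\<exists>x\<in>carrier_vec ((3 * r) div 2 * n). P x \<noteq> 0 \<and> simple_off n S (pencil_add L (Phi st n r x))"
proof -
  define N q where "N = (3 * r) div 2" and "q = r div 2"
  define E where "E x k = pair_sum st (odd_term st n r (vec_block n x (3 * q))) (vec_block n x)
    (\<lambda>j. vec_block n x (q + j)) (\<lambda>j. vec_block n x (2 * q + j)) k" for x k
  have N: "N = 3 * q + r mod 2" unfolding N_def q_def by (rule block_count)
  have cE: "perturbation st n (2 * k + r mod 2) (E x k)" for x k
    unfolding E_def by (rule perturbation_pair_sum) simp_all
  note P' = P[folded N_def] and x0' = x0[folded N_def]
  have zl: "a + t \<cdot>\<^sub>v 0\<^sub>v n = a" if "a \<in> carrier_vec n" for a and t :: complex using that by auto
  have "k \<le> q \<Longrightarrow> \<exists>x\<in>carrier_vec (N * n). P x \<noteq> 0 \<and> simple_off n S (pencil_add L (E x k))" for k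
  proof (induction k)
    case 0
    show ?case
    proof (cases "odd r")
      case False
      then have "E x 0 = (0\<^sub>m n n, 0\<^sub>m n n)" for x by (simp add: E_def odd_term_def)
      moreover have "simple_off n S L" using d S by (auto simp: simple_off_def)
      ultimately show ?thesis using x0' pencil_add_zero(2)[OF L] by auto
    next
      case True
      then have q3: "3 * q < N" using N by (simp add: odd_iff_mod_2_eq_one)
      let ?b = "\<lambda>u. (vec_block n x0)(3 * q := u)"
      have same: "?b (vec_block n x0 (3 * q)) = vec_block n x0" by simp
      have "\<exists>u\<in>carrier_vec n. P (blocks (N * n) n (?b u)) \<noteq> 0 \<and> simple_off n S (pencil_add L (rank1 st u))"
      proof (rule exists_simple_rank1[OF L d])
        show "poly (pdet n L) x \<noteq> 0" if "x \<notin> S" for x using S that by blast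
        show "vec_block n x0 (3 * q) \<in> carrier_vec n" by simp
        show nz: "P (blocks (N * n) n (?b (vec_block n x0 (3 * q)))) \<noteq> 0"
          unfolding same blocks_vec_block[OF x0'(1)] by (rule x0'(2))
        show "finite {t. \<not> P (blocks (N * n) n (?b (vec_block n x0 (3 * q) + t \<cdot>\<^sub>v vec_block n x0 (3 * q)))) \<noteq> 0}"
          by (rule finite_block_line[OF P', of "vec_block n x0" "(\<lambda>_. 0\<^sub>v n)(3 * q := vec_block n x0 (3 * q))"])
            (use nz zl in auto)
      qed
      then obtain u where u: "u \<in> carrier_vec n" "P (blocks (N * n) n (?b u)) \<noteq> 0" "simple_off n S (pencil_add L (rank1 st u))" by blast
      have "vec_block n (blocks (N * n) n (?b u)) (3 * q) = u" using vec_block_blocks[OF q3, of "?b u" n] u(1) by simp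
      then have "E (blocks (N * n) n (?b u)) 0 = rank1 st u" using True by (simp add: E_def odd_term_def)
      then show ?thesis using u by (intro bexI[of _ "blocks (N * n) n (?b u)"]) auto
    qed
  next
    case (Suc k)
    then obtain x where x: "x \<in> carrier_vec (N * n)" "P x \<noteq> 0" "simple_off n S (pencil_add L (E x k))" by auto
    have kq: "k < q" using Suc by simp
    let ?M = "pencil_add L (E x k)" and ?\<beta> = "vec_block n x"
    let ?b = "\<lambda>v g d. ?\<beta>(k := v, q + k := g, 2 * q + k := d)"
    let ?Z = "\<lambda>v g d. P (blocks (N * n) n (?b v g d)) \<noteq> 0"
    have same: "?b (?\<beta> k) (?\<beta> (q + k)) (?\<beta> (2 * q + k)) = ?\<beta>" by auto
    have "adding_pair n st ?M S ?Z (?\<beta> k) (?\<beta> (q + k)) (?\<beta> (2 * q + k))"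
    proof
      show "?M \<in> pencil_carrier n" "has_structure st ?M"
        using structure_add[OF L perturbation_carrier[OF cE] s perturbation_structure[OF cE]] L perturbation_carrier[OF cE] by auto
      show "simple_off n S ?M" by (rule x(3))
      show "- ssign st \<notin> S \<Longrightarrow> even n" by (rule par)
      show "?Z (?\<beta> k) (?\<beta> (q + k)) (?\<beta> (2 * q + k))" unfolding same blocks_vec_block[OF x(1)] by (rule x(2))
      fix v g d v' g' d' :: "complex vec" assume c: "v \<in> carrier_vec n" "g \<in> carrier_vec n" "d \<in> carrier_vec n"
        "v' \<in> carrier_vec n" "g' \<in> carrier_vec n" "d' \<in> carrier_vec n" and nz: "?Z v g d"
      show "finite {t. \<not> ?Z (v + t \<cdot>\<^sub>v v') (g + t \<cdot>\<^sub>v g') (d + t \<cdot>\<^sub>v d')}"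
        by (rule finite_block_line[OF P' _ _ nz, of "(\<lambda>_. 0\<^sub>v n)(k := v', q + k := g', 2 * q + k := d')"]) (use c zl in auto)
    qed simp_all
    from adding_pair.exists_simple[OF this] obtain v g d where c: "v \<in> carrier_vec n" "g \<in> carrier_vec n" "d \<in> carrier_vec n"
      and z: "?Z v g d" and simple: "simple_off n S (pencil_add ?M (pair_pencil st v g d))" by (elim exE conjE) (rule that)
    let ?x = "blocks (N * n) n (?b v g d)"
    have bl: "vec_block n ?x j = ?b v g d j" if "j < N" for j by (rule vec_block_blocks[OF that]) (use c in auto)
    have eo: "odd_term st n r (vec_block n ?x (3 * q)) = odd_term st n r (?\<beta> (3 * q))"
      using bl[of "3 * q"] kq N by (auto simp: odd_term_def odd_iff_mod_2_eq_one)
    have NN: "3 * q \<le> N" using N by simp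
    have ep: "pair_sum st U (vec_block n ?x) (\<lambda>j. vec_block n ?x (q + j)) (\<lambda>j. vec_block n ?x (2 * q + j)) k =
        pair_sum st U ?\<beta> (\<lambda>j. ?\<beta> (q + j)) (\<lambda>j. ?\<beta> (2 * q + j)) k" for U
      by (rule pair_sum_cong) (use kq NN in \<open>simp add: bl\<close>)
    have last: "vec_block n ?x k = v" "vec_block n ?x (q + k) = g" "vec_block n ?x (2 * q + k) = d"
      using kq NN by (simp_all add: bl)
    have "E ?x (Suc k) = pencil_add (E x k) (pair_pencil st v g d)"
      unfolding E_def pair_sum.simps eo ep last ..
    then have "pencil_add L (E ?x (Suc k)) = pencil_add ?M (pair_pencil st v g d)"
      using pencil_add_assoc[OF L perturbation_carrier[OF cE] pair_pencil_carrier[OF c]] by simp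
    then show ?case using z simple by (intro bexI[of _ ?x]) auto
  qed
  from this[OF le_refl] show ?thesis unfolding E_def q_def N_def Phi_eq_pair_sum .
qed

text \<open>A polynomial in characteristic zero has a multiple root exactly if it shares a root with its derivative.\<close>

lemma resultant_pderiv:
  fixes q :: "complex poly"
  assumes q: "q \<noteq> 0"
  shows "resultant q (pderiv q) \<noteq> 0 \<longleftrightarrow> (\<forall>y. poly q y = 0 \<longrightarrow> order y q = 1)"
proof
  assume r: "resultant q (pderiv q) \<noteq> 0"
  then have g: "degree (gcd q (pderiv q)) = 0" by (simp add: resultant_0_gcd)
  show "\<forall>y. poly q y = 0 \<longrightarrow> order y q = 1"
  proof (intro allI impI, rule ccontr)
    fix y assume y: "poly q y = 0" and o: "order y q \<noteq> 1"
    have "order y q = Suc (order y (pderiv q))" by (rule order_pderiv[OF q y])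
    then have "poly (pderiv q) y = 0" using o order_root[of "pderiv q" y] by simp
    then have "lin y dvd gcd q (pderiv q)" using y by (simp add: lin_dvd_iff)
    moreover have "gcd q (pderiv q) \<noteq> 0" using q by simp
    ultimately have "degree (lin y) \<le> degree (gcd q (pderiv q))" by (rule dvd_imp_degree_le)
    then show False using g by (simp add: lin_def)
  qed
next
  assume s: "\<forall>y. poly q y = 0 \<longrightarrow> order y q = 1"
  show "resultant q (pderiv q) \<noteq> 0"
  proof
    assume "resultant q (pderiv q) = 0"
    then have "degree (gcd q (pderiv q)) \<noteq> 0" by (simp add: resultant_0_gcd)
    then obtain y where y: "poly (gcd q (pderiv q)) y = 0"
      using fundamental_theorem_of_algebra[of "gcd q (pderiv q)"] constant_degree[of "gcd q (pderiv q)"] by auto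
    then have "lin y dvd q" "lin y dvd pderiv q" unfolding lin_dvd_iff[symmetric] by auto
    then have r: "poly q y = 0" "poly (pderiv q) y = 0" by (simp_all add: lin_dvd_iff)
    have e: "order y q = Suc (order y (pderiv q))" by (rule order_pderiv[OF q r(1)])
    then have p0: "order y (pderiv q) = 0" using s r(1) by simp
    have "pderiv q \<noteq> 0"
    proof
      assume "pderiv q = 0"
      then have "degree q = 0" by (simp add: pderiv_eq_0_iff)
      then obtain c where "q = [:c:]" by (rule degree_eq_zeroE)
      then show False using r(1) q by simp
    qed
    then show False using p0 r(2) by (simp add: order_root)
  qed
qed

lemma prod_lin_dvd:
  assumes "finite S" "p \<noteq> 0" "\<And>a. a \<in> S \<Longrightarrow> n a \<le> order a p"
  shows "(\<Prod>a\<in>S. lin a ^ n a) dvd p"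
  using assms(1,3)
proof (induction S)
  case (insert a S)
  then obtain k where k: "p = (\<Prod>a\<in>S. lin a ^ n a) * k" by (auto elim: dvdE)
  have k0: "k \<noteq> 0" and P0: "(\<Prod>a\<in>S. lin a ^ n a) \<noteq> 0" using k assms(2) by auto
  have "poly (\<Prod>a\<in>S. lin a ^ n a) a \<noteq> 0" using insert(1,2) by (auto simp: poly_prod)
  then have "order a p = order a k" unfolding k using k0 P0 by (simp add: order_mult order_0I)
  then have "lin a ^ n a dvd k" using insert.prems[of a] by (simp add: lin_power_dvd_order[OF k0])
  then show ?case using insert(1,2) k by (simp add: mult.commute mult_dvd_mono)
qed simp

lemma order_prod_lin:
  assumes "finite S"
  shows "order y (\<Prod>a\<in>S. lin a ^ n a) = (if y \<in> S then n y else 0)"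
  using assms
proof (induction S)
  case (insert a S)
  have P0: "(\<Prod>a\<in>S. lin a ^ n a) \<noteq> 0" using insert(1) by simp
  have "order y (lin a ^ n a) = (if y = a then n a else 0)"
    by (cases "y = a") (auto intro: order_eq_iff[of _ _ _ 1] order_0I)
  then show ?case using insert P0 by (auto simp: order_mult)
qed simp

text \<open>Dividing by the known roots, whose multiplicities are generically constant, gives a family of polynomials whose
  coefficients are again polynomials in the parameters.  Where its degree is maximal, the discriminant is a polynomial
  in the parameters as well, and density provides a point where it does not vanish.\<close>

lemma generically_simple_roots:
  fixes F :: "complex vec \<Rightarrow> complex poly"
  assumes F: "poly_family m F" and deg: "\<And>x. degree (F x) \<le> N" and fin: "finite S"
    and gen: "generically m (\<lambda>x. F x \<noteq> 0 \<and> (\<forall>a\<in>S. order a (F x) = n a))"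
    and dense: "\<And>P x0. polynomial_function m P \<Longrightarrow> x0 \<in> carrier_vec m \<Longrightarrow> P x0 \<noteq> 0 \<Longrightarrow>
      \<exists>x\<in>carrier_vec m. P x \<noteq> 0 \<and> (\<forall>y. poly (F x) y = 0 \<and> y \<notin> S \<longrightarrow> order y (F x) = 1)"
  shows "generically m (\<lambda>x. \<forall>y. poly (F x) y = 0 \<and> y \<notin> S \<longrightarrow> order y (F x) = 1)"
proof -
  define D where "D = (\<Prod>a\<in>S. lin a ^ n a)"
  have D0: "D \<noteq> 0" using fin by (simp add: D_def)
  define q where "q x = F x div D" for x
  have fq: "poly_family m q" unfolding q_def
    by (rule poly_family_linear[OF F deg]) (simp_all add: poly_div_add_left div_smult_left)
  from gen obtain P0 x0 where P0: "polynomial_function m P0" and x0: "x0 \<in> carrier_vec m" "P0 x0 \<noteq> 0"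
    and F0: "\<And>x. x \<in> carrier_vec m \<Longrightarrow> P0 x \<noteq> 0 \<Longrightarrow> F x \<noteq> 0 \<and> (\<forall>a\<in>S. order a (F x) = n a)"
    unfolding generically_def by blast
  have split: "F x = D * q x" "q x \<noteq> 0" if x: "x \<in> carrier_vec m" "P0 x \<noteq> 0" for x
  proof -
    have "D dvd F x" unfolding D_def by (rule prod_lin_dvd[OF fin]) (use F0[OF x] in auto)
    then show "F x = D * q x" by (simp add: q_def)
    then show "q x \<noteq> 0" using F0[OF x] by auto
  qed
  have orders: "order y (F x) = (if y \<in> S then n y else 0) + order y (q x)" if x: "x \<in> carrier_vec m" "P0 x \<noteq> 0" for x y
    using split[OF x] D0 order_prod_lin[OF fin, of y n] by (simp add: order_mult D_def[symmetric])
  have nS: "poly (q x) a \<noteq> 0" if x: "x \<in> carrier_vec m" "P0 x \<noteq> 0" and a: "a \<in> S" for x a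
    using orders[OF x, of a] F0[OF x] a split(2)[OF x] by (simp add: order_root)
  have dq: "degree (q x) \<le> N" if x: "x \<in> carrier_vec m" "P0 x \<noteq> 0" for x
    using deg[of x] split[OF x] D0 by (simp add: degree_mult_eq)
  obtain x1 where x1: "x1 \<in> carrier_vec m" "P0 x1 \<noteq> 0"
    and max: "\<And>x. x \<in> carrier_vec m \<Longrightarrow> P0 x \<noteq> 0 \<Longrightarrow> degree (q x) \<le> degree (q x1)"
    using ex_has_greatest_nat[of "\<lambda>x. x \<in> carrier_vec m \<and> P0 x \<noteq> 0" x0 "\<lambda>x. degree (q x)" "Suc N"] x0 dq
    by (auto simp: less_Suc_eq_le)
  define d where "d = degree (q x1)"
  define P1 where "P1 x = P0 x * coeff (q x) d" for x
  have P1: "polynomial_function m P1" unfolding P1_def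
    by (intro polynomial_function_mult P0) (use fq in \<open>simp add: poly_family_def\<close>)
  have P1x1: "P1 x1 \<noteq> 0" using x1 split(2)[OF x1] by (simp add: P1_def d_def)
  have P1D: "P0 x \<noteq> 0" "degree (q x) = d" if x: "x \<in> carrier_vec m" "P1 x \<noteq> 0" for x
  proof -
    show p: "P0 x \<noteq> 0" using x by (simp add: P1_def)
    show "degree (q x) = d" using max[OF x(1) p] le_degree[of "q x" d] x(2) by (auto simp: P1_def d_def)
  qed
  show ?thesis
  proof (cases "d = 0")
    case True
    have "generically m (\<lambda>x. P1 x \<noteq> 0)" by (rule generically_polynomial[OF P1 x1(1) P1x1])
    then show ?thesis
    proof (rule generically_mono, intro allI impI)
      fix x y assume x: "x \<in> carrier_vec m" "P1 x \<noteq> 0" and y: "poly (F x) y = 0 \<and> y \<notin> S"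
      note p = P1D[OF x]
      obtain c where c: "q x = [:c:]" using p(2) True by (auto elim: degree_eq_zeroE)
      then have "order y (q x) = 0" using split(2)[OF x(1) p(1)] by (intro order_0I) auto
      then show "order y (F x) = 1" using orders[OF x(1) p(1), of y] y F0[OF x(1) p(1)] by (simp add: order_root)
    qed
  next
    case False
    define R where "R x = resultant_sub d (d - 1) (q x) (pderiv (q x))" for x
    have Rres: "R x = resultant (q x) (pderiv (q x))" if "degree (q x) = d" for x
      using that by (simp add: R_def resultant_sub degree_pderiv)
    have cq: "polynomial_function m (\<lambda>x. coeff (q x) k)" for k using fq by (simp add: poly_family_def)
    have cp: "polynomial_function m (\<lambda>x. coeff (pderiv (q x)) k)" for k
      unfolding coeff_pderiv by (intro polynomial_function_mult polynomial_function_const cq)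
    have R: "polynomial_function m R" unfolding R_def resultant_sub_def
    proof (rule polynomial_function_det)
      show "polynomial_function m (\<lambda>x. sylvester_mat_sub d (d - 1) (q x) (pderiv (q x)) $$ (i, j))"
        if "i < d + (d - 1)" "j < d + (d - 1)" for i j
        unfolding sylvester_mat_sub_index[OF that]
        by (intro polynomial_function_if polynomial_function_const cq cp)
    qed (simp add: carrier_matI)
    obtain x2 where x2: "x2 \<in> carrier_vec m" "P1 x2 \<noteq> 0" and s2: "\<forall>y. poly (F x2) y = 0 \<and> y \<notin> S \<longrightarrow> order y (F x2) = 1"
      using dense[OF P1 x1(1) P1x1] by blast
    note p2 = P1D[OF x2]
    have "\<forall>y. poly (q x2) y = 0 \<longrightarrow> order y (q x2) = 1"
    proof (intro allI impI)
      fix y assume y: "poly (q x2) y = 0"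
      then have "y \<notin> S" using nS[OF x2(1) p2(1)] by blast
      moreover have "poly (F x2) y = 0" using split(1)[OF x2(1) p2(1)] y by simp
      ultimately show "order y (q x2) = 1" using s2 orders[OF x2(1) p2(1), of y] by simp
    qed
    then have R2: "R x2 \<noteq> 0" unfolding Rres[OF p2(2)] resultant_pderiv[OF split(2)[OF x2(1) p2(1)]] .
    have "generically m (\<lambda>x. P1 x * R x \<noteq> 0)"
      by (rule generically_polynomial[OF polynomial_function_mult[OF P1 R] x2(1)]) (use x2 R2 in simp)
    then show ?thesis
    proof (rule generically_mono, intro allI impI)
      fix x y assume x: "x \<in> carrier_vec m" "P1 x * R x \<noteq> 0" and y: "poly (F x) y = 0 \<and> y \<notin> S"
      have x': "P1 x \<noteq> 0" "R x \<noteq> 0" using x(2) by auto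
      note p = P1D[OF x(1) x'(1)]
      have "poly (q x) y = 0 \<longrightarrow> order y (q x) = 1"
        using x'(2) unfolding Rres[OF p(2)] resultant_pderiv[OF split(2)[OF x(1) p(1)]] by blast
      moreover have "poly D y \<noteq> 0" using y fin by (auto simp: D_def poly_prod)
      ultimately show "order y (F x) = 1" using orders[OF x(1) p(1), of y] split(1)[OF x(1) p(1)] y by auto
    qed
  qed
qed

section \<open>The theorem\<close>

lemma polynomial_pencils_add:
  assumes L: "L \<in> pencil_carrier n" and E: "polynomial_pencils m n E" and c: "\<And>y. E y \<in> pencil_carrier n"
  shows "polynomial_pencils m n (\<lambda>y. pencil_add L (E y))"
  using E unfolding polynomial_pencils_def
  by (auto simp: pencil_add_index[OF L c] intro!: polynomial_function_add polynomial_function_const)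

lemma generic_partial_mults:
  assumes L: "L \<in> pencil_carrier n" and s: "has_structure st L" and pm: "finite_partial_mults n L x ns" and r: "0 < r"
    and E: "polynomial_pencils m n E" and ran: "\<And>y. perturbation st n r (E y)"
    and onto: "\<And>F. perturbation st n r F \<Longrightarrow> \<exists>y\<in>carrier_vec m. E y = F"
  shows "generically m (\<lambda>y. finite_partial_mults n (pencil_add L (E y)) x (perturbed_mults st r (Finite x) ns))"
proof -
  have reg: "pencil_regular L" using finite_partial_mults_facts(1)[OF L pm] pencil_regular_iff[OF L] by simp
  have "\<exists>F. perturbation st n r F \<and> attains n (pencil_add L F) x (repaired st x n (base_list st x r ns))"
    using example_regular_point[OF L s reg pm] example_skew_point[OF L s reg pm] by (cases "x = - ssign st")
  then obtain y where y: "y \<in> carrier_vec m" "attains n (pencil_add L (E y)) x (repaired st x n (base_list st x r ns))"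
    using onto by blast
  note g = generic_mults_at_point[OF L s pm polynomial_pencils_add[OF L E perturbation_carrier[OF ran]] ran y]
  show ?thesis by (rule generically_mono[OF g]) (simp add: base_list_perturbed[OF L s reg pm r])
qed

lemma perturbed_mults_beyond:
  assumes "length ns \<le> r" "0 < r"
  shows "perturbed_mults st r (Finite x) ns = [] \<or> x = - ssign st \<and> perturbed_mults st r (Finite x) ns = [1]"
proof -
  have "\<not> property_P r ns" using assms by (auto simp: property_P_def pm_def)
  then show ?thesis using assms by (cases st) (auto simp: perturbed_mults_def)
qed

lemma perturbed_mults_infinity: "perturbed_mults st r Infinity ns = perturbed_mults st r (Finite 0) ns"
  by (cases st) (auto simp: perturbed_mults_def)

lemma pencil_rev_rev [simp]: "pencil_rev (pencil_rev L) = L"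
  by (simp add: pencil_rev_def)

lemma pencil_rev_add: "pencil_rev (pencil_add L E) = pencil_add (pencil_rev L) (pencil_rev E)"
  by (simp add: pencil_rev_def pencil_add_def)

theorem theorem20:
  fixes n r \<kappa> :: nat
    and st :: pencil_structure
    and L :: pencil
    and ev :: "nat \<Rightarrow> eigval"
    and ns :: "nat \<Rightarrow> nat list"
  assumes "L \<in> pencil_carrier n"
    and "has_structure st L"
    and "pencil_regular L"
    and "inj_on ev {1..\<kappa>}"
    and "ev ` {1..\<kappa>} = {\<mu>. is_eigenvalue L \<mu>}"
    and "\<And>i. i \<in> {1..\<kappa>} \<Longrightarrow> partial_mults n L (ev i) (ns i)"
    and "r > 0"
  shows "\<exists>G. generic_set ((3 * r) div 2 * n) G \<and>
    (\<forall>E \<in> Phi st n r ` G.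
       pencil_regular (pencil_add L E) \<and>
       (\<forall>i \<in> {1..\<kappa>}.
          partial_mults n (pencil_add L E) (ev i) (perturbed_mults st r (ev i) (ns i))) \<and>
       (\<forall>i \<in> {1..\<kappa>}.
          r \<ge> length (ns i) \<and> \<not> (ev i = Finite (- ssign st) \<and> odd n) \<longrightarrow>
          \<not> is_eigenvalue (pencil_add L E) (ev i)) \<and>
       (\<forall>\<mu>. is_eigenvalue (pencil_add L E) \<mu> \<and> \<not> is_eigenvalue L \<mu> \<longrightarrow>
          simple_eigenvalue n (pencil_add L E) \<mu>))"
proof -
  note L = assms(1) and s = assms(2) and reg = assms(3) and pm = assms(6) and r = assms(7)
  define m where "m = (3 * r) div 2 * n"
  let ?Lx = "\<lambda>x. pencil_add L (Phi st n r x)"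
  have iff: "perturbation st n r E \<longleftrightarrow> (\<exists>x\<in>carrier_vec m. E = Phi st n r x)" for E
    unfolding perturbation_iff_Phi m_def by blast
  have per: "perturbation st n r (Phi st n r x)" for x
    using perturbation_pair_sum[of "vec_block n x (3 * (r div 2))" n "vec_block n x" "\<lambda>j. vec_block n x (r div 2 + j)"
        "\<lambda>j. vec_block n x (2 * (r div 2) + j)" st "r div 2" r] unfolding Phi_eq_pair_sum[symmetric] by simp
  have c: "?Lx x \<in> pencil_carrier n" "has_structure st (?Lx x)" for x
    using structure_add[OF L perturbation_carrier[OF per] s perturbation_structure[OF per]] L perturbation_carrier[OF per] by auto
  have pp: "polynomial_pencils m n (Phi st n r)" unfolding polynomial_pencils_def m_def
    by (intro allI impI conjI polynomial_function_Phi)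
  have pr: "polynomial_pencils m n (\<lambda>x. pencil_rev (Phi st n r x))"
    using pp by (simp add: polynomial_pencils_def pencil_rev_def)
  have fin: "generically m (\<lambda>x. finite_partial_mults n (?Lx x) a (perturbed_mults st r (Finite a) l))"
    if "finite_partial_mults n L a l" for a l
    by (rule generic_partial_mults[OF L s that r pp per]) (metis iff)
  have inf: "generically m (\<lambda>x. finite_partial_mults n (pencil_rev (?Lx x)) 0 (perturbed_mults st r (Finite 0) l))"
    if "finite_partial_mults n (pencil_rev L) 0 l" for l
    unfolding pencil_rev_add
  proof (rule generic_partial_mults[OF _ structure_rev[OF L s] that r pr perturbation_rev[OF per]])
    fix F assume "perturbation st n r F"
    then have "perturbation st n r (pencil_rev F)" by (rule perturbation_rev)
    then obtain y where "y \<in> carrier_vec m" "pencil_rev F = Phi st n r y" using iff by blast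
    then show "\<exists>y\<in>carrier_vec m. pencil_rev (Phi st n r y) = F" by (metis pencil_rev_rev)
  qed (use L in simp)
  have eigF: "is_eigenvalue M (Finite a) \<longleftrightarrow> poly (pdet n M) a = 0" if "M \<in> pencil_carrier n" for M a
    using poly_pdet[OF that] by simp
  have eigI: "is_eigenvalue M Infinity \<longleftrightarrow> poly (pdet n (pencil_rev M)) 0 = 0" if "M \<in> pencil_carrier n" for M
    using poly_pdet[of "pencil_rev M" n 0] that by simp
  have d: "pdet n L \<noteq> 0" using reg pencil_regular_iff[OF L] by simp
  define S where "S = {a. poly (pdet n L) a = 0}"
  have finS: "finite S" unfolding S_def by (rule poly_roots_finite[OF d])
  have par: "even n" if "- ssign st \<notin> S"
  proof -
    have "(ssign st * - ssign st) ^ n = (- 1) ^ order (- ssign st) (pdet n L)" by (rule order_parity[OF L s d]) simp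
    moreover have "order (- ssign st) (pdet n L) = 0" using that by (intro order_0I) (simp add: S_def)
    ultimately have "(- 1 :: complex) ^ n = 1" by simp
    then show ?thesis by (cases "even n") auto
  qed
  have SI: "x \<in> S" if "poly (pdet n L) x = 0" for x using that by (simp add: S_def)
  have dense: "\<exists>x\<in>carrier_vec m. P x \<noteq> 0 \<and> pdet n (?Lx x) \<noteq> 0 \<and>
      (\<forall>y. poly (pdet n (?Lx x)) y = 0 \<and> y \<notin> S \<longrightarrow> order y (pdet n (?Lx x)) = 1)"
    if P: "polynomial_function m P" "x0 \<in> carrier_vec m" "P x0 \<noteq> 0" for P x0
    using dense_simple[OF L s d SI par P[unfolded m_def]] unfolding m_def simple_off_def by blast
  define l where "l a = (SOME l. finite_partial_mults n L a l)" for a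
  have l: "finite_partial_mults n L a (l a)" for a
    unfolding l_def by (rule finite_partial_mults_exists[OF L reg]) (rule someI)
  obtain x1 where x1: "x1 \<in> carrier_vec m" "pdet n (?Lx x1) \<noteq> 0"
    using dense[OF polynomial_function_const zero_carrier_vec, of 1] by auto
  have fam: "poly_family m (\<lambda>x. pdet n (?Lx x))"
    by (rule poly_family_det[OF poly_family_pmat[OF polynomial_pencils_add[OF L pp perturbation_carrier[OF per]]] pmat_carrier])
  have g1: "generically m (\<lambda>x. pdet n (?Lx x) \<noteq> 0)"
  proof -
    obtain k where k: "coeff (pdet n (?Lx x1)) k \<noteq> 0" using x1(2) by (metis leading_coeff_0_iff)
    have "polynomial_function m (\<lambda>x. coeff (pdet n (?Lx x)) k)" using fam by (simp add: poly_family_def)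
    from generically_polynomial[OF this x1(1)] k show ?thesis by (auto elim: generically_mono)
  qed
  have g2: "generically m (\<lambda>x. \<forall>a\<in>S. finite_partial_mults n (?Lx x) a (perturbed_mults st r (Finite a) (l a)))"
    by (rule generically_ball[OF finS fin[OF l]])
  have g3: "generically m (\<lambda>x. \<forall>y. poly (pdet n (?Lx x)) y = 0 \<and> y \<notin> S \<longrightarrow> order y (pdet n (?Lx x)) = 1)"
  proof (rule generically_simple_roots[OF fam degree_pdet finS])
    show "generically m (\<lambda>x. pdet n (?Lx x) \<noteq> 0 \<and> (\<forall>a\<in>S. order a (pdet n (?Lx x)) = sum_list (perturbed_mults st r (Finite a) (l a))))"
      by (rule generically_mono[OF generically_conj[OF g1 g2]]) (use finite_partial_mults_facts(2)[OF c(1)] in blast)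
    show "\<exists>x\<in>carrier_vec m. P x \<noteq> 0 \<and> (\<forall>y. poly (pdet n (?Lx x)) y = 0 \<and> y \<notin> S \<longrightarrow> order y (pdet n (?Lx x)) = 1)"
      if "polynomial_function m P" "x0 \<in> carrier_vec m" "P x0 \<noteq> 0" for P x0
      using dense[OF that] by blast
  qed
  have g4: "generically m (\<lambda>x. \<forall>i\<in>{1..\<kappa>}. partial_mults n (?Lx x) (ev i) (perturbed_mults st r (ev i) (ns i)))"
  proof (rule generically_ball)
    fix i assume i: "i \<in> {1..\<kappa>}"
    show "generically m (\<lambda>x. partial_mults n (?Lx x) (ev i) (perturbed_mults st r (ev i) (ns i)))"
    proof (cases "ev i")
      case (Finite a)
      then show ?thesis using fin[of a "ns i"] pm[OF i] by simp
    next
      case Infinity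
      then show ?thesis using inf[of "ns i"] pm[OF i] by (simp add: perturbed_mults_infinity)
    qed
  qed simp
  have g5: "generically m (\<lambda>x. \<not> is_eigenvalue L Infinity \<longrightarrow> \<not> is_eigenvalue (?Lx x) Infinity)"
  proof (cases "is_eigenvalue L Infinity")
    case True
    show ?thesis by (rule generically_mono[OF generically_True]) (use True in simp)
  next
    case False
    have Lr: "pencil_rev L \<in> pencil_carrier n" using L by simp
    have p0: "poly (pdet n (pencil_rev L)) 0 \<noteq> 0" using False eigI[OF L] by simp
    then have "pdet n (pencil_rev L) \<noteq> 0" by auto
    then have "pencil_regular (pencil_rev L)" using pencil_regular_iff[OF Lr] by simp
    then obtain l' where l': "finite_partial_mults n (pencil_rev L) 0 l'" by (rule finite_partial_mults_exists[OF Lr])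
    note f = finite_partial_mults_facts[OF Lr l']
    have "sum_list l' = 0" using f(2) p0 by (simp add: order_0I)
    then have "l' = []" using f(5) by (cases l') auto
    then have e: "perturbed_mults st r (Finite 0) l' = []" using perturbed_mults_beyond[of "[]" r st 0] r by simp
    show ?thesis
    proof (rule generically_mono[OF inf[OF l']], intro impI)
      fix x assume x: "finite_partial_mults n (pencil_rev (?Lx x)) 0 (perturbed_mults st r (Finite 0) l')"
      have cr: "pencil_rev (?Lx x) \<in> pencil_carrier n" using c(1) by simp
      show "\<not> is_eigenvalue (?Lx x) Infinity" unfolding eigI[OF c(1)]
        using finite_partial_mults_facts(1,2)[OF cr x] unfolding e by (simp add: order_root)
    qed
  qed
  define Q where "Q x \<longleftrightarrow> pdet n (?Lx x) \<noteq> 0 \<and>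
      (\<forall>y. poly (pdet n (?Lx x)) y = 0 \<and> y \<notin> S \<longrightarrow> order y (pdet n (?Lx x)) = 1) \<and>
      (\<forall>i\<in>{1..\<kappa>}. partial_mults n (?Lx x) (ev i) (perturbed_mults st r (ev i) (ns i))) \<and>
      (\<not> is_eigenvalue L Infinity \<longrightarrow> \<not> is_eigenvalue (?Lx x) Infinity)" for x
  have "generically m Q" unfolding Q_def by (intro generically_conj g1 g3 g4 g5)
  then have gs: "generic_set m {x \<in> carrier_vec m. Q x}" by (rule generic_set_Collect)
  have main: "pencil_regular (?Lx x) \<and>
      (\<forall>i\<in>{1..\<kappa>}. partial_mults n (?Lx x) (ev i) (perturbed_mults st r (ev i) (ns i))) \<and>
      (\<forall>i\<in>{1..\<kappa>}. r \<ge> length (ns i) \<and> \<not> (ev i = Finite (- ssign st) \<and> odd n) \<longrightarrow> \<not> is_eigenvalue (?Lx x) (ev i)) \<and>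
      (\<forall>\<mu>. is_eigenvalue (?Lx x) \<mu> \<and> \<not> is_eigenvalue L \<mu> \<longrightarrow> simple_eigenvalue n (?Lx x) \<mu>)"
    if Q: "Q x" for x
  proof (intro conjI ballI allI impI)
    have d': "pdet n (?Lx x) \<noteq> 0" and simple: "\<And>y. poly (pdet n (?Lx x)) y = 0 \<Longrightarrow> y \<notin> S \<Longrightarrow> order y (pdet n (?Lx x)) = 1"
      and pms: "\<And>i. i \<in> {1..\<kappa>} \<Longrightarrow> partial_mults n (?Lx x) (ev i) (perturbed_mults st r (ev i) (ns i))"
      and noinf: "\<not> is_eigenvalue L Infinity \<Longrightarrow> \<not> is_eigenvalue (?Lx x) Infinity"
      using Q unfolding Q_def by blast+
    show reg': "pencil_regular (?Lx x)" using d' pencil_regular_iff[OF c(1)] by simp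
    show "partial_mults n (?Lx x) (ev i) (perturbed_mults st r (ev i) (ns i))" if "i \<in> {1..\<kappa>}" for i by (rule pms[OF that])
    show "\<not> is_eigenvalue (?Lx x) (ev i)"
      if i: "i \<in> {1..\<kappa>}" and h: "r \<ge> length (ns i) \<and> \<not> (ev i = Finite (- ssign st) \<and> odd n)" for i
    proof (cases "ev i")
      case (Finite a)
      have fm: "finite_partial_mults n (?Lx x) a (perturbed_mults st r (Finite a) (ns i))" using pms[OF i] Finite by simp
      have "perturbed_mults st r (Finite a) (ns i) = []"
        using perturbed_mults_beyond[of "ns i" r st a] h r not_wrong[OF c fm] Finite by (auto simp: wrong_def)
      then show ?thesis unfolding Finite eigF[OF c(1)] using finite_partial_mults_facts(1,2)[OF c(1) fm] by (simp add: order_root)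
    next
      case Infinity
      have fm: "finite_partial_mults n (pencil_rev (?Lx x)) 0 (perturbed_mults st r (Finite 0) (ns i))"
        using pms[OF i] Infinity by (simp add: perturbed_mults_infinity)
      have cr: "pencil_rev (?Lx x) \<in> pencil_carrier n" using c(1) by simp
      have "perturbed_mults st r (Finite 0) (ns i) = []" using perturbed_mults_beyond[of "ns i" r st 0] h r by auto
      then show ?thesis unfolding Infinity eigI[OF c(1)] using finite_partial_mults_facts(1,2)[OF cr fm] by (simp add: order_root)
    qed
    show "simple_eigenvalue n (?Lx x) \<mu>" if h: "is_eigenvalue (?Lx x) \<mu> \<and> \<not> is_eigenvalue L \<mu>" for \<mu>
    proof (cases \<mu>)
      case (Finite a)
      obtain t where t: "finite_partial_mults n (?Lx x) a t" by (rule finite_partial_mults_exists[OF c(1) reg'])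
      have "poly (pdet n (?Lx x)) a = 0" using h unfolding Finite eigF[OF c(1)] by blast
      moreover have "a \<notin> S" using h unfolding Finite eigF[OF L] S_def by blast
      ultimately have "order a (pdet n (?Lx x)) = 1" by (rule simple)
      then have "sum_list t = 1" using finite_partial_mults_facts(2)[OF c(1) t] by simp
      then show ?thesis using h t unfolding simple_eigenvalue_def Finite partial_mults.simps by blast
    qed (use h noinf in blast)
  qed
  show ?thesis
  proof (rule exI[of _ "{x \<in> carrier_vec m. Q x}"], rule conjI)
    show "generic_set ((3 * r) div 2 * n) {x \<in> carrier_vec m. Q x}" using gs unfolding m_def .
  qed (use main in blast)
qed

end
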